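(* Let $G$ be a finite planar trivalent graph containing a square, i.e. four edges connecting four vertices cyclically in a standard disk, and let $G'$ and $G''$ be the two graphs obtained from $G$ by the two planar resolutions of the square. Then $$\chi(\mathcal{M}(G))=\chi(\mathcal{M}(G'))+\chi(\mathcal{M}(G'')).$$
   Context: Graphs are finite; multiple edges are allowed, and closed circle components without vertices are allowed (such a circle counts as a single edge with no vertices). Trivalent means that every vertex has exactly three incident edge-ends. A decoration of $G$ assigns to each edge $e\in E(G)$ a point $D(e)\in\mathbb{CP}^2$, i.e. a complex line through the origin in $\mathbb{C}^3$. It is admissible if at every vertex the three lines attached to the three incident edge-ends are pairwise orthogonal in $\mathbb{C}^3$ with respect to the standard Hermitian inner product. $\mathcal{M}(G)$ is the set of admissible decorations with the subspace topology from $\prod_{e\in E(G)}\mathbb{CP}^2$; $\chi$ denotes the Euler characteristic. Square and its resolutions: $G$ meets a disk in a $4$-cycle with four distinct vertices $v_a,v_b,v_c,v_d$ in cyclic order, together with four outgoing legs $a,b,c,d$, where leg $a$ is the third edge-end at $v_a$, and so on; the legs meet the boundary of the disk in the cyclic order $a,b,c,d$. The graph $G'$ is obtained by replacing the contents of the disk by two disjoint arcs, one joining leg $a$ to leg $b$ and the other joining leg $c$ to leg $d$; the graph $G''$ is obtained by replacing the contents of the disk by two disjoint arcs, one joining leg $a$ to leg $d$ and the other joining leg $b$ to leg $c$. (In each case the four vertices disappear and the joined legs become parts of single edges, or of vertexless circles.) *)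

theory Defs
  imports "HOL-Analysis.Analysis" "HOL-Homology.Homology"
begin

section \<open>Trivalent multigraphs\<close>

text \<open>
  A graph has edge-ends as primitive data: \<open>end_vertex h\<close> is the vertex at which the edge-end \<open>h\<close>
  sits and \<open>end_edge h\<close> is the edge it belongs to. An ordinary edge (possibly a loop) has two
  edge-ends; a closed circle component without vertices is an edge with no edge-ends.
\<close>

record ('v, 'h, 'e) multigraph =
  verts :: "'v set"
  ends :: "'h set"
  edges :: "'e set"
  end_vertex :: "'h \<Rightarrow> 'v"
  end_edge :: "'h \<Rightarrow> 'e"

definition ends_at :: "('v, 'h, 'e) multigraph \<Rightarrow> 'v \<Rightarrow> 'h set" where
  "ends_at G v = {h \<in> ends G. end_vertex G h = v}"

definition ends_on :: "('v, 'h, 'e) multigraph \<Rightarrow> 'e \<Rightarrow> 'h set" where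
  "ends_on G e = {h \<in> ends G. end_edge G h = e}"

definition multigraph :: "('v, 'h, 'e) multigraph \<Rightarrow> bool" where
  "multigraph G \<longleftrightarrow>
     finite (verts G) \<and> finite (ends G) \<and> finite (edges G) \<and>
     end_vertex G ` ends G \<subseteq> verts G \<and> end_edge G ` ends G \<subseteq> edges G \<and>
     (\<forall>e\<in>edges G. card (ends_on G e) = 2 \<or> ends_on G e = {})"

definition trivalent :: "('v, 'h, 'e) multigraph \<Rightarrow> bool" where
  "trivalent G \<longleftrightarrow> (\<forall>v\<in>verts G. card (ends_at G v) = 3)"


section \<open>Drawings in the plane\<close>

text \<open>The points of an edge other than its end vertices (all points, for a vertexless circle).\<close>

definition edge_points ::
    "('v, 'h, 'e) multigraph \<Rightarrow> ('e \<Rightarrow> real \<Rightarrow> complex) \<Rightarrow> 'e \<Rightarrow> complex set" where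
  "edge_points G \<gamma> e =
     (if ends_on G e = {} then path_image (\<gamma> e) else \<gamma> e ` {0<..<1})"

text \<open>
  An embedding of \<open>G\<close> in the plane, which is taken to be the type of complex numbers: \<open>p\<close> places
  the vertices and \<open>\<gamma>\<close> parametrises the edges. (A simple path may be closed, as loops and circles
  require.)
\<close>

definition plane_drawing ::
    "('v, 'h, 'e) multigraph \<Rightarrow> ('v \<Rightarrow> complex) \<Rightarrow> ('e \<Rightarrow> real \<Rightarrow> complex) \<Rightarrow> bool" where
  "plane_drawing G p \<gamma> \<longleftrightarrow>
     inj_on p (verts G) \<and>
     (\<forall>e\<in>edges G. simple_path (\<gamma> e) \<and>
        (if ends_on G e = {} then pathfinish (\<gamma> e) = pathstart (\<gamma> e)
         else {pathstart (\<gamma> e), pathfinish (\<gamma> e)} = p ` end_vertex G ` ends_on G e) \<and>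
        edge_points G \<gamma> e \<inter> p ` verts G = {}) \<and>
     (\<forall>e\<in>edges G. \<forall>e'\<in>edges G. e \<noteq> e' \<longrightarrow> edge_points G \<gamma> e \<inter> edge_points G \<gamma> e' = {})"

definition drawing_points ::
    "('v, 'h, 'e) multigraph \<Rightarrow> ('v \<Rightarrow> complex) \<Rightarrow> ('e \<Rightarrow> real \<Rightarrow> complex) \<Rightarrow> complex set" where
  "drawing_points G p \<gamma> = p ` verts G \<union> (\<Union>e\<in>edges G. edge_points G \<gamma> e)"


section \<open>Squares and their resolutions\<close>

text \<open>
  The vertices \<open>v 0, v 1, v 2, v 3\<close> of a square are in cyclic order, \<open>q k\<close> is the edge of the square
  from \<open>v k\<close> to the next vertex, and \<open>l k\<close> is the remaining edge-end at \<open>v k\<close>; so the legs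
  \<open>a, b, c, d\<close> are \<open>l 0, l 1, l 2, l 3\<close>. Two legs may be the two ends of one edge.
\<close>

definition square ::
    "('v, 'h, 'e) multigraph \<Rightarrow> (nat \<Rightarrow> 'v) \<Rightarrow> (nat \<Rightarrow> 'e) \<Rightarrow> (nat \<Rightarrow> 'h) \<Rightarrow> bool" where
  "square G v q l \<longleftrightarrow>
     v ` {..<4} \<subseteq> verts G \<and> inj_on v {..<4} \<and>
     q ` {..<4} \<subseteq> edges G \<and> inj_on q {..<4} \<and>
     (\<forall>k<4. end_vertex G ` ends_on G (q k) = {v k, v (Suc k mod 4)}) \<and>
     (\<forall>k<4. l k \<in> ends_at G (v k) \<and> end_edge G (l k) \<notin> q ` {..<4})"

text \<open>
  The intersection of the drawing with some closed topological disk is the image, under a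
  homeomorphism \<open>f\<close> from the closed unit disk, of the standard picture: the square with corners
  \<open>\<i>\<^sup>k / 2\<close> together with radial segments from its corners to the boundary points \<open>\<i>\<^sup>k\<close>.
  The map \<open>f\<close> may reverse the orientation, so the cyclic order may be clockwise or anticlockwise.
\<close>

definition square_in_disk ::
    "('v, 'h, 'e) multigraph \<Rightarrow> ('v \<Rightarrow> complex) \<Rightarrow> ('e \<Rightarrow> real \<Rightarrow> complex) \<Rightarrow>
     (nat \<Rightarrow> 'v) \<Rightarrow> (nat \<Rightarrow> 'e) \<Rightarrow> (nat \<Rightarrow> 'h) \<Rightarrow> bool" where
  "square_in_disk G p \<gamma> v q l \<longleftrightarrow>
     square G v q l \<and>
     (\<exists>f :: complex \<Rightarrow> complex.
        continuous_on (cball 0 1) f \<and> inj_on f (cball 0 1) \<and>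
        drawing_points G p \<gamma> \<inter> f ` cball 0 1 =
          f ` (\<Union>k<4. closed_segment (\<i> ^ k / 2) (\<i> ^ Suc k / 2) \<union> closed_segment (\<i> ^ k / 2) (\<i> ^ k)) \<and>
        (\<forall>k<4. f (\<i> ^ k / 2) = p (v k) \<and>
           f ` open_segment (\<i> ^ k / 2) (\<i> ^ Suc k / 2) = edge_points G \<gamma> (q k) \<and>
           f ` (closed_segment (\<i> ^ k / 2) (\<i> ^ k) - {\<i> ^ k / 2})
             \<subseteq> edge_points G \<gamma> (end_edge G (l k))))"

text \<open>
  Delete the vertices \<open>v k\<close> and the edges \<open>q k\<close>, and fuse the remaining edges along the pairs in
  \<open>J\<close>. An edge of the new graph is the class of all old edges that are joined end to end into it.
  If every end of the old edges in a class lay at a deleted vertex, no edge-ends remain and the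
  class is a vertexless circle.
\<close>

definition fusion :: "('v, 'h, 'e) multigraph \<Rightarrow> (nat \<Rightarrow> 'e) \<Rightarrow> ('e \<times> 'e) set \<Rightarrow> ('e \<times> 'e) set" where
  "fusion G q J = Restr ((J \<union> J\<inverse>)\<^sup>*) (edges G - q ` {..<4})"

definition replace_square ::
    "('v, 'h, 'e) multigraph \<Rightarrow> (nat \<Rightarrow> 'v) \<Rightarrow> (nat \<Rightarrow> 'e) \<Rightarrow> ('e \<times> 'e) set \<Rightarrow>
     ('v, 'h, 'e set) multigraph" where
  "replace_square G v q J =
     \<lparr>verts = verts G - v ` {..<4},
      ends = {h \<in> ends G. end_vertex G h \<notin> v ` {..<4}},
      edges = (edges G - q ` {..<4}) // fusion G q J,
      end_vertex = end_vertex G,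
      end_edge = (\<lambda>h. fusion G q J `` {end_edge G h})\<rparr>"

definition resolution_ab_cd ::
    "('v, 'h, 'e) multigraph \<Rightarrow> (nat \<Rightarrow> 'v) \<Rightarrow> (nat \<Rightarrow> 'e) \<Rightarrow> (nat \<Rightarrow> 'h) \<Rightarrow>
     ('v, 'h, 'e set) multigraph" where
  "resolution_ab_cd G v q l =
     replace_square G v q
       {(end_edge G (l 0), end_edge G (l 1)), (end_edge G (l 2), end_edge G (l 3))}"

definition resolution_ad_bc ::
    "('v, 'h, 'e) multigraph \<Rightarrow> (nat \<Rightarrow> 'v) \<Rightarrow> (nat \<Rightarrow> 'e) \<Rightarrow> (nat \<Rightarrow> 'h) \<Rightarrow>
     ('v, 'h, 'e set) multigraph" where
  "resolution_ad_bc G v q l =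
     replace_square G v q
       {(end_edge G (l 0), end_edge G (l 3)), (end_edge G (l 1), end_edge G (l 2))}"


section \<open>The complex projective plane\<close>

text \<open>
  The prefix \<open>vec\<close> refers to the complex vector space structure of the type \<open>complex ^ 3\<close>;
  the unprefixed \<open>subspace\<close>, \<open>span\<close>, \<open>dim\<close> would be the real ones.
\<close>

definition complex_lines :: "(complex ^ 3) set set" where
  "complex_lines = {L. vec.subspace L \<and> vec.dim L = 1}"

text \<open>The quotient topology from the nonzero vectors, a vector being sent to the line it spans.\<close>

definition CP2 :: "(complex ^ 3) set topology" where
  "CP2 = topology (\<lambda>U. U \<subseteq> complex_lines \<and>
           openin (top_of_set (- {0})) {x \<in> - {0}. vec.span {x} \<in> U})"

lemma openin_CP2:
  "openin CP2 U \<longleftrightarrow> U \<subseteq> complex_lines \<and>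
     openin (top_of_set (- {0})) {x \<in> - {0}. vec.span {x} \<in> U}"
proof -
  let ?P = "\<lambda>U. {x \<in> - {0 :: complex ^ 3}. vec.span {x} \<in> U}"
  have "istopology (\<lambda>U. U \<subseteq> complex_lines \<and> openin (top_of_set (- {0})) (?P U))"
    unfolding istopology_def
  proof (intro conjI allI impI)
    fix S T
    assume "S \<subseteq> complex_lines \<and> openin (top_of_set (- {0})) (?P S)"
      and "T \<subseteq> complex_lines \<and> openin (top_of_set (- {0})) (?P T)"
    moreover have "?P (S \<inter> T) = ?P S \<inter> ?P T" by auto
    ultimately show "S \<inter> T \<subseteq> complex_lines" "openin (top_of_set (- {0})) (?P (S \<inter> T))"
      by (auto intro: openin_Int)
  next
    fix \<K>
    assume *: "\<forall>K\<in>\<K>. K \<subseteq> complex_lines \<and> openin (top_of_set (- {0})) (?P K)"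
    have "?P (\<Union>\<K>) = (\<Union>K\<in>\<K>. ?P K)" by auto
    with * show "\<Union>\<K> \<subseteq> complex_lines" "openin (top_of_set (- {0})) (?P (\<Union>\<K>))"
      by (auto intro!: openin_Union)
  qed
  then show ?thesis by (simp add: CP2_def)
qed

lemma span_in_complex_lines: "x \<noteq> 0 \<Longrightarrow> vec.span {x} \<in> complex_lines"
  using vec.dim_eq_card_independent[of "{x}"] by (simp add: complex_lines_def vec.subspace_span)

lemma complex_lines_eq: "complex_lines = (\<lambda>x. vec.span {x}) ` (- {0})"
proof
  show "complex_lines \<subseteq> (\<lambda>x. vec.span {x}) ` (- {0})"
  proof
    fix L :: "(complex ^ 3) set"
    assume "L \<in> complex_lines"
    then have L: "vec.subspace L" "vec.dim L = 1" by (auto simp: complex_lines_def)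
    obtain B where B: "B \<subseteq> L" "vec.independent B" "L \<subseteq> vec.span B" "card B = vec.dim L"
      using vec.basis_exists[of L] by metis
    then obtain x where x: "B = {x}" using L by (auto simp: card_1_singleton_iff)
    have "L = vec.span {x}" using B L x by (metis subset_antisym vec.span_minimal)
    moreover have "x \<noteq> 0" using B(2) x vec.dependent_zero by blast
    ultimately show "L \<in> (\<lambda>x. vec.span {x}) ` (- {0})" by blast
  qed
  show "(\<lambda>x. vec.span {x}) ` (- {0}) \<subseteq> complex_lines"
    using span_in_complex_lines by blast
qed

lemma topspace_CP2: "topspace CP2 = complex_lines"
proof
  have "{x \<in> - {0}. vec.span {x} \<in> complex_lines} = - {0}"
    by (auto simp: span_in_complex_lines)
  then have "openin CP2 complex_lines" by (simp add: openin_CP2)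
  then show "complex_lines \<subseteq> topspace CP2" by (rule openin_subset)
  show "topspace CP2 \<subseteq> complex_lines"
    using openin_topspace[of CP2] unfolding openin_CP2 by blast
qed

lemma quotient_map_CP2: "quotient_map (top_of_set (- {0})) CP2 (\<lambda>x. vec.span {x})"
  unfolding quotient_map_def by (auto simp: topspace_CP2 complex_lines_eq openin_CP2)

definition hermitian :: "complex ^ 3 \<Rightarrow> complex ^ 3 \<Rightarrow> complex" where
  "hermitian x y = (\<Sum>i\<in>UNIV. x $ i * cnj (y $ i))"

definition orthogonal_lines :: "(complex ^ 3) set \<Rightarrow> (complex ^ 3) set \<Rightarrow> bool" where
  "orthogonal_lines L M \<longleftrightarrow> (\<forall>x\<in>L. \<forall>y\<in>M. hermitian x y = 0)"


section \<open>The space of admissible decorations\<close>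

text \<open>
  At a vertex the condition ranges over pairs of distinct edge-ends, not distinct edges; in
  particular a graph with a loop has no admissible decoration.
\<close>

definition admissible :: "('v, 'h, 'e) multigraph \<Rightarrow> ('e \<Rightarrow> (complex ^ 3) set) \<Rightarrow> bool" where
  "admissible G D \<longleftrightarrow>
     (\<forall>v\<in>verts G. \<forall>h\<in>ends_at G v. \<forall>h'\<in>ends_at G v. h \<noteq> h' \<longrightarrow>
        orthogonal_lines (D (end_edge G h)) (D (end_edge G h')))"

definition decoration_space :: "('v, 'h, 'e) multigraph \<Rightarrow> ('e \<Rightarrow> (complex ^ 3) set) topology" where
  "decoration_space G = subtopology (product_topology (\<lambda>e. CP2) (edges G)) {D. admissible G D}"


section \<open>The Euler characteristic\<close>

text \<open>
  The rank of an abelian group is the largest number of elements that are linearly independent over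
  the integers. The supremum is meaningful only for groups of finite rank.
\<close>

definition int_independent :: "('a, 'b) monoid_scheme \<Rightarrow> 'a set \<Rightarrow> bool" where
  "int_independent A S \<longleftrightarrow>
     (\<forall>c :: 'a \<Rightarrow> int. finprod A (\<lambda>s. s [^]\<^bsub>A\<^esub> c s) S = \<one>\<^bsub>A\<^esub> \<longrightarrow> (\<forall>s\<in>S. c s = 0))"

definition abelian_rank :: "('a, 'b) monoid_scheme \<Rightarrow> nat" where
  "abelian_rank A = Sup {card S | S. finite S \<and> S \<subseteq> carrier A \<and> int_independent A S}"

definition betti :: "nat \<Rightarrow> 'a topology \<Rightarrow> nat" where
  "betti n X = abelian_rank (homology_group (int n) X)"

text \<open>
  The alternating sum of the ranks of the integral singular homology groups, for spaces whose total
  homology has finite rank. Spaces of admissible decorations are compact real algebraic sets and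
  so have finitely generated homology.
\<close>

definition euler_characteristic :: "'a topology \<Rightarrow> int" where
  "euler_characteristic X = (\<Sum>n | betti n X \<noteq> 0. (-1) ^ n * int (betti n X))"

end

(*
  A compactly supported Euler characteristic cchi is defined by the ranks of the maps
  H(S, S - Q') -> H(S, S - Q) for large compact Q <= Q'. It depends only on the homeomorphism type,
  agrees with the usual one on compact sets, and is additive over the cells of a finite cell complex.
  A cylindrical decomposition makes every bounded semialgebraic set a union of such cells, so cchi is
  additive over semialgebraic pieces and invariant under products with the complex plane.

  A line is encoded by its orthogonal projector; three pairwise orthogonal lines are projectors with
  sum 1. So the lines on the legs and sides of a square determine each other, and opposite sides
  satisfy q0 = q2 or q1 = q3. The decorations with q0 ~= q2 correspond to the decorations of one
  resolution whose two arcs carry different lines, those with q1 ~= q3 to the same for the other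
  resolution. In the rest all four legs carry one line and q0 ranges over a projective line of lines
  orthogonal to it, which contributes the Euler characteristic 2 of a sphere times that of the common
  part of the two resolutions: once for each resolution.
*)
theory Submission
  imports Defs "HOL-Computational_Algebra.Fundamental_Theorem_Algebra"
begin

section \<open>Integral ranks of abelian groups and rank-nullity\<close>

section \<open>Ranks of abelian groups\<close>

text \<open>The pieces into which the square cuts the decoration space, such as the part with
  \<open>q0 ~= q2\<close>, are in general not compact, and the ordinary Euler characteristic is not
  additive over such pieces; this forces homology at infinity. The pieces are compared by
  homeomorphisms, so the invariant is built from homology and not from a count of cells. The factor
  2 hides a second obstacle: the lines orthogonal to a varying leg form a bundle of projective lines
  that need not be trivial. The base is therefore cut by the first nonzero diagonal entry of the
  projector of the leg. On each stratum the lines orthogonal to the leg and to a fixed coordinate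
  axis form a section, and the complement of the section is a product with the complex plane. The
  decomposition tracks only zero sets, because signs are constant on connected cells without zeros.
  A generic direction gives all polynomials constant leading coefficients; roots then stay bounded
  and root branches extend to the frontier of a cell.\<close>

lemma linear_dependence_idom:
  fixes a :: "'u \<Rightarrow> 't \<Rightarrow> 'r::idom"
  assumes "finite T" "finite U" "card T < card U"
  shows "\<exists>x. (\<exists>u\<in>U. x u \<noteq> 0) \<and> (\<forall>t\<in>T. (\<Sum>u\<in>U. x u * a u t) = 0)"
  using assms
proof (induction T arbitrary: U a rule: finite_induct)
  case empty
  then obtain u where "u \<in> U" by fastforce
  then show ?case by (intro exI[of _ "\<lambda>_. 1"]) auto
next
  case (insert t T)
  show ?case
  proof (cases "\<forall>u\<in>U. a u t = 0")
    case True
    have "card T < card U" using insert by simp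
    from insert.IH[OF insert.prems(1) this, of a] True show ?thesis by auto
  next
    case False
    then obtain u0 where u0: "u0 \<in> U" "a u0 t \<noteq> 0" by auto
    define U' where "U' = U - {u0}"
    \<comment> \<open>Fraction-free elimination of the unknown \<open>u0\<close> with pivot
      \<open>a u0 t\<close>: cross-multiplying avoids division, so the argument stays inside an
      integral domain.\<close>
    define b where "b = (\<lambda>u s. a u0 t * a u s - a u t * a u0 s)"
    have U': "finite U'" "card T < card U'"
      using insert u0 by (auto simp: U'_def)
    obtain x where x: "\<exists>u\<in>U'. x u \<noteq> 0" "\<And>s. s \<in> T \<Longrightarrow> (\<Sum>u\<in>U'. x u * b u s) = 0"
      using insert.IH[OF U', of b] by auto
    define x' where "x' = (\<lambda>u. if u = u0 then - (\<Sum>u\<in>U'. x u * a u t) else x u * a u0 t)"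
    have split: "(\<Sum>u\<in>U. x' u * a u s) =
        - (\<Sum>u\<in>U'. x u * a u t) * a u0 s + (\<Sum>u\<in>U'. x u * a u0 t * a u s)" for s
    proof -
      have "(\<Sum>u\<in>U. x' u * a u s) = x' u0 * a u0 s + (\<Sum>u\<in>U'. x' u * a u s)"
        unfolding U'_def using insert.prems(1) u0 by (simp add: sum.remove)
      moreover have "(\<Sum>u\<in>U'. x' u * a u s) = (\<Sum>u\<in>U'. x u * a u0 t * a u s)"
        by (rule sum.cong) (auto simp: x'_def U'_def)
      ultimately show ?thesis by (simp add: x'_def)
    qed
    have "(\<Sum>u\<in>U. x' u * a u s) = 0" if "s \<in> insert t T" for s
    proof (cases "s = t")
      case True
      then show ?thesis unfolding split
        by (simp add: sum_distrib_right sum_distrib_left mult_ac)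
    next
      case False
      with that have "(\<Sum>u\<in>U'. x u * b u s) = 0" using x by auto
      then show ?thesis unfolding split b_def
        by (simp add: right_diff_distrib sum_subtractf sum_distrib_right sum_distrib_left mult_ac)
    qed
    moreover have "\<exists>u\<in>U. x' u \<noteq> 0"
      using x(1) u0 by (auto simp: x'_def U'_def)
    ultimately show ?thesis by blast
  qed
qed

definition int_comb :: "('a, 'b) monoid_scheme \<Rightarrow> ('a \<Rightarrow> int) \<Rightarrow> 'a set \<Rightarrow> 'a" where
  "int_comb A c S = finprod A (\<lambda>s. s [^]\<^bsub>A\<^esub> c s) S"

lemma int_independent_comb:
  "int_independent A S \<longleftrightarrow> (\<forall>c. int_comb A c S = \<one>\<^bsub>A\<^esub> \<longrightarrow> (\<forall>s\<in>S. c s = 0))"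
  by (simp add: int_independent_def int_comb_def)

context comm_group
begin

lemma int_comb_closed: "S \<subseteq> carrier G \<Longrightarrow> int_comb G c S \<in> carrier G"
  unfolding int_comb_def by (intro finprod_closed) auto

lemma int_comb_empty [simp]: "int_comb G c {} = \<one>"
  by (simp add: int_comb_def)

lemma int_comb_insert:
  "\<lbrakk>finite S; x \<notin> S; x \<in> carrier G; S \<subseteq> carrier G\<rbrakk> \<Longrightarrow>
    int_comb G c (insert x S) = x [^] c x \<otimes> int_comb G c S"
  unfolding int_comb_def by (intro finprod_insert) auto

lemma int_comb_cong: "S \<subseteq> carrier G \<Longrightarrow> (\<And>s. s \<in> S \<Longrightarrow> c s = d s) \<Longrightarrow> int_comb G c S = int_comb G d S"
  unfolding int_comb_def by (intro finprod_cong') auto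

lemma int_comb_zero: "S \<subseteq> carrier G \<Longrightarrow> (\<And>s. s \<in> S \<Longrightarrow> c s = 0) \<Longrightarrow> int_comb G c S = \<one>"
  unfolding int_comb_def by (intro finprod_one_eqI) auto

lemma int_comb_add:
  "S \<subseteq> carrier G \<Longrightarrow> int_comb G (\<lambda>s. c s + d s) S = int_comb G c S \<otimes> int_comb G d S"
proof -
  assume S: "S \<subseteq> carrier G"
  have "int_comb G (\<lambda>s. c s + d s) S = finprod G (\<lambda>s. s [^] c s \<otimes> s [^] d s) S"
    unfolding int_comb_def using S by (intro finprod_cong') (auto simp: int_pow_mult)
  also have "\<dots> = int_comb G c S \<otimes> int_comb G d S"
    unfolding int_comb_def using S by (intro finprod_multf) auto
  finally show ?thesis .
qed

lemma int_comb_scale: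
  assumes "finite S" "S \<subseteq> carrier G"
  shows "int_comb G (\<lambda>s. k * c s) S = int_comb G c S [^] (k::int)"
  using assms
proof (induction S rule: finite_induct)
  case empty then show ?case by (simp add: int_pow_one)
next
  case (insert x S)
  then have "int_comb G c S \<in> carrier G" by (simp add: int_comb_closed)
  moreover have "x [^] (k * c x) = (x [^] c x) [^] k"
    using insert by (simp add: int_pow_pow mult.commute)
  ultimately show ?case using insert by (simp add: int_comb_insert int_pow_distrib)
qed

lemma int_comb_sum:
  assumes "finite U" "S \<subseteq> carrier G" "finite S"
  shows "finprod G (\<lambda>u. int_comb G (c u) S [^] (x u::int)) U = int_comb G (\<lambda>s. \<Sum>u\<in>U. x u * c u s) S"
  using assms(1)
proof (induction U rule: finite_induct)
  case empty then show ?case using assms by (simp add: int_comb_zero)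
next
  case (insert u U)
  have "finprod G (\<lambda>u. int_comb G (c u) S [^] (x u::int)) (insert u U) =
      int_comb G (c u) S [^] x u \<otimes> int_comb G (\<lambda>s. \<Sum>u\<in>U. x u * c u s) S"
    using insert assms by (subst finprod_insert) (auto simp: int_comb_closed)
  then show ?case using insert assms by (simp add: int_comb_add int_comb_scale)
qed

text \<open>Rationally, \<open>U\<close> lies in the span of fewer elements. The exponents
  \<open>k u\<close> clear denominators, so a relation between the coefficient vectors
  \<open>c u\<close> becomes an integral relation with coefficients
  \<open>k u * x u\<close>.\<close>

lemma int_dependent_of_span:
  assumes U: "finite U" "U \<subseteq> carrier G" and T: "finite T" "T \<subseteq> carrier G"
    and span: "\<And>u. u \<in> U \<Longrightarrow> \<exists>k c. k \<noteq> (0::int) \<and> u [^] k = int_comb G c T"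
    and card: "card T < card U"
  shows "\<not> int_independent G U"
proof
  assume ind: "int_independent G U"
  obtain k c where kc: "\<And>u. u \<in> U \<Longrightarrow> k u \<noteq> (0::int) \<and> u [^] k u = int_comb G (c u) T"
    using span by metis
  obtain x where x: "\<exists>u\<in>U. x u \<noteq> (0::int)" "\<And>t. t \<in> T \<Longrightarrow> (\<Sum>u\<in>U. x u * c u t) = 0"
    using linear_dependence_idom[OF T(1) U(1) card, of c] by auto
  have "int_comb G (\<lambda>u. k u * x u) U = finprod G (\<lambda>u. int_comb G (c u) T [^] x u) U"
    unfolding int_comb_def[of G "\<lambda>u. k u * x u"] using U T kc
    by (intro finprod_cong') (auto simp: int_comb_closed int_pow_pow[symmetric])
  also have "\<dots> = \<one>"
    using x(2) U T by (subst int_comb_sum) (auto intro!: int_comb_zero)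
  finally have "\<forall>u\<in>U. k u * x u = 0" using ind unfolding int_independent_comb by blast
  then show False using x(1) kc by auto
qed

end

text \<open>Values in \<open>enat\<close> keep infinite rank apart from finite rank, which the
  natural-number supremum in \<open>abelian_rank\<close> cannot do. The rank is that of a subset of
  an ambient group, so kernels and images enter without being made into groups of their own.\<close>

definition ab_rank :: "('a, 'b) monoid_scheme \<Rightarrow> 'a set \<Rightarrow> enat" where
  "ab_rank A H = (SUP S\<in>{S. finite S \<and> S \<subseteq> H \<and> int_independent A S}. enat (card S))"

lemma ab_rank_upper:
  "finite S \<Longrightarrow> S \<subseteq> H \<Longrightarrow> int_independent A S \<Longrightarrow> enat (card S) \<le> ab_rank A H"
  unfolding ab_rank_def by (rule SUP_upper) auto

lemma ab_rank_mono: "H \<subseteq> K \<Longrightarrow> ab_rank A H \<le> ab_rank A K"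
  unfolding ab_rank_def by (rule SUP_subset_mono) auto

lemma ab_rank_least:
  "(\<And>S. finite S \<Longrightarrow> S \<subseteq> H \<Longrightarrow> int_independent A S \<Longrightarrow> enat (card S) \<le> n) \<Longrightarrow> ab_rank A H \<le> n"
  unfolding ab_rank_def by (rule SUP_least) auto

lemma int_independent_empty: "int_independent A {}"
  by (simp add: int_independent_def)

lemma ab_rank_attained:
  assumes "ab_rank A H \<noteq> \<infinity>"
  obtains S where "finite S" "S \<subseteq> H" "int_independent A S" "ab_rank A H = enat (card S)"
proof -
  define X where "X = (\<lambda>S. enat (card S)) ` {S. finite S \<and> S \<subseteq> H \<and> int_independent A S}"
  have ne: "X \<noteq> {}" using int_independent_empty unfolding X_def by fastforce
  have "Sup X \<noteq> \<infinity>" using assms by (simp add: ab_rank_def X_def)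
  then have "finite X" "Sup X = Max X" using ne unfolding Sup_enat_def by (auto split: if_splits)
  then have "Sup X \<in> X" using ne by simp
  then show ?thesis using that unfolding ab_rank_def X_def by auto
qed

lemma one_notin_int_independent:
  assumes "comm_group A" "int_independent A S"
  shows "\<one>\<^bsub>A\<^esub> \<notin> S"
proof
  interpret comm_group A by fact
  assume *: "\<one>\<^bsub>A\<^esub> \<in> S"
  have "int_comb A (\<lambda>t. if t = \<one>\<^bsub>A\<^esub> then 1 else 0) S = \<one>\<^bsub>A\<^esub>"
    unfolding int_comb_def by (rule finprod_one_eqI) auto
  then have "\<forall>s\<in>S. (if s = \<one>\<^bsub>A\<^esub> then 1 else 0) = (0::int)"
    using assms(2) unfolding int_independent_comb by blast
  then show False using * by auto
qed

lemma ab_rank_trivial: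
  assumes "comm_group A"
  shows "ab_rank A {\<one>\<^bsub>A\<^esub>} = 0"
proof -
  have "ab_rank A {\<one>\<^bsub>A\<^esub>} \<le> 0"
  proof (rule ab_rank_least)
    fix S assume "S \<subseteq> {\<one>\<^bsub>A\<^esub>}" "int_independent A S"
    then have "S = {}" using one_notin_int_independent[OF assms] by blast
    then show "enat (card S) \<le> 0" by (simp add: zero_enat_def)
  qed
  then show ?thesis by simp
qed

lemma abelian_rank_eq:
  assumes "ab_rank A (carrier A) = enat n"
  shows "abelian_rank A = n"
proof -
  have fin: "ab_rank A (carrier A) \<noteq> \<infinity>" using assms by simp
  obtain S where S: "finite S" "S \<subseteq> carrier A" "int_independent A S" "n = card S"
    using ab_rank_attained[OF fin] assms by (metis enat.inject)
  let ?X = "{card S |S. finite S \<and> S \<subseteq> carrier A \<and> int_independent A S}"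
  have "k \<le> n" if "k \<in> ?X" for k
  proof -
    from that obtain S where "finite S" "S \<subseteq> carrier A" "int_independent A S" "k = card S" by auto
    then show ?thesis using ab_rank_upper[of S "carrier A" A] assms by simp
  qed
  moreover have "n \<in> ?X" using S by auto
  ultimately show ?thesis unfolding abelian_rank_def by (rule cSup_eq_maximum[rotated])
qed

text \<open>Maximality puts \<open>u\<close> into the rational span: if \<open>u\<close> is not in
  \<open>S\<close>, then \<open>insert u S\<close> has a relation, and its coefficient at
  \<open>u\<close> is nonzero because \<open>S\<close> alone is independent.\<close>

lemma ab_rank_attained_span:
  assumes "comm_group D" "finite S" "S \<subseteq> H" "H \<subseteq> carrier D" "int_independent D S"
    "ab_rank D H = enat (card S)" "u \<in> H"
  shows "\<exists>k c. k \<noteq> (0::int) \<and> u [^]\<^bsub>D\<^esub> k = int_comb D c S"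
proof -
  interpret D: comm_group D by fact
  have SD: "S \<subseteq> carrier D" "u \<in> carrier D" using assms by auto
  show ?thesis
  proof (cases "u \<in> S")
    case True
    have "int_comb D (\<lambda>s. if s = u then 1 else 0) S = finprod D (\<lambda>s. if s = u then s else \<one>\<^bsub>D\<^esub>) S"
      unfolding int_comb_def using SD by (intro D.finprod_cong') auto
    also have "\<dots> = u" using True assms SD by (intro D.finprod_singleton_swap) auto
    finally have "u [^]\<^bsub>D\<^esub> (1::int) = int_comb D (\<lambda>s. if s = u then 1 else 0) S" using SD by simp
    then show ?thesis by (metis zero_neq_one)
  next
    case False
    have "\<not> int_independent D (insert u S)"
    proof
      assume "int_independent D (insert u S)"
      then have "enat (card (insert u S)) \<le> enat (card S)"
        using ab_rank_upper[of "insert u S" H D] assms by auto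
      then show False using False assms by simp
    qed
    then obtain c where c: "int_comb D c (insert u S) = \<one>\<^bsub>D\<^esub>" "\<exists>s\<in>insert u S. c s \<noteq> 0"
      unfolding int_independent_comb by auto
    have eq: "u [^]\<^bsub>D\<^esub> c u \<otimes>\<^bsub>D\<^esub> int_comb D c S = \<one>\<^bsub>D\<^esub>"
      using c(1) False SD assms by (simp add: D.int_comb_insert)
    have cu: "c u \<noteq> 0"
    proof
      assume "c u = 0"
      then have "int_comb D c S = \<one>\<^bsub>D\<^esub>" using eq SD by (simp add: D.int_comb_closed)
      then show False using c(2) \<open>c u = 0\<close> assms unfolding int_independent_comb by auto
    qed
    have "int_comb D (\<lambda>s. - 1 * c s) S = inv\<^bsub>D\<^esub> (int_comb D c S)"
      using SD assms D.int_comb_scale[of S "-1" c] by (simp add: D.int_pow_neg D.int_comb_closed)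
    also have "\<dots> = u [^]\<^bsub>D\<^esub> c u"
      using eq SD by (simp add: D.int_comb_closed D.inv_equality)
    finally show ?thesis using cu by metis
  qed
qed

text \<open>Rank-nullity, including infinite ranks. A maximal independent set of the kernel and
  lifts of one of the image are together independent, and some nonzero multiple of every element
  lies in their integral span.\<close>

theorem ab_rank_kernel_image:
  assumes "comm_group A" "comm_group B" and h: "h \<in> hom A B"
  shows "ab_rank A (carrier A) = ab_rank A (kernel A B h) + ab_rank B (h ` carrier A)"
proof -
  interpret A: comm_group A by fact
  interpret B: comm_group B by fact
  interpret h: group_hom A B h by unfold_locales (use h in auto)
  let ?K = "kernel A B h" and ?I = "h ` carrier A"
  have KA: "?K \<subseteq> carrier A" by (auto simp: kernel_def)
  have IB: "?I \<subseteq> carrier B" using h by (auto simp: hom_def)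
  have hcomb: "h (int_comb A c S) = finprod B (\<lambda>s. h s [^]\<^bsub>B\<^esub> c s) S"
    if "finite S" "S \<subseteq> carrier A" for c S
    using that
  proof (induction S rule: finite_induct)
    case empty then show ?case by simp
  next
    case (insert x F)
    have "finprod B (\<lambda>s. h s [^]\<^bsub>B\<^esub> c s) (insert x F) = h x [^]\<^bsub>B\<^esub> c x \<otimes>\<^bsub>B\<^esub> finprod B (\<lambda>s. h s [^]\<^bsub>B\<^esub> c s) F"
      using insert by (intro B.finprod_insert) auto
    then show ?case using insert by (simp add: A.int_comb_insert A.int_comb_closed h.hom_int_pow)
  qed
  have lift: "\<exists>T'. finite T' \<and> T' \<subseteq> carrier A \<and> inj_on h T' \<and> h ` T' = T"
    if T: "finite T" "T \<subseteq> ?I" for T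
  proof -
    obtain T' where T': "T' \<subseteq> carrier A" "inj_on h T'" "T = h ` T'"
      using T(2) unfolding subset_image_inj by auto
    then have "finite T'" using T(1) finite_imageD by blast
    then show ?thesis using T' by auto
  qed
  have hcomb': "h (int_comb A c T') = int_comb B (\<lambda>t. c (inv_into T' h t)) (h ` T')"
    if "finite T'" "T' \<subseteq> carrier A" "inj_on h T'" for c T'
  proof -
    have "int_comb B (\<lambda>t. c (inv_into T' h t)) (h ` T') = finprod B (\<lambda>s. h s [^]\<^bsub>B\<^esub> c (inv_into T' h (h s))) T'"
      unfolding int_comb_def using that by (subst B.finprod_reindex) auto
    also have "\<dots> = finprod B (\<lambda>s. h s [^]\<^bsub>B\<^esub> c s) T'"
      using that by (intro B.finprod_cong') auto
    finally show ?thesis using hcomb that by simp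
  qed
  have ge: "\<exists>W. finite W \<and> W \<subseteq> carrier A \<and> int_independent A W \<and> card W = card S + card T"
    if S: "finite S" "S \<subseteq> ?K" "int_independent A S" and T: "finite T" "T \<subseteq> ?I" "int_independent B T" for S T
  proof -
    obtain T' where T': "finite T'" "T' \<subseteq> carrier A" "inj_on h T'" "h ` T' = T"
      using lift[OF T(1,2)] by metis
    have SA: "S \<subseteq> carrier A" using S KA by blast
    have one: "\<one>\<^bsub>B\<^esub> \<notin> T" using one_notin_int_independent[OF \<open>comm_group B\<close> T(3)] .
    have "h s = \<one>\<^bsub>B\<^esub>" if "s \<in> S" for s using S that by (auto simp: kernel_def)
    then have disj: "S \<inter> T' = {}" using one T'(4) by (metis disjoint_iff imageI)
    have "int_independent A (S \<union> T')"
      unfolding int_independent_comb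
    proof (intro allI impI)
      fix c assume c: "int_comb A c (S \<union> T') = \<one>\<^bsub>A\<^esub>"
      have eq: "int_comb A c (S \<union> T') = int_comb A c S \<otimes>\<^bsub>A\<^esub> int_comb A c T'"
        unfolding int_comb_def using S T' disj SA by (intro A.finprod_Un_disjoint) auto
      have "h (int_comb A c S) = \<one>\<^bsub>B\<^esub>"
        using hcomb[OF S(1) SA] S by (simp add: kernel_def subset_iff B.finprod_one_eqI)
      then have "h (int_comb A c T') = \<one>\<^bsub>B\<^esub>"
        using arg_cong[OF c, of h] eq SA T' by (simp add: A.int_comb_closed)
      then have *: "\<forall>t\<in>T. c (inv_into T' h t) = 0"
        using hcomb'[of T' c] T' T(3) unfolding int_independent_comb by metis
      have cT: "\<forall>t\<in>T'. c t = 0"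
        using * T' by (metis imageI inv_into_f_f)
      then have "int_comb A c T' = \<one>\<^bsub>A\<^esub>" using T' by (intro A.int_comb_zero) auto
      then have "int_comb A c S = \<one>\<^bsub>A\<^esub>" using eq c SA by (simp add: A.int_comb_closed)
      then show "\<forall>s\<in>S \<union> T'. c s = 0" using cT S(3) unfolding int_independent_comb by blast
    qed
    moreover have "card (S \<union> T') = card S + card T"
      using disj S T' card_image by (metis card_Un_disjoint)
    ultimately show ?thesis using S T' SA by (metis Un_least finite_UnI)
  qed
  show ?thesis
  proof (cases "ab_rank A ?K = \<infinity> \<or> ab_rank B ?I = \<infinity>")
    case True
    then have "ab_rank A (carrier A) = \<infinity>"
    proof
      assume "ab_rank A ?K = \<infinity>"
      then show ?thesis using ab_rank_mono[OF KA, of A] by simp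
    next
      assume inf: "ab_rank B ?I = \<infinity>"
      have "ab_rank B ?I \<le> ab_rank A (carrier A)"
      proof (rule ab_rank_least)
        fix T assume "finite T" "T \<subseteq> ?I" "int_independent B T"
        then obtain W where "finite W" "W \<subseteq> carrier A" "int_independent A W" "card W = card T"
          using ge[of "{}" T] int_independent_empty by auto
        then show "enat (card T) \<le> ab_rank A (carrier A)" using ab_rank_upper by metis
      qed
      then show ?thesis using inf by simp
    qed
    then show ?thesis using True by auto
  next
    case False
    then obtain S T where S: "finite S" "S \<subseteq> ?K" "int_independent A S" "ab_rank A ?K = enat (card S)"
      and T: "finite T" "T \<subseteq> ?I" "int_independent B T" "ab_rank B ?I = enat (card T)"
      using ab_rank_attained by metis
    have SA: "S \<subseteq> carrier A" using S KA by blast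
    note max = ab_rank_attained_span
    obtain T' where T': "finite T'" "T' \<subseteq> carrier A" "inj_on h T'" "h ` T' = T"
      using lift[OF T(1,2)] by metis
    have "ab_rank A (carrier A) \<le> enat (card S + card T)"
    proof (rule ab_rank_least)
      fix U assume U: "finite U" "U \<subseteq> carrier A" "int_independent A U"
      have disj: "card (S \<union> T') \<le> card S + card T"
        using T' card_Un_le[of S T'] card_image by metis
      have "\<exists>k c. k \<noteq> (0::int) \<and> u [^]\<^bsub>A\<^esub> k = int_comb A c (S \<union> T')" if u: "u \<in> U" for u
      proof -
        have uA: "u \<in> carrier A" using u U by auto
        obtain k c where kc: "k \<noteq> (0::int)" "h u [^]\<^bsub>B\<^esub> k = int_comb B c T"
          using max[OF \<open>comm_group B\<close> T(1,2) IB T(3,4)] uA by blast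
        \<comment> \<open>Dividing out a lift of the relation for \<open>h u\<close> brings a power
          of \<open>u\<close> into the kernel, where \<open>S\<close> spans rationally.\<close>
        define w where "w = u [^]\<^bsub>A\<^esub> k \<otimes>\<^bsub>A\<^esub> inv\<^bsub>A\<^esub> (int_comb A (c \<circ> h) T')"
        have cl: "int_comb A (c \<circ> h) T' \<in> carrier A" using T' by (simp add: A.int_comb_closed)
        have "h (int_comb A (c \<circ> h) T') = int_comb B c T"
        proof -
          have "h (int_comb A (c \<circ> h) T') = finprod B (\<lambda>s. h s [^]\<^bsub>B\<^esub> c (h s)) T'"
            using hcomb T' by simp
          also have "\<dots> = int_comb B c T" unfolding int_comb_def T'(4)[symmetric]
            using T' by (subst B.finprod_reindex) auto
          finally show ?thesis .
        qed
        moreover have "h (u [^]\<^bsub>A\<^esub> k) = h u [^]\<^bsub>B\<^esub> k" using uA by (simp add: h.hom_int_pow)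
        ultimately have "h w = \<one>\<^bsub>B\<^esub>"
          using kc uA cl T IB B.int_comb_closed[of T c] by (auto simp: w_def)
        then have wK: "w \<in> ?K" using uA cl by (auto simp: kernel_def w_def)
        then obtain m d where md: "m \<noteq> (0::int)" "w [^]\<^bsub>A\<^esub> m = int_comb A d S"
          using max[OF \<open>comm_group A\<close> S(1,2) KA S(3,4) wK] by metis
        have uk: "u [^]\<^bsub>A\<^esub> k = w \<otimes>\<^bsub>A\<^esub> int_comb A (c \<circ> h) T'"
          using uA cl by (simp add: w_def A.m_assoc)
        have "u [^]\<^bsub>A\<^esub> (k * m) = w [^]\<^bsub>A\<^esub> m \<otimes>\<^bsub>A\<^esub> int_comb A (c \<circ> h) T' [^]\<^bsub>A\<^esub> m"
        proof -
          have "w \<in> carrier A" using wK KA by blast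
          then have "(w \<otimes>\<^bsub>A\<^esub> int_comb A (c \<circ> h) T') [^]\<^bsub>A\<^esub> m =
              w [^]\<^bsub>A\<^esub> m \<otimes>\<^bsub>A\<^esub> int_comb A (c \<circ> h) T' [^]\<^bsub>A\<^esub> m"
            using cl by (rule A.int_pow_distrib)
          then show ?thesis unfolding uk[symmetric] using A.int_pow_pow[OF uA, of k m] by simp
        qed
        also have "\<dots> = int_comb A d S \<otimes>\<^bsub>A\<^esub> int_comb A (\<lambda>s. m * (c \<circ> h) s) T'"
          using md A.int_comb_scale[of T' m "c \<circ> h"] T' by simp
        also have "\<dots> = int_comb A (\<lambda>s. if s \<in> S then d s else 0) (S \<union> T') \<otimes>\<^bsub>A\<^esub>
            int_comb A (\<lambda>s. if s \<in> T' then m * (c \<circ> h) s else 0) (S \<union> T')"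
        proof -
          have "int_comb A d S = int_comb A (\<lambda>s. if s \<in> S then d s else 0) (S \<union> T')"
            unfolding int_comb_def using SA T' S
            by (intro A.finprod_mono_neutral_cong_left) auto
          moreover have "int_comb A (\<lambda>s. m * (c \<circ> h) s) T' = int_comb A (\<lambda>s. if s \<in> T' then m * (c \<circ> h) s else 0) (S \<union> T')"
            unfolding int_comb_def using SA T' S
            by (intro A.finprod_mono_neutral_cong_left) auto
          ultimately show ?thesis by simp
        qed
        also have "\<dots> = int_comb A (\<lambda>s. (if s \<in> S then d s else 0) + (if s \<in> T' then m * (c \<circ> h) s else 0)) (S \<union> T')"
          using SA T' by (subst A.int_comb_add) auto
        finally have "u [^]\<^bsub>A\<^esub> (k * m) =
            int_comb A (\<lambda>s. (if s \<in> S then d s else 0) + (if s \<in> T' then m * (c \<circ> h) s else 0)) (S \<union> T')" .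
        moreover have "k * m \<noteq> 0" using kc md by simp
        ultimately show ?thesis by blast
      qed
      then have "\<not> card (S \<union> T') < card U"
        using A.int_dependent_of_span[of U "S \<union> T'"] U SA T' S by auto
      then show "enat (card U) \<le> enat (card S + card T)" using disj by simp
    qed
    moreover have "enat (card S + card T) \<le> ab_rank A (carrier A)"
      using ge[OF S(1-3) T(1-3)] ab_rank_upper by metis
    ultimately show ?thesis using S T by simp
  qed
qed

section \<open>The homotopy extension property\<close>

section \<open>Cofibrations\<close>

definition cofibration :: "'a::topological_space set \<Rightarrow> 'a set \<Rightarrow> bool" where
  "cofibration K L \<longleftrightarrow> L \<subseteq> K \<and> (K \<times> {0::real} \<union> L \<times> {0..1}) retract_of (K \<times> {0..1})"

text \<open>The two components of a retraction of \<open>K \<times> {0..1}\<close> onto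
  \<open>K \<times> {0} \<union> L \<times> {0..1}\<close>: a deformation \<open>f\<close> that
  fixes \<open>L\<close>, and a height \<open>g\<close> that is positive only where \<open>f\<close>
  has arrived in \<open>L\<close>.\<close>

definition cofibration_maps ::
    "'a::topological_space set \<Rightarrow> 'a set \<Rightarrow> ('a \<times> real \<Rightarrow> 'a) \<Rightarrow> ('a \<times> real \<Rightarrow> real) \<Rightarrow> bool" where
  "cofibration_maps K L f g \<longleftrightarrow>
     continuous_on (K \<times> {0..1}) f \<and> continuous_on (K \<times> {0..1}) g \<and>
     (\<forall>x\<in>K. \<forall>t\<in>{0..1}. f (x, t) \<in> K \<and> g (x, t) \<in> {0..1} \<and> (g (x, t) = 0 \<or> f (x, t) \<in> L)) \<and>
     (\<forall>x\<in>K. f (x, 0) = x \<and> g (x, 0) = 0) \<and>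
     (\<forall>x\<in>L. \<forall>t\<in>{0..1}. f (x, t) = x \<and> g (x, t) = t)"

lemma cofibration_mapsD:
  assumes "cofibration_maps K L f g"
  shows "continuous_on (K \<times> {0..1}) f" "continuous_on (K \<times> {0..1}) g"
    "\<And>x t. x \<in> K \<Longrightarrow> t \<in> {0..1} \<Longrightarrow> f (x, t) \<in> K"
    "\<And>x t. x \<in> K \<Longrightarrow> t \<in> {0..1} \<Longrightarrow> g (x, t) \<in> {0..1::real}"
    "\<And>x t. x \<in> K \<Longrightarrow> t \<in> {0..1} \<Longrightarrow> g (x, t) = 0 \<or> f (x, t) \<in> L"
    "\<And>x. x \<in> K \<Longrightarrow> f (x, 0) = x" "\<And>x. x \<in> K \<Longrightarrow> g (x, 0) = 0"
    "\<And>x t. x \<in> L \<Longrightarrow> t \<in> {0..1} \<Longrightarrow> f (x, t) = x"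
    "\<And>x t. x \<in> L \<Longrightarrow> t \<in> {0..1} \<Longrightarrow> g (x, t) = t"
  using assms unfolding cofibration_maps_def by blast+

lemma cofibrationE:
  assumes "cofibration K L"
  obtains f g where "cofibration_maps K L f g"
proof -
  have L: "L \<subseteq> K" using assms by (simp add: cofibration_def)
  obtain r where r0: "retraction (K \<times> {0..1}) (K \<times> {0::real} \<union> L \<times> {0..1}) r"
    using assms unfolding cofibration_def retract_of_def by metis
  note r = r0[unfolded retraction_def, THEN conjunct2, THEN conjunct1]
    r0[unfolded retraction_def, THEN conjunct2, THEN conjunct2, THEN conjunct1]
    r0[unfolded retraction_def, THEN conjunct2, THEN conjunct2, THEN conjunct2]
  have rz: "r (x, t) \<in> K \<times> {0} \<union> L \<times> {0..1}" if "x \<in> K" "t \<in> {0..1}" for x t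
    using r(2) that by blast
  show ?thesis
  proof (rule that[of "fst \<circ> r" "snd \<circ> r"])
    show "cofibration_maps K L (fst \<circ> r) (snd \<circ> r)"
      unfolding cofibration_maps_def
    proof (intro conjI ballI)
      show "continuous_on (K \<times> {0..1}) (fst \<circ> r)" "continuous_on (K \<times> {0..1}) (snd \<circ> r)"
        unfolding o_def by (intro continuous_intros r)+
      fix x and t :: real assume xt: "x \<in> K" "t \<in> {0..1}"
      show "(fst \<circ> r) (x, t) \<in> K" "(snd \<circ> r) (x, t) \<in> {0..1}" "(snd \<circ> r) (x, t) = 0 \<or> (fst \<circ> r) (x, t) \<in> L"
        using rz[OF xt] L by auto
    qed (use r(3) in auto)
  qed
qed

lemma cofibrationI:
  assumes "L \<subseteq> K" "continuous_on (K \<times> {0..1}) f" "continuous_on (K \<times> {0..1}) g"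
    "\<And>x t. x \<in> K \<Longrightarrow> t \<in> {0..1} \<Longrightarrow> f (x, t) \<in> K"
    "\<And>x t. x \<in> K \<Longrightarrow> t \<in> {0..1} \<Longrightarrow> g (x, t) \<in> {0..1::real}"
    "\<And>x t. x \<in> K \<Longrightarrow> t \<in> {0..1} \<Longrightarrow> g (x, t) = 0 \<or> f (x, t) \<in> L"
    "\<And>x. x \<in> K \<Longrightarrow> f (x, 0) = x" "\<And>x. x \<in> K \<Longrightarrow> g (x, 0) = 0"
    "\<And>x t. x \<in> L \<Longrightarrow> t \<in> {0..1} \<Longrightarrow> f (x, t) = x"
    "\<And>x t. x \<in> L \<Longrightarrow> t \<in> {0..1} \<Longrightarrow> g (x, t) = t"
  shows "cofibration K L"
  unfolding cofibration_def retract_of_def retraction_def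
proof (intro conjI exI[of _ "\<lambda>z. (f z, g z)"])
  show "K \<times> {0} \<union> L \<times> {0..1} \<subseteq> K \<times> {0..1::real}" using assms(1) by auto
  show "continuous_on (K \<times> {0..1}) (\<lambda>z. (f z, g z))" by (intro continuous_intros assms)
  show "(\<lambda>z. (f z, g z)) \<in> K \<times> {0..1} \<rightarrow> K \<times> {0} \<union> L \<times> {0..1}"
  proof
    fix z :: "'a \<times> real" assume "z \<in> K \<times> {0..1}"
    then obtain x t where z: "z = (x, t)" "x \<in> K" "t \<in> {0..1}" by auto
    have "f z \<in> K" "g z \<in> {0..1}" "g z = 0 \<or> f z \<in> L"
      unfolding z(1) using assms(4-6)[OF z(2,3)] by blast+
    then show "(f z, g z) \<in> K \<times> {0} \<union> L \<times> {0..1}" by blast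
  qed
  show "\<forall>x\<in>K \<times> {0} \<union> L \<times> {0..1}. (f x, g x) = x"
    using assms(7-10) by auto
qed (fact assms(1))

lemma cofibration_empty: "cofibration K {}"
  by (rule cofibrationI[where f = fst and g = "\<lambda>_. 0"]) (auto intro!: continuous_intros)

lemma cofibration_homeomorphism:
  assumes "cofibration K L" "homeomorphism K K' h h'" "h ` L = L'"
  shows "cofibration K' L'"
proof -
  note hh = homeomorphism_apply1[OF assms(2)] homeomorphism_apply2[OF assms(2)]
  have im: "h ` K = K'" "h' ` K' = K" and ch: "continuous_on K h" "continuous_on K' h'"
    using assms(2) by (auto simp: homeomorphism_def)
  obtain f g where d: "cofibration_maps K L f g"
    using cofibrationE[OF assms(1)] by metis
  note fg = cofibration_mapsD[OF d]
  have LK: "L \<subseteq> K" using assms(1) by (simp add: cofibration_def)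
  have h'K: "h' y \<in> K" if "y \<in> K'" for y using im that by auto
  have h'L: "h' y \<in> L" if "y \<in> L'" for y using assms(3) that hh LK by auto
  have hK: "h y \<in> K'" if "y \<in> K" for y using im that by auto
  have hL: "h y \<in> L'" if "y \<in> L" for y using assms(3) that by auto
  have L'K: "L' \<subseteq> K'" using LK im assms(3) by blast
  let ?m = "\<lambda>z :: 'b \<times> real. (h' (fst z), snd z)"
  have cm: "continuous_on (K' \<times> {0..1}) ?m"
    by (intro continuous_intros continuous_on_compose2[OF ch(2) continuous_on_fst]) auto
  have mm: "?m ` (K' \<times> {0..1}) \<subseteq> K \<times> {0..1}" using h'K by auto
  have cf: "continuous_on (K' \<times> {0..1}) (\<lambda>z. f (?m z))" "continuous_on (K' \<times> {0..1}) (\<lambda>z. g (?m z))"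
    using continuous_on_compose2[OF fg(1) cm mm] continuous_on_compose2[OF fg(2) cm mm] by auto
  show ?thesis
  proof (rule cofibrationI[where f = "\<lambda>z. h (f (?m z))" and g = "\<lambda>z. g (?m z)"])
    show "continuous_on (K' \<times> {0..1}) (\<lambda>z. h (f (?m z)))"
      by (rule continuous_on_compose2[OF ch(1) cf(1)]) (use fg(3) h'K in auto)
    show "g (?m (y, t)) = 0 \<or> h (f (?m (y, t))) \<in> L'" if "y \<in> K'" "t \<in> {0..1}" for y t
      using fg(5)[OF h'K[OF that(1)] that(2)] hL by auto
  qed (use cf fg hh h'K h'L hK hL L'K in auto)
qed

text \<open>The retraction for \<open>L\<close> in \<open>M\<close>, extended by the identity over
  \<open>K \<times> {0}\<close>, is applied after the one for \<open>M\<close> in \<open>K\<close>.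
  Closedness makes the glued map continuous.\<close>

lemma cofibration_trans:
  assumes c1: "cofibration K M" and c2: "cofibration M L" and "closed K" "closed M"
  shows "cofibration K L"
proof -
  have sub: "L \<subseteq> M" "M \<subseteq> K" using assms by (auto simp: cofibration_def)
  obtain r where r0: "retraction (M \<times> {0..1}) (M \<times> {0::real} \<union> L \<times> {0..1}) r"
    using c2 unfolding cofibration_def retract_of_def by metis
  note r = r0[unfolded retraction_def, THEN conjunct2, THEN conjunct1]
    r0[unfolded retraction_def, THEN conjunct2, THEN conjunct2, THEN conjunct1]
    r0[unfolded retraction_def, THEN conjunct2, THEN conjunct2, THEN conjunct2]
  define r' where "r' = (\<lambda>z. if z \<in> K \<times> {0::real} then z else r z)"
  have "(K \<times> {0} \<union> L \<times> {0..1}) retract_of (K \<times> {0} \<union> M \<times> {0..1::real})"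
    unfolding retract_of_def retraction_def
  proof (intro exI[of _ r'] conjI)
    show "continuous_on (K \<times> {0} \<union> M \<times> {0..1}) r'"
      unfolding r'_def
      by (rule continuous_on_If) (use assms r in \<open>auto intro!: closed_Times\<close>)
    show "r' \<in> K \<times> {0} \<union> M \<times> {0..1} \<rightarrow> K \<times> {0} \<union> L \<times> {0..1}"
    proof (rule funcsetI)
      fix z assume z: "z \<in> K \<times> {0::real} \<union> M \<times> {0..1}"
      show "r' z \<in> K \<times> {0} \<union> L \<times> {0..1}"
      proof (cases "z \<in> K \<times> {0}")
        case False
        then have "r z \<in> M \<times> {0} \<union> L \<times> {0..1}" using z r(2) by blast
        then show ?thesis using False sub by (auto simp: r'_def)
      qed (auto simp: r'_def)
    qed
  qed (use sub r(3) in \<open>auto simp: r'_def\<close>)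
  moreover have "(K \<times> {0} \<union> M \<times> {0..1}) retract_of (K \<times> {0..1::real})"
    using c1 by (simp add: cofibration_def)
  ultimately show ?thesis using sub unfolding cofibration_def by (meson order_trans retract_of_trans)
qed

text \<open>The identity over \<open>K0\<close> and the retraction over \<open>E\<close> agree over
  \<open>D\<close>, where the two sets meet, so they glue to a retraction.\<close>

lemma cofibration_attach:
  assumes ED: "cofibration E D" and "closed K0" "closed E" "E \<inter> K0 = D"
  shows "cofibration (K0 \<union> E) K0"
proof -
  obtain r where r0: "retraction (E \<times> {0..1}) (E \<times> {0::real} \<union> D \<times> {0..1}) r"
    using ED unfolding cofibration_def retract_of_def by metis
  note r = r0[unfolded retraction_def, THEN conjunct2, THEN conjunct1]
    r0[unfolded retraction_def, THEN conjunct2, THEN conjunct2, THEN conjunct1]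
    r0[unfolded retraction_def, THEN conjunct2, THEN conjunct2, THEN conjunct2]
  define r' where "r' = (\<lambda>z. if z \<in> K0 \<times> {0..1::real} then z else r z)"
  have rE: "r z \<in> E \<times> {0} \<union> D \<times> {0..1}" if "z \<in> E \<times> {0..1}" for z using r(2) that by blast
  have eq: "(K0 \<union> E) \<times> {0..1::real} = K0 \<times> {0..1} \<union> E \<times> {0..1}" by auto
  have "((K0 \<union> E) \<times> {0} \<union> K0 \<times> {0..1}) retract_of ((K0 \<union> E) \<times> {0..1::real})"
    unfolding retract_of_def retraction_def
  proof (intro exI[of _ r'] conjI)
    show "continuous_on ((K0 \<union> E) \<times> {0..1}) r'"
      unfolding r'_def eq
      by (rule continuous_on_If) (use assms r in \<open>auto intro!: closed_Times\<close>)
    show "r' \<in> (K0 \<union> E) \<times> {0..1} \<rightarrow> (K0 \<union> E) \<times> {0} \<union> K0 \<times> {0..1}"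
    proof
      fix z assume "z \<in> (K0 \<union> E) \<times> {0..1::real}"
      then show "r' z \<in> (K0 \<union> E) \<times> {0} \<union> K0 \<times> {0..1}"
        using rE[of z] assms(4) by (auto simp: r'_def)
    qed
    show "\<forall>x\<in>(K0 \<union> E) \<times> {0} \<union> K0 \<times> {0..1}. r' x = x"
    proof
      fix z assume z: "z \<in> (K0 \<union> E) \<times> {0::real} \<union> K0 \<times> {0..1}"
      show "r' z = z"
      proof (cases "z \<in> K0 \<times> {0..1}")
        case False
        then have "z \<in> E \<times> {0}" using z by auto
        then show ?thesis using r(3) False by (simp add: r'_def)
      qed (simp add: r'_def)
    qed
  qed auto
  then show ?thesis unfolding cofibration_def by blast
qed

text \<open>
  Radial projection of the rectangle \<open>[-1,1] \<times> [0,1]\<close> from the point \<open>(0,2)\<close> onto its bottom and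
  vertical sides replaces the second coordinate by a height \<open>\<tau>\<close> to which the given retraction applies.
\<close>

lemma cofibration_times_interval:
  assumes "cofibration K L"
  shows "cofibration (K \<times> {-1..1::real}) (L \<times> {-1..1} \<union> K \<times> {-1, 1})"
proof -
  obtain f g where d: "cofibration_maps K L f g"
    using cofibrationE[OF assms] by metis
  note fg = cofibration_mapsD[OF d]
  have LK: "L \<subseteq> K" using assms by (simp add: cofibration_def)
  \<comment> \<open>Scaling the point \<open>(s, t)\<close> from the centre \<open>(0, 2)\<close> by
    \<open>1 / \<mu> s t\<close> reaches the bottom or a vertical side, whichever comes first;
    \<open>\<mu>\<close> equals 1 exactly on these sides. The height is \<open>1 - \<mu>\<close>,
    and scaling the boundary point back by \<open>1 - T\<close> undoes the projection when
    \<open>T = 1 - \<mu>\<close>.\<close>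
  define \<mu> where "\<mu> = (\<lambda>s t :: real. max (1 - t / 2) \<bar>s\<bar>)"
  have \<mu>: "1/2 \<le> \<mu> s t" "\<mu> s t \<le> 1" "\<bar>s\<bar> \<le> \<mu> s t" "1 - t / 2 \<le> \<mu> s t"
    if "s \<in> {-1..1}" "t \<in> {0..1}" for s t
    using that by (auto simp: \<mu>_def max_def)
  define F where "F = (\<lambda>z :: ('a \<times> real) \<times> real. f (fst (fst z), 1 - \<mu> (snd (fst z)) (snd z)))"
  \<comment> \<open>The minimum keeps the new height at most the old one, so that the scaled point
    does not leave the rectangle.\<close>
  define T where "T = (\<lambda>z :: ('a \<times> real) \<times> real.
     min (g (fst (fst z), 1 - \<mu> (snd (fst z)) (snd z))) (1 - \<mu> (snd (fst z)) (snd z)))"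
  let ?P = "(K \<times> {-1..1::real}) \<times> {0..1::real}"
  have c\<mu>: "continuous_on ?P (\<lambda>z. \<mu> (snd (fst z)) (snd z))"
    unfolding \<mu>_def by (intro continuous_intros) auto
  have cm: "continuous_on ?P (\<lambda>z. (fst (fst z), 1 - \<mu> (snd (fst z)) (snd z)))"
    by (intro continuous_intros c\<mu>)
  have mm: "(\<lambda>z. (fst (fst z), 1 - \<mu> (snd (fst z)) (snd z))) ` ?P \<subseteq> K \<times> {0..1}"
  proof (rule image_subsetI)
    fix z assume "z \<in> ?P"
    then have z: "snd (fst z) \<in> {-1..1}" "snd z \<in> {0..1}" "fst (fst z) \<in> K" by (auto simp: mem_Times_iff)
    show "(fst (fst z), 1 - \<mu> (snd (fst z)) (snd z)) \<in> K \<times> {0..1}"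
      using \<mu>(1,2)[OF z(1,2)] z by auto
  qed
  have cF: "continuous_on ?P F" unfolding F_def by (rule continuous_on_compose2[OF fg(1) cm mm])
  have cT: "continuous_on ?P T" unfolding T_def
    by (intro continuous_intros c\<mu> continuous_on_compose2[OF fg(2) cm mm])
  define S' where "S' = (\<lambda>z. snd (fst z) / \<mu> (snd (fst z)) (snd z) * (1 - T z))"
  define T' where "T' = (\<lambda>z. 2 - (2 - snd z) / \<mu> (snd (fst z)) (snd z) * (1 - T z))"
  have pos: "\<mu> (snd (fst z)) (snd z) \<noteq> 0" if "z \<in> ?P" for z
  proof -
    have "snd (fst z) \<in> {-1..1}" "snd z \<in> {0..1}" using that by (auto simp: mem_Times_iff)
    from \<mu>(1)[OF this] show ?thesis by linarith
  qed
  have main: "F ((x, s), t) \<in> K \<and> S' ((x, s), t) \<in> {-1..1} \<and> T' ((x, s), t) \<in> {0..1} \<and>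
      (T' ((x, s), t) = 0 \<or> F ((x, s), t) \<in> L \<or> S' ((x, s), t) \<in> {-1, 1})"
    if xst: "x \<in> K" "s \<in> {-1..1}" "t \<in> {0..1}" for x s t
  proof -
    let ?m = "\<mu> s t" and ?\<tau> = "T ((x, s), t)"
    note m = \<mu>[OF xst(2,3)]
    have t1: "1 - ?m \<in> {0..1}" using m by auto
    have fK: "f (x, 1 - ?m) \<in> K" and gI: "g (x, 1 - ?m) \<in> {0..1}"
      and gL: "g (x, 1 - ?m) = 0 \<or> f (x, 1 - ?m) \<in> L"
      using fg(3-5)[OF xst(1) t1] by auto
    have \<tau>: "0 \<le> ?\<tau>" "?\<tau> \<le> 1 - ?m" "?\<tau> = 0 \<or> F ((x, s), t) \<in> L"
      using gI gL t1 by (auto simp: T_def F_def min_def)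
    have a: "0 < ?m" "?m \<le> 1 - ?\<tau>" "1 - ?\<tau> \<le> 1" using m \<tau> by auto
    have "\<bar>s / ?m\<bar> \<le> 1" using m a by (simp add: abs_div_pos[symmetric] divide_le_eq)
    then have "\<bar>s / ?m * (1 - ?\<tau>)\<bar> \<le> 1"
      using a by (simp only: abs_mult) (intro mult_le_one; simp)
    moreover have "S' ((x, s), t) = s / ?m * (1 - ?\<tau>)" by (simp add: S'_def)
    ultimately have S: "S' ((x, s), t) \<in> {-1..1}" unfolding atLeastAtMost_iff by linarith
    have b1: "(2 - t) / ?m \<le> 2" using m a by (simp add: divide_le_eq)
    have b0: "0 \<le> (2 - t) / ?m" using xst a by simp
    have "(2 - t) / ?m * (1 - ?\<tau>) \<le> 2" using b0 b1 a
      by (meson mult_left_le order_trans)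
    moreover have "(2 - t) / ?m * (1 - ?\<tau>) \<ge> 1"
    proof -
      have "(2 - t) / ?m * (1 - ?\<tau>) \<ge> (2 - t) / ?m * ?m" using b0 a by (intro mult_left_mono) auto
      moreover have "(2 - t) / ?m * ?m = 2 - t" using a by simp
      ultimately show ?thesis using xst by simp
    qed
    ultimately have T: "T' ((x, s), t) \<in> {0..1}" by (auto simp: T'_def)
    have "T' ((x, s), t) = 0 \<or> F ((x, s), t) \<in> L \<or> S' ((x, s), t) \<in> {-1, 1}"
    proof (cases "F ((x, s), t) \<in> L")
      case False
      then have \<tau>0: "?\<tau> = 0" using \<tau> by auto
      show ?thesis
      proof (cases "\<bar>s\<bar> \<le> 1 - t / 2")
        case True
        then have "?m = 1 - t / 2" by (simp add: \<mu>_def)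
        then have "T' ((x, s), t) = 0" using a \<tau>0 by (simp add: T'_def field_simps)
        then show ?thesis by blast
      next
        case False
        then have "?m = \<bar>s\<bar>" by (simp add: \<mu>_def)
        then have "S' ((x, s), t) \<in> {-1, 1}" using a \<tau>0 by (auto simp: S'_def abs_if split: if_splits)
        then show ?thesis by blast
      qed
    qed simp
    then show ?thesis using fK S T by (simp add: F_def)
  qed
  have fixed: "F ((x, s), t) = x \<and> S' ((x, s), t) = s \<and> T' ((x, s), t) = t"
    if xst: "x \<in> K" "s \<in> {-1..1}" "t \<in> {0..1}" "t = 0 \<or> x \<in> L \<or> s \<in> {-1, 1}" for x s t
  proof -
    let ?m = "\<mu> s t"
    note m = \<mu>[OF xst(2,3)]
    have "F ((x, s), t) = x \<and> T ((x, s), t) = 1 - ?m"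
    proof (cases "x \<in> L")
      case True
      then show ?thesis using fg(8,9) m by (simp add: F_def T_def)
    next
      case False
      then have "?m = 1" using xst by (auto simp: \<mu>_def)
      then show ?thesis using fg(6,7) xst by (simp add: F_def T_def)
    qed
    then show ?thesis using m by (simp add: S'_def T'_def)
  qed
  show ?thesis
  proof (rule cofibrationI[where f = "\<lambda>z. (F z, S' z)" and g = T'])
    show "continuous_on ?P (\<lambda>z. (F z, S' z))" "continuous_on ?P T'"
      unfolding S'_def T'_def using pos by (auto intro!: continuous_intros cF cT c\<mu>)
    show "L \<times> {-1..1} \<union> K \<times> {-1, 1} \<subseteq> K \<times> {-1..1::real}" using LK by auto
    fix z t assume z: "z \<in> K \<times> {-1..1::real}" and t: "t \<in> {0..1::real}"
    then obtain x s where xs: "z = (x, s)" "x \<in> K" "s \<in> {-1..1}" by auto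
    from main[OF xs(2,3) t] xs show "(F (z, t), S' (z, t)) \<in> K \<times> {-1..1}" "T' (z, t) \<in> {0..1}"
      "T' (z, t) = 0 \<or> (F (z, t), S' (z, t)) \<in> L \<times> {-1..1} \<union> K \<times> {-1, 1}" by auto
  next
    fix z assume "z \<in> K \<times> {-1..1::real}"
    then show "(F (z, 0), S' (z, 0)) = z" "T' (z, 0) = 0"
      using fixed[of "fst z" "snd z" 0] by auto
  next
    fix z and t :: real assume "z \<in> L \<times> {-1..1} \<union> K \<times> {-1, 1::real}" "t \<in> {0..1}"
    then show "(F (z, t), S' (z, t)) = z" "T' (z, t) = t"
      using fixed[of "fst z" "snd z" t] LK by (auto simp: subset_iff)
  qed
qed

text \<open>A continuous map from a compact space to a Hausdorff space is closed, hence a quotient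
  map onto its image; continuity may be tested upstairs.\<close>

lemma continuous_on_compact_quotient:
  fixes \<pi> :: "'a::topological_space \<Rightarrow> 'b::t2_space" and h :: "'b \<Rightarrow> 'c::topological_space"
  assumes "compact P" "continuous_on P \<pi>" "continuous_on P (\<lambda>x. h (\<pi> x))"
  shows "continuous_on (\<pi> ` P) h"
  unfolding continuous_on_closed_invariant
proof (intro allI impI)
  fix B :: "'c set" assume "closed B"
  then obtain A where A: "closed A" "A \<inter> P = (\<lambda>x. h (\<pi> x)) -` B \<inter> P"
    using assms(3) unfolding continuous_on_closed_invariant by metis
  have "compact (\<pi> ` (P \<inter> A))"
    using assms A by (meson compact_Int_closed compact_continuous_image continuous_on_subset inf_le1)
  moreover have "\<pi> ` (P \<inter> A) \<inter> \<pi> ` P = h -` B \<inter> \<pi> ` P"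
  proof -
    have "x \<in> P \<inter> A \<longleftrightarrow> x \<in> P \<and> h (\<pi> x) \<in> B" for x using A(2) by blast
    then show ?thesis by blast
  qed
  ultimately show "\<exists>A. closed A \<and> A \<inter> \<pi> ` P = h -` B \<inter> \<pi> ` P"
    using compact_imp_closed by blast
qed

text \<open>Points are identified only inside \<open>F\<close>, where the deformation stands still,
  so both components of the retraction descend. This serves for bands that are pinched over the
  frontier of a cell.\<close>

lemma cofibration_quotient:
  fixes \<pi> :: "'a::t2_space \<Rightarrow> 'b::t2_space"
  assumes PF: "cofibration P F" and "compact P" "continuous_on P \<pi>"
    and inj: "\<And>x y. x \<in> P \<Longrightarrow> y \<in> P \<Longrightarrow> \<pi> x = \<pi> y \<Longrightarrow> x = y \<or> (x \<in> F \<and> y \<in> F)"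
  shows "cofibration (\<pi> ` P) (\<pi> ` F)"
proof -
  obtain f g where d: "cofibration_maps P F f g"
    using cofibrationE[OF PF] by metis
  note fg = cofibration_mapsD[OF d]
  have FP: "F \<subseteq> P" using PF by (simp add: cofibration_def)
  define s where "s = inv_into P \<pi>"
  have s: "s (\<pi> x) \<in> P" "\<pi> (s (\<pi> x)) = \<pi> x" if "x \<in> P" for x
    using that by (auto simp: s_def inv_into_into f_inv_into_f)
  have sx: "s (\<pi> x) = x \<or> (s (\<pi> x) \<in> F \<and> x \<in> F)" if "x \<in> P" for x
    using inj s that by blast
  have eqf: "\<pi> (f (s (\<pi> x), t)) = \<pi> (f (x, t))" and eqg: "g (s (\<pi> x), t) = g (x, t)"
    if "x \<in> P" "t \<in> {0..1}" for x t
    using sx[OF that(1)] fg(8,9) that s by metis+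
  let ?m = "\<lambda>z :: 'a \<times> real. (\<pi> (fst z), snd z)"
  have P1: "compact (P \<times> {0..1::real})" using assms by (intro compact_Times) auto
  have cm: "continuous_on (P \<times> {0..1}) ?m"
    by (intro continuous_intros continuous_on_compose2[OF assms(3) continuous_on_fst]) auto
  have im: "?m ` (P \<times> {0..1}) = \<pi> ` P \<times> {0..1}" by force
  have c1: "continuous_on (P \<times> {0..1}) (\<lambda>z. \<pi> (f z))"
    by (rule continuous_on_compose2[OF assms(3) fg(1)]) (use fg(3) in auto)
  have c2: "continuous_on (P \<times> {0..1}) (\<lambda>z. \<pi> (f (s (fst (?m z)), snd (?m z))))"
    using c1 by (rule continuous_on_eq) (auto simp: eqf)
  have c3: "continuous_on (P \<times> {0..1}) (\<lambda>z. g (s (fst (?m z)), snd (?m z)))"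
    using fg(2) by (rule continuous_on_eq) (auto simp: eqg)
  show ?thesis
  proof (rule cofibrationI[where f = "\<lambda>z. \<pi> (f (s (fst z), snd z))" and g = "\<lambda>z. g (s (fst z), snd z)"])
    show "\<pi> ` F \<subseteq> \<pi> ` P" using FP by blast
    show "continuous_on (\<pi> ` P \<times> {0..1}) (\<lambda>z. \<pi> (f (s (fst z), snd z)))"
      using continuous_on_compact_quotient[OF P1 cm c2] im by simp
    show "continuous_on (\<pi> ` P \<times> {0..1}) (\<lambda>z. g (s (fst z), snd z))"
      using continuous_on_compact_quotient[OF P1 cm c3] im by simp
  next
    fix y and t :: real assume "y \<in> \<pi> ` P" and t: "t \<in> {0..1}"
    then obtain x where y: "y = \<pi> x" "x \<in> P" by auto
    show "\<pi> (f (s (fst (y, t)), snd (y, t))) \<in> \<pi> ` P" "g (s (fst (y, t)), snd (y, t)) \<in> {0..1}"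
      "g (s (fst (y, t)), snd (y, t)) = 0 \<or> \<pi> (f (s (fst (y, t)), snd (y, t))) \<in> \<pi> ` F"
      using fg(3-5)[OF y(2) t] eqf[OF y(2) t] eqg[OF y(2) t] y by auto
  next
    fix y assume "y \<in> \<pi> ` P"
    then obtain x where y: "y = \<pi> x" "x \<in> P" by auto
    show "\<pi> (f (s (fst (y, 0)), snd (y, 0))) = y" "g (s (fst (y, 0)), snd (y, 0)) = 0"
      using fg(6,7)[OF y(2)] eqf[OF y(2), of 0] eqg[OF y(2), of 0] y by auto
  next
    fix y and t :: real assume "y \<in> \<pi> ` F" and t: "t \<in> {0..1}"
    then obtain x where y: "y = \<pi> x" "x \<in> F" by auto
    then have "x \<in> P" using FP by blast
    show "\<pi> (f (s (fst (y, t)), snd (y, t))) = y" "g (s (fst (y, t)), snd (y, t)) = t"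
      using fg(8,9)[OF y(2) t] eqf[OF \<open>x \<in> P\<close> t] eqg[OF \<open>x \<in> P\<close> t] y by auto
  qed
qed

section \<open>Borel-Moore Betti numbers through ranks of maps\<close>

section \<open>Homology at infinity\<close>

lemma hom_int_comb:
  assumes "comm_group A" "comm_group B" "h \<in> hom A B" "finite S" "S \<subseteq> carrier A" "inj_on h S"
  shows "int_comb B c (h ` S) = h (int_comb A (c \<circ> h) S)"
proof -
  interpret A: comm_group A by fact
  interpret B: comm_group B by fact
  interpret h: group_hom A B h by unfold_locales (use assms in auto)
  show ?thesis
    using assms(4-6)
  proof (induction S rule: finite_induct)
    case empty then show ?case by simp
  next
    case (insert x F)
    then have "h x \<notin> h ` F" "h ` F \<subseteq> carrier B" by (auto simp: inj_on_def)
    then show ?case using insert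
      by (simp add: A.int_comb_insert B.int_comb_insert A.int_comb_closed h.hom_int_pow)
  qed
qed

lemma ab_rank_inj_image:
  assumes "comm_group A" "comm_group B" "h \<in> hom A B" "inj_on h (carrier A)" "H \<subseteq> carrier A"
  shows "ab_rank B (h ` H) = ab_rank A H"
proof -
  interpret A: comm_group A by fact
  interpret h: group_hom A B h
    using assms by (simp add: group_hom_def group_hom_axioms_def comm_group_def)
  have ind: "int_independent B (h ` S) \<longleftrightarrow> int_independent A S" if S: "finite S" "S \<subseteq> H" for S
  proof -
    have SA: "S \<subseteq> carrier A" "inj_on h S" using S assms by (auto intro: inj_on_subset)
    have eq1: "h x = \<one>\<^bsub>B\<^esub> \<longleftrightarrow> x = \<one>\<^bsub>A\<^esub>" if "x \<in> carrier A" for x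
      using that assms(4) h.hom_one by (metis A.one_closed inj_onD)
    have comb: "int_comb B c (h ` S) = \<one>\<^bsub>B\<^esub> \<longleftrightarrow> int_comb A (c \<circ> h) S = \<one>\<^bsub>A\<^esub>" for c
      using hom_int_comb[OF assms(1-3) S(1) SA] eq1 SA by (simp add: A.int_comb_closed)
    show ?thesis
    proof
      assume B: "int_independent B (h ` S)"
      show "int_independent A S"
        unfolding int_independent_comb
      proof (intro allI impI)
        fix c assume c: "int_comb A c S = \<one>\<^bsub>A\<^esub>"
        define d where "d = c \<circ> inv_into S h"
        have dc: "(d \<circ> h) s = c s" if "s \<in> S" for s using that SA by (simp add: d_def)
        then have "int_comb A (d \<circ> h) S = int_comb A c S" using SA by (intro A.int_comb_cong) auto
        then have "\<forall>t\<in>h ` S. d t = 0" using B c comb unfolding int_independent_comb by metis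
        then show "\<forall>s\<in>S. c s = 0" using dc by auto
      qed
    next
      assume A: "int_independent A S"
      show "int_independent B (h ` S)"
        unfolding int_independent_comb
      proof (intro allI impI)
        fix c assume "int_comb B c (h ` S) = \<one>\<^bsub>B\<^esub>"
        then have "\<forall>s\<in>S. (c \<circ> h) s = 0" using A comb unfolding int_independent_comb by metis
        then show "\<forall>t\<in>h ` S. c t = 0" by auto
      qed
    qed
  qed
  show ?thesis
  proof (rule antisym)
    show "ab_rank B (h ` H) \<le> ab_rank A H"
    proof (rule ab_rank_least)
      fix T assume T: "finite T" "T \<subseteq> h ` H" "int_independent B T"
      obtain S where S: "S \<subseteq> H" "inj_on h S" "T = h ` S"
        using T(2) unfolding subset_image_inj by auto
      then have "finite S" using T(1) finite_imageD by blast
      then show "enat (card T) \<le> ab_rank A H"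
        using S T ind[of S] ab_rank_upper[of S H A] by (simp add: card_image)
    qed
    show "ab_rank A H \<le> ab_rank B (h ` H)"
    proof (rule ab_rank_least)
      fix S assume S: "finite S" "S \<subseteq> H" "int_independent A S"
      have "inj_on h S" using S assms by (meson inj_on_subset)
      then show "enat (card S) \<le> ab_rank B (h ` H)"
        using S ind[of S] ab_rank_upper[of "h ` S" "h ` H" B] by (simp add: card_image image_mono)
    qed
  qed
qed

definition hrank :: "int \<Rightarrow> 'a topology \<Rightarrow> 'a set \<Rightarrow> enat" where
  "hrank p X S = ab_rank (relative_homology_group p X S) (carrier (relative_homology_group p X S))"

lemma hom_induced_carrier: "hom_induced p X S Y T f c \<in> carrier (relative_homology_group p Y T)"
  using hom_induced by blast

lemma hrank_iso:
  assumes "h \<in> iso (relative_homology_group p X S) (relative_homology_group p Y T)"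
  shows "hrank p X S = hrank p Y T"
proof -
  have "inj_on h (carrier (relative_homology_group p X S))"
    "h ` carrier (relative_homology_group p X S) = carrier (relative_homology_group p Y T)"
    "h \<in> hom (relative_homology_group p X S) (relative_homology_group p Y T)"
    using assms by (auto simp: iso_def bij_betw_def)
  then show ?thesis unfolding hrank_def
    using ab_rank_inj_image[of "relative_homology_group p X S" "relative_homology_group p Y T" h, OF _ _ _ _ subset_refl]
    by simp
qed

definition complement_map ::
    "int \<Rightarrow> 'a::topological_space set \<Rightarrow> 'a set \<Rightarrow> 'a set \<Rightarrow> 'a chain set \<Rightarrow> 'a chain set" where
  "complement_map p S Q Q' = hom_induced p (top_of_set S) (S - Q) (top_of_set S) (S - Q') id"

definition complement_rank :: "int \<Rightarrow> 'a::topological_space set \<Rightarrow> 'a set \<Rightarrow> 'a set \<Rightarrow> enat" where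
  "complement_rank p S Q Q' =
     ab_rank (relative_homology_group p (top_of_set S) (S - Q'))
       (complement_map p S Q Q' ` carrier (relative_homology_group p (top_of_set S) (S - Q)))"

text \<open>The images in \<open>H_p(S, S - Q1)\<close> shrink as \<open>Q3\<close> grows. Asking
  for an eventually constant rank is a Mittag-Leffler condition expressed by ranks alone.\<close>

definition limit_rank :: "int \<Rightarrow> 'a::topological_space set \<Rightarrow> enat \<Rightarrow> 'a set \<Rightarrow> bool" where
  "limit_rank p S k Q1 \<longleftrightarrow>
     (\<exists>Q2. compact Q2 \<and> Q1 \<subseteq> Q2 \<and> Q2 \<subseteq> S \<and>
        (\<forall>Q3. compact Q3 \<longrightarrow> Q2 \<subseteq> Q3 \<longrightarrow> Q3 \<subseteq> S \<longrightarrow> complement_rank p S Q3 Q1 = k))"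

text \<open>
  The rank of the inverse limit of \<open>H\<^sub>p(S, S - Q)\<close> over the compact subsets \<open>Q\<close> of \<open>S\<close> (Borel--Moore
  homology), stated under a stability condition so that no limit has to be formed.
\<close>

definition stable_rank :: "int \<Rightarrow> 'a::topological_space set \<Rightarrow> enat \<Rightarrow> bool" where
  "stable_rank p S k \<longleftrightarrow>
     (\<exists>Q0. compact Q0 \<and> Q0 \<subseteq> S \<and>
       (\<forall>Q1. compact Q1 \<longrightarrow> Q0 \<subseteq> Q1 \<longrightarrow> Q1 \<subseteq> S \<longrightarrow> limit_rank p S k Q1))"

lemma stable_rankE:
  assumes "stable_rank p S k"
  obtains Q0 where "compact Q0" "Q0 \<subseteq> S"
    "\<forall>Q1. compact Q1 \<longrightarrow> Q0 \<subseteq> Q1 \<longrightarrow> Q1 \<subseteq> S \<longrightarrow> limit_rank p S k Q1"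
  using assms unfolding stable_rank_def by auto

lemma limit_rankE:
  assumes "limit_rank p S k Q1"
  obtains Q2 where "compact Q2" "Q1 \<subseteq> Q2" "Q2 \<subseteq> S"
    "\<forall>Q3. compact Q3 \<longrightarrow> Q2 \<subseteq> Q3 \<longrightarrow> Q3 \<subseteq> S \<longrightarrow> complement_rank p S Q3 Q1 = k"
  using assms unfolding limit_rank_def by auto

text \<open>Each stability statement holds for all compact sets beyond some stage, so the two can be
  compared at a union of stages, first for the outer and then for the inner quantifier.\<close>

lemma stable_rank_unique:
  assumes "stable_rank p S k" "stable_rank p S k'"
  shows "k = k'"
proof -
  obtain Q0 where Q0: "compact Q0" "Q0 \<subseteq> S"
    "\<forall>Q1. compact Q1 \<longrightarrow> Q0 \<subseteq> Q1 \<longrightarrow> Q1 \<subseteq> S \<longrightarrow> limit_rank p S k Q1"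
    using assms(1) by (rule stable_rankE)
  obtain P0 where P0: "compact P0" "P0 \<subseteq> S"
    "\<forall>Q1. compact Q1 \<longrightarrow> P0 \<subseteq> Q1 \<longrightarrow> Q1 \<subseteq> S \<longrightarrow> limit_rank p S k' Q1"
    using assms(2) by (rule stable_rankE)
  have "limit_rank p S k (Q0 \<union> P0)" "limit_rank p S k' (Q0 \<union> P0)"
    using Q0(1,2) P0(1,2) by (auto intro!: Q0(3)[rule_format] P0(3)[rule_format])
  note lim = this
  obtain Q2 where Q2: "compact Q2" "Q0 \<union> P0 \<subseteq> Q2" "Q2 \<subseteq> S"
    "\<forall>Q3. compact Q3 \<longrightarrow> Q2 \<subseteq> Q3 \<longrightarrow> Q3 \<subseteq> S \<longrightarrow> complement_rank p S Q3 (Q0 \<union> P0) = k"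
    using lim(1) by (rule limit_rankE)
  obtain P2 where P2: "compact P2" "Q0 \<union> P0 \<subseteq> P2" "P2 \<subseteq> S"
    "\<forall>Q3. compact Q3 \<longrightarrow> P2 \<subseteq> Q3 \<longrightarrow> Q3 \<subseteq> S \<longrightarrow> complement_rank p S Q3 (Q0 \<union> P0) = k'"
    using lim(2) by (rule limit_rankE)
  show ?thesis
    using Q2(4)[rule_format, of "Q2 \<union> P2"] P2(4)[rule_format, of "Q2 \<union> P2"] Q2(1,3) P2(1,3) by auto
qed

lemma stable_rank_homeomorphic:
  assumes "stable_rank p S k" "S homeomorphic S'"
  shows "stable_rank p S' k"
proof -
  obtain f g where fg: "homeomorphism S S' f g" using assms(2) by (auto simp: homeomorphic_def)
  then have fg': "homeomorphism S' S g f" by (rule homeomorphism_symD)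
  note ap = homeomorphism_apply1[OF fg] homeomorphism_apply2[OF fg]
  have im: "f ` S = S'" "g ` S' = S" and cf: "continuous_on S f" "continuous_on S' g"
    using fg by (auto simp: homeomorphism_def)
  have hf: "homeomorphic_map (top_of_set S) (top_of_set S') f"
    using fg homeomorphic_map_maps homeomorphic_maps_iff_homeomorphism by blast
  let ?H = "\<lambda>Q. relative_homology_group p (top_of_set S) (S - Q)"
  let ?H' = "\<lambda>Q. relative_homology_group p (top_of_set S') (S' - Q)"
  define \<phi> where "\<phi> = (\<lambda>Q. hom_induced p (top_of_set S) (S - Q) (top_of_set S') (S' - f ` Q) f)"
  have imd: "f ` (S - Q) = S' - f ` Q" if "Q \<subseteq> S" for Q
  proof -
    have "inj_on f S" using ap(1) by (rule inj_on_inverseI)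
    then show ?thesis using that im(1) inj_on_image_set_diff[of f S S Q] by auto
  qed
  have iso: "\<phi> Q \<in> iso (?H Q) (?H' (f ` Q))" if "Q \<subseteq> S" for Q
    unfolding \<phi>_def using imd[OF that] by (intro homeomorphic_map_relative_homology_iso hf) auto
  have cmf: "continuous_map (top_of_set S) (top_of_set S') f"
    by (rule homeomorphic_imp_continuous_map[OF hf])
  have comm: "complement_map p S' (f ` Q3) (f ` Q1) (\<phi> Q3 c) = \<phi> Q1 (complement_map p S Q3 Q1 c)"
    if "Q1 \<subseteq> Q3" "Q3 \<subseteq> S" for Q1 Q3 c
  proof -
    have m: "f \<in> S - Q3 \<rightarrow> S' - f ` Q3" "f \<in> S - Q1 \<rightarrow> S' - f ` Q1"
      using imd[of Q3] imd[of Q1] that by blast+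
    have i: "id \<in> S - Q3 \<rightarrow> S - Q1" "id \<in> S' - f ` Q3 \<rightarrow> S' - f ` Q1" using that by auto
    show ?thesis unfolding complement_map_def \<phi>_def
      using hom_induced_compose'[OF cmf m(1) continuous_map_id i(2)]
        hom_induced_compose'[OF continuous_map_id i(1) cmf m(2)] by simp
  qed
  have rank: "complement_rank p S' (f ` Q3) (f ` Q1) = complement_rank p S Q3 Q1"
    if Q: "Q1 \<subseteq> Q3" "Q3 \<subseteq> S" for Q1 Q3
  proof -
    have i3: "\<phi> Q3 ` carrier (?H Q3) = carrier (?H' (f ` Q3))"
      using iso[OF Q(2)] by (auto simp: iso_def bij_betw_def)
    have i1: "\<phi> Q1 \<in> hom (?H Q1) (?H' (f ` Q1))" "inj_on (\<phi> Q1) (carrier (?H Q1))"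
      using iso[of Q1] Q by (auto simp: iso_def bij_betw_def)
    have "complement_map p S' (f ` Q3) (f ` Q1) ` carrier (?H' (f ` Q3)) =
        \<phi> Q1 ` (complement_map p S Q3 Q1 ` carrier (?H Q3))"
      unfolding i3[symmetric] image_image using comm[OF Q] by simp
    moreover have "complement_map p S Q3 Q1 ` carrier (?H Q3) \<subseteq> carrier (?H Q1)"
      unfolding complement_map_def by (auto simp: hom_induced_carrier)
    ultimately show ?thesis unfolding complement_rank_def using ab_rank_inj_image[OF _ _ i1] by simp
  qed
  obtain Q0 where Q0: "compact Q0" "Q0 \<subseteq> S"
    "\<forall>Q1. compact Q1 \<longrightarrow> Q0 \<subseteq> Q1 \<longrightarrow> Q1 \<subseteq> S \<longrightarrow> limit_rank p S k Q1"
    using assms(1) by (rule stable_rankE)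
  have cmp: "compact (f ` Q)" if "compact Q" "Q \<subseteq> S" for Q
    using that cf by (meson compact_continuous_image continuous_on_subset)
  have cmp': "compact (g ` Q)" if "compact Q" "Q \<subseteq> S'" for Q
    using that cf by (meson compact_continuous_image continuous_on_subset)
  have sub: "f ` Q \<subseteq> S'" if "Q \<subseteq> S" for Q using that im by blast
  have sub': "g ` Q \<subseteq> S" if "Q \<subseteq> S'" for Q using that im by blast
  have fgi: "f ` g ` Q = Q" if "Q \<subseteq> S'" for Q
    using that ap by (force simp: image_image)
  have gfi: "g ` f ` Q = Q" if "Q \<subseteq> S" for Q
    using that ap by (force simp: image_image)
  show ?thesis
    unfolding stable_rank_def
  proof (intro exI[of _ "f ` Q0"] conjI allI impI)
    fix Q1 assume Q1: "compact Q1" "f ` Q0 \<subseteq> Q1" "Q1 \<subseteq> S'"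
    have "Q0 \<subseteq> g ` Q1" using gfi[OF Q0(2)] Q1(2) by blast
    then have "limit_rank p S k (g ` Q1)"
      using cmp' sub' Q1 by (intro Q0(3)[rule_format]) auto
    then obtain Q2 where Q2: "compact Q2" "g ` Q1 \<subseteq> Q2" "Q2 \<subseteq> S"
      "\<forall>Q3. compact Q3 \<longrightarrow> Q2 \<subseteq> Q3 \<longrightarrow> Q3 \<subseteq> S \<longrightarrow> complement_rank p S Q3 (g ` Q1) = k"
      by (rule limit_rankE)
    show "limit_rank p S' k Q1"
      unfolding limit_rank_def
    proof (intro exI[of _ "f ` Q2"] conjI allI impI)
      show "Q1 \<subseteq> f ` Q2" using Q2(2) fgi[of Q1] Q1(3) by blast
      fix Q3 assume Q3: "compact Q3" "f ` Q2 \<subseteq> Q3" "Q3 \<subseteq> S'"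
      have b: "Q2 \<subseteq> g ` Q3" using Q3(2) gfi[OF Q2(3)] by blast
      have "complement_rank p S (g ` Q3) (g ` Q1) = k"
        using Q3 b cmp' sub' by (intro Q2(4)[rule_format]) auto
      moreover have "g ` Q1 \<subseteq> g ` Q3" "g ` Q3 \<subseteq> S" using b Q2(2) sub'[OF Q3(3)] by blast+
      ultimately show "complement_rank p S' Q3 Q1 = k"
        using rank[of "g ` Q1" "g ` Q3"] fgi[OF Q1(3)] fgi[OF Q3(3)] by simp
    qed (use cmp sub Q2 in auto)
  qed (use cmp sub Q0 in auto)
qed

lemma homotopic_with_top_of_setI:
  assumes c: "continuous_on (K \<times> {0..1::real}) f" and K: "\<And>x t. x \<in> K \<Longrightarrow> t \<in> {0..1} \<Longrightarrow> f (x, t) \<in> K'"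
    and A: "A \<subseteq> K" "\<And>x t. x \<in> A \<Longrightarrow> t \<in> {0..1} \<Longrightarrow> f (x, t) \<in> B"
  shows "homotopic_with (\<lambda>h. h \<in> A \<rightarrow> B) (top_of_set K) (top_of_set K') (\<lambda>x. f (x, 0)) (\<lambda>x. f (x, 1))"
proof -
  have cont: "homotopic_with (\<lambda>h. h \<in> A \<rightarrow> B) (top_of_set K) (top_of_set K') (\<lambda>x. f (x, 0)) (\<lambda>x. f (x, 1)) \<longleftrightarrow>
      (\<exists>h. continuous_map (prod_topology (subtopology euclideanreal {0..1}) (top_of_set K)) (top_of_set K') h \<and>
              (\<forall>x \<in> topspace (top_of_set K). h(0,x) = f (x, 0)) \<and>
              (\<forall>x \<in> topspace (top_of_set K). h(1,x) = f (x, 1)) \<and>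
              (\<forall>t \<in> {0..1}. (\<lambda>x. h(t, x)) \<in> A \<rightarrow> B))"
    by (rule homotopic_with) (use A(1) in \<open>auto simp: Pi_iff subset_iff\<close>)
  show ?thesis
    unfolding cont
  proof (intro exI[of _ "\<lambda>z. f (snd z, fst z)"] conjI)
    have eq: "prod_topology (subtopology euclideanreal {0..1}) (top_of_set K) = top_of_set ({0..1} \<times> K)"
      by (metis euclidean_product_topology prod_topology_subtopology_eu subtopology_Times)
    have "continuous_on ({0..1} \<times> K) (\<lambda>z. f (snd z, fst z))"
      by (rule continuous_on_compose2[OF c]) (auto intro!: continuous_intros)
    then show "continuous_map (prod_topology (subtopology euclideanreal {0..1}) (top_of_set K)) (top_of_set K') (\<lambda>z. f (snd z, fst z))"
      unfolding eq using K by (auto simp: continuous_map_in_subtopology)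
  qed (use A in auto)
qed

text \<open>Excision of \<open>L\<close> identifies \<open>H_p(K - L, K - L - Q)\<close> with
  \<open>H_p(K, K - Q)\<close>. The end \<open>r\<close> of the deformation pushes everything
  outside a compact set \<open>Q0\<close> into \<open>L\<close>, so \<open>H_p(K, L)\<close> embeds
  in \<open>H_p(K, K - Q)\<close> once \<open>Q\<close> contains \<open>Q0\<close>. If the
  deformation carries no point outside \<open>Q3\<close> into \<open>Q1\<close>, then
  \<open>H_p(K, K - Q3)\<close> and \<open>H_p(K, L)\<close> have the same image in
  \<open>H_p(K, K - Q1)\<close>.\<close>

theorem stable_rank_cofibration:
  fixes K :: "'a::t2_space set"
  assumes cof: "cofibration K L" and K: "compact K" and L: "closed L"
  shows "stable_rank p (K - L) (hrank p (top_of_set K) L)"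
proof -
  obtain f g where d: "cofibration_maps K L f g" using cofibrationE[OF cof] by metis
  note fg = cofibration_mapsD[OF d]
  have LK: "L \<subseteq> K" using cof by (simp add: cofibration_def)
  let ?X = "top_of_set K" and ?S = "K - L"
  let ?HK = "\<lambda>N. relative_homology_group p ?X N"
  let ?HS = "\<lambda>Q. relative_homology_group p (top_of_set ?S) (?S - Q)"
  define r where "r = (\<lambda>x. f (x, 1))"
  have cc: "continuous_on K (\<lambda>x. h (x, 1))" if "continuous_on (K \<times> {0..1::real}) h" for h :: "'a \<times> real \<Rightarrow> 'b::topological_space"
    by (rule continuous_on_compose2[OF that]) (auto intro!: continuous_intros)
  have contr: "continuous_map ?X ?X r"
    using cc[OF fg(1)] fg(3) by (auto simp: r_def continuous_map_in_subtopology)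
  \<comment> \<open>As \<open>g\<close> is nonnegative, this is where the final height vanishes; at
    all other points of \<open>K\<close> the deformation ends in \<open>L\<close>.\<close>
  define Q0 where "Q0 = {x \<in> K. g (x, 1) \<le> 0}"
  have "closedin ?X (K \<inter> (\<lambda>x. g (x, 1)) -` {..0})"
    by (rule continuous_closedin_preimage[OF cc[OF fg(2)]]) simp
  moreover have "K \<inter> (\<lambda>x. g (x, 1)) -` {..0} = Q0" by (auto simp: Q0_def)
  ultimately have Q0c: "compact Q0" using K closedin_compact_eq by fastforce
  have Q0S: "Q0 \<subseteq> ?S" using fg(9) by (auto simp: Q0_def)
  have rL: "r x \<in> L" if "x \<in> K" "x \<notin> Q0" for x
    using fg(5)[of x 1] that by (auto simp: Q0_def r_def)
  have i: "id \<in> A \<rightarrow> B" if "A \<subseteq> B" for A B :: "'a set" using that by auto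
  have homot: "homotopic_with (\<lambda>h. h \<in> A \<rightarrow> B) ?X ?X id r"
    if "A \<subseteq> K" "\<And>x t. x \<in> A \<Longrightarrow> t \<in> {0..1} \<Longrightarrow> f (x, t) \<in> B" for A B
  proof -
    have "homotopic_with (\<lambda>h. h \<in> A \<rightarrow> B) ?X ?X (\<lambda>x. f (x, 0)) r"
      unfolding r_def using that fg by (intro homotopic_with_top_of_setI) auto
    moreover have "homotopic_with (\<lambda>h. h \<in> A \<rightarrow> B) ?X ?X id (\<lambda>x. f (x, 0))"
    proof (rule homotopic_with_equal)
      show "id \<in> A \<rightarrow> B" "(\<lambda>x. f (x, 0)) \<in> A \<rightarrow> B" using that(2)[of _ 0] fg(6) that(1) by force+
    qed (use fg(6) in auto)
    ultimately show ?thesis using homotopic_with_trans by blast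
  qed
  define j where "j = (\<lambda>Q. hom_induced p ?X L ?X (K - Q) id)"
  have inj: "inj_on (j Q) (carrier (?HK L))" if Q: "Q0 \<subseteq> Q" "Q \<subseteq> ?S" for Q
  proof (rule inj_on_inverseI)
    fix c assume c: "c \<in> carrier (?HK L)"
    have "hom_induced p ?X (K - Q) ?X L r (j Q c) = hom_induced p ?X L ?X L (r \<circ> id) c"
      unfolding j_def using Q rL LK by (intro hom_induced_compose' contr i continuous_map_id) auto
    also have "\<dots> = hom_induced p ?X L ?X L id c"
      using homology_homotopy_axiom[OF homot[of L L], of p] LK fg(8) by simp
    also have "\<dots> = c" using c by (rule hom_induced_id)
    finally show "hom_induced p ?X (K - Q) ?X L r (j Q c) = c" .
  qed
  define \<kappa> where "\<kappa> = (\<lambda>Q Q'. hom_induced p ?X (K - Q) ?X (K - Q') id)"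
  have image: "\<kappa> Q3 Q1 ` carrier (?HK (K - Q3)) = j Q1 ` carrier (?HK L)"
    if Q: "Q0 \<subseteq> Q1" "Q1 \<subseteq> Q3" "Q3 \<subseteq> ?S" and m: "\<And>x t. x \<in> K - Q3 \<Longrightarrow> t \<in> {0..1} \<Longrightarrow> f (x, t) \<in> K - Q1" for Q1 Q3
  proof
    show "\<kappa> Q3 Q1 ` carrier (?HK (K - Q3)) \<subseteq> j Q1 ` carrier (?HK L)"
    proof
      fix y assume "y \<in> \<kappa> Q3 Q1 ` carrier (?HK (K - Q3))"
      then obtain c where c: "y = \<kappa> Q3 Q1 c" by auto
      have "\<kappa> Q3 Q1 c = hom_induced p ?X (K - Q3) ?X (K - Q1) r c"
        unfolding \<kappa>_def using homology_homotopy_axiom[OF homot[of "K - Q3" "K - Q1"], of p] m by simp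
      also have "\<dots> = j Q1 (hom_induced p ?X (K - Q3) ?X L r c)"
      proof -
        have "hom_induced p ?X L ?X (K - Q1) id (hom_induced p ?X (K - Q3) ?X L r c) =
            hom_induced p ?X (K - Q3) ?X (K - Q1) (id \<circ> r) c"
          using Q rL LK by (intro hom_induced_compose' contr i continuous_map_id) auto
        then show ?thesis by (simp add: j_def)
      qed
      finally show "y \<in> j Q1 ` carrier (?HK L)" unfolding c by (simp add: imageI hom_induced_carrier)
    qed
    show "j Q1 ` carrier (?HK L) \<subseteq> \<kappa> Q3 Q1 ` carrier (?HK (K - Q3))"
    proof
      fix y assume "y \<in> j Q1 ` carrier (?HK L)"
      then obtain c where c: "y = j Q1 c" by auto
      have "\<kappa> Q3 Q1 (j Q3 c) = hom_induced p ?X L ?X (K - Q1) (id \<circ> id) c"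
        unfolding j_def \<kappa>_def using Q LK by (intro hom_induced_compose' i continuous_map_id) auto
      then have "y = \<kappa> Q3 Q1 (j Q3 c)" unfolding c by (simp add: j_def)
      then show "y \<in> \<kappa> Q3 Q1 ` carrier (?HK (K - Q3))"
        by (simp add: imageI hom_induced_carrier j_def)
    qed
  qed
  define e where "e = (\<lambda>Q. hom_induced p (top_of_set ?S) (?S - Q) ?X (K - Q) id)"
  \<comment> \<open>Excision applies because \<open>L\<close> is closed and lies in the set
    \<open>K - Q\<close>, which is open in \<open>K\<close>.\<close>
  have excision: "e Q \<in> iso (?HS Q) (?HK (K - Q))" if Q: "compact Q" "Q \<subseteq> ?S" for Q
  proof -
    have "closedin ?X Q" using Q by (meson Diff_subset closed_subset compact_imp_closed order_trans)
    then have "openin ?X (K - Q)" by (simp add: closedin_def)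
    then have int: "?X interior_of (K - Q) = K - Q" by (rule interior_of_openin)
    have cl: "?X closure_of L = L" using L LK by (simp add: closure_of_closedin closed_subset)
    have "hom_induced p (subtopology ?X (K - L)) ((K - Q) - L) (subtopology ?X K) (K - Q) id
       \<in> iso (relative_homology_group p (subtopology ?X (K - L)) ((K - Q) - L)) (relative_homology_group p (subtopology ?X K) (K - Q))"
      by (rule homology_excision_axiom) (use int cl Q LK in auto)
    moreover have "subtopology ?X (K - L) = top_of_set ?S" "subtopology ?X K = ?X"
      by (simp_all add: subtopology_subtopology Int_absorb1)
    moreover have "(K - Q) - L = ?S - Q" by auto
    ultimately show ?thesis by (simp add: e_def)
  qed
  have rank: "complement_rank p ?S Q3 Q1 = hrank p ?X L"
    if Q: "compact Q1" "compact Q3" "Q0 \<subseteq> Q1" "Q1 \<subseteq> Q3" "Q3 \<subseteq> ?S"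
      and m: "\<And>x t. x \<in> K - Q3 \<Longrightarrow> t \<in> {0..1} \<Longrightarrow> f (x, t) \<in> K - Q1" for Q1 Q3
  proof -
    have Q1S: "Q1 \<subseteq> ?S" using Q by blast
    have e1: "e Q1 \<in> hom (?HS Q1) (?HK (K - Q1))" "inj_on (e Q1) (carrier (?HS Q1))"
      using excision[OF Q(1) Q1S] by (auto simp: iso_def bij_betw_def)
    have e3: "e Q3 ` carrier (?HS Q3) = carrier (?HK (K - Q3))"
      using excision[OF Q(2,5)] by (auto simp: iso_def bij_betw_def)
    have idc: "continuous_map (top_of_set ?S) ?X id"
      by (simp add: continuous_map_in_subtopology continuous_map_from_subtopology)
    have comm: "\<kappa> Q3 Q1 (e Q3 c) = e Q1 (complement_map p ?S Q3 Q1 c)" for c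
    proof -
      have "\<kappa> Q3 Q1 (e Q3 c) = hom_induced p (top_of_set ?S) (?S - Q3) ?X (K - Q1) (id \<circ> id) c"
        unfolding \<kappa>_def e_def using Q by (intro hom_induced_compose' i continuous_map_id idc) auto
      also have "\<dots> = e Q1 (complement_map p ?S Q3 Q1 c)"
        unfolding complement_map_def e_def using Q
        by (intro hom_induced_compose'[symmetric] i continuous_map_id idc) auto
      finally show ?thesis .
    qed
    have sub: "complement_map p ?S Q3 Q1 ` carrier (?HS Q3) \<subseteq> carrier (?HS Q1)"
      unfolding complement_map_def by (auto simp: hom_induced_carrier)
    have "complement_rank p ?S Q3 Q1 =
        ab_rank (?HK (K - Q1)) (e Q1 ` complement_map p ?S Q3 Q1 ` carrier (?HS Q3))"
      unfolding complement_rank_def by (rule ab_rank_inj_image[OF _ _ e1 sub, symmetric]) simp_all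
    also have "e Q1 ` complement_map p ?S Q3 Q1 ` carrier (?HS Q3) = \<kappa> Q3 Q1 ` carrier (?HK (K - Q3))"
      unfolding e3[symmetric] image_image comm ..
    also have "\<dots> = j Q1 ` carrier (?HK L)" using image[OF Q(3-5) m] by simp
    also have "ab_rank (?HK (K - Q1)) \<dots> = hrank p ?X L"
      unfolding hrank_def using inj[OF Q(3) Q1S]
      by (intro ab_rank_inj_image) (auto simp: j_def hom_induced_hom)
    finally show ?thesis .
  qed
  show ?thesis
    unfolding stable_rank_def
  proof (intro exI[of _ Q0] conjI allI impI)
    fix Q1 assume Q1: "compact Q1" "Q0 \<subseteq> Q1" "Q1 \<subseteq> ?S"
    \<comment> \<open>The points whose track under the deformation meets \<open>Q1\<close>. This set
      is the projection of a compact set, and it misses \<open>L\<close> because points of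
      \<open>L\<close> do not move.\<close>
    define Q2 where "Q2 = fst ` {z \<in> K \<times> {0..1::real}. f z \<in> Q1}"
    have "closedin (top_of_set (K \<times> {0..1})) ((K \<times> {0..1::real}) \<inter> f -` Q1)"
      using Q1 compact_imp_closed by (intro continuous_closedin_preimage[OF fg(1)]) auto
    then have "compact ((K \<times> {0..1::real}) \<inter> f -` Q1)"
      using K closedin_compact compact_Times by blast
    then have "compact (fst ` ((K \<times> {0..1::real}) \<inter> f -` Q1))"
      by (intro compact_continuous_image continuous_intros)
    moreover have "(K \<times> {0..1::real}) \<inter> f -` Q1 = {z \<in> K \<times> {0..1::real}. f z \<in> Q1}" by auto
    ultimately have Q2c: "compact Q2" unfolding Q2_def by simp
    have Q2i: "f (x, t) \<in> Q1 \<Longrightarrow> x \<in> Q2" if "x \<in> K" "t \<in> {0..1}" for x t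
      using that by (force simp: Q2_def)
    have Q12: "Q1 \<subseteq> Q2" using Q2i[of _ 0] fg(6) Q1 by force
    have Q2S: "Q2 \<subseteq> ?S"
    proof
      fix x assume "x \<in> Q2"
      then obtain t where t: "x \<in> K" "t \<in> {0..1}" "f (x, t) \<in> Q1" by (auto simp: Q2_def)
      then have "x \<notin> L" using fg(8)[of x t] Q1 by auto
      then show "x \<in> ?S" using t by simp
    qed
    show "limit_rank p ?S (hrank p ?X L) Q1"
      unfolding limit_rank_def
    proof (intro exI[of _ Q2] conjI allI impI Q2c Q12 Q2S)
      fix Q3 assume Q3: "compact Q3" "Q2 \<subseteq> Q3" "Q3 \<subseteq> ?S"
      show "complement_rank p ?S Q3 Q1 = hrank p ?X L"
      proof (rule rank)
        show "f (x, t) \<in> K - Q1" if "x \<in> K - Q3" "t \<in> {0..1}" for x t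
          using Q2i[of x t] fg(3)[of x t] that Q3(2) by blast
      qed (use Q1 Q3 Q12 in auto)
    qed
  qed (use Q0c Q0S in auto)
qed

section \<open>Additivity from the long exact sequence\<close>

section \<open>The Euler characteristic at infinity\<close>

text \<open>The long exact sequence of the pair, kept only as the ranks of its three kinds of map.
  Homology in negative degrees is trivial, which ends the sequence in
  \<open>d 0 = 0\<close>.\<close>

lemma pair_exact_ranks:
  fixes X :: "'a topology"
  obtains i j d :: "int \<Rightarrow> enat" where
    "\<And>p. hrank p (subtopology X S) {} = d (p + 1) + i p"
    "\<And>p. hrank p X {} = i p + j p" "\<And>p. hrank p X S = j p + d p" "\<And>p. p \<le> 0 \<Longrightarrow> d p = 0"
proof -
  let ?A = "\<lambda>p. homology_group p (subtopology X S)" and ?X = "\<lambda>p. homology_group p X"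
  let ?R = "\<lambda>p. relative_homology_group p X S"
  let ?i = "\<lambda>p. hom_induced p (subtopology X S) {} X {} id" and ?j = "\<lambda>p. hom_induced p X {} X S id"
  let ?d = "\<lambda>p. hom_boundary p X S"
  have ex1: "kernel (?R p) (?A (p - 1)) (?d p) = ?j p ` carrier (?X p)" for p
    using homology_exactness_axiom_1[of p X S] by simp
  have ex2: "kernel (?A (p - 1)) (?X (p - 1)) (?i (p - 1)) = ?d p ` carrier (?R p)" for p
    using homology_exactness_axiom_2[of p X S] by simp
  have ex3: "kernel (?X p) (?R p) (?j p) = ?i p ` carrier (?A p)" for p
    using homology_exactness_axiom_3[of p X S] by simp
  define i where "i = (\<lambda>p. ab_rank (?X p) (?i p ` carrier (?A p)))"
  define j where "j = (\<lambda>p. ab_rank (?R p) (?j p ` carrier (?X p)))"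
  define d where "d = (\<lambda>p. ab_rank (?A (p - 1)) (?d p ` carrier (?R p)))"
  show ?thesis
  proof (rule that[of d i j])
    fix p
    show "hrank p (subtopology X S) {} = d (p + 1) + i p"
      unfolding hrank_def d_def i_def using ex2[of "p + 1"]
        ab_rank_kernel_image[of "?A p" "?X p" "?i p"] by (simp add: hom_induced_hom)
    show "hrank p X {} = i p + j p"
      unfolding hrank_def j_def i_def using ex3[of p]
        ab_rank_kernel_image[of "?X p" "?R p" "?j p"] by (simp add: hom_induced_hom)
    show "hrank p X S = j p + d p"
      unfolding hrank_def j_def d_def using ex1[of p]
        ab_rank_kernel_image[of "?R p" "?A (p - 1)" "?d p"] by (simp add: hom_boundary_hom)
    assume p: "p \<le> 0"
    have "?d p ` carrier (?R p) \<subseteq> carrier (?A (p - 1))"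
      using hom_boundary_hom[of p X S] by (auto simp: hom_def)
    moreover have "carrier (?A (p - 1)) = {\<one>\<^bsub>?A (p - 1)\<^esub>}"
      using p trivial_homology_group[of "p - 1" "subtopology X S"] by (simp add: trivial_group_def)
    ultimately have "d p \<le> ab_rank (?A (p - 1)) {\<one>\<^bsub>?A (p - 1)\<^esub>}"
      unfolding d_def by (intro ab_rank_mono) simp
    then show "d p = 0" using ab_rank_trivial[of "?A (p - 1)"] by simp
  qed
qed

lemma alternating_telescope:
  fixes d :: "nat \<Rightarrow> int"
  shows "(\<Sum>n<N. (-1) ^ n * (d (Suc n) + d n)) = d 0 - (-1) ^ N * d N"
  by (induction N) (auto simp: algebra_simps)

lemma enat_seq_finite:
  fixes f :: "nat \<Rightarrow> enat"
  assumes "\<And>n. f n \<noteq> \<infinity>"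
  shows "\<exists>g. \<forall>n. f n = enat (g n)"
proof (rule exI[of _ "\<lambda>n. the_enat (f n)"], rule allI)
  fix n show "f n = enat (the_enat (f n))" using assms[of n] by (cases "f n") auto
qed

text \<open>Exactness writes every rank as a sum of two neighbouring ranks of maps, and the
  alternating sum telescopes. Finiteness of \<open>a\<close> and of one of the other two sequences
  bounds all of \<open>i\<close>, \<open>j\<close> and \<open>d\<close>.\<close>

lemma pair_euler:
  fixes a x r :: "nat \<Rightarrow> enat" and i j d :: "nat \<Rightarrow> enat"
  assumes a: "\<And>n. a n = d (Suc n) + i n" and x: "\<And>n. x n = i n + j n" and r: "\<And>n. r n = j n + d n" and d0: "d 0 = 0"
    and fin: "((\<forall>n. a n \<noteq> \<infinity>) \<and> (\<exists>N. \<forall>n\<ge>N. a n = 0) \<and> (\<forall>n. x n \<noteq> \<infinity>) \<and> (\<exists>N. \<forall>n\<ge>N. x n = 0)) \<or>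
      ((\<forall>n. a n \<noteq> \<infinity>) \<and> (\<exists>N. \<forall>n\<ge>N. a n = 0) \<and> (\<forall>n. r n \<noteq> \<infinity>) \<and> (\<exists>N. \<forall>n\<ge>N. r n = 0))"
  obtains a' x' r' N where "\<And>n. a n = enat (a' n)" "\<And>n. x n = enat (x' n)" "\<And>n. r n = enat (r' n)"
    "\<And>n. n \<ge> N \<Longrightarrow> a' n = 0 \<and> x' n = 0 \<and> r' n = 0"
    "(\<Sum>n<N. (-1) ^ n * int (x' n)) = (\<Sum>n<N. (-1) ^ n * int (a' n)) + (\<Sum>n<N. (-1) ^ n * int (r' n))"
proof -
  have finite: "i n \<noteq> \<infinity> \<and> j n \<noteq> \<infinity> \<and> d n \<noteq> \<infinity>" for n
  proof -
    have A: "a n \<noteq> \<infinity>" "a (n - 1) \<noteq> \<infinity>" and B: "x n \<noteq> \<infinity> \<or> r n \<noteq> \<infinity>" using fin by auto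
    have "d n \<noteq> \<infinity>"
    proof (cases n)
      case 0 then show ?thesis using d0 by simp
    next
      case (Suc m) then show ?thesis using A(2) a[of m] by (cases "d (Suc m)") auto
    qed
    moreover have "i n \<noteq> \<infinity>" using A(1) a[of n] by (cases "i n") auto
    moreover have "j n \<noteq> \<infinity>" using B x[of n] r[of n] by (cases "j n") auto
    ultimately show ?thesis by simp
  qed
  obtain i' where i': "\<And>n. i n = enat (i' n)" using enat_seq_finite[of i] finite by metis
  obtain j' where j': "\<And>n. j n = enat (j' n)" using enat_seq_finite[of j] finite by metis
  obtain d' where d': "\<And>n. d n = enat (d' n)" using enat_seq_finite[of d] finite by metis
  obtain N where N: "\<And>n. n \<ge> N \<Longrightarrow> a n = 0" "\<And>n. n \<ge> N \<Longrightarrow> x n = 0 \<or> r n = 0"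
  proof -
    obtain N1 where 1: "\<forall>n\<ge>N1. a n = 0" using fin by auto
    obtain N2 where 2: "\<forall>n\<ge>N2. x n = 0 \<or> r n = 0" using fin by blast
    show ?thesis by (rule that[of "max N1 N2"]) (use 1 2 in auto)
  qed
  have z: "i' n = 0 \<and> d' (Suc n) = 0 \<and> j' n = 0" if "n \<ge> N" for n
    using N[OF that] a[of n] x[of n] r[of n] by (auto simp: i' j' d' zero_enat_def)
  show ?thesis
  \<comment> \<open>The sums run one degree beyond \<open>N\<close>: from \<open>N\<close> on only
    the shifted terms \<open>d' (Suc n)\<close> are known to vanish, and \<open>d' N\<close> may
    still contribute.\<close>
  proof (rule that[of "\<lambda>n. d' (Suc n) + i' n" "\<lambda>n. i' n + j' n" "\<lambda>n. j' n + d' n" "Suc N"])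
    show "d' (Suc n) + i' n = 0 \<and> i' n + j' n = 0 \<and> j' n + d' n = 0" if n: "n \<ge> Suc N" for n
    proof -
      obtain m where "n = Suc m" "m \<ge> N" using n by (cases n) auto
      then show ?thesis using z[of m] z[of n] by auto
    qed
    have "(\<Sum>n<Suc N. (-1) ^ n * (int (d' (Suc n)) + int (d' n))) = 0"
      using alternating_telescope[of "\<lambda>n. int (d' n)" "Suc N"] z[of N] d0 by (simp add: d' zero_enat_def)
    then show "(\<Sum>n<Suc N. (-1) ^ n * int (i' n + j' n)) =
      (\<Sum>n<Suc N. (-1) ^ n * int (d' (Suc n) + i' n)) + (\<Sum>n<Suc N. (-1) ^ n * int (j' n + d' n))"
      by (simp only: sum.distrib[symmetric] of_nat_add distrib_left) (simp add: sum.distrib algebra_simps)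
  qed (simp_all add: a x r i' j' d')
qed

text \<open>Finite total Borel-Moore rank: every degree stabilizes at a finite value, and all large
  degrees at zero.\<close>

definition ctame :: "'a::topological_space set \<Rightarrow> bool" where
  "ctame S \<longleftrightarrow> (\<exists>b N. (\<forall>n. stable_rank (int n) S (enat (b n))) \<and> (\<forall>n\<ge>N. b n = 0))"

definition cbetti :: "nat \<Rightarrow> 'a::topological_space set \<Rightarrow> nat" where
  "cbetti n S = (THE k. stable_rank (int n) S (enat k))"

text \<open>The Euler characteristic with compact supports, computed from Borel-Moore Betti numbers.
  It is meaningful for sets that are \<open>ctame\<close>.\<close>

definition cchi :: "'a::topological_space set \<Rightarrow> int" where
  "cchi S = (\<Sum>n | cbetti n S \<noteq> 0. (-1) ^ n * int (cbetti n S))"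

lemma cbetti_eq: "stable_rank (int n) S (enat k) \<Longrightarrow> cbetti n S = k"
  unfolding cbetti_def by (rule the_equality) (auto dest: stable_rank_unique)

lemma alternating_sum_support:
  assumes "\<And>n. n \<ge> N \<Longrightarrow> b n = (0::nat)"
  shows "(\<Sum>n | b n \<noteq> 0. (-1) ^ n * int (b n)) = (\<Sum>n<N. (-1) ^ n * int (b n))"
proof (rule sum.mono_neutral_left)
  show "{n. b n \<noteq> 0} \<subseteq> {..<N}"
  proof
    fix n assume "n \<in> {n. b n \<noteq> 0}"
    then show "n \<in> {..<N}" using assms[of n] by (cases "n < N") auto
  qed
qed auto

lemma ctameI:
  assumes "\<And>n. stable_rank (int n) S (enat (b n))" "\<And>n. n \<ge> N \<Longrightarrow> b n = 0"
  shows "ctame S" "cchi S = (\<Sum>n<N. (-1) ^ n * int (b n))"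
proof -
  show "ctame S" using assms unfolding ctame_def by blast
  have "cbetti n S = b n" for n using assms(1) by (rule cbetti_eq)
  then show "cchi S = (\<Sum>n<N. (-1) ^ n * int (b n))"
    unfolding cchi_def using alternating_sum_support[of N b] assms(2) by simp
qed

lemma ctame_homeomorphic:
  assumes "ctame S" "S homeomorphic S'"
  shows "ctame S'" "cchi S' = cchi S"
proof -
  obtain b N where b: "\<And>n. stable_rank (int n) S (enat (b n))" "\<And>n. n \<ge> N \<Longrightarrow> b n = 0"
    using assms(1) unfolding ctame_def by auto
  have b': "stable_rank (int n) S' (enat (b n))" for n
    by (rule stable_rank_homeomorphic[OF b(1) assms(2)])
  show "ctame S'" by (rule ctameI(1)[OF b' b(2)])
  show "cchi S' = cchi S" using ctameI(2)[OF b' b(2)] ctameI(2)[OF b] by simp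
qed

text \<open>With \<open>L\<close> empty the pair is \<open>K\<close> alone, so on compact sets the
  homology at infinity is the ordinary one.\<close>

lemma stable_rank_compact:
  fixes K :: "'a::t2_space set"
  assumes "compact K"
  shows "stable_rank p K (hrank p (top_of_set K) {})"
  using stable_rank_cofibration[OF cofibration_empty assms, of p] by simp

lemma ctame_hrank:
  assumes "ctame S" "\<And>p. stable_rank p S (k p)"
  shows "\<forall>n::nat. k (int n) \<noteq> \<infinity>" "\<exists>N::nat. \<forall>n\<ge>N. k (int n) = 0"
proof -
  obtain b and N :: nat where b: "\<And>n. stable_rank (int n) S (enat (b n))" "\<And>n. n \<ge> N \<Longrightarrow> b n = 0"
    using assms(1) unfolding ctame_def by auto
  have k: "k (int n) = enat (b n)" for n using stable_rank_unique[OF assms(2) b(1)] .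
  then show "\<forall>n::nat. k (int n) \<noteq> \<infinity>" by simp
  show "\<exists>N::nat. \<forall>n\<ge>N. k (int n) = 0" using k b(2) by (auto simp: zero_enat_def)
qed

text \<open>By \<open>stable_rank_cofibration\<close> the relative homology of the pair is the
  homology at infinity of \<open>K - L\<close>, so the long exact sequence becomes an additivity
  formula. Tameness of \<open>L\<close> and of one of the other two sets gives tameness of the
  third.\<close>

theorem cchi_cofibration:
  fixes K :: "'a::t2_space set"
  assumes cof: "cofibration K L" and K: "compact K" and L: "closed L"
    and tame: "ctame L" "ctame K \<or> ctame (K - L)"
  shows "ctame K" "ctame (K - L)" "cchi K = cchi L + cchi (K - L)"
proof -
  have LK: "L \<subseteq> K" using cof by (simp add: cofibration_def)
  have cL: "compact L" using K L LK by (metis compact_Int_closed inf.absorb_iff2)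
  obtain i j d where ex: "\<And>p. hrank p (subtopology (top_of_set K) L) {} = d (p + 1) + i p"
    "\<And>p. hrank p (top_of_set K) {} = i p + j p" "\<And>p. hrank p (top_of_set K) L = j p + d p" "\<And>p. p \<le> 0 \<Longrightarrow> d p = 0"
    by (rule pair_exact_ranks[where X = "top_of_set K" and S = L]) (rule that)
  have subL: "subtopology (top_of_set K) L = top_of_set L"
    using LK by (simp add: subtopology_subtopology inf_absorb2)
  note sr = stable_rank_compact[OF cL] stable_rank_compact[OF K] stable_rank_cofibration[OF cof K L]
  let ?a = "\<lambda>n::nat. hrank (int n) (top_of_set L) {}"
  let ?x = "\<lambda>n::nat. hrank (int n) (top_of_set K) {}" and ?r = "\<lambda>n::nat. hrank (int n) (top_of_set K) L"
  have fin: "((\<forall>n. ?a n \<noteq> \<infinity>) \<and> (\<exists>N. \<forall>n\<ge>N. ?a n = 0) \<and> (\<forall>n. ?x n \<noteq> \<infinity>) \<and> (\<exists>N. \<forall>n\<ge>N. ?x n = 0)) \<or>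
      ((\<forall>n. ?a n \<noteq> \<infinity>) \<and> (\<exists>N. \<forall>n\<ge>N. ?a n = 0) \<and> (\<forall>n. ?r n \<noteq> \<infinity>) \<and> (\<exists>N. \<forall>n\<ge>N. ?r n = 0))"
    using tame(2)
  proof
    assume "ctame K"
    from ctame_hrank[OF tame(1) sr(1)] ctame_hrank[OF this sr(2)] show ?thesis by simp
  next
    assume "ctame (K - L)"
    from ctame_hrank[OF tame(1) sr(1)] ctame_hrank[OF this sr(3)] show ?thesis by simp
  qed
  have exa: "?a n = d (int (Suc n)) + i (int n)" for n using ex(1)[of "int n"] by (simp add: subL add.commute)
  obtain a' x' r' N where eq: "\<And>n. ?a n = enat (a' n)" "\<And>n. ?x n = enat (x' n)" "\<And>n. ?r n = enat (r' n)"
    and N: "\<And>n. n \<ge> N \<Longrightarrow> a' n = 0 \<and> x' n = 0 \<and> r' n = 0"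
    and sum: "(\<Sum>n<N. (-1) ^ n * int (x' n)) = (\<Sum>n<N. (-1) ^ n * int (a' n)) + (\<Sum>n<N. (-1) ^ n * int (r' n))"
    by (rule pair_euler[where a = ?a and x = ?x and r = ?r and i = "\<lambda>n. i (int n)" and j = "\<lambda>n. j (int n)"
      and d = "\<lambda>n. d (int n)", OF exa ex(2,3) _ fin]) (use ex(4) that in auto)
  have s: "stable_rank (int n) L (enat (a' n))" "stable_rank (int n) K (enat (x' n))"
    "stable_rank (int n) (K - L) (enat (r' n))" for n
    using sr[of "int n"] eq by simp_all
  show "ctame K" "ctame (K - L)" using s N by (auto intro!: ctameI(1))
  show "cchi K = cchi L + cchi (K - L)"
    using ctameI(2)[of L a' N] ctameI(2)[of K x' N] ctameI(2)[of "K - L" r' N] s N sum by simp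
qed

lemma hrank_homeomorphic_space:
  assumes "X homeomorphic_space Y"
  shows "hrank p X {} = hrank p Y {}"
proof -
  obtain h where "h \<in> iso (homology_group p X) (homology_group p Y)"
    using homeomorphic_space_imp_isomorphic_homology_groups[OF assms, of p] by (auto simp: is_iso_def)
  then show ?thesis by (rule hrank_iso)
qed

theorem euler_characteristic_eq_cchi:
  fixes K :: "'a::t2_space set"
  assumes "X homeomorphic_space (top_of_set K)" "compact K" "ctame K"
  shows "euler_characteristic X = cchi K"
proof -
  obtain b N where b: "\<And>n. stable_rank (int n) K (enat (b n))" "\<And>n. n \<ge> N \<Longrightarrow> b n = 0"
    using assms(3) unfolding ctame_def by auto
  have "hrank (int n) X {} = enat (b n)" for n
    using stable_rank_unique[OF stable_rank_compact[OF assms(2)] b(1)] hrank_homeomorphic_space[OF assms(1)] by simp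
  then have "betti n X = b n" for n
    unfolding betti_def by (intro abelian_rank_eq) (simp add: hrank_def)
  then show ?thesis
    unfolding euler_characteristic_def using alternating_sum_support[of N b] ctameI(2)[OF b] b(2) by simp
qed

lemma ab_rank_integer_group: "ab_rank integer_group UNIV \<le> 1"
proof (rule ab_rank_least)
  interpret comm_group integer_group by (rule abelian_integer_group)
  fix S :: "int set" assume S: "finite S" "int_independent integer_group S"
  have "\<exists>k c. k \<noteq> (0::int) \<and> u [^]\<^bsub>integer_group\<^esub> k = int_comb integer_group c {1}" for u :: int
    by (rule exI[of _ 1], rule exI[of _ "\<lambda>_. u"]) (simp add: int_comb_insert)
  then have "\<not> card {1::int} < card S"
    using int_dependent_of_span[of S "{1}"] S by auto
  then show "enat (card S) \<le> 1" by (simp add: one_enat_def)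
qed

text \<open>The homology is that of a point or of the empty set. This is the source of all
  finiteness: closures of cells are contractible.\<close>

lemma ctame_contractible:
  fixes K :: "'a::t2_space set"
  assumes "compact K" "contractible K"
  shows "ctame K"
proof -
  have fin: "hrank p (top_of_set K) {} \<noteq> \<infinity>" "p \<noteq> 0 \<Longrightarrow> hrank p (top_of_set K) {} = 0" for p
  proof -
    consider "K = {}" | a where "a \<in> K" "top_of_set K homotopy_equivalent_space top_of_set {a}"
    proof -
      assume *: "K = {} \<Longrightarrow> thesis" "\<And>a. a \<in> K \<Longrightarrow> top_of_set K homotopy_equivalent_space top_of_set {a} \<Longrightarrow> thesis"
      show thesis
      proof (cases "K = {}")
        case False
        then have "top_of_set K \<noteq> trivial_topology"
          by (metis topspace_discrete_topology topspace_euclidean_subtopology)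
        then obtain a where a: "a \<in> K" "top_of_set K homotopy_equivalent_space subtopology (top_of_set K) {a}"
          using assms(2) contractible_eq_homotopy_equivalent_singleton_subtopology[of "top_of_set K"]
          unfolding contractible_space_top_of_set topspace_euclidean_subtopology by metis
        then show thesis using *(2)[of a] by (simp add: subtopology_subtopology inf_absorb2)
      qed (rule *(1))
    qed
    then have "hrank p (top_of_set K) {} \<noteq> \<infinity> \<and> (p \<noteq> 0 \<longrightarrow> hrank p (top_of_set K) {} = 0)"
    proof cases
      case 1
      then have "carrier (homology_group p (top_of_set K)) = {\<one>\<^bsub>homology_group p (top_of_set K)\<^esub>}"
        using trivial_homology_group_empty[of "top_of_set K" p] by (simp add: trivial_group_def)
      then show ?thesis unfolding hrank_def using ab_rank_trivial[of "homology_group p (top_of_set K)"] by simp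
    next
      case 2
      obtain h where h: "h \<in> iso (homology_group p (top_of_set K)) (homology_group p (top_of_set {a}))"
        using homotopy_equivalent_space_imp_isomorphic_homology_groups[OF 2(2), of p] by (auto simp: is_iso_def)
      show ?thesis
      proof (cases "p = 0")
        case False
        then have "carrier (homology_group p (top_of_set {a})) = {\<one>\<^bsub>homology_group p (top_of_set {a})\<^esub>}"
          using homology_dimension_axiom[of "top_of_set {a}" a p] by (simp add: trivial_group_def)
        then show ?thesis
          using ab_rank_trivial[of "homology_group p (top_of_set {a})"] hrank_iso[OF h] by (simp add: hrank_def)
      next
        case True
        obtain k where k: "k \<in> iso (homology_group 0 (top_of_set {a})) integer_group"
          using homology_coefficients[of "top_of_set {a}" a] by (auto simp: is_iso_def)
        have "ab_rank integer_group (k ` carrier (homology_group 0 (top_of_set {a}))) = hrank 0 (top_of_set {a}) {}"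
          unfolding hrank_def using k
          by (intro ab_rank_inj_image) (auto simp: iso_def bij_betw_def abelian_integer_group)
        moreover have "k ` carrier (homology_group 0 (top_of_set {a})) = UNIV"
          using k by (auto simp: iso_def bij_betw_def)
        ultimately have "hrank 0 (top_of_set {a}) {} \<le> 1" using ab_rank_integer_group by simp
        then show ?thesis using True hrank_iso[OF h] by (cases "hrank 0 (top_of_set {a}) {}") auto
      qed
    qed
    then show "hrank p (top_of_set K) {} \<noteq> \<infinity>" "p \<noteq> 0 \<Longrightarrow> hrank p (top_of_set K) {} = 0" by auto
  qed
  obtain b where b: "\<And>n::nat. hrank (int n) (top_of_set K) {} = enat (b n)"
    using enat_seq_finite[of "\<lambda>n. hrank (int n) (top_of_set K) {}"] fin(1) by metis
  show ?thesis
  proof (rule ctameI(1)[where b = b and N = 1])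
    show "stable_rank (int n) K (enat (b n))" for n using stable_rank_compact[OF assms(1)] b by metis
    show "b n = 0" if "n \<ge> 1" for n using fin(2)[of "int n"] b[of n] that by (simp add: zero_enat_def)
  qed
qed

lemma cofibration_times:
  assumes "cofibration K L"
  shows "cofibration (K \<times> T) (L \<times> T)"
proof -
  obtain f g where d: "cofibration_maps K L f g" using cofibrationE[OF assms] by metis
  note fg = cofibration_mapsD[OF d]
  have LK: "L \<subseteq> K" using assms by (simp add: cofibration_def)
  let ?m = "\<lambda>z :: ('a \<times> 'b) \<times> real. (fst (fst z), snd z)"
  have cm: "continuous_on ((K \<times> T) \<times> {0..1}) ?m" by (intro continuous_intros)
  have mm: "?m ` ((K \<times> T) \<times> {0..1}) \<subseteq> K \<times> {0..1}" by auto
  note c = continuous_on_compose2[OF fg(1) cm mm] continuous_on_compose2[OF fg(2) cm mm]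
  show ?thesis
  proof (rule cofibrationI[where f = "\<lambda>z. (f (?m z), snd (fst z))" and g = "\<lambda>z. g (?m z)"])
    fix z and t :: real assume z: "z \<in> K \<times> T" "t \<in> {0..1}"
    then have x: "fst z \<in> K" "snd z \<in> T" by auto
    show "g (?m (z, t)) = 0 \<or> (f (?m (z, t)), snd (fst (z, t))) \<in> L \<times> T"
      using fg(5)[OF x(1) z(2)] x by auto
  qed (use LK fg in \<open>auto intro!: continuous_intros c\<close>)
qed

text \<open>Projection is a homotopy equivalence of the pairs
  \<open>(K \<times> I, L \<times> I)\<close> and \<open>(K, L)\<close>, and their relative homology
  computes the homology at infinity of the two differences.\<close>

lemma ctame_times_interval:
  fixes K :: "'a::t2_space set"
  assumes cof: "cofibration K L" and K: "compact K" and L: "closed L" and tame: "ctame (K - L)"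
  shows "ctame ((K - L) \<times> {0..1::real})" "cchi ((K - L) \<times> {0..1::real}) = cchi (K - L)"
proof -
  let ?I = "{0..1::real}"
  have LK: "L \<subseteq> K" using cof by (simp add: cofibration_def)
  have "(fst \<in> L \<times> ?I \<rightarrow> L)" "(\<lambda>x. (x, 0)) \<in> L \<rightarrow> L \<times> ?I" by auto
  have h: "hrank p (top_of_set K) L = hrank p (top_of_set (K \<times> ?I)) (L \<times> ?I)" for p
  proof (rule hrank_iso, rule homotopy_equivalence_relative_homology_group_isomorphism)
    show "continuous_map (top_of_set K) (top_of_set (K \<times> ?I)) (\<lambda>x. (x, 0))"
      by (auto simp: continuous_map_in_subtopology intro!: continuous_intros)
    show "continuous_map (top_of_set (K \<times> ?I)) (top_of_set K) fst"
      by (auto simp: continuous_map_in_subtopology intro!: continuous_intros)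
    show "homotopic_with (\<lambda>h. h \<in> L \<rightarrow> L) (top_of_set K) (top_of_set K) (fst \<circ> (\<lambda>x. (x, 0))) id"
      by (rule homotopic_with_equal) auto
    have "homotopic_with (\<lambda>k. k \<in> L \<times> ?I \<rightarrow> L \<times> ?I) (top_of_set (K \<times> ?I)) (top_of_set (K \<times> ?I))
        (\<lambda>z. (\<lambda>w. (fst (fst w), snd w * snd (fst w))) (z, 0)) (\<lambda>z. (\<lambda>w. (fst (fst w), snd w * snd (fst w))) (z, 1))"
      by (rule homotopic_with_top_of_setI) (use LK in \<open>auto intro!: continuous_intros mult_le_one\<close>)
    then show "homotopic_with (\<lambda>k. k \<in> L \<times> ?I \<rightarrow> L \<times> ?I) (top_of_set (K \<times> ?I)) (top_of_set (K \<times> ?I))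
        ((\<lambda>x. (x, 0)) \<circ> fst) id"
      by (simp add: o_def id_def)
  qed auto
  have S: "K \<times> ?I - L \<times> ?I = (K - L) \<times> ?I" by auto
  obtain b N where b: "\<And>n. stable_rank (int n) (K - L) (enat (b n))" "\<And>n. n \<ge> N \<Longrightarrow> b n = 0"
    using tame unfolding ctame_def by auto
  have "stable_rank (int n) ((K - L) \<times> ?I) (hrank (int n) (top_of_set (K \<times> ?I)) (L \<times> ?I))" for n
    using stable_rank_cofibration[OF cofibration_times[OF cof, of ?I]] K L S
    by (metis closed_Times closed_atLeastAtMost compact_Icc compact_Times)
  moreover have "hrank (int n) (top_of_set K) L = enat (b n)" for n
    using stable_rank_unique[OF stable_rank_cofibration[OF cof K L] b(1)] .
  ultimately have b': "stable_rank (int n) ((K - L) \<times> ?I) (enat (b n))" for n using h by metis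
  show "ctame ((K - L) \<times> ?I)" by (rule ctameI(1)[OF b' b(2)])
  show "cchi ((K - L) \<times> ?I) = cchi (K - L)" using ctameI(2)[OF b' b(2)] ctameI(2)[OF b] by simp
qed

section \<open>Finite cell complexes and additivity over cells\<close>

section \<open>Cell complexes\<close>

text \<open>Limits along a connected set that takes finitely many limit values exist under this condition.\<close>

definition boundary_connected :: "'a::topological_space set \<Rightarrow> bool" where
  "boundary_connected C \<longleftrightarrow>
     (\<forall>x\<in>closure C. \<forall>U. open U \<longrightarrow> x \<in> U \<longrightarrow> (\<exists>V. open V \<and> x \<in> V \<and> V \<subseteq> U \<and> connected (V \<inter> C)))"

lemma boundary_connectedD:
  assumes "boundary_connected C" "x \<in> closure C" "open U" "x \<in> U"
  obtains V where "open V" "x \<in> V" "V \<subseteq> U" "connected (V \<inter> C)"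
  using assms unfolding boundary_connected_def by metis

text \<open>A cell need not be given as an open ball. Contractibility of the closure gives finite
  Betti numbers, the cofibration gives additivity, and \<open>boundary_connected\<close> lets root
  functions extend to the frontier. All these properties pass from a base cell to the graphs and
  bands over it.\<close>

definition cell :: "'a::topological_space set \<Rightarrow> bool" where
  "cell C \<longleftrightarrow> C \<noteq> {} \<and> connected C \<and> boundary_connected C \<and> compact (closure C) \<and>
     contractible (closure C) \<and> closed (closure C - C) \<and> cofibration (closure C) (closure C - C)"

definition cell_complex :: "'a::topological_space set set \<Rightarrow> bool" where
  "cell_complex \<C> \<longleftrightarrow> finite \<C> \<and> (\<forall>C\<in>\<C>. cell C) \<and> pairwise disjnt \<C> \<and>
     (\<forall>C\<in>\<C>. \<forall>D\<in>\<C>. D \<inter> closure C \<noteq> {} \<longrightarrow> D \<subseteq> closure C) \<and> (\<forall>C\<in>\<C>. closure C \<subseteq> \<Union>\<C>)"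

context
  fixes \<C> :: "'a::t2_space set set"
  assumes complex: "cell_complex \<C>"
begin

lemma cells:
  "finite \<C>" "\<And>C. C \<in> \<C> \<Longrightarrow> cell C"
  "\<And>C D. C \<in> \<C> \<Longrightarrow> D \<in> \<C> \<Longrightarrow> D \<inter> closure C \<noteq> {} \<Longrightarrow> D \<subseteq> closure C"
  "\<And>C. C \<in> \<C> \<Longrightarrow> closure C \<subseteq> \<Union>\<C>"
  "\<And>C D. C \<in> \<C> \<Longrightarrow> D \<in> \<C> \<Longrightarrow> C \<noteq> D \<Longrightarrow> C \<inter> D = {}"
proof -
  show "finite \<C>" "\<And>C. C \<in> \<C> \<Longrightarrow> cell C" using complex by (simp_all add: cell_complex_def)
  show "D \<subseteq> closure C" if "C \<in> \<C>" "D \<in> \<C>" "D \<inter> closure C \<noteq> {}" for C D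
    using complex that by (simp add: cell_complex_def)
  show "closure C \<subseteq> \<Union>\<C>" if "C \<in> \<C>" for C using complex that by (simp add: cell_complex_def)
  show "C \<inter> D = {}" if "C \<in> \<C>" "D \<in> \<C>" "C \<noteq> D" for C D
    using complex that by (simp add: cell_complex_def pairwise_def disjnt_def)
qed

lemma cell_union_mem:
  assumes "\<K> \<subseteq> \<C>" "C \<in> \<C>" "C \<inter> \<Union>\<K> \<noteq> {}"
  shows "C \<in> \<K>"
proof -
  obtain D where "D \<in> \<K>" "C \<inter> D \<noteq> {}" using assms(3) by blast
  then show ?thesis using cells(5)[OF assms(2), of D] assms(1) by blast
qed

lemma closure_subset_union:
  assumes "\<K> \<subseteq> \<C>" "closed (\<Union>\<K>)" "C \<in> \<K>"
  shows "closure C \<subseteq> \<Union>\<K>"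
  using assms by (intro closure_minimal) auto

lemma closure_union_cells:
  assumes "\<S> \<subseteq> \<C>"
  shows "closure (\<Union>\<S>) = \<Union>{D \<in> \<C>. D \<subseteq> closure (\<Union>\<S>)}"
proof
  have fin: "finite \<S>" using assms cells(1) finite_subset by blast
  have cl: "closure (\<Union>\<S>) = (\<Union>C\<in>\<S>. closure C)" 
    using fin by (induction \<S> rule: finite_induct) auto
  show "closure (\<Union>\<S>) \<subseteq> \<Union>{D \<in> \<C>. D \<subseteq> closure (\<Union>\<S>)}"
  proof
    fix x assume "x \<in> closure (\<Union>\<S>)"
    then obtain C where C: "C \<in> \<S>" "x \<in> closure C" using cl by auto
    then obtain D where D: "D \<in> \<C>" "x \<in> D" using cells(4)[of C] assms by blast
    then have "D \<subseteq> closure C" using cells(3)[of C D] C assms by blast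
    then show "x \<in> \<Union>{D \<in> \<C>. D \<subseteq> closure (\<Union>\<S>)}" using D C cl by blast
  qed
qed auto

lemma closed_union_compact:
  assumes "\<K> \<subseteq> \<C>" "closed (\<Union>\<K>)"
  shows "compact (\<Union>\<K>)"
proof -
  have "finite \<K>" using assms(1) cells(1) finite_subset by blast
  moreover have "\<Union>\<K> = (\<Union>C\<in>\<K>. closure C)"
    using closure_subset_union[OF assms] closure_subset by blast
  moreover have "compact (closure C)" if "C \<in> \<K>" for C
    using cells(2)[of C] assms(1) that by (auto simp: cell_def)
  ultimately show ?thesis by (auto intro: compact_UN)
qed

text \<open>The number of cells in the closure replaces dimension: it drops strictly from a cell to
  a cell in its frontier. A cell outside \<open>\<L>\<close> that maximizes it lies in the closure
  of no other cell of \<open>\<K>\<close>, so its removal leaves a closed union.\<close>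

lemma removable_cell:
  assumes K: "\<K> \<subseteq> \<C>" "closed (\<Union>\<K>)" and L: "\<L> \<subseteq> \<K>" "closed (\<Union>\<L>)" "\<L> \<noteq> \<K>"
  obtains C where "C \<in> \<K>" "C \<notin> \<L>" "closed (\<Union>(\<K> - {C}))"
proof -
  have finK: "finite \<K>" using K(1) cells(1) finite_subset by blast
  define m where "m = (\<lambda>C. card {E \<in> \<C>. E \<subseteq> closure C})"
  have "\<K> - \<L> \<noteq> {}" "finite (\<K> - \<L>)" using L finK by auto
  then have "Max (m ` (\<K> - \<L>)) \<in> m ` (\<K> - \<L>)" by (intro Max_in) auto
  then obtain C where C0: "C \<in> \<K> - \<L>" "m C = Max (m ` (\<K> - \<L>))" by auto
  have "m D \<le> m C" if "D \<in> \<K> - \<L>" for D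
    unfolding C0(2) using that \<open>finite (\<K> - \<L>)\<close> by (intro Max_ge) auto
  note C = C0(1) this
  have disj: "C \<inter> closure D = {}" if D: "D \<in> \<K>" "D \<noteq> C" for D
  proof (rule ccontr)
    assume ne: "C \<inter> closure D \<noteq> {}"
    have CD: "C \<in> \<C>" "D \<in> \<C>" using C D K by auto
    have sub: "C \<subseteq> closure D" using cells(3)[OF CD(2,1) ne] .
    have "D \<notin> \<L>"
    proof
      assume "D \<in> \<L>"
      then have "closure D \<subseteq> \<Union>\<L>" using L by (intro closure_minimal) auto
      moreover have "C \<noteq> {}" using cells(2)[OF CD(1)] by (simp add: cell_def)
      ultimately have "C \<in> \<L>" using cell_union_mem[of \<L> C] sub L K CD by blast
      then show False using C by blast
    qed
    then have le: "m D \<le> m C" using C(2) D by blast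
    have "C \<subseteq> closure D - D" using sub cells(5)[OF CD] D by blast
    moreover have "closed (closure D - D)" using cells(2)[OF CD(2)] by (simp add: cell_def)
    ultimately have "closure C \<subseteq> closure D - D" by (rule closure_minimal)
    moreover have "D \<noteq> {}" using cells(2)[OF CD(2)] by (simp add: cell_def)
    ultimately have "{E \<in> \<C>. E \<subseteq> closure C} \<subset> {E \<in> \<C>. E \<subseteq> closure D}"
      using CD(2) closure_subset[of D] by blast
    then have "m C < m D" unfolding m_def using cells(1) by (intro psubset_card_mono) auto
    then show False using le by simp
  qed
  have "\<Union>(\<K> - {C}) = (\<Union>D\<in>\<K> - {C}. closure D)"
  proof
    show "\<Union>(\<K> - {C}) \<subseteq> (\<Union>D\<in>\<K> - {C}. closure D)" using closure_subset by blast
    show "(\<Union>D\<in>\<K> - {C}. closure D) \<subseteq> \<Union>(\<K> - {C})"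
    proof
      fix x assume "x \<in> (\<Union>D\<in>\<K> - {C}. closure D)"
      then obtain D where D: "D \<in> \<K>" "D \<noteq> C" "x \<in> closure D" by auto
      then have "x \<in> \<Union>\<K>" "x \<notin> C" using closure_subset_union[OF K D(1)] disj[OF D(1,2)] by blast+
      then show "x \<in> \<Union>(\<K> - {C})" by auto
    qed
  qed
  then have "closed (\<Union>(\<K> - {C}))" using finK by auto
  then show ?thesis by (intro that[of C]) (use C(1) in auto)
qed

lemma boundary_union_cells:
  assumes K: "\<K> \<subseteq> \<C>" "closed (\<Union>\<K>)" and C: "C \<in> \<K>"
  shows "closure C - C = \<Union>{D \<in> \<K>. D \<subseteq> closure C \<and> D \<noteq> C}"
proof
  show "closure C - C \<subseteq> \<Union>{D \<in> \<K>. D \<subseteq> closure C \<and> D \<noteq> C}"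
  proof
    fix x assume x: "x \<in> closure C - C"
    then obtain D where D: "D \<in> \<K>" "x \<in> D" using closure_subset_union[OF K C] by blast
    then have "D \<subseteq> closure C" using cells(3)[of C D] x K C by blast
    then show "x \<in> \<Union>{D \<in> \<K>. D \<subseteq> closure C \<and> D \<noteq> C}" using D x by blast
  qed
  show "\<Union>{D \<in> \<K>. D \<subseteq> closure C \<and> D \<noteq> C} \<subseteq> closure C - C"
    using cells(5)[of C] K C by blast
qed

lemma cofibration_remove_cell:
  assumes K: "\<K> \<subseteq> \<C>" "closed (\<Union>\<K>)" and C: "C \<in> \<K>" "closed (\<Union>(\<K> - {C}))"
  shows "cofibration (\<Union>\<K>) (\<Union>(\<K> - {C}))" "\<Union>\<K> - \<Union>(\<K> - {C}) = C"
proof -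
  have CC: "cell C" "C \<in> \<C>" using cells(2) C K by auto
  have dis: "C \<inter> \<Union>(\<K> - {C}) = {}"
    using cells(5)[OF CC(2)] K by blast
  have cl: "closure C \<subseteq> \<Union>\<K>" using closure_subset_union[OF K C(1)] .
  have "closure C \<inter> \<Union>(\<K> - {C}) = closure C - C" using dis cl by blast
  then have "cofibration (\<Union>(\<K> - {C}) \<union> closure C) (\<Union>(\<K> - {C}))"
    using CC C by (intro cofibration_attach[where D = "closure C - C"]) (auto simp: cell_def)
  moreover have "\<Union>(\<K> - {C}) \<union> closure C = \<Union>\<K>" using cl C(1) closure_subset[of C] by blast
  ultimately show "cofibration (\<Union>\<K>) (\<Union>(\<K> - {C}))" by simp
  show "\<Union>\<K> - \<Union>(\<K> - {C}) = C" using dis C(1) by blast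
qed

text \<open>Cells are removed one at a time. Each was attached along its frontier, which is a
  cofibration, and cofibrations compose.\<close>

theorem cofibration_cell_unions:
  assumes K: "\<K> \<subseteq> \<C>" "closed (\<Union>\<K>)" and L: "\<L> \<subseteq> \<K>" "closed (\<Union>\<L>)"
  shows "cofibration (\<Union>\<K>) (\<Union>\<L>)"
  using assms
proof (induction "card (\<K> - \<L>)" arbitrary: \<K> rule: less_induct)
  case less
  show ?case
  proof (cases "\<L> = \<K>")
    case True
    have "cofibration (\<Union>\<K>) (\<Union>\<K>)"
      by (rule cofibrationI[where f = fst and g = snd]) (auto intro!: continuous_intros)
    then show ?thesis using True by simp
  next
    case False
    obtain C where C: "C \<in> \<K>" "C \<notin> \<L>" "closed (\<Union>(\<K> - {C}))"
      using removable_cell[OF less.prems False] .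
    have "finite \<K>" using less.prems(1) cells(1) finite_subset by blast
    then have "card (\<K> - {C} - \<L>) < card (\<K> - \<L>)"
      using C by (intro psubset_card_mono) auto
    then have "cofibration (\<Union>(\<K> - {C})) (\<Union>\<L>)"
      using C less.prems by (intro less.hyps) auto
    then show ?thesis
      using cofibration_trans[OF cofibration_remove_cell(1)[OF less.prems(1,2) C(1,3)]] C less.prems by blast
  qed
qed

text \<open>Induction on the number of cells. The frontier of a removable cell is a smaller closed
  union and its closure is contractible, so the cell itself is tame; attaching it adds its value to
  that of the rest.\<close>

theorem ctame_closed_union:
  assumes "\<K> \<subseteq> \<C>" "closed (\<Union>\<K>)"
  shows "ctame (\<Union>\<K>) \<and> (\<forall>C\<in>\<K>. ctame C) \<and> cchi (\<Union>\<K>) = (\<Sum>C\<in>\<K>. cchi C)"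
  using assms
proof (induction "card \<K>" arbitrary: \<K> rule: less_induct)
  case less
  note K = less.prems
  have finK: "finite \<K>" using K(1) cells(1) finite_subset by blast
  show ?case
  proof (cases "\<K> = {}")
    case True
    have "ctame ({} :: 'a set)" by (rule ctame_contractible) auto
    moreover have "cchi ({} :: 'a set) = 0"
    proof -
      have "cofibration ({} :: 'a set) {}" by (rule cofibration_empty)
      from cchi_cofibration(3)[OF this] \<open>ctame ({} :: 'a set)\<close> show ?thesis by simp
    qed
    ultimately show ?thesis using True by simp
  next
    case False
    obtain C where C: "C \<in> \<K>" "closed (\<Union>(\<K> - {C}))"
      using removable_cell[OF K, of "{}"] False by auto
    have lt: "card \<K>' < card \<K>" if "\<K>' \<subseteq> \<K> - {C}" for \<K>'
      using that finK C(1) by (intro psubset_card_mono) auto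
    have CC: "cell C" using cells(2) C K by auto
    then have cC: "compact (closure C)" "contractible (closure C)" "closed (closure C - C)"
      "cofibration (closure C) (closure C - C)" by (auto simp: cell_def)
    note bd = boundary_union_cells[OF K C(1)]
    have sub: "{D \<in> \<K>. D \<subseteq> closure C \<and> D \<noteq> C} \<subseteq> \<K> - {C}" by auto
    have "ctame (closure C - C)"
      unfolding bd using less.hyps[OF lt[OF sub]] K sub cC(3)[unfolded bd] by blast
    then have "ctame (closure C - (closure C - C))"
      using cchi_cofibration(2)[OF cC(4,1,3)] ctame_contractible[OF cC(1,2)] by blast
    moreover have "closure C - (closure C - C) = C" using closure_subset by blast
    ultimately have tC: "ctame C" by simp
    have IH: "ctame (\<Union>(\<K> - {C}))" "\<forall>D\<in>\<K> - {C}. ctame D"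
      "cchi (\<Union>(\<K> - {C})) = (\<Sum>D\<in>\<K> - {C}. cchi D)"
      using less.hyps[OF lt[OF subset_refl]] K C(2) by blast+
    note r = cofibration_remove_cell[OF K C]
    have tame: "ctame (\<Union>\<K> - \<Union>(\<K> - {C}))" unfolding r(2) by (rule tC)
    note cc = cchi_cofibration[OF r(1) closed_union_compact[OF K] C(2) IH(1) disjI2[OF tame]]
    have "cchi (\<Union>\<K>) = (\<Sum>D\<in>\<K>. cchi D)"
      using cc(3) IH(3) finK C(1) unfolding r(2) by (simp add: sum.remove)
    then show ?thesis using cc(1) IH(2) tC by auto
  qed
qed

text \<open>Local closedness presents the set as a difference of two closed unions of cells, and the
  values of these are subtracted.\<close>

theorem locally_closed_union:
  assumes S: "\<S> \<subseteq> \<C>" and lc: "closed (closure (\<Union>\<S>) - \<Union>\<S>)"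
  shows "ctame (\<Union>\<S>)" "cchi (\<Union>\<S>) = (\<Sum>C\<in>\<S>. cchi C)"
    "cofibration (closure (\<Union>\<S>)) (closure (\<Union>\<S>) - \<Union>\<S>)" "compact (closure (\<Union>\<S>))"
proof -
  define \<K> where "\<K> = {D \<in> \<C>. D \<subseteq> closure (\<Union>\<S>)}"
  define \<L> where "\<L> = \<K> - \<S>"
  have K: "\<K> \<subseteq> \<C>" "\<Union>\<K> = closure (\<Union>\<S>)" "\<S> \<subseteq> \<K>"
    using closure_union_cells[OF S] S closure_subset[of "\<Union>\<S>"] by (auto simp: \<K>_def)
  have finK: "finite \<K>" using K(1) cells(1) finite_subset by blast
  have "D \<inter> \<Union>\<S> = {}" if "D \<in> \<L>" for D
    using cell_union_mem[OF S, of D] that K by (auto simp: \<L>_def)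
  then have "\<Union>\<L> = \<Union>\<K> - \<Union>\<S>" unfolding \<L>_def by blast
  then have L: "\<Union>\<L> = closure (\<Union>\<S>) - \<Union>\<S>" using K by simp
  have cK: "closed (\<Union>\<K>)" and cL: "closed (\<Union>\<L>)" using K L lc by auto
  have LK: "\<L> \<subseteq> \<K>" by (auto simp: \<L>_def)
  show cof: "cofibration (closure (\<Union>\<S>)) (closure (\<Union>\<S>) - \<Union>\<S>)"
    using cofibration_cell_unions[OF K(1) cK LK cL] K L by simp
  show cpt: "compact (closure (\<Union>\<S>))" using closed_union_compact[OF K(1) cK] K by simp
  note tK = ctame_closed_union[OF K(1) cK] and tL = ctame_closed_union[OF order_trans[OF LK K(1)] cL]
  have eq: "closure (\<Union>\<S>) - (closure (\<Union>\<S>) - \<Union>\<S>) = \<Union>\<S>" by (simp add: double_diff closure_subset)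
  have t1: "ctame (closure (\<Union>\<S>) - \<Union>\<S>)" "ctame (closure (\<Union>\<S>))"
    using conjunct1[OF tL] conjunct1[OF tK] unfolding K(2) L by - assumption+
  note cc = cchi_cofibration[OF cof cpt lc t1(1) disjI1[OF t1(2)], unfolded eq]
  show "ctame (\<Union>\<S>)" by (rule cc(2))
  have "(\<Sum>C\<in>\<K>. cchi C) = (\<Sum>C\<in>\<L>. cchi C) + (\<Sum>C\<in>\<S>. cchi C)"
    unfolding \<L>_def using sum.subset_diff[OF K(3) finK] by simp
  then show "cchi (\<Union>\<S>) = (\<Sum>C\<in>\<S>. cchi C)" using cc(3) tK tL K L by simp
qed

end

section \<open>Graphs and bands of functions over a cell\<close>

section \<open>Cells over a base\<close>

lemma connected_between_graphs:
  fixes lo hi :: "'a::topological_space \<Rightarrow> real"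
  assumes "connected B" "continuous_on B lo" "continuous_on B hi" "\<And>x. x \<in> B \<Longrightarrow> lo x < hi x"
  shows "connected {(x, t). x \<in> B \<and> lo x < t \<and> t < hi x}"
proof -
  let ?h = "\<lambda>z. (fst z, lo (fst z) + snd z * (hi (fst z) - lo (fst z)))"
  have "{(x, t). x \<in> B \<and> lo x < t \<and> t < hi x} = ?h ` (B \<times> {0<..<1})"
  proof (intro Set.set_eqI iffI)
    fix z assume "z \<in> {(x, t). x \<in> B \<and> lo x < t \<and> t < hi x}"
    then obtain x t where z: "z = (x, t)" "x \<in> B" "lo x < t" "t < hi x" by auto
    then have "z = ?h (x, (t - lo x) / (hi x - lo x))" "(x, (t - lo x) / (hi x - lo x)) \<in> B \<times> {0<..<1}"
      by (auto simp: field_simps)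
    then show "z \<in> ?h ` (B \<times> {0<..<1})" by blast
  next
    fix z assume "z \<in> ?h ` (B \<times> {0<..<1})"
    then obtain w where w: "z = ?h w" "w \<in> B \<times> {0<..<1}" by (rule imageE)
    obtain x s where "w = (x, s)" by (cases w)
    with w have z: "z = (x, lo x + s * (hi x - lo x))" "x \<in> B" "0 < s" "s < 1" by simp_all
    have "0 < s * (hi x - lo x)" "s * (hi x - lo x) < 1 * (hi x - lo x)"
      using z assms(4)[of x] by (auto intro!: mult_strict_right_mono mult_pos_pos)
    then show "z \<in> {(x, t). x \<in> B \<and> lo x < t \<and> t < hi x}" using z by auto
  qed
  moreover have "continuous_on (B \<times> {0<..<1}) ?h"
    by (intro continuous_intros continuous_on_compose2[OF assms(2)] continuous_on_compose2[OF assms(3)]) auto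
  ultimately show ?thesis
    using connected_continuous_image[of "B \<times> {0<..<1}" ?h] connected_Times[OF assms(1), of "{0<..<1::real}"]
    by simp
qed

text \<open>Clamping the last coordinate between \<open>g\<close> and \<open>h\<close> retracts a
  contractible product \<open>K \<times> {-r..r}\<close> onto the region.\<close>

lemma contractible_between_graphs:
  fixes K :: "'a::topological_space set" and g h :: "'a \<Rightarrow> real"
  assumes "compact K" "contractible K" "continuous_on K g" "continuous_on K h" "\<And>x. x \<in> K \<Longrightarrow> g x \<le> h x"
  shows "contractible {(x, t). x \<in> K \<and> g x \<le> t \<and> t \<le> h x}" (is "contractible ?E")
proof -
  obtain r where r: "\<And>x. x \<in> K \<Longrightarrow> \<bar>g x\<bar> \<le> r" "\<And>x. x \<in> K \<Longrightarrow> \<bar>h x\<bar> \<le> r"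
  proof -
    have "bounded (g ` K \<union> h ` K)" using assms by (simp add: compact_continuous_image compact_imp_bounded)
    then obtain r where "\<And>y. y \<in> g ` K \<union> h ` K \<Longrightarrow> norm y \<le> r" unfolding bounded_iff by blast
    then show ?thesis by (intro that[of r]) auto
  qed
  have "contractible (K \<times> {-r..r})"
  proof -
    have "contractible_space (prod_topology (top_of_set K) (top_of_set {-r..r}))"
      unfolding contractible_space_prod_topology
      using assms(2) convex_imp_contractible[of "{-r..r}"] by auto
    moreover have "prod_topology (top_of_set K) (top_of_set {-r..r}) = top_of_set (K \<times> {-r..r})"
      by (simp add: euclidean_product_topology subtopology_Times)
    ultimately show ?thesis by simp
  qed
  moreover have "?E retract_of (K \<times> {-r..r})"
    unfolding retract_of_def retraction_def
  proof (intro exI[of _ "\<lambda>z. (fst z, max (g (fst z)) (min (snd z) (h (fst z))))"] conjI)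
    show "?E \<subseteq> K \<times> {-r..r}"
    proof
      fix z assume "z \<in> ?E"
      then obtain x t where z: "z = (x, t)" "x \<in> K" "g x \<le> t" "t \<le> h x" by auto
      then show "z \<in> K \<times> {-r..r}" using r(1)[of x] r(2)[of x] by auto
    qed
    show "continuous_on (K \<times> {-r..r}) (\<lambda>z. (fst z, max (g (fst z)) (min (snd z) (h (fst z)))))"
      by (intro continuous_intros continuous_on_compose2[OF assms(3)] continuous_on_compose2[OF assms(4)]) auto
  qed (use assms(5) in auto)
  ultimately show ?thesis by (rule retract_of_contractible)
qed

text \<open>Projection to the base is a homeomorphism from the closure of the graph to
  \<open>closure C\<close>, and every property of a cell passes through it.\<close>

lemma graph_cell:
  fixes C :: "'a::metric_space set" and g :: "'a \<Rightarrow> real"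
  assumes C: "cell C" and g: "continuous_on (closure C) g"
  shows "closure ((\<lambda>x. (x, g x)) ` C) = (\<lambda>x. (x, g x)) ` closure C" "cell ((\<lambda>x. (x, g x)) ` C)"
proof -
  let ?\<gamma> = "\<lambda>x. (x, g x)"
  note CC = C[unfolded cell_def]
  have c\<gamma>: "continuous_on (closure C) ?\<gamma>" by (intro continuous_intros g)
  have inj: "inj ?\<gamma>" by (auto simp: inj_def)
  have cpt: "compact (?\<gamma> ` closure C)" using CC c\<gamma> compact_continuous_image by blast
  show cl: "closure (?\<gamma> ` C) = ?\<gamma> ` closure C"
  proof
    show "closure (?\<gamma> ` C) \<subseteq> ?\<gamma> ` closure C"
      using cpt by (intro closure_minimal) (auto intro: compact_imp_closed closure_subset[THEN subsetD])
    show "?\<gamma> ` closure C \<subseteq> closure (?\<gamma> ` C)"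
      by (rule image_closure_subset[OF c\<gamma>]) (auto simp: closure_subset[THEN subsetD])
  qed
  have diff: "closure (?\<gamma> ` C) - ?\<gamma> ` C = ?\<gamma> ` (closure C - C)"
    unfolding cl by (rule image_set_diff[OF inj, symmetric])
  have hom: "homeomorphism (closure C) (?\<gamma> ` closure C) ?\<gamma> fst"
    unfolding homeomorphism_def by (auto intro!: continuous_intros c\<gamma> simp: image_image)
  have bc: "boundary_connected (?\<gamma> ` C)"
    unfolding boundary_connected_def cl
  proof (intro ballI allI impI)
    fix z U assume "z \<in> ?\<gamma> ` closure C" and U: "open U" "z \<in> U"
    then obtain x0 where x0: "z = ?\<gamma> x0" "x0 \<in> closure C" by auto
    obtain A B where AB: "open A" "open B" "z \<in> A \<times> B" "A \<times> B \<subseteq> U"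
      using open_prod_elim[OF U] by metis
    obtain A' where A': "open A'" "A' \<inter> closure C = g -` B \<inter> closure C"
      using g AB(2) unfolding continuous_on_open_invariant by metis
    have x0A: "x0 \<in> A \<inter> A'" using AB x0 A' by auto
    obtain V where V: "open V" "x0 \<in> V" "V \<subseteq> A \<inter> A'" "connected (V \<inter> C)"
      using boundary_connectedD[of C x0 "A \<inter> A'"] CC x0 x0A A' AB by (metis open_Int)
    have gB: "g x \<in> B" if "x \<in> V \<inter> C" for x
    proof -
      have "x \<in> A' \<inter> closure C" using that V closure_subset[of C] by blast
      then show ?thesis using A'(2) by blast
    qed
    have "(V \<times> B) \<inter> ?\<gamma> ` C = ?\<gamma> ` (V \<inter> C)" using gB by auto
    moreover have "connected (?\<gamma> ` (V \<inter> C))"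
      using V(4) c\<gamma> closure_subset[of C]
      by (intro connected_continuous_image continuous_on_subset[OF c\<gamma>]) auto
    ultimately have "connected ((V \<times> B) \<inter> ?\<gamma> ` C)" by simp
    moreover have "open (V \<times> B)" "z \<in> V \<times> B" "V \<times> B \<subseteq> U"
      using V AB x0 by (auto intro: open_Times)
    ultimately show "\<exists>V. open V \<and> z \<in> V \<and> V \<subseteq> U \<and> connected (V \<inter> ?\<gamma> ` C)" by blast
  qed
  have "contractible (?\<gamma> ` closure C)"
  proof -
    have "?\<gamma> ` closure C = {(x, t). x \<in> closure C \<and> g x \<le> t \<and> t \<le> g x}" by auto
    then show ?thesis using contractible_between_graphs[of "closure C" g g] CC g by simp
  qed
  moreover have "connected (?\<gamma> ` C)"
    using CC closure_subset[of C] by (intro connected_continuous_image continuous_on_subset[OF c\<gamma>]) auto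
  moreover have "closed (?\<gamma> ` (closure C - C))"
  proof -
    have "compact (closure C - C)" using CC by (metis Diff_subset compact_Int_closed inf.absorb_iff2)
    then show ?thesis
      by (intro compact_imp_closed compact_continuous_image continuous_on_subset[OF c\<gamma>]) auto
  qed
  moreover have "cofibration (?\<gamma> ` closure C) (?\<gamma> ` (closure C - C))"
    using CC by (intro cofibration_homeomorphism[OF _ hom]) auto
  ultimately show "cell (?\<gamma> ` C)"
    unfolding cell_def diff using CC bc cpt by (simp add: cl)
qed

text \<open>The closure is a quotient of \<open>closure C \<times> {-1..1}\<close> in which a
  vertical segment collapses wherever \<open>g = h\<close>. This happens only over the frontier of
  \<open>C\<close>, so \<open>cofibration_quotient\<close> transfers the cofibration of the prism to
  the band.\<close>

lemma band_cell:
  fixes C :: "'a::metric_space set" and g h :: "'a \<Rightarrow> real"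
  assumes C: "cell C" and g: "continuous_on (closure C) g" and h: "continuous_on (closure C) h"
    and less: "\<And>x. x \<in> C \<Longrightarrow> g x < h x" and le: "\<And>x. x \<in> closure C \<Longrightarrow> g x \<le> h x"
  shows "closure {(x, t). x \<in> C \<and> g x < t \<and> t < h x} = {(x, t). x \<in> closure C \<and> g x \<le> t \<and> t \<le> h x}"
      (is "closure ?B = ?E")
    and "cell {(x, t). x \<in> C \<and> g x < t \<and> t < h x}"
proof -
  note CC = C[unfolded cell_def]
  let ?P = "closure C \<times> {-1..1::real}"
  let ?F = "(closure C - C) \<times> {-1..1::real} \<union> closure C \<times> {-1, 1}"
  define \<pi> where "\<pi> = (\<lambda>z. (fst z, g (fst z) + (1 + snd z) / 2 * (h (fst z) - g (fst z))))"
  have c\<pi>: "continuous_on ?P \<pi>"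
    unfolding \<pi>_def
    by (intro continuous_intros continuous_on_compose2[OF g] continuous_on_compose2[OF h]) auto
  have P: "compact ?P" using CC by (intro compact_Times) auto
  have CcC: "C \<subseteq> closure C" by (rule closure_subset)
  have \<pi>P: "\<pi> ` ?P = ?E"
  proof (intro Set.set_eqI iffI)
    fix z assume "z \<in> \<pi> ` ?P"
    then obtain w where w: "z = \<pi> w" "w \<in> ?P" by (rule imageE)
    obtain x s where "w = (x, s)" by (cases w)
    with w have z: "z = (x, g x + (1 + s) / 2 * (h x - g x))" "x \<in> closure C" "-1 \<le> s" "s \<le> 1"
      by (simp_all add: \<pi>_def)
    have "0 \<le> (1 + s) / 2 * (h x - g x)" using z le[of x] by simp
    moreover have "(1 + s) / 2 * (h x - g x) \<le> 1 * (h x - g x)"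
      using z le[of x] by (intro mult_right_mono) auto
    ultimately show "z \<in> ?E" using z by auto
  next
    fix z assume "z \<in> ?E"
    then obtain x t where z: "z = (x, t)" "x \<in> closure C" "g x \<le> t" "t \<le> h x" by auto
    show "z \<in> \<pi> ` ?P"
    proof (cases "g x = h x")
      case True
      then show ?thesis using z by (intro image_eqI[of _ _ "(x, 0)"]) (auto simp: \<pi>_def)
    next
      case False
      define d where "d = h x - g x"
      have d: "d > 0" "t - g x \<le> d" "0 \<le> t - g x" using False z by (auto simp: d_def)
      define r where "r = (t - g x) / d"
      have r: "0 \<le> r" "r \<le> 1" "t = g x + r * d" using d by (simp_all add: r_def)
      have "\<pi> (x, 2 * r - 1) = z" using r(3) z(1) by (simp add: \<pi>_def d_def[symmetric])
      moreover have "(x, 2 * r - 1) \<in> ?P" using r z(2) by simp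
      ultimately show ?thesis by blast
    qed
  qed
  have \<pi>B: "\<pi> (x, s) \<in> ?B \<longleftrightarrow> x \<in> C \<and> -1 < s \<and> s < 1" if "x \<in> closure C" "s \<in> {-1..1}" for x s
  proof (cases "x \<in> C")
    case True
    then have d: "0 < h x - g x" using less by simp
    define q where "q = (1 + s) / 2 * (h x - g x)"
    have "\<pi> (x, s) = (x, g x + q)" unfolding \<pi>_def q_def fst_conv snd_conv ..
    then have "\<pi> (x, s) \<in> ?B \<longleftrightarrow> 0 < q \<and> q < h x - g x" using True by auto
    also have "\<dots> \<longleftrightarrow> 0 * (h x - g x) < (1 + s) / 2 * (h x - g x) \<and>
        (1 + s) / 2 * (h x - g x) < 1 * (h x - g x)"
      unfolding q_def by (simp only: mult_zero_left mult_1_left)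
    also have "\<dots> \<longleftrightarrow> -1 < s \<and> s < 1"
      unfolding mult_less_cancel_right_pos[OF d] by auto
    finally show ?thesis using True by simp
  qed (auto simp: \<pi>_def)
  have \<pi>F: "\<pi> ` ?F = ?E - ?B"
  proof (intro Set.set_eqI iffI)
    fix z assume "z \<in> \<pi> ` ?F"
    then obtain x s where z: "z = \<pi> (x, s)" "(x, s) \<in> ?F" by auto
    then have xs: "x \<in> closure C" "s \<in> {-1..1}" "\<not> (x \<in> C \<and> -1 < s \<and> s < 1)" by auto
    then have "(x, s) \<in> ?P" by simp
    then have "z \<in> ?E" unfolding \<pi>P[symmetric] z(1) by (rule imageI)
    moreover have "z \<notin> ?B" unfolding z(1) \<pi>B[OF xs(1,2)] by (rule xs(3))
    ultimately show "z \<in> ?E - ?B" by (rule DiffI)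
  next
    fix z assume z: "z \<in> ?E - ?B"
    then have "z \<in> \<pi> ` ?P" unfolding \<pi>P by blast
    then obtain x s where xs: "z = \<pi> (x, s)" "x \<in> closure C" "s \<in> {-1..1}" by auto
    have "\<pi> (x, s) \<notin> ?B" using z xs(1) by auto
    then have "\<not> (x \<in> C \<and> -1 < s \<and> s < 1)" unfolding \<pi>B[OF xs(2,3)] .
    then have "(x, s) \<in> ?F" using xs by auto
    then show "z \<in> \<pi> ` ?F" using xs by blast
  qed
  have cE: "compact ?E" using compact_continuous_image[OF c\<pi> P] \<pi>P by simp
  show cl: "closure ?B = ?E"
  proof
    show "closure ?B \<subseteq> ?E"
      using cE CcC by (intro closure_minimal compact_imp_closed) auto
    show "?E \<subseteq> closure ?B"
    proof
      fix z assume "z \<in> ?E"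
      then obtain x s where xs: "z = \<pi> (x, s)" "(x, s) \<in> ?P" unfolding \<pi>P[symmetric] by auto
      have "\<pi> ` closure (C \<times> {-1<..<1::real}) \<subseteq> closure ?B"
      proof (rule image_closure_subset)
        show "continuous_on (closure (C \<times> {-1<..<1::real})) \<pi>" using c\<pi> by (simp add: closure_Times)
        show "\<pi> ` (C \<times> {-1<..<1}) \<subseteq> closure ?B"
        proof (rule image_subsetI)
          fix z assume "z \<in> C \<times> {-1<..<1::real}"
          then obtain x s where "z = (x, s)" "x \<in> C" "-1 < s" "s < 1" by auto
          then have z: "z = (x, s)" "x \<in> closure C" "s \<in> {-1..1}" "x \<in> C \<and> -1 < s \<and> s < 1" using CcC by auto
          have "\<pi> z \<in> ?B" unfolding z(1) \<pi>B[OF z(2,3)] by (rule z(4))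
          then show "\<pi> z \<in> closure ?B" by (rule closure_subset[THEN subsetD])
        qed
      qed simp
      then show "z \<in> closure ?B" using xs by (auto simp: closure_Times)
    qed
  qed
  have inj: "x = y \<or> (x \<in> ?F \<and> y \<in> ?F)" if xy: "x \<in> ?P" "y \<in> ?P" "\<pi> x = \<pi> y" for x y
  proof -
    obtain a s where x: "x = (a, s)" "a \<in> closure C" "s \<in> {-1..1}" using xy by auto
    obtain s' where y: "y = (a, s')" "s' \<in> {-1..1}" using xy x by (cases y) (auto simp: \<pi>_def)
    have eq: "(1 + s) / 2 * (h a - g a) = (1 + s') / 2 * (h a - g a)" using xy(3) x y by (simp add: \<pi>_def)
    show ?thesis
    proof (cases "a \<in> C")
      case True
      then have "h a - g a \<noteq> 0" using less[of a] by simp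
      then show ?thesis using eq x y by simp
    qed (use x y in auto)
  qed
  have cof: "cofibration (\<pi> ` ?P) (\<pi> ` ?F)"
    by (rule cofibration_quotient[OF cofibration_times_interval P c\<pi> inj]) (use CC in auto)
  have closedF: "closed (?E - ?B)"
  proof -
    have "compact (closure C - C)" using CC by (metis Diff_subset compact_Int_closed inf.absorb_iff2)
    then have "compact ?F" using CC by (intro compact_Un compact_Times) auto
    then have "compact (\<pi> ` ?F)" by (rule compact_continuous_image[rotated]) (rule continuous_on_subset[OF c\<pi>], auto)
    then show ?thesis unfolding \<pi>F by (rule compact_imp_closed)
  qed
  have gC: "continuous_on C g" "continuous_on C h" using g h CcC continuous_on_subset by blast+
  have bc: "boundary_connected ?B"
    unfolding boundary_connected_def cl
  proof (intro ballI allI impI)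
    fix z U assume "z \<in> ?E" and U: "open U" "z \<in> U"
    then obtain x0 t0 where z: "z = (x0, t0)" "x0 \<in> closure C" "g x0 \<le> t0" "t0 \<le> h x0" by auto
    obtain A B where AB: "open A" "open B" "z \<in> A \<times> B" "A \<times> B \<subseteq> U"
      using open_prod_elim[OF U] by metis
    obtain e where e: "e > 0" "\<And>t. \<bar>t - t0\<bar> < e \<Longrightarrow> t \<in> B"
      using AB(2,3) z unfolding open_dist by (auto simp: dist_real_def)
    \<comment> \<open>The limit point may lie where the band is pinched. Near it \<open>g\<close>
      stays below \<open>t0 + e\<close> and \<open>h\<close> above \<open>t0 - e\<close>, so the
      band cut off at these two heights still lies between strictly ordered graphs over
      \<open>V \<inter> C\<close>, and is connected.\<close>
    obtain A1 where A1: "open A1" "A1 \<inter> closure C = g -` {..<t0 + e} \<inter> closure C"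
      using g unfolding continuous_on_open_invariant by (metis open_lessThan)
    obtain A2 where A2: "open A2" "A2 \<inter> closure C = h -` {t0 - e<..} \<inter> closure C"
      using h unfolding continuous_on_open_invariant by (metis open_greaterThan)
    have "x0 \<in> g -` {..<t0 + e} \<inter> closure C" "x0 \<in> h -` {t0 - e<..} \<inter> closure C" using z e by auto
    then have x0A: "x0 \<in> A \<inter> A1 \<inter> A2" using A1 A2 AB(3) z by blast
    obtain V where V: "open V" "x0 \<in> V" "V \<subseteq> A \<inter> A1 \<inter> A2" "connected (V \<inter> C)"
      using boundary_connectedD[of C x0 "A \<inter> A1 \<inter> A2"] CC z(2) x0A A1 A2 AB by (metis open_Int)
    have gV: "g x < t0 + e" "h x > t0 - e" if "x \<in> V \<inter> C" for x
    proof -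
      have "x \<in> A1 \<inter> closure C" "x \<in> A2 \<inter> closure C" using that V CcC by blast+
      then show "g x < t0 + e" "h x > t0 - e" using A1(2) A2(2) by auto
    qed
    let ?V = "V \<times> {t0 - e<..<t0 + e}"
    have "?V \<inter> ?B = {(x, t). x \<in> V \<inter> C \<and> max (g x) (t0 - e) < t \<and> t < min (h x) (t0 + e)}" by auto
    moreover have "connected {(x, t). x \<in> V \<inter> C \<and> max (g x) (t0 - e) < t \<and> t < min (h x) (t0 + e)}"
    proof (rule connected_between_graphs[OF V(4)])
      show "continuous_on (V \<inter> C) (\<lambda>x. max (g x) (t0 - e))" "continuous_on (V \<inter> C) (\<lambda>x. min (h x) (t0 + e))"
        by (auto intro!: continuous_intros continuous_on_subset[OF gC(1)] continuous_on_subset[OF gC(2)])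
      show "max (g x) (t0 - e) < min (h x) (t0 + e)" if "x \<in> V \<inter> C" for x
        using gV[OF that] less[of x] that e by auto
    qed
    ultimately have "connected (?V \<inter> ?B)" by simp
    moreover have "open ?V" "z \<in> ?V" using V z e by (auto intro: open_Times)
    moreover have "?V \<subseteq> U"
    proof -
      have "{t0 - e<..<t0 + e} \<subseteq> B" using e(2) by (auto simp: abs_less_iff)
      then show ?thesis using V(3) AB(4) by blast
    qed
    ultimately show "\<exists>V. open V \<and> z \<in> V \<and> V \<subseteq> U \<and> connected (V \<inter> ?B)" by blast
  qed
  obtain x where "x \<in> C" using CC by auto
  then have "(x, (g x + h x) / 2) \<in> ?B" using less[of x] by (auto simp: field_simps)
  then have "?B \<noteq> {}" by blast
  moreover have "connected ?B" using connected_between_graphs[OF _ gC less] CC by simp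
  moreover have "contractible ?E"
    using CC by (intro contractible_between_graphs g h le) auto
  ultimately show "cell ?B"
    unfolding cell_def cl using bc cE closedF cof unfolding \<pi>P \<pi>F by simp
qed

section \<open>Root branches and the cylinder that they cut up\<close>

section \<open>Cylinders over a cell complex\<close>

lemma separated_finite:
  fixes A :: "'a::metric_space set"
  assumes "finite A" "e > 0"
  obtains d where "0 < d" "d \<le> e" "\<And>s t. s \<in> A \<Longrightarrow> t \<in> A \<Longrightarrow> s \<noteq> t \<Longrightarrow> 2 * d \<le> dist s t"
proof -
  have "\<exists>d>0. d \<le> e \<and> (\<forall>s\<in>A. \<forall>t\<in>A. s \<noteq> t \<longrightarrow> 2 * d \<le> dist s t)"
  proof -
    let ?D = "insert e ((\<lambda>(s, t). dist s t / 2) ` {(s, t). s \<in> A \<and> t \<in> A \<and> s \<noteq> t})"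
    have fin: "finite ?D"
      using finite_subset[of "{(s, t). s \<in> A \<and> t \<in> A \<and> s \<noteq> t}" "A \<times> A"] assms(1) by auto
    have "Min ?D > 0" using fin assms(2) by (subst Min_gr_iff) auto
    moreover have "Min ?D \<le> e" using fin by (intro Min_le) auto
    moreover have "2 * Min ?D \<le> dist s t" if "s \<in> A" "t \<in> A" "s \<noteq> t" for s t
    proof -
      have "Min ?D \<le> dist s t / 2" using that fin by (intro Min_le) auto
      then show ?thesis by simp
    qed
    ultimately show ?thesis by blast
  qed
  then show ?thesis using that by blast
qed

text \<open>Near a point of the closure the values of \<open>f\<close> cluster at finitely many
  numbers. A neighbourhood that meets \<open>C\<close> in a connected set cannot carry two clusters,
  so \<open>f\<close> has a limit at the point.\<close>

lemma extend_to_closure_finite_limits: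
  fixes f :: "'a::metric_space \<Rightarrow> real"
  assumes bc: "boundary_connected C" and f: "continuous_on C f"
    and fin: "\<And>x. x \<in> closure C \<Longrightarrow> finite (A x)"
    and near: "\<And>x0 e. x0 \<in> closure C \<Longrightarrow> e > 0 \<Longrightarrow>
      \<exists>d>0. \<forall>x\<in>C. dist x x0 < d \<longrightarrow> (\<exists>s\<in>A x0. \<bar>f x - s\<bar> < e)"
  obtains g where "continuous_on (closure C) g" "\<And>x. x \<in> C \<Longrightarrow> g x = f x" "\<And>x. x \<in> closure C \<Longrightarrow> g x \<in> A x"
proof -
  have lim: "\<exists>a\<in>A x0. \<forall>e>0. \<exists>d>0. \<forall>x\<in>C. dist x x0 < d \<longrightarrow> \<bar>f x - a\<bar> < e" if x0: "x0 \<in> closure C" for x0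
  proof -
    obtain e0 where e0: "0 < e0" "e0 \<le> 1" "\<And>s t. s \<in> A x0 \<Longrightarrow> t \<in> A x0 \<Longrightarrow> s \<noteq> t \<Longrightarrow> 2 * e0 \<le> \<bar>s - t\<bar>"
      using separated_finite[OF fin[OF x0] zero_less_one] unfolding dist_real_def by metis
    obtain d0 where d0: "d0 > 0" "\<And>x. x \<in> C \<Longrightarrow> dist x x0 < d0 \<Longrightarrow> \<exists>s\<in>A x0. \<bar>f x - s\<bar> < e0"
      using near[OF x0 e0(1)] by auto
    obtain V where V: "open V" "x0 \<in> V" "V \<subseteq> ball x0 d0" "connected (V \<inter> C)"
      using boundary_connectedD[OF bc x0, of "ball x0 d0"] d0(1) by auto
    have Vd: "dist x x0 < d0" if "x \<in> V" for x using that V(3) by (auto simp: dist_commute)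
    obtain x1 where x1: "x1 \<in> V \<inter> C" using x0 V by (meson open_Int_closure_eq_empty disjoint_iff IntI)
    obtain a where a: "a \<in> A x0" "\<bar>f x1 - a\<bar> < e0" using d0(2)[of x1] x1 Vd by auto
    have conn: "connected (f ` (V \<inter> C))"
      using V(4) f by (intro connected_continuous_image continuous_on_subset[OF f]) auto
    \<comment> \<open>A value at distance exactly \<open>e0\<close> from \<open>a\<close> would be
      within \<open>e0\<close> of another candidate, contrary to the separation by
      \<open>2 * e0\<close>. Hence the connected image cannot leave the interval around
      \<open>a\<close>.\<close>
    have off: "\<bar>y - a\<bar> \<noteq> e0" if yV: "y \<in> f ` (V \<inter> C)" for y
    proof
      assume y: "\<bar>y - a\<bar> = e0"
      obtain x where "x \<in> V \<inter> C" "y = f x" using yV by (rule imageE) auto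
      then obtain s where s: "s \<in> A x0" "\<bar>y - s\<bar> < e0" using d0(2)[of x] Vd by auto
      then have "s \<noteq> a" using y by auto
      then have "2 * e0 \<le> \<bar>s - a\<bar>" using e0(3) s a by blast
      then show False using y s by linarith
    qed
    have allnear: "\<bar>f x - a\<bar> < e0" if x: "x \<in> V \<inter> C" for x
    proof (rule ccontr)
      assume "\<not> \<bar>f x - a\<bar> < e0"
      then consider "f x \<ge> a + e0" | "f x \<le> a - e0" by linarith
      then show False
      proof cases
        case 1
        then have "a + e0 \<in> f ` (V \<inter> C)"
          using connectedD_interval[OF conn, of "f x1" "f x" "a + e0"] x x1 a by force
        then show False using off[of "a + e0"] e0 by simp
      next
        case 2
        then have "a - e0 \<in> f ` (V \<inter> C)"
          using connectedD_interval[OF conn, of "f x" "f x1" "a - e0"] x x1 a by force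
        then show False using off[of "a - e0"] e0 by simp
      qed
    qed
    obtain r where r: "r > 0" "ball x0 r \<subseteq> V" using V(1,2) open_contains_ball by blast
    have "\<exists>d>0. \<forall>x\<in>C. dist x x0 < d \<longrightarrow> \<bar>f x - a\<bar> < e" if e: "e > 0" for e
    proof -
      obtain d where d: "d > 0" "\<And>x. x \<in> C \<Longrightarrow> dist x x0 < d \<Longrightarrow> \<exists>s\<in>A x0. \<bar>f x - s\<bar> < min e e0"
        using near[OF x0, of "min e e0"] e e0(1) by auto
      show ?thesis
      proof (intro exI[of _ "min d r"] conjI ballI impI)
        fix x assume x: "x \<in> C" "dist x x0 < min d r"
        then have "x \<in> V" using r(2) by (auto simp: dist_commute)
        then have 1: "\<bar>f x - a\<bar> < e0" using allnear x by blast
        obtain s where s: "s \<in> A x0" "\<bar>f x - s\<bar> < min e e0" using d(2)[OF x(1)] x(2) by auto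
        have "s = a"
        proof (rule ccontr)
          assume "s \<noteq> a"
          then have "2 * e0 \<le> \<bar>s - a\<bar>" using e0(3) s a by blast
          then show False using 1 s by linarith
        qed
        then show "\<bar>f x - a\<bar> < e" using s by simp
      qed (use d r in auto)
    qed
    then show ?thesis using a(1) by blast
  qed
  obtain g where g: "\<And>x. x \<in> closure C \<Longrightarrow> g x \<in> A x"
    "\<And>x0 e. x0 \<in> closure C \<Longrightarrow> e > 0 \<Longrightarrow> \<exists>d>0. \<forall>x\<in>C. dist x x0 < d \<longrightarrow> \<bar>f x - g x0\<bar> < e"
    using lim by metis
  show ?thesis
  proof (rule that[of g])
    show "g x = f x" if x: "x \<in> C" for x
    proof (rule ccontr)
      assume "g x \<noteq> f x"
      then obtain d where "d > 0" "\<forall>y\<in>C. dist y x < d \<longrightarrow> \<bar>f y - g x\<bar> < \<bar>f x - g x\<bar>"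
        using g(2)[of x "\<bar>f x - g x\<bar>"] x closure_subset by auto
      then show False using x by force
    qed
    show "continuous_on (closure C) g"
      unfolding continuous_on_iff
    proof (intro ballI allI impI)
      fix x0 and e :: real assume x0: "x0 \<in> closure C" and e: "e > 0"
      obtain d where d: "d > 0" "\<And>x. x \<in> C \<Longrightarrow> dist x x0 < d \<Longrightarrow> \<bar>f x - g x0\<bar> < e / 2"
        using g(2)[OF x0, of "e / 2"] e by auto
      show "\<exists>d>0. \<forall>y\<in>closure C. dist y x0 < d \<longrightarrow> dist (g y) (g x0) < e"
      proof (intro exI[of _ "d / 2"] conjI ballI impI)
        fix y assume y: "y \<in> closure C" "dist y x0 < d / 2"
        obtain d' where d': "d' > 0" "\<And>x. x \<in> C \<Longrightarrow> dist x y < d' \<Longrightarrow> \<bar>f x - g y\<bar> < e / 2"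
          using g(2)[OF y(1), of "e / 2"] e by auto
        obtain x where x: "x \<in> C" "dist x y < min d' (d / 2)"
          using y(1) d' d unfolding closure_approachable by (metis half_gt_zero min_less_iff_conj)
        have "dist x x0 < d" using x y dist_triangle[of x x0 y] by auto
        then show "dist (g y) (g x0) < e"
        proof -
          have "\<bar>f x - g x0\<bar> < e / 2" "\<bar>f x - g y\<bar> < e / 2"
            using d(2)[OF x(1) \<open>dist x x0 < d\<close>] d'(2)[OF x(1)] x(2) by auto
          then show ?thesis unfolding dist_real_def by linarith
        qed
      qed (use d in auto)
    qed
  qed (use g in auto)
qed

text \<open>The sets where \<open>f\<close> agrees with the several branches are finitely many,
  closed, disjoint and cover \<open>B\<close>; so each is also open, and connectedness leaves only
  one.\<close>

lemma equal_branch: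
  fixes f :: "'a::topological_space \<Rightarrow> real" and k :: nat
  assumes B: "connected B" "x1 \<in> B" and f: "continuous_on B f" and \<xi>: "\<And>i. i < k \<Longrightarrow> continuous_on B (\<lambda>x. \<xi> x i)"
    and inj: "\<And>x i j. x \<in> B \<Longrightarrow> i < k \<Longrightarrow> j < k \<Longrightarrow> \<xi> x i = \<xi> x j \<Longrightarrow> i = j"
    and mem: "\<And>x. x \<in> B \<Longrightarrow> \<exists>i<k. f x = \<xi> x i"
  obtains i where "i < k" "\<And>x. x \<in> B \<Longrightarrow> f x = \<xi> x i"
proof -
  obtain i where i: "i < k" "f x1 = \<xi> x1 i" using mem B by auto
  have cl: "closedin (top_of_set B) {x \<in> B. f x = \<xi> x j}" if "j < k" for j
  proof -
    have "closedin (top_of_set B) (B \<inter> (\<lambda>x. f x - \<xi> x j) -` {0})"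
      by (intro continuous_closedin_preimage continuous_intros f \<xi> that)
    moreover have "B \<inter> (\<lambda>x. f x - \<xi> x j) -` {0} = {x \<in> B. f x = \<xi> x j}" by auto
    ultimately show ?thesis by simp
  qed
  have "closedin (top_of_set B) (\<Union>j\<in>{..<k} - {i}. {x \<in> B. f x = \<xi> x j})"
    by (intro closedin_Union) (auto intro: cl)
  moreover have "(\<Union>j\<in>{..<k} - {i}. {x \<in> B. f x = \<xi> x j}) = B - {x \<in> B. f x = \<xi> x i}"
  proof (intro Set.set_eqI iffI)
    fix x assume "x \<in> B - {x \<in> B. f x = \<xi> x i}"
    then show "x \<in> (\<Union>j\<in>{..<k} - {i}. {x \<in> B. f x = \<xi> x j})" using mem[of x] by auto
  next
    fix x assume "x \<in> (\<Union>j\<in>{..<k} - {i}. {x \<in> B. f x = \<xi> x j})"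
    then obtain j where "j < k" "j \<noteq> i" "x \<in> B" "f x = \<xi> x j" by auto
    then show "x \<in> B - {x \<in> B. f x = \<xi> x i}" using inj[of x j i] i(1) by auto
  qed
  ultimately have "openin (top_of_set B) {x \<in> B. f x = \<xi> x i}"
    by (simp add: openin_closedin_eq double_diff subset_iff)
  then have "{x \<in> B. f x = \<xi> x i} = B"
    using B(1) cl[OF i(1)] B(2) i(2) unfolding connected_clopen by blast
  then show ?thesis using that[OF i(1)] by blast
qed

text \<open>Delineability in metric terms. Near any point of the union no root appears far from the
  roots at that point, though roots may collide there; within one cell the roots also persist, and
  their number is constant.\<close>

definition root_family :: "'a::metric_space set set \<Rightarrow> ('a \<Rightarrow> real set) \<Rightarrow> bool" where
  "root_family \<C> r \<longleftrightarrow>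
     (\<forall>x\<in>\<Union>\<C>. finite (r x)) \<and>
     (\<forall>x0\<in>\<Union>\<C>. \<forall>e>0. \<exists>d>0. \<forall>x\<in>\<Union>\<C>. dist x x0 < d \<longrightarrow> (\<forall>t\<in>r x. \<exists>s\<in>r x0. \<bar>t - s\<bar> < e)) \<and>
     (\<forall>C\<in>\<C>. \<forall>x0\<in>C. \<forall>e>0. \<exists>d>0. \<forall>x\<in>C. dist x x0 < d \<longrightarrow> (\<forall>s\<in>r x0. \<exists>t\<in>r x. \<bar>t - s\<bar> < e)) \<and>
     (\<forall>C\<in>\<C>. \<forall>x\<in>C. \<forall>y\<in>C. card (r x) = card (r y))"

lemma root_familyD:
  assumes "root_family \<C> r"
  shows "x \<in> \<Union>\<C> \<Longrightarrow> finite (r x)"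
    "x0 \<in> \<Union>\<C> \<Longrightarrow> e > 0 \<Longrightarrow> \<exists>d>0. \<forall>x\<in>\<Union>\<C>. dist x x0 < d \<longrightarrow> (\<forall>t\<in>r x. \<exists>s\<in>r x0. \<bar>t - s\<bar> < e)"
    "C \<in> \<C> \<Longrightarrow> x0 \<in> C \<Longrightarrow> e > 0 \<Longrightarrow> \<exists>d>0. \<forall>x\<in>C. dist x x0 < d \<longrightarrow> (\<forall>s\<in>r x0. \<exists>t\<in>r x. \<bar>t - s\<bar> < e)"
    "C \<in> \<C> \<Longrightarrow> x \<in> C \<Longrightarrow> y \<in> C \<Longrightarrow> card (r x) = card (r y)"
proof -
  note a = assms[unfolded root_family_def]
  show "x \<in> \<Union>\<C> \<Longrightarrow> finite (r x)" by (rule a[THEN conjunct1, rule_format])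
  show "x0 \<in> \<Union>\<C> \<Longrightarrow> e > 0 \<Longrightarrow> \<exists>d>0. \<forall>x\<in>\<Union>\<C>. dist x x0 < d \<longrightarrow> (\<forall>t\<in>r x. \<exists>s\<in>r x0. \<bar>t - s\<bar> < e)"
    by (rule a[THEN conjunct2, THEN conjunct1, rule_format])
  show "C \<in> \<C> \<Longrightarrow> x0 \<in> C \<Longrightarrow> e > 0 \<Longrightarrow> \<exists>d>0. \<forall>x\<in>C. dist x x0 < d \<longrightarrow> (\<forall>s\<in>r x0. \<exists>t\<in>r x. \<bar>t - s\<bar> < e)"
    by (rule a[THEN conjunct2, THEN conjunct2, THEN conjunct1, rule_format])
  show "C \<in> \<C> \<Longrightarrow> x \<in> C \<Longrightarrow> y \<in> C \<Longrightarrow> card (r x) = card (r y)"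
    by (rule a[THEN conjunct2, THEN conjunct2, THEN conjunct2, rule_format])
qed

definition root_at :: "('a \<Rightarrow> real set) \<Rightarrow> 'a \<Rightarrow> nat \<Rightarrow> real" where
  "root_at r x j = sorted_list_of_set (r x) ! j"

lemma root_at:
  assumes "finite (r x)"
  shows "j < card (r x) \<Longrightarrow> root_at r x j \<in> r x"
    "i < j \<Longrightarrow> j < card (r x) \<Longrightarrow> root_at r x i < root_at r x j"
    "t \<in> r x \<Longrightarrow> \<exists>j<card (r x). t = root_at r x j"
proof -
  note s = set_sorted_list_of_set[OF assms] length_sorted_list_of_set[of "r x"]
  show "j < card (r x) \<Longrightarrow> root_at r x j \<in> r x" unfolding root_at_def using s nth_mem by metis
  show "i < j \<Longrightarrow> j < card (r x) \<Longrightarrow> root_at r x i < root_at r x j"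
    unfolding root_at_def using s strict_sorted_list_of_set[of "r x"] by (simp add: sorted_wrt_iff_nth_less)
  show "t \<in> r x \<Longrightarrow> \<exists>j<card (r x). t = root_at r x j"
    unfolding root_at_def using s by (metis in_set_conv_nth)
qed

lemma root_at_inj:
  assumes "finite (r x)" "i < card (r x)" "j < card (r x)" "root_at r x i = root_at r x j"
  shows "i = j"
  using root_at(2)[of r x, OF assms(1), of i j] root_at(2)[of r x, OF assms(1), of j i] assms by (metis less_irrefl nat_neq_iff)

text \<open>Every root at \<open>x0\<close> has a root nearby at \<open>x\<close>. Equal numbers of
  roots make this a bijection and separation makes it increasing, so the roots match in
  order.\<close>

lemma root_at_near:
  assumes fam: "root_family \<C> r" and C: "C \<in> \<C>" "x0 \<in> C" and e: "e > 0"
  obtains d where "d > 0" "\<And>x j. x \<in> C \<Longrightarrow> dist x x0 < d \<Longrightarrow> j < card (r x0) \<Longrightarrow> \<bar>root_at r x j - root_at r x0 j\<bar> < e"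
proof -
  note F = root_familyD[OF fam]
  have finx: "finite (r x)" if "x \<in> C" for x using F(1) that C by blast
  obtain e' where e': "0 < e'" "e' \<le> e" "\<And>s t. s \<in> r x0 \<Longrightarrow> t \<in> r x0 \<Longrightarrow> s \<noteq> t \<Longrightarrow> 2 * e' \<le> \<bar>s - t\<bar>"
    using separated_finite[OF finx[OF C(2)] e] unfolding dist_real_def by metis
  obtain d where d: "d > 0" "\<And>x. x \<in> C \<Longrightarrow> dist x x0 < d \<Longrightarrow> (\<forall>s\<in>r x0. \<exists>t\<in>r x. \<bar>t - s\<bar> < e')"
    using F(3)[OF C e'(1)] by auto
  show ?thesis
  proof (rule that[OF d(1)])
    fix x j assume x: "x \<in> C" "dist x x0 < d" and j: "j < card (r x0)"
    obtain b where b: "\<And>s. s \<in> r x0 \<Longrightarrow> b s \<in> r x \<and> \<bar>b s - s\<bar> < e'" using d(2)[OF x] by metis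
    have mono: "b s < b t" if "s \<in> r x0" "t \<in> r x0" "s < t" for s t
      using b[OF that(1)] b[OF that(2)] e'(3)[of s t] that by force
    then have inj: "inj_on b (r x0)" by (metis inj_onI less_irrefl linorder_neqE)
    have "card (b ` r x0) = card (r x)" using inj F(4)[OF C(1,2) x(1)] by (simp add: card_image)
    then have im: "b ` r x0 = r x" using b finx[OF x(1)] by (intro card_subset_eq) auto
    let ?l = "map b (sorted_list_of_set (r x0))"
    have "sorted_wrt (<) ?l"
      unfolding sorted_wrt_iff_nth_less using finx[OF C(2)] mono root_at(1,2)[of r x0]
      by (simp add: root_at_def)
    moreover have "set ?l = r x" using im finx[OF C(2)] by simp
    ultimately have "sorted_list_of_set (r x) = ?l"
      by (metis strict_sorted_iff sorted_list_of_set.idem_if_sorted_distinct)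
    then have "root_at r x j = b (root_at r x0 j)" using j by (simp add: root_at_def)
    then show "\<bar>root_at r x j - root_at r x0 j\<bar> < e"
      using b root_at(1)[of r x0, OF finx[OF C(2)] j] e'(2) by force
  qed
qed

lemma root_at_continuous:
  assumes fam: "root_family \<C> r" and C: "C \<in> \<C>" "x1 \<in> C" "j < card (r x1)"
  shows "continuous_on C (\<lambda>x. root_at r x j)"
  unfolding continuous_on_iff
proof (intro ballI allI impI)
  fix x0 and e :: real assume x0: "x0 \<in> C" "e > 0"
  have j: "j < card (r x0)" using root_familyD(4)[OF fam C(1) x0(1) C(2)] C(3) by simp
  obtain d where "d > 0" "\<And>x j. x \<in> C \<Longrightarrow> dist x x0 < d \<Longrightarrow> j < card (r x0) \<Longrightarrow> \<bar>root_at r x j - root_at r x0 j\<bar> < e"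
    using root_at_near[OF fam C(1) x0] by blast
  then show "\<exists>d>0. \<forall>x\<in>C. dist x x0 < d \<longrightarrow> dist (root_at r x j) (root_at r x0 j) < e"
    using j by (auto simp: dist_real_def)
qed

lemma root_at_extend:
  assumes fam: "root_family \<C> r" and C: "C \<in> \<C>" "x1 \<in> C" "j < card (r x1)"
    and bc: "boundary_connected C" and sub: "closure C \<subseteq> \<Union>\<C>"
  obtains g where "continuous_on (closure C) g" "\<And>x. x \<in> C \<Longrightarrow> g x = root_at r x j"
    "\<And>x. x \<in> closure C \<Longrightarrow> g x \<in> r x"
proof (rule extend_to_closure_finite_limits[OF bc root_at_continuous[OF fam C], of r])
  note F = root_familyD[OF fam]
  show "finite (r x)" if "x \<in> closure C" for x using F(1) sub that by blast
  fix x0 and e :: real assume x0: "x0 \<in> closure C" "e > 0"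
  obtain d where d: "d > 0" "\<And>x. x \<in> \<Union>\<C> \<Longrightarrow> dist x x0 < d \<Longrightarrow> (\<forall>t\<in>r x. \<exists>s\<in>r x0. \<bar>t - s\<bar> < e)"
    using F(2)[of x0 e] x0 sub by blast
  have "\<exists>s\<in>r x0. \<bar>root_at r x j - s\<bar> < e" if x: "x \<in> C" "dist x x0 < d" for x
  proof -
    have xU: "x \<in> \<Union>\<C>" using x C by blast
    have "j < card (r x)" using F(4)[OF C(1) x(1) C(2)] C(3) by simp
    then have "root_at r x j \<in> r x" using root_at(1)[of r x, OF F(1)[OF xU]] by blast
    then show ?thesis using d(2)[OF xU x(2)] by blast
  qed
  then show "\<exists>d>0. \<forall>x\<in>C. dist x x0 < d \<longrightarrow> (\<exists>s\<in>r x0. \<bar>root_at r x j - s\<bar> < e)" using d(1) by blast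
qed (rule that)

text \<open>To be applied to the roots of one factor among the roots of a product: along a branch of
  the product, being a root of the factor is locally constant, since a root of either family that is
  close enough to a branch lies on it.\<close>

lemma subfamily_constant:
  assumes fam: "root_family \<C> r" and fam': "root_family \<C> r'" and sub: "\<And>x. x \<in> \<Union>\<C> \<Longrightarrow> r' x \<subseteq> r x"
    and C: "C \<in> \<C>" "connected C" "x1 \<in> C" "x2 \<in> C" "j < card (r x1)"
  shows "root_at r x1 j \<in> r' x1 \<longleftrightarrow> root_at r x2 j \<in> r' x2"
proof (rule connected_local_const[OF C(2-4), where f = "\<lambda>x. root_at r x j \<in> r' x"], rule ballI)
  fix x0 assume x0: "x0 \<in> C"
  note F = root_familyD[OF fam] and F' = root_familyD[OF fam']
  have CU: "x \<in> \<Union>\<C>" if "x \<in> C" for x using that C(1) by blast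
  have j: "j < card (r x)" if "x \<in> C" for x using F(4)[OF C(1) that C(3)] C(5) by simp
  let ?s = "root_at r x0 j"
  obtain e0 where e0: "0 < e0" "\<And>s t. s \<in> insert ?s (r x0) \<Longrightarrow> t \<in> r x0 \<Longrightarrow> s \<noteq> t \<Longrightarrow> 2 * e0 \<le> \<bar>s - t\<bar>"
    using separated_finite[of "insert ?s (r x0)" 1] F(1)[OF CU[OF x0]]
    unfolding dist_real_def by (metis finite_insert insertCI zero_less_one)
  obtain d1 where d1: "d1 > 0" "\<And>x j. x \<in> C \<Longrightarrow> dist x x0 < d1 \<Longrightarrow> j < card (r x0) \<Longrightarrow> \<bar>root_at r x j - root_at r x0 j\<bar> < e0"
    using root_at_near[OF fam C(1) x0 e0(1)] by blast
  obtain d2 where d2: "d2 > 0" "\<And>x. x \<in> \<Union>\<C> \<Longrightarrow> dist x x0 < d2 \<Longrightarrow> (\<forall>t\<in>r' x. \<exists>s\<in>r' x0. \<bar>t - s\<bar> < e0)"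
    using F'(2)[OF CU[OF x0] e0(1)] by blast
  obtain d3 where d3: "d3 > 0" "\<And>x. x \<in> C \<Longrightarrow> dist x x0 < d3 \<Longrightarrow> (\<forall>s\<in>r' x0. \<exists>t\<in>r' x. \<bar>t - s\<bar> < e0)"
    using F'(3)[OF C(1) x0 e0(1)] by blast
  have "(?s \<in> r' x0) = (root_at r x j \<in> r' x)" if x: "x \<in> C" "dist x x0 < min d1 (min d2 d3)" for x
  proof
    assume "?s \<in> r' x0"
    then obtain t where t: "t \<in> r' x" "\<bar>t - ?s\<bar> < e0" using d3(2)[OF x(1)] x(2) by auto
    then obtain i where i: "i < card (r x)" "t = root_at r x i"
      using sub[OF CU[OF x(1)]] root_at(3)[of r x, OF F(1)[OF CU[OF x(1)]]] by blast
    have ci: "i < card (r x0)" using i F(4)[OF C(1) x0 x(1)] by simp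
    then have "\<bar>t - root_at r x0 i\<bar> < e0" using d1(2)[OF x(1)] x(2) i by auto
    then have "\<bar>?s - root_at r x0 i\<bar> < 2 * e0" using t by linarith
    then have "?s = root_at r x0 i"
      using e0(2)[of ?s "root_at r x0 i"] root_at(1)[of r x0, OF F(1)[OF CU[OF x0]] ci] by force
    then have "i = j" using root_at_inj[of r x0 i j, OF F(1)[OF CU[OF x0]]] j[OF x0] ci by simp
    then show "root_at r x j \<in> r' x" using t i by simp
  next
    assume "root_at r x j \<in> r' x"
    then obtain s where s: "s \<in> r' x0" "\<bar>root_at r x j - s\<bar> < e0" using d2(2)[OF CU[OF x(1)]] x(2) by auto
    have "\<bar>root_at r x j - ?s\<bar> < e0" using d1(2)[OF x(1)] x(2) j[OF x0] by auto
    then have "\<bar>?s - s\<bar> < 2 * e0" using s by linarith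
    then have "?s = s" using e0(2)[of ?s s] s sub[OF CU[OF x0]] by force
    then show "?s \<in> r' x0" using s by simp
  qed
  then show "\<forall>\<^sub>F b in at x0 within C. (?s \<in> r' x0) = (root_at r b j \<in> r' b)"
    unfolding eventually_at using d1(1) d2(1) d3(1) by (intro exI[of _ "min d1 (min d2 d3)"]) auto
qed

lemma le_on_closure:
  fixes g h :: "'a::topological_space \<Rightarrow> real"
  assumes "continuous_on (closure C) g" "continuous_on (closure C) h" "\<And>x. x \<in> C \<Longrightarrow> g x \<le> h x" "x \<in> closure C"
  shows "g x \<le> h x"
proof -
  have "closedin (top_of_set (closure C)) (closure C \<inter> (\<lambda>x. g x - h x) -` {..0})"
    by (intro continuous_closedin_preimage continuous_intros assms)
  then have "closed (closure C \<inter> (\<lambda>x. g x - h x) -` {..0})" using closedin_closed_trans closed_closure by blast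
  moreover have "C \<subseteq> closure C \<inter> (\<lambda>x. g x - h x) -` {..0}" using assms(3) closure_subset[of C] by auto
  ultimately have "closure C \<subseteq> closure C \<inter> (\<lambda>x. g x - h x) -` {..0}" by (rule closure_minimal[rotated])
  then show ?thesis using assms(4) by auto
qed

text \<open>The cells are the graphs of the branches over each base cell and the bands between
  consecutive branches. The roots \<open>-R\<close> and \<open>R\<close> form the floor and the lid.
  The frontier condition holds because an extended branch coincides, over each cell in the closure,
  with a single branch of that cell.\<close>

theorem cylinder_complex:
  fixes \<C> :: "'a::metric_space set set"
  assumes complex: "cell_complex \<C>" and fam: "root_family \<C> r"
    and ends: "\<And>x. x \<in> \<Union>\<C> \<Longrightarrow> -R \<in> r x \<and> R \<in> r x \<and> r x \<subseteq> {-R..R}"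
  obtains \<D> where "cell_complex \<D>" "\<Union>\<D> = \<Union>\<C> \<times> {-R..R}"
    "\<And>r' D. root_family \<C> r' \<Longrightarrow> (\<And>x. x \<in> \<Union>\<C> \<Longrightarrow> r' x \<subseteq> r x) \<Longrightarrow> D \<in> \<D> \<Longrightarrow>
       (\<forall>z\<in>D. snd z \<in> r' (fst z)) \<or> (\<forall>z\<in>D. snd z \<notin> r' (fst z))"
proof -
  note cc = cells[OF complex]
  note F = root_familyD[OF fam]
  have CU: "x \<in> \<Union>\<C>" if "C \<in> \<C>" "x \<in> C" for x C using that by blast
  have fin: "finite (r x)" if "C \<in> \<C>" "x \<in> C" for x C using F(1) CU that by blast
  define k where "k = (\<lambda>C. card (r (SOME x. x \<in> C)))"
  have k: "card (r x) = k C" if "C \<in> \<C>" "x \<in> C" for x C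
    unfolding k_def using F(4)[OF that(1,2), of "SOME x. x \<in> C"] someI[of "\<lambda>x. x \<in> C"] that by blast
  have "\<exists>g. continuous_on (closure C) g \<and> (\<forall>x\<in>C. g x = root_at r x j) \<and> (\<forall>x\<in>closure C. g x \<in> r x)"
    if C: "C \<in> \<C>" "j < k C" for C j
  proof -
    have cell: "cell C" using cc(2) C by blast
    obtain x1 where x1: "x1 \<in> C" using cell by (auto simp: cell_def)
    have "boundary_connected C" using cell by (simp add: cell_def)
    from root_at_extend[OF fam C(1) x1 _ this cc(4)[OF C(1)], of j] obtain g where
      "continuous_on (closure C) g" "\<And>x. x \<in> C \<Longrightarrow> g x = root_at r x j" "\<And>x. x \<in> closure C \<Longrightarrow> g x \<in> r x"
      using C(2) k[OF C(1) x1] by metis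
    then show ?thesis by blast
  qed
  then obtain G where G: "\<And>C j. C \<in> \<C> \<Longrightarrow> j < k C \<Longrightarrow> continuous_on (closure C) (G C j) \<and>
      (\<forall>x\<in>C. G C j x = root_at r x j) \<and> (\<forall>x\<in>closure C. G C j x \<in> r x)"
    by metis
  have Gc: "continuous_on (closure C) (G C j)" if "C \<in> \<C>" "j < k C" for C j using G[OF that] by blast
  have GC: "G C j x = root_at r x j" if "C \<in> \<C>" "j < k C" "x \<in> C" for C j x using G[OF that(1,2)] that(3) by blast
  have Gr: "G C j x \<in> r x" if "C \<in> \<C>" "j < k C" "x \<in> closure C" for C j x using G[OF that(1,2)] that(3) by blast
  have Gless: "G C i x < G C j x" if "C \<in> \<C>" "i < j" "j < k C" "x \<in> C" for C i j x
    using root_at(2)[of r x i j] fin[OF that(1,4)] k[OF that(1,4)] GC that by auto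
  have Gless_iff: "G C i x < G C j x \<longleftrightarrow> i < j" "G C i x \<le> G C j x \<longleftrightarrow> i \<le> j"
    if "C \<in> \<C>" "i < k C" "j < k C" "x \<in> C" for C i j x
    using Gless[OF that(1), of i j x] Gless[OF that(1), of j i x] that by (metis less_irrefl linorder_neqE_nat not_less order_le_less order_less_asym)+
  have Gle: "G C i x \<le> G C j x" if "C \<in> \<C>" "i \<le> j" "j < k C" "x \<in> closure C" for C i j x
    by (rule le_on_closure[OF Gc Gc _ that(4)]) (use that Gless_iff in auto)
  define gr where "gr = (\<lambda>C j. (\<lambda>x. (x, G C j x)) ` C)"
  define bd where "bd = (\<lambda>C j. {(x, t). x \<in> C \<and> G C j x < t \<and> t < G C (Suc j) x})"
  define E where "E = (\<lambda>C i j. {(x, t). x \<in> closure C \<and> G C i x \<le> t \<and> t \<le> G C j x})"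
  define \<D> where "\<D> = (\<Union>C\<in>\<C>. gr C ` {..<k C} \<union> bd C ` {j. Suc j < k C})"
  have Dcases: "(\<exists>C\<in>\<C>. \<exists>j<k C. D = gr C j) \<or> (\<exists>C\<in>\<C>. \<exists>j. Suc j < k C \<and> D = bd C j)" if "D \<in> \<D>" for D
    using that by (auto simp: \<D>_def)
  have grD: "gr C j \<in> \<D>" if "C \<in> \<C>" "j < k C" for C j using that by (auto simp: \<D>_def)
  have bdD: "bd C j \<in> \<D>" if "C \<in> \<C>" "Suc j < k C" for C j using that by (auto simp: \<D>_def)
  have gr_cell: "cell (gr C j)" "closure (gr C j) = E C j j" if "C \<in> \<C>" "j < k C" for C j
  proof -
    note g = graph_cell[OF cc(2)[OF that(1)] Gc[OF that]]
    show "cell (gr C j)" unfolding gr_def by (rule g(2))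
    show "closure (gr C j) = E C j j" unfolding gr_def g(1) E_def by auto
  qed
  have bd_cell: "cell (bd C j)" "closure (bd C j) = E C j (Suc j)" if "C \<in> \<C>" "Suc j < k C" for C j
  proof -
    have j: "j < k C" using that by simp
    note b = band_cell[OF cc(2)[OF that(1)] Gc[OF that(1) j] Gc[OF that]
      Gless[OF that(1) lessI that(2)] Gle[OF that(1) _ that(2)]]
    show "cell (bd C j)" unfolding bd_def by (rule b(2)) auto
    show "closure (bd C j) = E C j (Suc j)" unfolding bd_def E_def by (rule b(1)) auto
  qed
  have locate: "\<exists>D\<in>\<D>. (x, t) \<in> D" if x: "x \<in> \<Union>\<C>" and t: "t \<in> {-R..R}" for x t
  proof -
    obtain C where C: "C \<in> \<C>" "x \<in> C" using x by blast
    note fx = fin[OF C] and kx = k[OF C]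
    \<comment> \<open>The largest root not above \<open>t\<close> decides which graph or band
      contains the point; it exists because \<open>-R\<close> is a root.\<close>
    let ?A = "{s \<in> r x. s \<le> t}"
    have A: "finite ?A" "?A \<noteq> {}" using fx ends[OF x] t by auto
    then have M: "Max ?A \<in> r x" "Max ?A \<le> t" using Max_in[OF A] by auto
    obtain j where j: "j < k C" "Max ?A = root_at r x j" using root_at(3)[of r x, OF fx M(1)] kx by auto
    show ?thesis
    proof (cases "t = Max ?A")
      case True
      then have "(x, t) \<in> gr C j" using GC[OF C(1) j(1) C(2)] j C by (auto simp: gr_def)
      then show ?thesis using grD[OF C(1) j(1)] by blast
    next
      case False
      then have lt: "root_at r x j < t" using M j by simp
      obtain j' where j': "j' < k C" "R = root_at r x j'" using root_at(3)[of r x R, OF fx] ends[OF x] kx by auto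
      have "t \<noteq> R"
      proof
        assume "t = R"
        then have "t \<in> ?A" using ends[OF x] by auto
        then have "t \<le> Max ?A" using A by simp
        then show False using False M by simp
      qed
      then have "t < R" using t by simp
      then have "G C j x < G C j' x" using lt j' GC[OF C(1) _ C(2)] j by auto
      then have Sj: "Suc j < k C" using Gless_iff(1)[OF C(1) j(1) j'(1) C(2)] j' by simp
      have "t < root_at r x (Suc j)"
      proof (rule ccontr)
        assume "\<not> t < root_at r x (Suc j)"
        then have "root_at r x (Suc j) \<in> ?A" using root_at(1)[of r x, OF fx] Sj kx by auto
        then have "root_at r x (Suc j) \<le> root_at r x j" using A j(2) by (metis Max_ge)
        then show False using root_at(2)[of r x, OF fx, of j "Suc j"] Sj kx by simp
      qed
      then have "(x, t) \<in> bd C j" using lt GC[OF C(1) j(1) C(2)] GC[OF C(1) Sj C(2)] C by (simp add: bd_def)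
      then show ?thesis using bdD[OF C(1) Sj] by blast
    qed
  qed
  \<comment> \<open>The extension of a branch to the closure takes values among the roots and is
    continuous, so over the connected cell \<open>C'\<close> it follows one branch.\<close>
  have branch: "\<exists>i<k C'. \<forall>x\<in>C'. G C j x = G C' i x"
    if C: "C \<in> \<C>" "C' \<in> \<C>" "C' \<subseteq> closure C" "j < k C" for C C' j
  proof -
    have cC': "connected C'" "C' \<noteq> {}" using cc(2)[OF C(2)] by (auto simp: cell_def)
    then obtain x1 where x1: "x1 \<in> C'" by blast
    obtain i where "i < k C'" "\<And>x. x \<in> C' \<Longrightarrow> G C j x = root_at r x i"
    proof (rule equal_branch[OF cC'(1) x1, of "G C j" "k C'" "root_at r"])
      show "continuous_on C' (G C j)" using Gc[OF C(1,4)] C(3) continuous_on_subset by blast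
      show "continuous_on C' (\<lambda>x. root_at r x i)" if "i < k C'" for i
        using root_at_continuous[OF fam C(2) x1, of i] that k[OF C(2) x1] by simp
      show "i = j" if "x \<in> C'" "i < k C'" "j < k C'" "root_at r x i = root_at r x j" for x i j
        using root_at_inj[of r x i j] that fin[OF C(2)] k[OF C(2)] by simp
      show "\<exists>i<k C'. G C j x = root_at r x i" if "x \<in> C'" for x
        using root_at(3)[of r x, OF fin[OF C(2) that] Gr[OF C(1,4)]] that C(3) k[OF C(2) that] by auto
    qed blast
    then show ?thesis using GC[OF C(2)] by auto
  qed
  \<comment> \<open>Over \<open>C'\<close> the order of the branches is the order of their indices.
    The position of a cell relative to the two bounding branches can therefore be read off at one
    common point, and it then holds over all of \<open>C'\<close>.\<close>
  have frontier: "D' \<subseteq> E C j j'" if C: "C \<in> \<C>" "j < k C" "j' < k C" and D': "D' \<in> \<D>" "D' \<inter> E C j j' \<noteq> {}" for C j j' D'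
  proof -
    obtain x0 t0 where z: "(x0, t0) \<in> D'" "x0 \<in> closure C" "G C j x0 \<le> t0" "t0 \<le> G C j' x0"
      using D'(2) by (auto simp: E_def)
    have sub: "C' \<subseteq> closure C" if "C' \<in> \<C>" "x0 \<in> C'" for C' using cc(3)[OF C(1) that(1)] that z(2) by blast
    from Dcases[OF D'(1)] show ?thesis
    proof (elim disjE bexE exE conjE)
      fix C' m assume m: "C' \<in> \<C>" "m < k C'" "D' = gr C' m"
      then have x0: "x0 \<in> C'" "t0 = G C' m x0" using z(1) by (auto simp: gr_def)
      note s = sub[OF m(1) x0(1)]
      obtain i where i: "i < k C'" "\<forall>x\<in>C'. G C j x = G C' i x" using branch[OF C(1) m(1) s C(2)] by blast
      obtain i' where i': "i' < k C'" "\<forall>x\<in>C'. G C j' x = G C' i' x" using branch[OF C(1) m(1) s C(3)] by blast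
      have "i \<le> m" "m \<le> i'"
        using z x0 i i' Gless_iff(2)[OF m(1) i(1) m(2) x0(1)] Gless_iff(2)[OF m(1,2) i'(1) x0(1)] by auto
      then show ?thesis using Gless_iff(2)[OF m(1) i(1) m(2)] Gless_iff(2)[OF m(1,2) i'(1)] i i' s
        by (auto simp: m(3) gr_def E_def)
    next
      fix C' m assume m: "C' \<in> \<C>" "Suc m < k C'" "D' = bd C' m"
      then have x0: "x0 \<in> C'" "G C' m x0 < t0" "t0 < G C' (Suc m) x0" using z(1) by (auto simp: bd_def)
      have m': "m < k C'" using m by simp
      note s = sub[OF m(1) x0(1)]
      obtain i where i: "i < k C'" "\<forall>x\<in>C'. G C j x = G C' i x" using branch[OF C(1) m(1) s C(2)] by blast
      obtain i' where i': "i' < k C'" "\<forall>x\<in>C'. G C j' x = G C' i' x" using branch[OF C(1) m(1) s C(3)] by blast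
      have "G C' i x0 < G C' (Suc m) x0" "G C' m x0 < G C' i' x0" using z x0 i i' by auto
      then have "i \<le> m" "Suc m \<le> i'"
        using Gless_iff(1)[OF m(1) i(1) m(2) x0(1)] Gless_iff(1)[OF m(1) m' i'(1) x0(1)] by auto
      then have "\<And>x. x \<in> C' \<Longrightarrow> G C' i x \<le> G C' m x" "\<And>x. x \<in> C' \<Longrightarrow> G C' (Suc m) x \<le> G C' i' x"
        using Gless_iff(2)[OF m(1) i(1) m'] Gless_iff(2)[OF m(1,2) i'(1)] by auto
      then show ?thesis using i i' s by (force simp: m(3) bd_def E_def)
    qed
  qed
  have Esub: "E C j j' \<subseteq> \<Union>\<C> \<times> {-R..R}" if C: "C \<in> \<C>" "j < k C" "j' < k C" for C j j'
  proof
    fix z assume "z \<in> E C j j'"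
    then obtain x t where z: "z = (x, t)" "x \<in> closure C" "G C j x \<le> t" "t \<le> G C j' x" by (auto simp: E_def)
    have x: "x \<in> \<Union>\<C>" using cc(4)[OF C(1)] z by blast
    have "G C j x \<in> {-R..R}" "G C j' x \<in> {-R..R}" using Gr[OF C(1) _ z(2)] C ends[OF x] by blast+
    then show "z \<in> \<Union>\<C> \<times> {-R..R}" using z x by auto
  qed
  have clD: "\<exists>C\<in>\<C>. \<exists>j<k C. \<exists>j'<k C. closure D = E C j j'" if "D \<in> \<D>" for D
    using Dcases[OF that]
  proof (elim disjE bexE exE conjE)
    fix C j assume "C \<in> \<C>" "j < k C" "D = gr C j"
    then show ?thesis using gr_cell(2) by blast
  next
    fix C j assume *: "C \<in> \<C>" "Suc j < k C" "D = bd C j"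
    then have "closure D = E C j (Suc j)" "j < k C" using bd_cell(2) by auto
    then show ?thesis using * by blast
  qed
  have DU: "\<Union>\<D> = \<Union>\<C> \<times> {-R..R}"
  proof
    show "\<Union>\<D> \<subseteq> \<Union>\<C> \<times> {-R..R}"
    proof
      fix z assume "z \<in> \<Union>\<D>"
      then obtain D where D: "D \<in> \<D>" "z \<in> D" by blast
      obtain C j j' where "C \<in> \<C>" "j < k C" "j' < k C" "closure D = E C j j'" using clD[OF D(1)] by blast
      then show "z \<in> \<Union>\<C> \<times> {-R..R}" using Esub[of C j j'] D(2) closure_subset[of D] by blast
    qed
    show "\<Union>\<C> \<times> {-R..R} \<subseteq> \<Union>\<D>"
    proof
      fix z assume "z \<in> \<Union>\<C> \<times> {-R..R}"
      then obtain x t where "z = (x, t)" "x \<in> \<Union>\<C>" "t \<in> {-R..R}" by (rule SigmaE)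
      then show "z \<in> \<Union>\<D>" using locate[of x t] by blast
    qed
  qed
  have complexD: "cell_complex \<D>"
    unfolding cell_complex_def
  proof (intro conjI ballI impI)
    have "finite {j. Suc j < k C}" for C by (rule finite_subset[of _ "{..<k C}"]) auto
    then show "finite \<D>" unfolding \<D>_def using cc(1) by auto
    show "cell D" if "D \<in> \<D>" for D using Dcases[OF that] gr_cell(1) bd_cell(1) by blast
    show "pairwise disjnt \<D>"
      unfolding pairwise_def disjnt_def
    proof (intro ballI impI, rule ccontr)
      fix D D' assume D: "D \<in> \<D>" "D' \<in> \<D>" "D \<noteq> D'" "D \<inter> D' \<noteq> {}"
      obtain x t where z: "(x, t) \<in> D" "(x, t) \<in> D'" using D(4) by auto
      have same: "C = C'" if "C \<in> \<C>" "C' \<in> \<C>" "x \<in> C" "x \<in> C'" for C C' using cc(5) that by blast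
      have rep: "\<exists>C\<in>\<C>. x \<in> C \<and> ((\<exists>j<k C. D = gr C j \<and> t = G C j x) \<or>
          (\<exists>j. Suc j < k C \<and> D = bd C j \<and> G C j x < t \<and> t < G C (Suc j) x))" if "D \<in> \<D>" "(x, t) \<in> D" for D
        using Dcases[OF that(1)]
      proof (elim disjE bexE exE conjE)
        fix C j assume "C \<in> \<C>" "j < k C" "D = gr C j"
        then show ?thesis using that(2) unfolding gr_def by auto
      next
        fix C j assume "C \<in> \<C>" "Suc j < k C" "D = bd C j"
        then show ?thesis using that(2) unfolding bd_def by auto
      qed
      obtain C where C: "C \<in> \<C>" "x \<in> C" and c1: "(\<exists>j<k C. D = gr C j \<and> t = G C j x) \<or>
          (\<exists>j. Suc j < k C \<and> D = bd C j \<and> G C j x < t \<and> t < G C (Suc j) x)" using rep[OF D(1) z(1)] by blast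
      have c2: "(\<exists>j<k C. D' = gr C j \<and> t = G C j x) \<or>
          (\<exists>j. Suc j < k C \<and> D' = bd C j \<and> G C j x < t \<and> t < G C (Suc j) x)"
        using rep[OF D(2) z(2)] same C by blast
      note iff = Gless_iff[OF C(1) _ _ C(2)]
      show False using c1
      proof (elim disjE exE conjE)
        fix j assume j: "j < k C" "D = gr C j" "t = G C j x"
        show False using c2
        proof (elim disjE exE conjE)
          fix i assume i: "i < k C" "D' = gr C i" "t = G C i x"
          then have "i = j" using j iff(2)[of i j] iff(2)[of j i] by simp
          then show False using i j D by simp
        next
          fix i assume i: "Suc i < k C" "G C i x < t" "t < G C (Suc i) x"
          then show False using j iff(1)[of i j] iff(1)[of j "Suc i"] by simp
        qed
      next
        fix j assume j: "Suc j < k C" "D = bd C j" "G C j x < t" "t < G C (Suc j) x"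
        show False using c2
        proof (elim disjE exE conjE)
          fix i assume i: "i < k C" "t = G C i x"
          then show False using j iff(1)[of j i] iff(1)[of i "Suc j"] by simp
        next
          fix i assume i: "Suc i < k C" "D' = bd C i" "G C i x < t" "t < G C (Suc i) x"
          then have "G C i x < G C (Suc j) x" "G C j x < G C (Suc i) x" using j by auto
          then have "i = j" using i j iff(1)[of i "Suc j"] iff(1)[of j "Suc i"] by simp
          then show False using i j D by simp
        qed
      qed
    qed
    show "D' \<subseteq> closure D" if "D \<in> \<D>" "D' \<in> \<D>" "D' \<inter> closure D \<noteq> {}" for D D'
      using clD[OF that(1)] frontier that(2,3) by metis
    show "closure D \<subseteq> \<Union>\<D>" if "D \<in> \<D>" for D
      using clD[OF that] Esub unfolding DU by metis
  qed
  show ?thesis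
  proof (rule that[OF complexD DU])
    fix r' D assume r': "root_family \<C> r'" "\<And>x. x \<in> \<Union>\<C> \<Longrightarrow> r' x \<subseteq> r x" and "D \<in> \<D>"
    from Dcases[OF this(3)] show "(\<forall>z\<in>D. snd z \<in> r' (fst z)) \<or> (\<forall>z\<in>D. snd z \<notin> r' (fst z))"
    proof (elim disjE bexE exE conjE)
      fix C j assume C: "C \<in> \<C>" "j < k C" "D = gr C j"
      have conn: "connected C" using cc(2)[OF C(1)] by (simp add: cell_def)
      have eq: "(G C j x \<in> r' x) = (G C j y \<in> r' y)" if "x \<in> C" "y \<in> C" for x y
      proof -
        have j: "j < card (r x)" using k[OF C(1) that(1)] C(2) by metis
        show ?thesis
          unfolding GC[OF C(1,2) that(1)] GC[OF C(1,2) that(2)]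
          by (rule subfamily_constant[OF fam r'(1) r'(2) C(1) conn that j])
      qed
      have "(\<forall>x\<in>C. G C j x \<in> r' x) \<or> (\<forall>x\<in>C. G C j x \<notin> r' x)" using eq by metis
      then show ?thesis unfolding C(3) gr_def by (simp add: ball_simps)
    next
      fix C j assume C: "C \<in> \<C>" "Suc j < k C" "D = bd C j"
      \<comment> \<open>A root strictly between consecutive branches would need an index strictly
        between \<open>j\<close> and \<open>Suc j\<close>.\<close>
      have "t \<notin> r' x" if t: "x \<in> C" "G C j x < t" "t < G C (Suc j) x" for x t
      proof
        assume "t \<in> r' x"
        then have "t \<in> r x" by (rule r'(2)[OF CU[OF C(1) t(1)], THEN subsetD])
        then obtain i where i: "i < k C" "t = root_at r x i"
          using root_at(3)[of r x t, OF fin[OF C(1) t(1)]] unfolding k[OF C(1) t(1)] by blast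
        then have "i < k C" "t = G C i x" using GC[OF C(1) i(1) t(1)] by simp_all
        then show False using t C(2) Gless_iff(1)[OF C(1) _ _ t(1), of j i] Gless_iff(1)[OF C(1) _ _ t(1), of i "Suc j"] by simp
      qed
      then show ?thesis unfolding C(3) bd_def by auto
    qed
  qed
qed

section \<open>Continuity of roots and constancy of their number\<close>

section \<open>Roots of polynomials with varying coefficients\<close>

text \<open>Distinct roots are counted over the complex numbers because that count depends only on
  which polynomials in the coefficients vanish. The real count may depend on signs, but it is
  constant on a connected set where the complex count is.\<close>

definition complex_roots :: "real poly \<Rightarrow> complex set" where
  "complex_roots q = {z. poly (map_poly complex_of_real q) z = 0}"

definition real_roots :: "real poly \<Rightarrow> real set" where
  "real_roots q = {t. poly q t = 0}"

lemma poly_of_real_poly: "poly (map_poly complex_of_real q) (complex_of_real t) = complex_of_real (poly q t)"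
  by (induction q) (auto simp: map_poly_pCons)

lemma poly_of_real_sum:
  "poly (map_poly complex_of_real q) z = (\<Sum>i\<le>degree q. complex_of_real (poly.coeff q i) * z ^ i)"
  by (simp add: poly_altdef coeff_map_poly degree_map_poly)

lemma complex_roots_cnj: "z \<in> complex_roots q \<Longrightarrow> cnj z \<in> complex_roots q"
proof -
  assume "z \<in> complex_roots q"
  then have "cnj (poly (map_poly complex_of_real q) z) = 0" by (simp add: complex_roots_def)
  then show ?thesis by (simp add: complex_roots_def poly_of_real_sum)
qed

lemma complex_roots_real: "complex_of_real t \<in> complex_roots q \<longleftrightarrow> t \<in> real_roots q"
  by (simp add: complex_roots_def real_roots_def poly_of_real_poly)

lemma finite_complex_roots: "q \<noteq> 0 \<Longrightarrow> finite (complex_roots q)"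
  unfolding complex_roots_def by (rule poly_roots_finite) (simp add: map_poly_eq_0_iff)

lemma finite_real_roots: "q \<noteq> 0 \<Longrightarrow> finite (real_roots q)"
  unfolding real_roots_def by (rule poly_roots_finite)

text \<open>The absolute value at \<open>z\<close> is that of the leading coefficient times the
  product of the distances from \<open>z\<close> to the roots. If all distances were at least
  \<open>e\<close>, the value could not be so small.\<close>

lemma root_near:
  fixes q :: "real poly"
  assumes d: "degree q > 0" and e: "e > 0"
    and small: "norm (poly (map_poly complex_of_real q) z) < \<bar>lead_coeff q\<bar> * e ^ degree q"
  obtains w where "w \<in> complex_roots q" "dist z w < e"
proof -
  let ?q = "map_poly complex_of_real q"
  have deg: "degree ?q = degree q" by (simp add: degree_map_poly)
  have lc: "lead_coeff ?q = complex_of_real (lead_coeff q)" by (simp add: coeff_map_poly deg)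
  obtain root where root: "Polynomial.smult (lead_coeff ?q) (\<Prod>i<degree ?q. [:- root i, 1:]) = ?q"
    by (rule complex_poly_decompose')
  have val: "poly ?q z = lead_coeff ?q * (\<Prod>i<degree q. z - root i)" for z
    using arg_cong[OF root, of "\<lambda>p. poly p z"] by (simp add: poly_prod deg)
  have "\<exists>i<degree q. dist z (root i) < e"
  proof (rule ccontr)
    assume "\<not> (\<exists>i<degree q. dist z (root i) < e)"
    then have ge: "e \<le> norm (z - root i)" if "i < degree q" for i 
    proof -
      have "\<not> dist z (root i) < e" using \<open>\<not> (\<exists>i<degree q. dist z (root i) < e)\<close> that by blast
      then show ?thesis by (simp add: dist_norm)
    qed
    have "e ^ degree q = (\<Prod>i<degree q. e)" by simp
    also have "\<dots> \<le> (\<Prod>i<degree q. norm (z - root i))" using e ge by (intro prod_mono) auto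
    finally have "\<bar>lead_coeff q\<bar> * e ^ degree q \<le> norm (poly ?q z)"
      unfolding val lc by (simp add: norm_mult prod_norm mult_left_mono)
    then show False using small by simp
  qed
  then obtain i where i: "i < degree q" "dist z (root i) < e" by blast
  have "poly ?q (root i) = 0" unfolding val using i(1) by (auto simp: prod_zero_iff)
  then show ?thesis using that[of "root i"] i(2) by (simp add: complex_roots_def)
qed

text \<open>A bound of Cauchy type: beyond radius 1 the leading term has to be balanced by
  \<open>d\<close> terms of size at most \<open>A * norm z ^ (d - 1)\<close>.\<close>

lemma root_bound:
  assumes d: "degree q = d" "c \<noteq> 0" "lead_coeff q = c" and b: "\<And>i. i < d \<Longrightarrow> \<bar>poly.coeff q i\<bar> \<le> A"
    and z: "z \<in> complex_roots q"
  shows "norm z \<le> max 1 (real d * A / \<bar>c\<bar>)"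
proof (cases "norm z \<le> 1 \<or> d = 0")
  case True
  have "d \<noteq> 0"
  proof
    assume "d = 0"
    then obtain a where "q = [:a:]" using d(1) degree_eq_zeroE by metis
    then show False using z d by (simp add: complex_roots_def map_poly_pCons)
  qed
  then show ?thesis using True by simp
next
  case False
  then have n: "norm z > 1" "d > 0" by auto
  have "(\<Sum>i<d. complex_of_real (poly.coeff q i) * z ^ i) + complex_of_real c * z ^ d = 0"
    using z d by (simp add: complex_roots_def poly_of_real_sum lessThan_Suc_atMost[symmetric])
  then have "norm (complex_of_real c * z ^ d) = norm (\<Sum>i<d. complex_of_real (poly.coeff q i) * z ^ i)"
    by (metis add.commute add_eq_0_iff norm_minus_cancel)
  also have "\<dots> \<le> (\<Sum>i<d. norm (complex_of_real (poly.coeff q i) * z ^ i))" by (rule norm_sum)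
  also have "\<dots> \<le> (\<Sum>i<d. A * norm z ^ (d - 1))"
  proof (rule sum_mono)
    fix i assume i: "i \<in> {..<d}"
    have "\<bar>poly.coeff q i\<bar> * norm z ^ i \<le> A * norm z ^ (d - 1)"
      using b[of i] i n by (intro mult_mono power_increasing) auto
    then show "norm (complex_of_real (poly.coeff q i) * z ^ i) \<le> A * norm z ^ (d - 1)"
      by (simp add: norm_mult norm_power)
  qed
  also have "\<dots> = real d * A * norm z ^ (d - 1)" by simp
  finally have le: "norm (complex_of_real c * z ^ d) \<le> real d * A * norm z ^ (d - 1)" .
  have "norm (complex_of_real c * z ^ d) = \<bar>c\<bar> * norm z * norm z ^ (d - 1)"
    using n(2) by (cases d) (simp_all add: norm_mult norm_power)
  then have "\<bar>c\<bar> * norm z * norm z ^ (d - 1) \<le> real d * A * norm z ^ (d - 1)" using le by simp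
  moreover have "norm z ^ (d - 1) > 0" using n by (intro zero_less_power) linarith
  ultimately have "\<bar>c\<bar> * norm z \<le> real d * A" by simp
  then have "norm z \<le> real d * A / \<bar>c\<bar>" using d(2) by (simp add: field_simps)
  then show ?thesis by simp
qed

text \<open>Monic up to a constant factor: degree and leading coefficient do not vary, which keeps
  the roots bounded over compact sets.\<close>

definition monic_family :: "'a::metric_space set \<Rightarrow> ('a \<Rightarrow> real poly) \<Rightarrow> bool" where
  "monic_family M p \<longleftrightarrow> (\<exists>d c. c \<noteq> 0 \<and> (\<forall>x\<in>M. degree (p x) = d \<and> lead_coeff (p x) = c)) \<and>
     (\<forall>i. continuous_on M (\<lambda>x. poly.coeff (p x) i))"

lemma monic_familyE:
  assumes "monic_family M p"
  obtains d c where "c \<noteq> 0" "\<And>x. x \<in> M \<Longrightarrow> degree (p x) = d" "\<And>x. x \<in> M \<Longrightarrow> lead_coeff (p x) = c"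
    "\<And>i. continuous_on M (\<lambda>x. poly.coeff (p x) i)"
  using assms unfolding monic_family_def by blast

lemma monic_family_roots_bounded:
  assumes p: "monic_family M p" and M: "compact M"
  obtains B where "B > 0" "\<And>x z. x \<in> M \<Longrightarrow> z \<in> complex_roots (p x) \<Longrightarrow> norm z \<le> B"
proof -
  obtain d c where dc: "c \<noteq> 0" "\<And>x. x \<in> M \<Longrightarrow> degree (p x) = d" "\<And>x. x \<in> M \<Longrightarrow> lead_coeff (p x) = c"
    "\<And>i. continuous_on M (\<lambda>x. poly.coeff (p x) i)"
    by (rule monic_familyE[OF p]) (rule that)
  have "\<exists>a. \<forall>x\<in>M. \<bar>poly.coeff (p x) i\<bar> \<le> a" for i
  proof -
    have "bounded ((\<lambda>x. poly.coeff (p x) i) ` M)"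
      using compact_imp_bounded[OF compact_continuous_image[OF dc(4) M]] .
    then obtain a where "\<forall>y\<in>(\<lambda>x. poly.coeff (p x) i) ` M. norm y \<le> a" unfolding bounded_iff ..
    then have "\<forall>x\<in>M. \<bar>poly.coeff (p x) i\<bar> \<le> a" by simp
    then show ?thesis ..
  qed
  then have "\<forall>i. \<exists>a. \<forall>x\<in>M. \<bar>poly.coeff (p x) i\<bar> \<le> a" ..
  from choice[OF this] obtain a where "\<forall>i. \<forall>x\<in>M. \<bar>poly.coeff (p x) i\<bar> \<le> a i" ..
  then have a: "\<bar>poly.coeff (p x) i\<bar> \<le> a i" if "x \<in> M" for x i using that by simp
  define A where "A = (\<Sum>i<d. \<bar>a i\<bar>)"
  have A: "\<bar>poly.coeff (p x) i\<bar> \<le> A" if "x \<in> M" "i < d" for x i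
  proof -
    have "\<bar>a i\<bar> \<le> A" unfolding A_def using that(2) by (intro member_le_sum) auto
    then show ?thesis using a[of x i] that(1) by linarith
  qed
  show ?thesis
  proof (rule that[of "max 1 (real d * A / \<bar>c\<bar>)"])
    show "norm z \<le> max 1 (real d * A / \<bar>c\<bar>)" if "x \<in> M" "z \<in> complex_roots (p x)" for x z
      using root_bound[OF dc(2) dc(1) dc(3) A] that by blast
  qed simp
qed

lemma monic_family_value_near:
  assumes p: "monic_family M p" and x0: "x0 \<in> M" and e: "e > 0" and B: "B > 0"
  obtains \<delta> where "\<delta> > 0" "\<And>x z. x \<in> M \<Longrightarrow> dist x x0 < \<delta> \<Longrightarrow> norm z \<le> B \<Longrightarrow>
    norm (poly (map_poly complex_of_real (p x)) z - poly (map_poly complex_of_real (p x0)) z) < e"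
proof -
  obtain d c where dc: "c \<noteq> 0" "\<And>x. x \<in> M \<Longrightarrow> degree (p x) = d" "\<And>x. x \<in> M \<Longrightarrow> lead_coeff (p x) = c"
    "\<And>i. continuous_on M (\<lambda>x. poly.coeff (p x) i)"
    by (rule monic_familyE[OF p]) (rule that)
  define h where "h = (\<lambda>x. \<Sum>i\<le>d. \<bar>poly.coeff (p x) i - poly.coeff (p x0) i\<bar> * B ^ i)"
  have ch: "continuous_on M h" unfolding h_def by (intro continuous_intros dc)
  have "h x0 = 0" by (simp add: h_def)
  then obtain \<delta> where \<delta>: "\<delta> > 0" "\<forall>x\<in>M. dist x x0 < \<delta> \<longrightarrow> dist (h x) 0 < e"
    using ch[unfolded continuous_on_iff, rule_format, OF x0 e] by auto
  show ?thesis
  proof (rule that[OF \<delta>(1)])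
    fix x z assume x: "x \<in> M" "dist x x0 < \<delta>" and z: "norm (z::complex) \<le> B"
    have "poly (map_poly complex_of_real (p x)) z - poly (map_poly complex_of_real (p x0)) z =
        (\<Sum>i\<le>d. complex_of_real (poly.coeff (p x) i - poly.coeff (p x0) i) * z ^ i)"
      using dc(2) x x0 by (simp add: poly_of_real_sum sum_subtractf[symmetric] algebra_simps)
    also have "norm \<dots> \<le> h x"
      unfolding h_def
    proof (rule order_trans[OF norm_sum sum_mono])
      fix i show "norm (complex_of_real (poly.coeff (p x) i - poly.coeff (p x0) i) * z ^ i) \<le> \<bar>poly.coeff (p x) i - poly.coeff (p x0) i\<bar> * B ^ i"
        using z by (simp add: norm_mult norm_power mult_left_mono power_mono flip: of_real_diff)
    qed
    also have "h x < e" using \<delta>(2) x by (auto simp: dist_real_def)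
    finally show "norm (poly (map_poly complex_of_real (p x)) z - poly (map_poly complex_of_real (p x0)) z) < e" .
  qed
qed

text \<open>By continuity of roots, every root at \<open>x0\<close> has a root nearby at
  \<open>x\<close>. Where the numbers of distinct complex roots agree, this is a bijection, and for
  nearby points it respects conjugation; so real roots correspond to real roots, and none are gained
  or lost along a cell.\<close>

theorem root_family_real_roots:
  fixes \<C> :: "'a::metric_space set set"
  assumes p: "monic_family (\<Union>\<C>) p" and M: "compact (\<Union>\<C>)"
    and conn: "\<And>C. C \<in> \<C> \<Longrightarrow> connected C"
    and const: "\<And>C x y. C \<in> \<C> \<Longrightarrow> x \<in> C \<Longrightarrow> y \<in> C \<Longrightarrow> card (complex_roots (p x)) = card (complex_roots (p y))"
  shows "root_family \<C> (\<lambda>x. real_roots (p x))"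
proof -
  let ?M = "\<Union>\<C>"
  let ?P = "\<lambda>x. poly (map_poly complex_of_real (p x))"
  obtain d c where dc: "c \<noteq> 0" "\<And>x. x \<in> ?M \<Longrightarrow> degree (p x) = d" "\<And>x. x \<in> ?M \<Longrightarrow> lead_coeff (p x) = c"
    by (rule monic_familyE[OF p]) (rule that)
  have p0: "p x \<noteq> 0" if "x \<in> ?M" for x using dc(1) dc(3)[OF that] by auto
  obtain B where B: "B > 0" "\<And>x z. x \<in> ?M \<Longrightarrow> z \<in> complex_roots (p x) \<Longrightarrow> norm z \<le> B"
    using monic_family_roots_bounded[OF p M] by blast
  have roots: "?P x z = 0 \<longleftrightarrow> z \<in> complex_roots (p x)" for x z by (simp add: complex_roots_def)
  have pos: "d > 0" if xz: "x \<in> ?M" "z \<in> complex_roots (p x)" for x z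
  proof (rule ccontr)
    assume "\<not> d > 0"
    then have "degree (p x) = 0" using dc(2)[OF xz(1)] by simp
    then obtain a where "p x = [:a:]" by (rule degree_eq_zeroE)
    then show False using p0[OF xz(1)] xz(2) by (simp add: complex_roots_def map_poly_pCons)
  qed
  have near1: "\<exists>\<delta>>0. \<forall>x\<in>?M. dist x x0 < \<delta> \<longrightarrow> (\<forall>z\<in>complex_roots (p x). \<exists>w\<in>complex_roots (p x0). dist z w < e) \<and>
      (\<forall>w\<in>complex_roots (p x0). \<exists>z\<in>complex_roots (p x). dist w z < e)"
    if x0: "x0 \<in> ?M" and e: "e > 0" for x0 e
  proof -
    have "\<bar>c\<bar> * e ^ d > 0" using dc(1) e by simp
    then obtain \<delta> where \<delta>: "\<delta> > 0" "\<And>x z. x \<in> ?M \<Longrightarrow> dist x x0 < \<delta> \<Longrightarrow> norm z \<le> B \<Longrightarrow> norm (?P x z - ?P x0 z) < \<bar>c\<bar> * e ^ d"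
      using monic_family_value_near[OF p x0 _ B(1)] by metis
    show ?thesis
    proof (intro exI[of _ \<delta>] conjI ballI impI \<delta>(1))
      fix x z assume x: "x \<in> ?M" "dist x x0 < \<delta>" and z: "z \<in> complex_roots (p x)"
      have "norm (?P x0 z) < \<bar>lead_coeff (p x0)\<bar> * e ^ degree (p x0)"
        using \<delta>(2)[OF x B(2)[OF x(1) z]] z roots[of x z] dc(2,3)[OF x0] by (simp add: norm_minus_commute)
      then show "\<exists>w\<in>complex_roots (p x0). dist z w < e"
        using root_near[of "p x0" e z] e pos[OF x(1) z] dc(2)[OF x0] by metis
    next
      fix x w assume x: "x \<in> ?M" "dist x x0 < \<delta>" and w: "w \<in> complex_roots (p x0)"
      have "norm (?P x w) < \<bar>lead_coeff (p x)\<bar> * e ^ degree (p x)"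
        using \<delta>(2)[OF x B(2)[OF x0 w]] w roots[of x0 w] dc(2,3)[OF x(1)] by simp
      then show "\<exists>z\<in>complex_roots (p x). dist w z < e"
        using root_near[of "p x" e w] e pos[OF x0 w] dc(2)[OF x(1)] by metis
    qed
  qed
  have sep: "\<exists>e'. 0 < e' \<and> e' \<le> e \<and> (\<forall>v\<in>complex_roots (p x0). \<forall>w\<in>complex_roots (p x0). v \<noteq> w \<longrightarrow> 2 * e' \<le> dist v w) \<and>
      (\<forall>w\<in>complex_roots (p x0). Im w \<noteq> 0 \<longrightarrow> e' \<le> \<bar>Im w\<bar>)"
    if x0: "x0 \<in> ?M" and e: "e > 0" for x0 e
  proof -
    obtain e' where e': "0 < e'" "e' \<le> e"
      "\<And>v w. v \<in> complex_roots (p x0) \<Longrightarrow> w \<in> complex_roots (p x0) \<Longrightarrow> v \<noteq> w \<Longrightarrow> 2 * e' \<le> dist v w"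
      using separated_finite[OF finite_complex_roots[OF p0[OF x0]] e] by metis
    \<comment> \<open>A root that is not real is separated from its conjugate, which is also a root,
      so it keeps distance \<open>e'\<close> from the real axis.\<close>
    have "e' \<le> \<bar>Im w\<bar>" if w: "w \<in> complex_roots (p x0)" "Im w \<noteq> 0" for w
    proof -
      have "w \<noteq> cnj w" using w(2) by (simp add: complex_eq_iff)
      then have "2 * e' \<le> dist w (cnj w)" using e'(3) complex_roots_cnj w(1) by blast
      also have "dist w (cnj w) = 2 * \<bar>Im w\<bar>" by (simp add: dist_norm complex_diff_cnj norm_mult)
      finally show ?thesis by simp
    qed
    then show ?thesis using e' by blast
  qed
  have real_near: "Im w = 0" if "w \<in> complex_roots (p x0)" "\<forall>w\<in>complex_roots (p x0). Im w \<noteq> 0 \<longrightarrow> e' \<le> \<bar>Im w\<bar>"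
    "dist (complex_of_real t) w < e'" for w x0 e' t
  proof (rule ccontr)
    assume "Im w \<noteq> 0"
    then have "e' \<le> \<bar>Im (complex_of_real t - w)\<bar>" using that by auto
    also have "\<dots> \<le> dist (complex_of_real t) w" unfolding dist_norm by (rule abs_Im_le_cmod)
    finally show False using that(3) by simp
  qed
  have dist_Re: "\<bar>t - Re w\<bar> \<le> dist (complex_of_real t) w" for t w
    using abs_Re_le_cmod[of "complex_of_real t - w"] by (simp add: dist_norm)
  have usc: "\<exists>\<delta>>0. \<forall>x\<in>?M. dist x x0 < \<delta> \<longrightarrow> (\<forall>t\<in>real_roots (p x). \<exists>s\<in>real_roots (p x0). \<bar>t - s\<bar> < e)"
    if x0: "x0 \<in> ?M" and e: "e > 0" for x0 e
  proof -
    obtain e' where e': "0 < e'" "e' \<le> e" "\<forall>w\<in>complex_roots (p x0). Im w \<noteq> 0 \<longrightarrow> e' \<le> \<bar>Im w\<bar>"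
      using sep[OF x0 e] by blast
    obtain \<delta> where \<delta>: "\<delta> > 0" "\<And>x. x \<in> ?M \<Longrightarrow> dist x x0 < \<delta> \<Longrightarrow> (\<forall>z\<in>complex_roots (p x). \<exists>w\<in>complex_roots (p x0). dist z w < e')"
      using near1[OF x0 e'(1)] by blast
    have "\<exists>s\<in>real_roots (p x0). \<bar>t - s\<bar> < e" if x: "x \<in> ?M" "dist x x0 < \<delta>" and t: "t \<in> real_roots (p x)" for x t
    proof -
      obtain w where w: "w \<in> complex_roots (p x0)" "dist (complex_of_real t) w < e'"
        using \<delta>(2)[OF x] t complex_roots_real by blast
      have "Im w = 0" using real_near[OF w(1) e'(3) w(2)] .
      then have "w = complex_of_real (Re w)" by (simp add: complex_eq_iff)
      then have "Re w \<in> real_roots (p x0)" using w(1) complex_roots_real by metis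
      then show ?thesis using w(2) dist_Re[of t w] e'(2) by force
    qed
    then show ?thesis using \<delta>(1) by blast
  qed
  have bij: "\<exists>\<delta>>0. \<forall>x\<in>C. dist x x0 < \<delta> \<longrightarrow>
      (\<forall>s\<in>real_roots (p x0). \<exists>t\<in>real_roots (p x). \<bar>t - s\<bar> < e) \<and> card (real_roots (p x)) = card (real_roots (p x0))"
    if C: "C \<in> \<C>" and x0: "x0 \<in> C" and e: "e > 0" for C x0 e
  proof -
    have x0M: "x0 \<in> ?M" using C x0 by blast
    obtain e' where e': "0 < e'" "e' \<le> e" "\<forall>v\<in>complex_roots (p x0). \<forall>w\<in>complex_roots (p x0). v \<noteq> w \<longrightarrow> 2 * e' \<le> dist v w"
      "\<forall>w\<in>complex_roots (p x0). Im w \<noteq> 0 \<longrightarrow> e' \<le> \<bar>Im w\<bar>"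
      using sep[OF x0M e] by blast
    obtain \<delta> where \<delta>: "\<delta> > 0" "\<And>x. x \<in> ?M \<Longrightarrow> dist x x0 < \<delta> \<Longrightarrow> (\<forall>w\<in>complex_roots (p x0). \<exists>z\<in>complex_roots (p x). dist w z < e')"
      using near1[OF x0M e'(1)] by blast
    have "(\<forall>s\<in>real_roots (p x0). \<exists>t\<in>real_roots (p x). \<bar>t - s\<bar> < e) \<and> card (real_roots (p x)) = card (real_roots (p x0))"
      if x: "x \<in> C" "dist x x0 < \<delta>" for x
    proof -
      have xM: "x \<in> ?M" using C x by blast
      note fin = finite_complex_roots[OF p0[OF xM]]
      obtain b where b: "\<And>w. w \<in> complex_roots (p x0) \<Longrightarrow> b w \<in> complex_roots (p x) \<and> dist w (b w) < e'"
        using \<delta>(2)[OF xM x(2)] by metis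
      have close: "v = w" if "v \<in> complex_roots (p x0)" "w \<in> complex_roots (p x0)" "dist v z < e'" "dist w z < e'" for v w z
      proof (rule ccontr)
        assume "v \<noteq> w"
        then have "2 * e' \<le> dist v w" using e'(3) that by blast
        also have "dist v w \<le> dist v z + dist w z" by (rule dist_triangle2)
        finally show False using that by simp
      qed
      have inj: "inj_on b (complex_roots (p x0))"
        by (rule inj_onI) (use b close in metis)
      have im: "b ` complex_roots (p x0) = complex_roots (p x)"
        using inj const[OF C x(1) x0] b fin by (intro card_subset_eq) (auto simp: card_image)
      have bre: "b (complex_of_real s) = complex_of_real (Re (b (complex_of_real s)))" if s: "s \<in> real_roots (p x0)" for s
      proof -
        let ?w = "complex_of_real s"
        have w: "?w \<in> complex_roots (p x0)" using s complex_roots_real by blast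
        have "cnj (b ?w) \<in> complex_roots (p x)" using b[OF w] complex_roots_cnj by blast
        then obtain v where v: "v \<in> complex_roots (p x0)" "cnj (b ?w) = b v" using im by (metis imageE)
        \<comment> \<open>The conjugate of the matched root is as close to the real number
          \<open>s\<close> as the root itself. Since it is matched to only one root at
          \<open>x0\<close>, it is the same root, which is therefore real.\<close>
        have "dist ?w (cnj (b ?w)) = dist ?w (b ?w)"
          by (metis complex_cnj_complex_of_real complex_cnj_diff complex_mod_cnj dist_norm)
        then have "v = ?w" using close[OF v(1) w, of "b v"] b[OF v(1)] b[OF w] v(2) by metis
        then have "cnj (b ?w) = b ?w" using v by simp
        then show ?thesis by (metis Reals_cnj_iff of_real_Re)
      qed
      define \<beta> where "\<beta> = (\<lambda>s. Re (b (complex_of_real s)))"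
      have \<beta>: "\<beta> s \<in> real_roots (p x)" "\<bar>\<beta> s - s\<bar> < e" if s: "s \<in> real_roots (p x0)" for s
      proof -
        have w: "complex_of_real s \<in> complex_roots (p x0)" using s complex_roots_real by blast
        show "\<beta> s \<in> real_roots (p x)" using b[OF w] bre[OF s] complex_roots_real unfolding \<beta>_def by metis
        show "\<bar>\<beta> s - s\<bar> < e" 
          unfolding \<beta>_def using conjunct2[OF b[OF w]] dist_Re[of s "b (complex_of_real s)"] e'(2) by linarith
      qed
      have "bij_betw \<beta> (real_roots (p x0)) (real_roots (p x))"
        unfolding bij_betw_def
      proof
        show "inj_on \<beta> (real_roots (p x0))"
        proof (rule inj_onI)
          fix s s' assume s: "s \<in> real_roots (p x0)" "s' \<in> real_roots (p x0)" "\<beta> s = \<beta> s'"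
          then have "b (complex_of_real s) = b (complex_of_real s')" using bre[OF s(1)] bre[OF s(2)] by (simp add: \<beta>_def)
          then show "s = s'" using inj s complex_roots_real by (metis inj_onD of_real_eq_iff)
        qed
        show "\<beta> ` real_roots (p x0) = real_roots (p x)"
        proof
          show "\<beta> ` real_roots (p x0) \<subseteq> real_roots (p x)" using \<beta>(1) by blast
          show "real_roots (p x) \<subseteq> \<beta> ` real_roots (p x0)"
          proof
            fix t assume "t \<in> real_roots (p x)"
            then have "complex_of_real t \<in> b ` complex_roots (p x0)" using im complex_roots_real by blast
            then obtain w where w: "w \<in> complex_roots (p x0)" "complex_of_real t = b w" by auto
            then have "dist (complex_of_real t) w < e'" using b[OF w(1)] by (simp add: dist_commute)
            then have "Im w = 0" using real_near[OF w(1) e'(4)] by blast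
            then have wr: "w = complex_of_real (Re w)" by (simp add: complex_eq_iff)
            then have "Re w \<in> real_roots (p x0)" using w(1) complex_roots_real by metis
            moreover have "t = \<beta> (Re w)" unfolding \<beta>_def using w(2) wr by (metis Re_complex_of_real)
            ultimately show "t \<in> \<beta> ` real_roots (p x0)" by blast
          qed
        qed
      qed
      then have "card (real_roots (p x)) = card (real_roots (p x0))" by (simp add: bij_betw_same_card)
      then show ?thesis using \<beta> by blast
    qed
    then show ?thesis using \<delta>(1) by blast
  qed
  show ?thesis
    unfolding root_family_def
  proof (intro conjI ballI allI impI)
    show "finite (real_roots (p x))" if "x \<in> ?M" for x using finite_real_roots[OF p0[OF that]] .
    show "\<exists>d>0. \<forall>x\<in>?M. dist x x0 < d \<longrightarrow> (\<forall>t\<in>real_roots (p x). \<exists>s\<in>real_roots (p x0). \<bar>t - s\<bar> < e)"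
      if "x0 \<in> ?M" "e > 0" for x0 e using usc[OF that] .
    show "\<exists>d>0. \<forall>x\<in>C. dist x x0 < d \<longrightarrow> (\<forall>s\<in>real_roots (p x0). \<exists>t\<in>real_roots (p x). \<bar>t - s\<bar> < e)"
      if "C \<in> \<C>" "x0 \<in> C" "e > 0" for C x0 e using bij[OF that] by blast
    show "card (real_roots (p x)) = card (real_roots (p y))" if C: "C \<in> \<C>" "x \<in> C" "y \<in> C" for C x y
    proof (rule connected_local_const[OF conn[OF C(1)] C(2,3), where f = "\<lambda>x. card (real_roots (p x))"], rule ballI)
      fix x0 assume x0: "x0 \<in> C"
      obtain \<delta> where "\<delta> > 0" "\<And>x. x \<in> C \<Longrightarrow> dist x x0 < \<delta> \<Longrightarrow> card (real_roots (p x)) = card (real_roots (p x0))"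
        using bij[OF C(1) x0 zero_less_one] by blast
      then show "\<forall>\<^sub>F y in at x0 within C. card (real_roots (p x0)) = card (real_roots (p y))"
        unfolding eventually_at by force
    qed
  qed
qed

section \<open>Polynomial functions and directions in which they are monic\<close>

section \<open>Polynomial functions of finitely many coordinates\<close>

type_synonym point = "nat \<Rightarrow> real"

text \<open>Points of all dimensions share one type, with zero coordinates from \<open>n\<close> on,
  so that the induction on the dimension does not change types.\<close>

definition coord_space :: "nat \<Rightarrow> point set" where
  "coord_space n = {x. \<forall>i\<ge>n. x i = 0}"

inductive polyfun :: "(point \<Rightarrow> real) \<Rightarrow> bool" where
  const: "polyfun (\<lambda>x. c)"
| coord: "polyfun (\<lambda>x. x i)"
| add: "polyfun f \<Longrightarrow> polyfun g \<Longrightarrow> polyfun (\<lambda>x. f x + g x)"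
| mult: "polyfun f \<Longrightarrow> polyfun g \<Longrightarrow> polyfun (\<lambda>x. f x * g x)"

lemma polyfun_minus: "polyfun f \<Longrightarrow> polyfun (\<lambda>x. - f x)"
  using polyfun.mult[OF polyfun.const[of "-1"]] by force

lemma polyfun_diff: "polyfun f \<Longrightarrow> polyfun g \<Longrightarrow> polyfun (\<lambda>x. f x - g x)"
  using polyfun.add[OF _ polyfun_minus] by force

lemma polyfun_sum: "(\<And>i. i \<in> A \<Longrightarrow> polyfun (f i)) \<Longrightarrow> polyfun (\<lambda>x. \<Sum>i\<in>A. f i x)"
  by (induction A rule: infinite_finite_induct) (auto intro: polyfun.intros)

lemma continuous_on_polyfun: "polyfun f \<Longrightarrow> continuous_on S f"
  by (induction rule: polyfun.induct)
    (auto intro!: continuous_intros continuous_on_subset[OF continuous_on_product_coordinates])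

text \<open>The zero function is homogeneous of every degree, so that absent components of a
  polynomial need no special case.\<close>

inductive homogeneous :: "nat \<Rightarrow> (point \<Rightarrow> real) \<Rightarrow> bool" where
  const: "homogeneous 0 (\<lambda>x. c)"
| zero: "homogeneous d (\<lambda>x. 0)"
| coord: "homogeneous 1 (\<lambda>x. x i)"
| add: "homogeneous d f \<Longrightarrow> homogeneous d g \<Longrightarrow> homogeneous d (\<lambda>x. f x + g x)"
| mult: "homogeneous d f \<Longrightarrow> homogeneous e g \<Longrightarrow> homogeneous (d + e) (\<lambda>x. f x * g x)"

lemma homogeneous_polyfun: "homogeneous d f \<Longrightarrow> polyfun f"
  by (induction rule: homogeneous.induct) (auto intro: polyfun.intros)

lemma homogeneous_sum: "(\<And>i. i \<in> A \<Longrightarrow> homogeneous d (f i)) \<Longrightarrow> homogeneous d (\<lambda>x. \<Sum>i\<in>A. f i x)"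
  by (induction A rule: infinite_finite_induct) (auto intro: homogeneous.intros)

lemma homogeneous_decomposition:
  assumes "polyfun f"
  shows "\<exists>h N. (\<forall>i. homogeneous i (h i)) \<and> (\<forall>i>N. h i = (\<lambda>x. 0)) \<and> (\<forall>x. f x = (\<Sum>i\<le>N. h i x))"
  using assms
proof (induction rule: polyfun.induct)
  case (const c)
  show ?case
    by (intro exI[of _ "\<lambda>i. if i = 0 then (\<lambda>x. c) else (\<lambda>x. 0)"] exI[of _ 0])
      (auto intro: homogeneous.intros)
next
  case (coord j)
  show ?case
    by (intro exI[of _ "\<lambda>i. if i = 1 then (\<lambda>x. x j) else (\<lambda>x. 0)"] exI[of _ 1])
      (auto intro: homogeneous.intros homogeneous.coord[unfolded One_nat_def])
next
  case (add f g)
  obtain h N where h: "\<forall>i. homogeneous i (h i)" "\<forall>i>N. h i = (\<lambda>x. 0)" "\<forall>x. f x = (\<Sum>i\<le>N. h i x)"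
    using add.IH(1) by blast
  obtain k M where k: "\<forall>i. homogeneous i (k i)" "\<forall>i>M. k i = (\<lambda>x. 0)" "\<forall>x. g x = (\<Sum>i\<le>M. k i x)"
    using add.IH(2) by blast
  have "f x = (\<Sum>i\<le>max N M. h i x)" for x
    unfolding h(3)[rule_format] using h(2) by (intro sum.mono_neutral_left) auto
  moreover have "g x = (\<Sum>i\<le>max N M. k i x)" for x
    unfolding k(3)[rule_format] using k(2) by (intro sum.mono_neutral_left) auto
  ultimately show ?case using h k
    by (intro exI[of _ "\<lambda>i x. h i x + k i x"] exI[of _ "max N M"])
      (auto intro: homogeneous.intros simp: sum.distrib)
next
  case (mult f g)
  obtain h N where h: "\<forall>i. homogeneous i (h i)" "\<forall>i>N. h i = (\<lambda>x. 0)" "\<forall>x. f x = (\<Sum>i\<le>N. h i x)"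
    using mult.IH(1) by blast
  obtain k M where k: "\<forall>i. homogeneous i (k i)" "\<forall>i>M. k i = (\<lambda>x. 0)" "\<forall>x. g x = (\<Sum>i\<le>M. k i x)"
    using mult.IH(2) by blast
  have hom: "homogeneous r (\<lambda>x. h i x * k (r - i) x)" if "i \<le> r" for i r
    using homogeneous.mult[of i "h i" "r - i" "k (r - i)"] h(1) k(1) that by simp
  have "f x * g x = (\<Sum>r\<le>N + M. \<Sum>i\<le>r. h i x * k (r - i) x)" for x
    using polynomial_product[of N "\<lambda>i. h i x" M "\<lambda>i. k i x" 1] h(2,3) k(2,3) by simp
  moreover have "(\<lambda>x. \<Sum>i\<le>r. h i x * k (r - i) x) = (\<lambda>x. 0)" if "r > N + M" for r
  proof
    fix x
    have "h i x * k (r - i) x = 0" for i using h(2) k(2) that by (cases "i > N") auto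
    then show "(\<Sum>i\<le>r. h i x * k (r - i) x) = 0" by (simp only: sum.neutral_const)
  qed
  ultimately show ?case
    by (intro exI[of _ "\<lambda>r x. \<Sum>i\<le>r. h i x * k (r - i) x"] exI[of _ "N + M"])
      (auto intro!: homogeneous_sum hom)
qed

definition translate :: "point \<Rightarrow> point \<Rightarrow> real \<Rightarrow> point" where
  "translate u x t = (\<lambda>i. x i + t * u i)"

definition poly_coeffs :: "(point \<Rightarrow> real poly) \<Rightarrow> bool" where
  "poly_coeffs p \<longleftrightarrow> (\<forall>i. polyfun (\<lambda>x. poly.coeff (p x) i))"

lemma poly_coeffs_const: "poly_coeffs (\<lambda>x. q)"
  by (simp add: poly_coeffs_def polyfun.const)

lemma poly_coeffs_add: "poly_coeffs p \<Longrightarrow> poly_coeffs q \<Longrightarrow> poly_coeffs (\<lambda>x. p x + q x)"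
  by (auto simp: poly_coeffs_def intro: polyfun.intros)

lemma poly_coeffs_mult: "poly_coeffs p \<Longrightarrow> poly_coeffs q \<Longrightarrow> poly_coeffs (\<lambda>x. p x * q x)"
  by (auto simp: poly_coeffs_def coeff_mult intro!: polyfun_sum polyfun.mult)

lemma poly_coeffs_sum: "(\<And>i. i \<in> A \<Longrightarrow> poly_coeffs (p i)) \<Longrightarrow> poly_coeffs (\<lambda>x. \<Sum>i\<in>A. p i x)"
  by (induction A rule: infinite_finite_induct) (auto intro: poly_coeffs_add poly_coeffs_const)

lemma coeff_mult_top:
  assumes "degree p \<le> d" "degree q \<le> e"
  shows "poly.coeff (p * q) (d + e) = poly.coeff p d * poly.coeff q e"
proof -
  have "poly.coeff (p * q) (d + e) = (\<Sum>i\<le>d + e. poly.coeff p i * poly.coeff q (d + e - i))"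
    by (rule coeff_mult)
  also have "\<dots> = (\<Sum>i\<in>{d}. poly.coeff p i * poly.coeff q (d + e - i))"
  proof (rule sum.mono_neutral_right, simp, simp, rule ballI)
    fix i assume "i \<in> {..d + e} - {d}"
    then have "i > d \<or> d + e - i > e" by auto
    then show "poly.coeff p i * poly.coeff q (d + e - i) = 0"
      using assms by (auto simp: coeff_eq_0)
  qed
  finally show ?thesis by simp
qed

text \<open>On a line in direction \<open>u\<close> the coefficient of \<open>t ^ d\<close> is
  \<open>f u\<close>, whatever the starting point. This is where constant leading coefficients come
  from.\<close>

lemma homogeneous_along_line:
  assumes "homogeneous d f"
  shows "\<exists>p. poly_coeffs p \<and> (\<forall>x t. poly (p x) t = f (translate u x t)) \<and>
    (\<forall>x. degree (p x) \<le> d \<and> poly.coeff (p x) d = f u)"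
  using assms
proof (induction rule: homogeneous.induct)
  case (const c)
  show ?case by (intro exI[of _ "\<lambda>x. [:c:]"]) (auto intro: poly_coeffs_const)
next
  case (zero d)
  show ?case by (intro exI[of _ "\<lambda>x. 0"]) (auto intro: poly_coeffs_const)
next
  case (coord i)
  have "poly_coeffs (\<lambda>x. [:x i, u i:])"
    unfolding poly_coeffs_def
  proof
    fix j show "polyfun (\<lambda>x. poly.coeff [:x i, u i:] j)"
      by (cases j; cases "j - 1") (auto intro: polyfun.intros)
  qed
  then show ?case by (intro exI[of _ "\<lambda>x. [:x i, u i:]"]) (auto simp: translate_def)
next
  case (add d f g)
  obtain p where p: "poly_coeffs p" "\<forall>x t. poly (p x) t = f (translate u x t)"
    "\<forall>x. degree (p x) \<le> d \<and> poly.coeff (p x) d = f u" using add.IH(1) by blast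
  obtain q where q: "poly_coeffs q" "\<forall>x t. poly (q x) t = g (translate u x t)"
    "\<forall>x. degree (q x) \<le> d \<and> poly.coeff (q x) d = g u" using add.IH(2) by blast
  show ?case using p q by (intro exI[of _ "\<lambda>x. p x + q x"]) (auto intro: poly_coeffs_add degree_add_le)
next
  case (mult d f e g)
  obtain p where p: "poly_coeffs p" "\<forall>x t. poly (p x) t = f (translate u x t)"
    "\<forall>x. degree (p x) \<le> d \<and> poly.coeff (p x) d = f u" using mult.IH(1) by blast
  obtain q where q: "poly_coeffs q" "\<forall>x t. poly (q x) t = g (translate u x t)"
    "\<forall>x. degree (q x) \<le> e \<and> poly.coeff (q x) e = g u" using mult.IH(2) by blast
  have "degree (p x * q x) \<le> d + e" for x
    using degree_mult_le[of "p x" "q x"] p(3) q(3) by (meson add_mono order_trans)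
  then show ?case using p q
    by (intro exI[of _ "\<lambda>x. p x * q x"]) (auto intro: poly_coeffs_mult simp: coeff_mult_top)
qed

lemma polyfun_along_line:
  assumes "polyfun f"
  shows "\<exists>p. \<forall>t. poly p t = f (translate u x t)"
proof -
  obtain h N where h: "\<forall>i. homogeneous i (h i)" "\<forall>x. f x = (\<Sum>i\<le>N. h i x)"
    using homogeneous_decomposition[OF assms] by blast
  have "\<forall>i. \<exists>p. \<forall>t. poly p t = h i (translate u x t)"
    using homogeneous_along_line h(1) by meson
  from choice[OF this] obtain p where "\<forall>i t. poly (p i) t = h i (translate u x t)" by blast
  then show ?thesis using h(2) by (intro exI[of _ "\<Sum>i\<le>N. p i"]) (simp add: poly_sum)
qed

text \<open>Join a point that is good for \<open>H\<close> to one that is good for \<open>g\<close>.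
  On this line every function is a nonzero polynomial in the parameter, so only finitely many
  parameters are bad.\<close>

lemma common_nonzero:
  assumes "finite H" "\<And>h. h \<in> H \<Longrightarrow> polyfun h \<and> (\<exists>x\<in>coord_space n. h x \<noteq> 0)"
  shows "\<exists>x\<in>coord_space n. \<forall>h\<in>H. h x \<noteq> 0"
  using assms
proof (induction H rule: finite_induct)
  case empty
  show ?case by (intro bexI[of _ "\<lambda>i. 0"]) (auto simp: coord_space_def)
next
  case (insert g H)
  obtain a where a: "a \<in> coord_space n" "\<forall>h\<in>H. h a \<noteq> 0" using insert by auto
  obtain b where b: "b \<in> coord_space n" "g b \<noteq> 0" using insert.prems[of g] by auto
  define w where "w = (\<lambda>i. b i - a i)"
  have ends: "translate w a 0 = a" "translate w a 1 = b" by (auto simp: translate_def w_def)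
  have fin: "finite {t. h (translate w a t) = 0}" if h: "h \<in> insert g H" for h
  proof -
    obtain p where p: "\<forall>t. poly p t = h (translate w a t)" using polyfun_along_line insert.prems[OF h] by blast
    have "p \<noteq> 0"
    proof
      assume "p = 0"
      then have "h a = 0" "h b = 0" using p ends by (metis poly_0)+
      then show False using h a b by auto
    qed
    then show ?thesis using poly_roots_finite[of p] p by simp
  qed
  have "finite (\<Union>h\<in>insert g H. {t. h (translate w a t) = 0})" using insert.hyps fin by blast
  then obtain t where t: "t \<notin> (\<Union>h\<in>insert g H. {t. h (translate w a t) = 0})"
    using ex_new_if_finite[OF infinite_UNIV_char_0] by blast
  have "translate w a t \<in> coord_space n" using a b by (auto simp: coord_space_def translate_def w_def)
  then show ?case using t by blast
qed

definition monic_polyfun :: "(point \<Rightarrow> real poly) \<Rightarrow> bool" where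
  "monic_polyfun p \<longleftrightarrow> poly_coeffs p \<and> (\<exists>d c. c \<noteq> 0 \<and> (\<forall>x. degree (p x) = d \<and> lead_coeff (p x) = c))"

lemma monic_polyfun_const: "q \<noteq> 0 \<Longrightarrow> monic_polyfun (\<lambda>x. q)"
  unfolding monic_polyfun_def by (auto intro: poly_coeffs_const)

lemma monic_polyfun_mult:
  assumes "monic_polyfun p" "monic_polyfun q"
  shows "monic_polyfun (\<lambda>x. p x * q x)"
proof -
  obtain d c where p: "poly_coeffs p" "c \<noteq> 0" "\<forall>x. degree (p x) = d \<and> lead_coeff (p x) = c"
    using assms(1) unfolding monic_polyfun_def by blast
  obtain e b where q: "poly_coeffs q" "b \<noteq> 0" "\<forall>x. degree (q x) = e \<and> lead_coeff (q x) = b"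
    using assms(2) unfolding monic_polyfun_def by blast
  have "p x \<noteq> 0" "q x \<noteq> 0" for x using p q by auto
  then have "degree (p x * q x) = degree (p x) + degree (q x)" for x by (rule degree_mult_eq)
  then have "degree (p x * q x) = d + e \<and> lead_coeff (p x * q x) = c * b" for x
    unfolding lead_coeff_mult using p(3) q(3) by metis
  moreover have "c * b \<noteq> 0" using p q by simp
  ultimately show ?thesis unfolding monic_polyfun_def using poly_coeffs_mult[OF p(1) q(1)] by blast
qed

lemma monic_polyfun_prod:
  "finite A \<Longrightarrow> (\<And>i. i \<in> A \<Longrightarrow> monic_polyfun (p i)) \<Longrightarrow> monic_polyfun (\<lambda>x. \<Prod>i\<in>A. p i x)"
  by (induction A rule: finite_induct) (auto intro: monic_polyfun_mult monic_polyfun_const)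

lemma monic_family_polyfun: "monic_polyfun p \<Longrightarrow> monic_family M p"
  unfolding monic_polyfun_def monic_family_def poly_coeffs_def by (auto intro: continuous_on_polyfun)

text \<open>The direction avoids the zeros of all top homogeneous parts; the values of these parts
  at \<open>u\<close> become the constant leading coefficients.\<close>

lemma monic_direction:
  assumes F: "finite F" "\<And>f. f \<in> F \<Longrightarrow> polyfun f \<and> (\<exists>x\<in>coord_space (Suc n). f x \<noteq> 0)"
  obtains u P where "u \<in> coord_space (Suc n)" "u n \<noteq> 0" "\<And>f. f \<in> F \<Longrightarrow> monic_polyfun (P f)"
    "\<And>f x t. f \<in> F \<Longrightarrow> x \<in> coord_space (Suc n) \<Longrightarrow> poly (P f x) t = f (translate u x t)"
proof -
  let ?V = "coord_space (Suc n)"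
  have "\<exists>h d. (\<forall>i. homogeneous i (h i)) \<and> (\<forall>x\<in>?V. f x = (\<Sum>i\<le>d. h i x)) \<and> (\<exists>x\<in>?V. h d x \<noteq> 0)"
    if f: "f \<in> F" for f
  proof -
    obtain h N where h: "\<forall>i. homogeneous i (h i)" "\<forall>x. f x = (\<Sum>i\<le>N. h i x)"
      using homogeneous_decomposition F(2)[OF f] by blast
    define I where "I = {i. i \<le> N \<and> (\<exists>x\<in>?V. h i x \<noteq> 0)}"
    have I: "finite I" by (simp add: I_def)
    have "I \<noteq> {}"
    proof
      assume "I = {}"
      then have "\<forall>x\<in>?V. f x = 0" using h(2) by (auto simp: I_def)
      then show False using F(2)[OF f] by blast
    qed
    \<comment> \<open>The degree that counts is that of the restriction to the coordinate space;
      components of higher degree vanish there, but perhaps not elsewhere.\<close>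
    then have M: "Max I \<in> I" using I by simp
    have "f x = (\<Sum>i\<le>Max I. h i x)" if x: "x \<in> ?V" for x
      unfolding h(2)[rule_format]
    proof (rule sum.mono_neutral_right)
      show "{..Max I} \<subseteq> {..N}" using M by (auto simp: I_def)
      show "\<forall>i\<in>{..N} - {..Max I}. h i x = 0"
      proof
        fix i assume "i \<in> {..N} - {..Max I}"
        then have "i \<notin> I" "i \<le> N" using Max_ge[OF I, of i] by auto
        then show "h i x = 0" using x by (auto simp: I_def)
      qed
    qed simp
    then show ?thesis using h(1) M by (intro exI[of _ h] exI[of _ "Max I"]) (auto simp: I_def)
  qed
  then obtain h d where h: "\<And>f i. f \<in> F \<Longrightarrow> homogeneous i (h f i)"
    "\<And>f x. f \<in> F \<Longrightarrow> x \<in> ?V \<Longrightarrow> f x = (\<Sum>i\<le>d f. h f i x)" "\<And>f. f \<in> F \<Longrightarrow> \<exists>x\<in>?V. h f (d f) x \<noteq> 0"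
    by metis
  \<comment> \<open>The last coordinate joins the list so that \<open>u n \<noteq> 0\<close>, which
    makes the direction transverse to \<open>coord_space n\<close>.\<close>
  have "\<exists>u\<in>?V. \<forall>g\<in>insert (\<lambda>x. x n) ((\<lambda>f. h f (d f)) ` F). g u \<noteq> 0"
  proof (rule common_nonzero)
    show "finite (insert (\<lambda>x. x n) ((\<lambda>f. h f (d f)) ` F))" using F by simp
    fix g assume "g \<in> insert (\<lambda>x. x n) ((\<lambda>f. h f (d f)) ` F)"
    then consider "g = (\<lambda>x. x n)" | f where "f \<in> F" "g = h f (d f)" by auto
    then show "polyfun g \<and> (\<exists>x\<in>?V. g x \<noteq> 0)"
    proof cases
      case 1
      have "(\<lambda>i. if i = n then 1 else 0) \<in> ?V" by (auto simp: coord_space_def)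
      then show ?thesis unfolding 1 by (auto intro!: polyfun.coord bexI[of _ "\<lambda>i. if i = n then 1 else 0"])
    next
      case 2
      then show ?thesis using h(1,3) homogeneous_polyfun by metis
    qed
  qed
  then obtain u where u: "u \<in> ?V" "u n \<noteq> 0" "\<And>f. f \<in> F \<Longrightarrow> h f (d f) u \<noteq> 0" by auto
  have "\<exists>p. poly_coeffs p \<and> (\<forall>x t. poly (p x) t = h f i (translate u x t)) \<and>
    (\<forall>x. degree (p x) \<le> i \<and> poly.coeff (p x) i = h f i u)" if "f \<in> F" for f i
    using homogeneous_along_line h(1)[OF that] by blast
  then obtain q where q: "\<And>f i. f \<in> F \<Longrightarrow> poly_coeffs (q f i)"
    "\<And>f i x t. f \<in> F \<Longrightarrow> poly (q f i x) t = h f i (translate u x t)"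
    "\<And>f i x. f \<in> F \<Longrightarrow> degree (q f i x) \<le> i \<and> poly.coeff (q f i x) i = h f i u"
    by metis
  define P where "P = (\<lambda>f x. \<Sum>i\<le>d f. q f i x)"
  show ?thesis
  proof (rule that[OF u(1,2), of P])
    fix f assume f: "f \<in> F"
    have "degree (P f x) \<le> d f" for x
      unfolding P_def using q(3)[OF f] by (intro degree_sum_le) (auto intro: order_trans)
    moreover have top: "poly.coeff (P f x) (d f) = h f (d f) u" for x
    proof -
      have "poly.coeff (P f x) (d f) = (\<Sum>i\<le>d f. poly.coeff (q f i x) (d f))" by (simp add: P_def coeff_sum)
      also have "\<dots> = (\<Sum>i\<in>{d f}. poly.coeff (q f i x) (d f))"
      proof (rule sum.mono_neutral_right, simp, simp, rule ballI)
        fix i assume "i \<in> {..d f} - {d f}"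
        then show "poly.coeff (q f i x) (d f) = 0" using q(3)[OF f, of i x] by (intro coeff_eq_0) auto
      qed
      finally show ?thesis using q(3)[OF f] by simp
    qed
    ultimately have "degree (P f x) = d f \<and> lead_coeff (P f x) = h f (d f) u" for x
      using u(3)[OF f] by (metis le_antisym le_degree)
    moreover have "poly_coeffs (P f)" unfolding P_def by (intro poly_coeffs_sum q(1) f)
    ultimately show "monic_polyfun (P f)" unfolding monic_polyfun_def using u(3)[OF f] by blast
    fix x t assume x: "x \<in> ?V"
    then have "translate u x t \<in> ?V" using u(1) by (auto simp: coord_space_def translate_def)
    then show "poly (P f x) t = f (translate u x t)"
      using h(2)[OF f] q(2)[OF f] by (simp add: P_def poly_sum)
  qed
qed

section \<open>Elimination with case distinctions on zeros\<close>

section \<open>Properties determined by the vanishing of polynomials\<close>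

text \<open>The conditions that become constant on every cell once the cells respect the zero sets
  of finitely many polynomials. They are closed under Boolean operations.\<close>

definition zero_determined :: "(point \<Rightarrow> bool) \<Rightarrow> bool" where
  "zero_determined P \<longleftrightarrow> (\<exists>F. finite F \<and> (\<forall>f\<in>F. polyfun f) \<and>
     (\<forall>x y. (\<forall>f\<in>F. f x = 0 \<longleftrightarrow> f y = 0) \<longrightarrow> (P x \<longleftrightarrow> P y)))"

lemma zero_determined_const: "zero_determined (\<lambda>x. b)"
  unfolding zero_determined_def by (rule exI[of _ "{}"]) auto

lemma zero_determined_zero: "polyfun f \<Longrightarrow> zero_determined (\<lambda>x. f x = 0)"
  unfolding zero_determined_def by (rule exI[of _ "{f}"]) auto

lemma zero_determined_binary:
  assumes "zero_determined P" "zero_determined Q"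
  shows "zero_determined (\<lambda>x. b (P x) (Q x))"
proof -
  obtain F where F: "finite F" "\<forall>f\<in>F. polyfun f" "\<forall>x y. (\<forall>f\<in>F. f x = 0 \<longleftrightarrow> f y = 0) \<longrightarrow> (P x \<longleftrightarrow> P y)"
    using assms(1) unfolding zero_determined_def by blast
  obtain G where G: "finite G" "\<forall>f\<in>G. polyfun f" "\<forall>x y. (\<forall>f\<in>G. f x = 0 \<longleftrightarrow> f y = 0) \<longrightarrow> (Q x \<longleftrightarrow> Q y)"
    using assms(2) unfolding zero_determined_def by blast
  show ?thesis
    unfolding zero_determined_def
  proof (intro exI[of _ "F \<union> G"] conjI allI impI)
    fix x y assume "\<forall>f\<in>F \<union> G. (f x = 0) = (f y = 0)"
    then have "P x = P y" "Q x = Q y" using F(3) G(3) by blast+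
    then show "b (P x) (Q x) = b (P y) (Q y)" by simp
  qed (use F G in auto)
qed

lemma zero_determined_not: "zero_determined P \<Longrightarrow> zero_determined (\<lambda>x. \<not> P x)"
  using zero_determined_binary[of P P "\<lambda>p q. \<not> p"] by simp

lemma zero_determined_bex:
  "finite A \<Longrightarrow> (\<And>a. a \<in> A \<Longrightarrow> zero_determined (P a)) \<Longrightarrow> zero_determined (\<lambda>x. \<exists>a\<in>A. P a x)"
  by (induction A rule: finite_induct)
    (auto intro: zero_determined_const zero_determined_binary[where b = "(\<or>)"])

lemma zero_determined_ball:
  "finite A \<Longrightarrow> (\<And>a. a \<in> A \<Longrightarrow> zero_determined (P a)) \<Longrightarrow> zero_determined (\<lambda>x. \<forall>a\<in>A. P a x)"
  by (induction A rule: finite_induct)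
    (auto intro: zero_determined_const zero_determined_binary[where b = "(\<and>)"])

text \<open>Gaussian elimination of the last unknown. Either all its coefficients vanish and the
  last unit vector is a solution, or some row is a pivot and a system with one unknown fewer
  remains. The case distinction itself concerns only zeros of polynomials.\<close>

lemma zero_determined_linear_system:
  fixes R :: "(nat \<Rightarrow> point \<Rightarrow> real) set"
  assumes "finite R" "\<And>r j. r \<in> R \<Longrightarrow> polyfun (r j)"
  shows "zero_determined (\<lambda>x. \<exists>v :: nat \<Rightarrow> complex. (\<exists>j<m. v j \<noteq> 0) \<and> (\<forall>r\<in>R. (\<Sum>j<m. complex_of_real (r j x) * v j) = 0))"
  using assms
proof (induction m arbitrary: R)
  case 0
  then show ?case by (simp add: zero_determined_const)
next
  case (Suc m)
  \<comment> \<open>The rows after elimination with pivot row \<open>r0\<close>, cross-multiplied so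
    that the coefficients remain polynomial functions.\<close>
  define E where "E = (\<lambda>r0 :: nat \<Rightarrow> point \<Rightarrow> real. (\<lambda>r j x. r0 m x * r j x - r m x * r0 j x) ` R)"
  define S where "S = (\<lambda>(R :: (nat \<Rightarrow> point \<Rightarrow> real) set) (m::nat) (x::point). \<exists>v :: nat \<Rightarrow> complex. (\<exists>j<m. v j \<noteq> 0) \<and>
    (\<forall>r\<in>R. (\<Sum>j<m. complex_of_real (r j x) * v j) = 0))"
  have "zero_determined (\<lambda>x. S (E r0) m x)" if "r0 \<in> R" for r0
    unfolding S_def
    by (rule Suc.IH) (use Suc.prems that in \<open>auto simp: E_def intro!: polyfun_diff polyfun.mult\<close>)
  moreover have "polyfun (r m)" if "r \<in> R" for r using Suc.prems that by blast
  ultimately have "zero_determined (\<lambda>x. (\<forall>r\<in>R. r m x = 0) \<or> (\<exists>r0\<in>R. r0 m x \<noteq> 0 \<and> S (E r0) m x))"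
    using Suc.prems(1)
    by (intro zero_determined_binary[where b = "(\<or>)"] zero_determined_ball zero_determined_bex
      zero_determined_binary[where b = "(\<and>)"] zero_determined_not zero_determined_zero) auto
  moreover have "(\<forall>r\<in>R. r m x = 0) \<or> (\<exists>r0\<in>R. r0 m x \<noteq> 0 \<and> S (E r0) m x) \<longleftrightarrow> S R (Suc m) x" for x
  proof
    assume "(\<forall>r\<in>R. r m x = 0) \<or> (\<exists>r0\<in>R. r0 m x \<noteq> 0 \<and> S (E r0) m x)"
    then show "S R (Suc m) x"
    proof
      assume 0: "\<forall>r\<in>R. r m x = 0"
      show ?thesis unfolding S_def
      proof (intro exI[of _ "\<lambda>j. if j = m then 1 else 0"] conjI ballI)
        fix r assume "r \<in> R"
        then show "(\<Sum>j<Suc m. complex_of_real (r j x) * (if j = m then 1 else 0)) = 0" using 0 by simp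
      qed auto
    next
      assume "\<exists>r0\<in>R. r0 m x \<noteq> 0 \<and> S (E r0) m x"
      then obtain r0 v where r0: "r0 \<in> R" "r0 m x \<noteq> 0" and v: "\<exists>j<m. v j \<noteq> 0"
        "\<And>r. r \<in> R \<Longrightarrow> (\<Sum>j<m. complex_of_real (r0 m x * r j x - r m x * r0 j x) * v j) = 0"
        unfolding S_def E_def by auto
      define a where "a = (\<Sum>j<m. complex_of_real (r0 j x) * v j)"
      define w where "w = (\<lambda>j. if j = m then - a / complex_of_real (r0 m x) else v j)"
      have "(\<Sum>j<Suc m. complex_of_real (r j x) * w j) = 0" if r: "r \<in> R" for r
      proof -
        let ?s = "\<Sum>j<m. complex_of_real (r j x) * v j"
        have "complex_of_real (r0 m x) * ?s - complex_of_real (r m x) * a = 0"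
          using v(2)[OF r] by (simp add: a_def sum_distrib_left sum_subtractf algebra_simps)
        then have "?s = complex_of_real (r m x) * a / complex_of_real (r0 m x)" using r0 by (simp add: field_simps)
        moreover have "(\<Sum>j<m. complex_of_real (r j x) * w j) = ?s" by (intro sum.cong) (auto simp: w_def)
        ultimately show ?thesis by (simp add: w_def)
      qed
      moreover have "\<exists>j<Suc m. w j \<noteq> 0" using v(1) by (auto simp: w_def less_Suc_eq)
      ultimately show ?thesis unfolding S_def by blast
    qed
  next
    assume "S R (Suc m) x"
    then obtain v where v: "\<exists>j<Suc m. v j \<noteq> 0" "\<And>r. r \<in> R \<Longrightarrow> (\<Sum>j<Suc m. complex_of_real (r j x) * v j) = 0"
      unfolding S_def by blast
    show "(\<forall>r\<in>R. r m x = 0) \<or> (\<exists>r0\<in>R. r0 m x \<noteq> 0 \<and> S (E r0) m x)"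
    proof (cases "\<forall>r\<in>R. r m x = 0")
      case False
      then obtain r0 where r0: "r0 \<in> R" "r0 m x \<noteq> 0" by blast
      have e: "(\<Sum>j<m. complex_of_real (r j x) * v j) = - complex_of_real (r m x) * v m" if "r \<in> R" for r
        using v(2)[OF that] by (simp add: add_eq_0_iff2)
      have "\<exists>j<m. v j \<noteq> 0"
      proof (rule ccontr)
        assume *: "\<not> (\<exists>j<m. v j \<noteq> 0)"
        then have "v m \<noteq> 0" using v(1) less_Suc_eq by blast
        moreover have "complex_of_real (r0 m x) * v m = 0" using e[OF r0(1)] * by simp
        ultimately show False using r0 by simp
      qed
      moreover have "(\<Sum>j<m. complex_of_real (r0 m x * r j x - r m x * r0 j x) * v j) = 0" if "r \<in> R" for r
      proof -
        have "(\<Sum>j<m. complex_of_real (r0 m x * r j x - r m x * r0 j x) * v j) =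
            complex_of_real (r0 m x) * (\<Sum>j<m. complex_of_real (r j x) * v j) -
            complex_of_real (r m x) * (\<Sum>j<m. complex_of_real (r0 j x) * v j)"
          by (simp add: sum_distrib_left sum_subtractf algebra_simps)
        then show ?thesis using e[OF that] e[OF r0(1)] by simp
      qed
      ultimately have "S (E r0) m x" unfolding S_def E_def by auto
      then show ?thesis using r0 by blast
    qed simp
  qed
  ultimately have "zero_determined (\<lambda>x. S R (Suc m) x)" by simp
  then show ?case by (simp only: S_def)
qed

section \<open>Counting distinct roots by linear algebra\<close>

section \<open>The number of distinct roots\<close>

text \<open>Differentiation takes one linear factor from each power; the product of the distinct
  linear factors restores it.\<close>

lemma dvd_radical_mult_pderiv:
  fixes e :: "'a::field \<Rightarrow> nat"
  assumes "finite A" "\<And>z. z \<in> A \<Longrightarrow> e z > 0"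
  shows "(\<Prod>z\<in>A. [:-z, 1:] ^ e z) dvd (\<Prod>z\<in>A. [:-z, 1:]) * pderiv (\<Prod>z\<in>A. [:-z, 1:] ^ e z)"
  using assms
proof (induction A rule: finite_induct)
  case empty then show ?case by simp
next
  case (insert a A)
  define L where "L = [:-a, 1:]"
  let ?P = "\<Prod>z\<in>A. [:-z, 1:] ^ e z" and ?U = "\<Prod>z\<in>A. [:-z, 1:]"
  have dL: "pderiv L = 1" by (simp add: L_def pderiv_pCons)
  obtain k where k: "?U * pderiv ?P = ?P * k" using insert by (auto simp: dvd_def)
  obtain n where n: "e a = Suc n" using insert.prems[of a] by (cases "e a") auto
  have "L * ?U * pderiv (L ^ e a * ?P) = L * ?U * (L ^ e a * pderiv ?P + ?P * pderiv (L ^ e a))"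
    by (simp only: pderiv_mult)
  also have "pderiv (L ^ e a) = of_nat (Suc n) * L ^ n"
    unfolding n pderiv_power_Suc dL by (simp add: of_nat_poly)
  also have "L * ?U * (L ^ e a * pderiv ?P + ?P * (of_nat (Suc n) * L ^ n)) =
      L * L ^ e a * (?U * pderiv ?P) + ?U * ?P * (of_nat (Suc n) * (L * L ^ n))"
    by (simp only: algebra_simps)
  also have "\<dots> = (L ^ e a * ?P) * (L * k + ?U * of_nat (Suc n))"
    unfolding k n power_Suc by (simp only: algebra_simps)
  finally have "L ^ e a * ?P dvd L * ?U * pderiv (L ^ e a * ?P)" by simp
  then show ?case using insert.hyps by (simp add: L_def)
qed

text \<open>If there are at most \<open>m\<close> roots, \<open>u\<close> can be the product over
  the distinct ones. Conversely, the order of \<open>pderiv p\<close> at a root of \<open>p\<close>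
  is one less than that of \<open>p\<close>, so \<open>u\<close> vanishes at every root. For fixed
  \<open>m\<close> the condition is a homogeneous linear system in the coefficients of
  \<open>u\<close> and \<open>v\<close>.\<close>

lemma card_roots_le_iff:
  fixes p :: "complex poly"
  assumes d: "degree p > 0"
  shows "card {z. poly p z = 0} \<le> m \<longleftrightarrow>
    (\<exists>u v. (u \<noteq> 0 \<or> v \<noteq> 0) \<and> degree u \<le> m \<and> degree v \<le> m \<and> u * pderiv p = v * p)"
proof
  let ?A = "{z. poly p z = 0}"
  have p0: "p \<noteq> 0" using d by auto
  have fin: "finite ?A" using p0 by (rule poly_roots_finite)
  have pd: "pderiv p \<noteq> 0" using d by (simp add: pderiv_eq_0_iff)
  assume m: "card ?A \<le> m"
  let ?u = "\<Prod>z\<in>?A. [:-z, 1:]"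
  let ?P = "\<Prod>z\<in>?A. [:-z, 1:] ^ Polynomial.order z p"
  have dec: "Polynomial.smult (lead_coeff p) ?P = p" by (rule complex_poly_decompose)
  have "?P dvd ?u * pderiv ?P"
    by (rule dvd_radical_mult_pderiv[OF fin]) (use p0 order_root in auto)
  then obtain k where k: "?u * pderiv ?P = ?P * k" by (auto simp: dvd_def)
  have "?u * pderiv p = k * p"
    by (subst (1 2) dec[symmetric]) (simp add: pderiv_smult k mult.commute)
  moreover have u0: "?u \<noteq> 0" using fin by (auto simp: prod_zero_iff)
  moreover have du: "degree ?u \<le> m" using m fin by (subst degree_prod_eq_sum_degree) auto
  moreover have "degree k \<le> m"
  proof (cases "k = 0")
    case False
    then have "degree k + degree p = degree ?u + degree (pderiv p)"
      using \<open>?u * pderiv p = k * p\<close> u0 pd p0 by (metis degree_mult_eq)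
    then show ?thesis using du by (simp add: degree_pderiv)
  qed simp
  ultimately show "\<exists>u v. (u \<noteq> 0 \<or> v \<noteq> 0) \<and> degree u \<le> m \<and> degree v \<le> m \<and> u * pderiv p = v * p" by blast
next
  let ?A = "{z. poly p z = 0}"
  have p0: "p \<noteq> 0" using d by auto
  have pd: "pderiv p \<noteq> 0" using d by (simp add: pderiv_eq_0_iff)
  assume "\<exists>u v. (u \<noteq> 0 \<or> v \<noteq> 0) \<and> degree u \<le> m \<and> degree v \<le> m \<and> u * pderiv p = v * p"
  then obtain u v where uv: "u \<noteq> 0 \<or> v \<noteq> 0" "degree u \<le> m" "u * pderiv p = v * p" by blast
  have u0: "u \<noteq> 0" and v0: "v \<noteq> 0" using uv p0 pd by auto
  have "?A \<subseteq> {z. poly u z = 0}"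
  proof
    fix z assume "z \<in> ?A"
    then have z: "poly p z = 0" by simp
    have "Polynomial.order z (u * pderiv p) = Polynomial.order z u + Polynomial.order z (pderiv p)"
      using u0 pd by (intro order_mult) simp
    moreover have "Polynomial.order z (v * p) = Polynomial.order z v + Polynomial.order z p"
      using v0 p0 by (intro order_mult) simp
    moreover have "Polynomial.order z p = Suc (Polynomial.order z (pderiv p))"
      by (rule order_pderiv[OF p0 z])
    ultimately have "Polynomial.order z u \<noteq> 0" using uv(3) by simp
    then show "z \<in> {z. poly u z = 0}" using order_root by auto
  qed
  then have "card ?A \<le> card {z. poly u z = 0}" using poly_roots_finite[OF u0] by (rule card_mono[rotated])
  also have "\<dots> \<le> degree u" by (rule card_poly_roots_bound[OF u0])
  finally show "card ?A \<le> m" using uv(2) by simp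
qed

lemma coeff_mult_bounded:
  assumes "degree u \<le> m"
  shows "poly.coeff (u * q) k = (\<Sum>j<Suc m. (if j \<le> k then poly.coeff q (k - j) else 0) * poly.coeff u j)"
proof -
  have "poly.coeff (u * q) k = (\<Sum>j\<le>k. poly.coeff u j * poly.coeff q (k - j))" by (rule coeff_mult)
  also have "\<dots> = (\<Sum>j\<in>{..k} \<inter> {..<Suc m}. poly.coeff u j * poly.coeff q (k - j))"
  proof (rule sum.mono_neutral_right, simp, simp, rule ballI)
    fix i assume "i \<in> {..k} - {..k} \<inter> {..<Suc m}"
    then have "degree u < i" using assms by auto
    then show "poly.coeff u i * poly.coeff q (k - i) = 0" by (simp add: coeff_eq_0)
  qed
  also have "\<dots> = (\<Sum>j<Suc m. (if j \<le> k then poly.coeff q (k - j) else 0) * poly.coeff u j)"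
    by (intro sum.mono_neutral_cong_left) (auto simp: mult.commute)
  finally show ?thesis .
qed

lemma sum_lessThan_add: "(\<Sum>j<a + b. f j) = (\<Sum>j<a. f j) + (\<Sum>j<(b::nat). f (a + j) :: 'a::comm_monoid_add)"
  by (induction b) (auto simp: add.assoc)

lemma zero_determined_card_roots:
  assumes p: "monic_polyfun p"
  shows "zero_determined (\<lambda>x. card (complex_roots (p x)) \<le> m)"
proof -
  obtain d c where dc: "poly_coeffs p" "c \<noteq> 0" "\<And>x. degree (p x) = d" "\<And>x. lead_coeff (p x) = c"
    using p unfolding monic_polyfun_def by blast
  have pc: "polyfun (\<lambda>x. poly.coeff (p x) i)" for i using dc(1) by (simp add: poly_coeffs_def)
  show ?thesis
  proof (cases "d = 0")
    case True
    have "complex_roots (p x) = {}" for x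
    proof -
      obtain a where "p x = [:a:]" using dc(3)[of x] True degree_eq_zeroE by blast
      then show ?thesis using dc(2) dc(4)[of x] by (auto simp: complex_roots_def map_poly_pCons)
    qed
    then show ?thesis by (simp add: zero_determined_const)
  next
    case False
    \<comment> \<open>Row \<open>k\<close> expresses the coefficient of degree \<open>k\<close> in
      \<open>u * pderiv p - v * p\<close>. The first \<open>Suc m\<close> unknowns are the
      coefficients of \<open>u\<close>, the next \<open>Suc m\<close> those of \<open>v\<close>.
      Rows beyond \<open>m + d\<close> would be zero for degree reasons.\<close>
    define a where "a = (\<lambda>k j x. if j < Suc m then (if j \<le> k then poly.coeff (pderiv (p x)) (k - j) else 0)
      else (if j - Suc m \<le> k then - poly.coeff (p x) (k - (j - Suc m)) else 0))"
    have a: "polyfun (a k j)" for k j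
      unfolding a_def coeff_pderiv
      by (cases "j < Suc m"; cases "j \<le> k"; cases "j - Suc m \<le> k")
        (simp_all only: if_True if_False, auto intro!: polyfun.mult[OF polyfun.const pc] pc polyfun_minus polyfun.const)
    have eq: "card (complex_roots (p x)) \<le> m \<longleftrightarrow>
        (\<exists>w :: nat \<Rightarrow> complex. (\<exists>j<Suc m + Suc m. w j \<noteq> 0) \<and>
          (\<forall>r\<in>a ` {..m + d}. (\<Sum>j<Suc m + Suc m. complex_of_real (r j x) * w j) = 0))" for x
    proof -
      let ?P = "map_poly complex_of_real (p x)"
      have deg: "degree ?P = d" by (simp add: degree_map_poly dc)
      have pdP: "pderiv ?P = map_poly complex_of_real (pderiv (p x))"
        by (intro poly_eqI) (simp add: coeff_pderiv coeff_map_poly)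
      have row: "(\<Sum>j<Suc m + Suc m. complex_of_real (a k j x) * w j) = poly.coeff (u * pderiv ?P - v * ?P) k"
        if "degree u \<le> m" "degree v \<le> m" "\<And>j. j < Suc m \<Longrightarrow> w j = poly.coeff u j" "\<And>j. j < Suc m \<Longrightarrow> w (Suc m + j) = poly.coeff v j"
        for k w u v
      proof -
        have "(\<Sum>j<Suc m. complex_of_real (a k j x) * w j) = poly.coeff (u * pderiv ?P) k"
          unfolding coeff_mult_bounded[OF that(1)] pdP using that(3)
          by (intro sum.cong) (auto simp: a_def coeff_map_poly)
        moreover have "(\<Sum>j<Suc m. complex_of_real (a k (Suc m + j) x) * w (Suc m + j)) = - poly.coeff (v * ?P) k"
          unfolding coeff_mult_bounded[OF that(2)] sum_negf[symmetric] using that(4)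
          by (intro sum.cong) (auto simp: a_def coeff_map_poly)
        ultimately show ?thesis unfolding sum_lessThan_add by simp
      qed
      have zero: "poly.coeff (u * pderiv ?P - v * ?P) k = 0" if "degree u \<le> m" "degree v \<le> m" "k > m + d" for u v k
      proof -
        have "degree (u * pderiv ?P) \<le> m + d"
          using degree_mult_le[of u "pderiv ?P"] that(1) deg by (simp add: degree_pderiv)
        moreover have "degree (v * ?P) \<le> m + d" using degree_mult_le[of v ?P] that(2) deg by simp
        ultimately have "degree (u * pderiv ?P - v * ?P) \<le> m + d" by (rule degree_diff_le)
        then show ?thesis using that(3) by (intro coeff_eq_0) simp
      qed
      have "card (complex_roots (p x)) \<le> m \<longleftrightarrow>
        (\<exists>u v. (u \<noteq> 0 \<or> v \<noteq> 0) \<and> degree u \<le> m \<and> degree v \<le> m \<and> u * pderiv ?P = v * ?P)"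
        unfolding complex_roots_def using False deg by (intro card_roots_le_iff) simp
      also have "\<dots> \<longleftrightarrow> (\<exists>w :: nat \<Rightarrow> complex. (\<exists>j<Suc m + Suc m. w j \<noteq> 0) \<and>
          (\<forall>r\<in>a ` {..m + d}. (\<Sum>j<Suc m + Suc m. complex_of_real (r j x) * w j) = 0))"
      proof
        assume "\<exists>u v. (u \<noteq> 0 \<or> v \<noteq> 0) \<and> degree u \<le> m \<and> degree v \<le> m \<and> u * pderiv ?P = v * ?P"
        then obtain u v where uv: "u \<noteq> 0 \<or> v \<noteq> 0" "degree u \<le> m" "degree v \<le> m" "u * pderiv ?P = v * ?P" by blast
        define w where "w = (\<lambda>j. if j < Suc m then poly.coeff u j else poly.coeff v (j - Suc m))"
        have "\<exists>j<Suc m + Suc m. w j \<noteq> 0"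
        proof (cases "u = 0")
          case False
          then have "w (degree u) \<noteq> 0" using uv by (simp add: w_def)
          then show ?thesis using uv(2) by (intro exI[of _ "degree u"]) auto
        next
          case True
          then have "w (Suc m + degree v) \<noteq> 0" using uv by (simp add: w_def)
          then show ?thesis using uv(3) by (intro exI[of _ "Suc m + degree v"]) auto
        qed
        moreover have "(\<Sum>j<Suc m + Suc m. complex_of_real (a k j x) * w j) = 0" for k
          using row[OF uv(2,3), of w k] uv(4) by (simp add: w_def)
        ultimately show "\<exists>w :: nat \<Rightarrow> complex. (\<exists>j<Suc m + Suc m. w j \<noteq> 0) \<and>
          (\<forall>r\<in>a ` {..m + d}. (\<Sum>j<Suc m + Suc m. complex_of_real (r j x) * w j) = 0)"
          by (intro exI[of _ w]) auto
      next
        assume "\<exists>w :: nat \<Rightarrow> complex. (\<exists>j<Suc m + Suc m. w j \<noteq> 0) \<and>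
          (\<forall>r\<in>a ` {..m + d}. (\<Sum>j<Suc m + Suc m. complex_of_real (r j x) * w j) = 0)"
        then obtain w :: "nat \<Rightarrow> complex" where w: "\<exists>j<Suc m + Suc m. w j \<noteq> 0"
          "\<And>k. k \<le> m + d \<Longrightarrow> (\<Sum>j<Suc m + Suc m. complex_of_real (a k j x) * w j) = 0" by auto
        define u where "u = (\<Sum>j<Suc m. Polynomial.monom (w j) j)"
        define v where "v = (\<Sum>j<Suc m. Polynomial.monom (w (Suc m + j)) j)"
        have deg': "degree u \<le> m" "degree v \<le> m"
          unfolding u_def v_def
          by (rule degree_sum_le, simp, rule order_trans[OF degree_monom_le], simp)+
        have cu: "w j = poly.coeff u j" "w (Suc m + j) = poly.coeff v j" if "j < Suc m" for j
          using that by (simp_all add: u_def v_def coeff_sum coeff_monom)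
        have "u * pderiv ?P - v * ?P = 0"
        proof (rule poly_eqI)
          fix k show "poly.coeff (u * pderiv ?P - v * ?P) k = poly.coeff 0 k"
            using row[OF deg' cu, of k] w(2)[of k] zero[OF deg', of k] by (cases "k \<le> m + d") auto
        qed
        moreover have "u \<noteq> 0 \<or> v \<noteq> 0"
        proof (rule ccontr)
          assume "\<not> (u \<noteq> 0 \<or> v \<noteq> 0)"
          then have "w j = 0" if "j < Suc m + Suc m" for j
            using cu(1)[of j] cu(2)[of "j - Suc m"] that by (cases "j < Suc m") auto
          then show False using w(1) by blast
        qed
        ultimately show "\<exists>u v. (u \<noteq> 0 \<or> v \<noteq> 0) \<and> degree u \<le> m \<and> degree v \<le> m \<and> u * pderiv ?P = v * ?P"
          using deg' by (intro exI[of _ u] exI[of _ v]) auto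
      qed
      finally show ?thesis .
    qed
    show ?thesis unfolding eq
      by (rule zero_determined_linear_system) (auto intro: a)
  qed
qed

text \<open>The count is at most the degree, so its comparisons with the finitely many thresholds up
  to the degree determine it.\<close>

lemma card_roots_zero_determined:
  assumes p: "monic_polyfun p"
  shows "\<exists>F. finite F \<and> (\<forall>f\<in>F. polyfun f) \<and>
    (\<forall>x y. (\<forall>f\<in>F. f x = 0 \<longleftrightarrow> f y = 0) \<longrightarrow> card (complex_roots (p x)) = card (complex_roots (p y)))"
proof -
  obtain d c where dc: "c \<noteq> 0" "\<And>x. degree (p x) = d" "\<And>x. lead_coeff (p x) = c"
    using p unfolding monic_polyfun_def by blast
  have le: "card (complex_roots (p x)) \<le> d" for x
  proof -
    have "p x \<noteq> 0" using dc(1) dc(3)[of x] by auto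
    then have "map_poly complex_of_real (p x) \<noteq> 0" by (simp add: map_poly_eq_0_iff)
    then show ?thesis
      using card_poly_roots_bound[of "map_poly complex_of_real (p x)"] dc(2)[of x]
      by (simp add: complex_roots_def degree_map_poly)
  qed
  have "zero_determined (\<lambda>x. card (complex_roots (p x)) \<le> m)" for m
    by (rule zero_determined_card_roots[OF p])
  then have "\<forall>m. \<exists>F. finite F \<and> (\<forall>f\<in>F. polyfun f) \<and> (\<forall>x y. (\<forall>f\<in>F. f x = 0 \<longleftrightarrow> f y = 0) \<longrightarrow>
      (card (complex_roots (p x)) \<le> m \<longleftrightarrow> card (complex_roots (p y)) \<le> m))"
    unfolding zero_determined_def ..
  from choice[OF this] obtain G where "\<forall>m. finite (G m) \<and> (\<forall>f\<in>G m. polyfun f) \<and>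
      (\<forall>x y. (\<forall>f\<in>G m. f x = 0 \<longleftrightarrow> f y = 0) \<longrightarrow>
      (card (complex_roots (p x)) \<le> m \<longleftrightarrow> card (complex_roots (p y)) \<le> m))" ..
  then have G: "finite (G m)" "f \<in> G m \<Longrightarrow> polyfun f"
    "(\<forall>f\<in>G m. f x = 0 \<longleftrightarrow> f y = 0) \<Longrightarrow> (card (complex_roots (p x)) \<le> m \<longleftrightarrow> card (complex_roots (p y)) \<le> m)"
    for m f x y by simp_all
  show ?thesis
  proof (intro exI[of _ "\<Union>m\<le>d. G m"] conjI allI impI)
    fix x y assume *: "\<forall>f\<in>(\<Union>m\<le>d. G m). (f x = 0) = (f y = 0)"
    have "card (complex_roots (p x)) \<le> m \<longleftrightarrow> card (complex_roots (p y)) \<le> m" if "m \<le> d" for m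
      using G(3)[of m x y] * that by blast
    then show "card (complex_roots (p x)) = card (complex_roots (p y))"
      using le by (metis le_antisym le_refl)
  qed (use G in auto)
qed

section \<open>Shears and the induction on dimension\<close>

section \<open>Cylindrical decomposition\<close>

lemma complex_compact:
  fixes \<C> :: "'a::t2_space set set"
  assumes "cell_complex \<C>"
  shows "compact (\<Union>\<C>)"
proof -
  have "\<Union>\<C> = (\<Union>C\<in>\<C>. closure C)"
    using cells(4)[OF assms] closure_subset by blast
  moreover have "compact (closure C)" if "C \<in> \<C>" for C
    using cells(2)[OF assms that] by (simp add: cell_def)
  ultimately show ?thesis using cells(1)[OF assms] by (auto intro: compact_UN)
qed

lemma closure_homeomorphism_image:
  fixes K :: "'a::t2_space set" and K' :: "'b::t2_space set"
  assumes h: "homeomorphism K K' \<theta> \<theta>'" and K: "compact K" and C: "C \<subseteq> K"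
  shows "closure C \<subseteq> K" "closure (\<theta> ` C) = \<theta> ` closure C" "closure (\<theta> ` C) - \<theta> ` C = \<theta> ` (closure C - C)"
proof -
  show sub: "closure C \<subseteq> K" using C K by (simp add: closure_minimal compact_imp_closed)
  have c: "continuous_on (closure C) \<theta>" using h sub by (meson continuous_on_subset homeomorphism_def)
  have cpt: "compact (closure C)" using K sub by (metis closed_closure compact_Int_closed inf.absorb_iff2)
  show cl: "closure (\<theta> ` C) = \<theta> ` closure C"
  proof
    show "closure (\<theta> ` C) \<subseteq> \<theta> ` closure C"
      by (intro closure_minimal image_mono closure_subset compact_imp_closed compact_continuous_image[OF c cpt])
    show "\<theta> ` closure C \<subseteq> closure (\<theta> ` C)"
      by (rule image_closure_subset[OF c]) (auto simp: closure_subset[THEN subsetD])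
  qed
  have inj: "inj_on \<theta> K" using homeomorphism_apply1[OF h] by (rule inj_on_inverseI)
  show "closure (\<theta> ` C) - \<theta> ` C = \<theta> ` (closure C - C)"
    unfolding cl using inj_on_image_set_diff[OF inj, of "closure C" C] sub C by blast
qed

lemma cell_image:
  fixes K :: "'a::t2_space set" and K' :: "'b::t2_space set"
  assumes h: "homeomorphism K K' \<theta> \<theta>'" and K: "compact K" and C: "C \<subseteq> K" "cell C"
  shows "cell (\<theta> ` C)"
proof -
  note CC = C(2)[unfolded cell_def]
  note cl = closure_homeomorphism_image[OF h K C(1)]
  note ap = homeomorphism_apply1[OF h] homeomorphism_apply2[OF h]
  have c\<theta>: "continuous_on K \<theta>" "\<theta> ` K = K'" and c\<theta>': "continuous_on K' \<theta>'" "\<theta>' ` K' = K"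
    using h by (auto simp: homeomorphism_def)
  have inj: "inj_on \<theta> K" using ap(1) by (rule inj_on_inverseI)
  have hC: "homeomorphism (closure C) (\<theta> ` closure C) \<theta> \<theta>'"
    by (rule homeomorphism_of_subsets[OF h cl(1)]) (use cl(1) c\<theta> in auto)
  have bc: "boundary_connected (\<theta> ` C)"
    unfolding boundary_connected_def cl(2)
  proof (intro ballI allI impI)
    fix y U assume "y \<in> \<theta> ` closure C" and U: "open U" "y \<in> U"
    then obtain x where x: "x \<in> closure C" "y = \<theta> x" by auto
    obtain A where A: "open A" "A \<inter> K = \<theta> -` U \<inter> K"
      using c\<theta>(1) U(1) unfolding continuous_on_open_invariant by metis
    have "x \<in> A" using A x cl(1) U by blast
    then obtain V where V: "open V" "x \<in> V" "V \<subseteq> A" "connected (V \<inter> C)"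
      using boundary_connectedD[of C x A] CC x A by metis
    obtain W where W: "open W" "W \<inter> K' = \<theta>' -` V \<inter> K'"
      using c\<theta>'(1) V(1) unfolding continuous_on_open_invariant by metis
    have yK: "y \<in> K'" using x cl(1) c\<theta>(2) by blast
    have "\<theta>' y = x" using x ap(1) cl(1) by blast
    then have "y \<in> W" using W V yK by blast
    moreover have "(W \<inter> U) \<inter> \<theta> ` C = \<theta> ` (V \<inter> C)"
    proof
      show "(W \<inter> U) \<inter> \<theta> ` C \<subseteq> \<theta> ` (V \<inter> C)"
      proof
        fix z assume z: "z \<in> (W \<inter> U) \<inter> \<theta> ` C"
        then obtain w where w: "w \<in> C" "z = \<theta> w" by auto
        then have "z \<in> K'" "\<theta>' z = w" using C(1) c\<theta>(2) ap(1) by blast+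
        then have "w \<in> V" using z W(2) by blast
        then show "z \<in> \<theta> ` (V \<inter> C)" using w by blast
      qed
      show "\<theta> ` (V \<inter> C) \<subseteq> (W \<inter> U) \<inter> \<theta> ` C"
      proof
        fix z assume "z \<in> \<theta> ` (V \<inter> C)"
        then obtain w where w: "w \<in> V" "w \<in> C" "z = \<theta> w" by auto
        then have wK: "w \<in> K" using C(1) by blast
        then have "z \<in> K'" "\<theta>' z = w" using w c\<theta>(2) ap(1) by blast+
        then have "z \<in> W" using W(2) w by blast
        moreover have "z \<in> U" using w wK V(3) A(2) by blast
        ultimately show "z \<in> (W \<inter> U) \<inter> \<theta> ` C" using w by blast
      qed
    qed
    moreover have "connected (\<theta> ` (V \<inter> C))"
      using V(4) C(1) by (intro connected_continuous_image continuous_on_subset[OF c\<theta>(1)]) auto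
    ultimately show "\<exists>V. open V \<and> y \<in> V \<and> V \<subseteq> U \<and> connected (V \<inter> \<theta> ` C)"
      using W(1) U by (intro exI[of _ "W \<inter> U"]) auto
  qed
  have "contractible_space (top_of_set (\<theta> ` closure C))"
  proof (rule contractible_space_retraction_map_image)
    show "retraction_map (top_of_set (closure C)) (top_of_set (\<theta> ` closure C)) \<theta>"
      unfolding retraction_map_def retraction_maps_def
      using hC by (intro exI[of _ \<theta>']) (auto simp: homeomorphism_def continuous_map_in_subtopology)
    show "contractible_space (top_of_set (closure C))" using CC by simp
  qed
  then have ctr: "contractible (\<theta> ` closure C)" by simp
  have cpt: "compact (\<theta> ` closure C)"
    using CC cl(1) by (intro compact_continuous_image continuous_on_subset[OF c\<theta>(1)]) auto
  have conn: "connected (\<theta> ` C)"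
    using CC C(1) by (intro connected_continuous_image continuous_on_subset[OF c\<theta>(1)]) auto
  have "compact (closure C - C)" using CC by (metis Diff_subset compact_Int_closed inf.absorb_iff2)
  then have "compact (\<theta> ` (closure C - C))"
    using cl(1) by (intro compact_continuous_image continuous_on_subset[OF c\<theta>(1)]) auto
  then have cd: "closed (\<theta> ` (closure C - C))" by (rule compact_imp_closed)
  have cof: "cofibration (\<theta> ` closure C) (\<theta> ` (closure C - C))"
    by (rule cofibration_homeomorphism[OF _ hC refl]) (use CC in simp)
  show ?thesis
    unfolding cell_def cl(3) unfolding cl(2) using bc ctr cpt conn cd cof CC by simp
qed

lemma cell_complex_image:
  fixes \<C> :: "'a::t2_space set set" and K' :: "'b::t2_space set"
  assumes complex: "cell_complex \<C>" and h: "homeomorphism (\<Union>\<C>) K' \<theta> \<theta>'"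
  shows "cell_complex ((`) \<theta> ` \<C>)"
proof -
  note cc = cells[OF complex]
  have K: "compact (\<Union>\<C>)" by (rule complex_compact[OF complex])
  have sub: "C \<subseteq> \<Union>\<C>" if "C \<in> \<C>" for C using that by blast
  note cl = closure_homeomorphism_image[OF h K sub]
  have inj: "inj_on \<theta> (\<Union>\<C>)" using homeomorphism_apply1[OF h] by (rule inj_on_inverseI)
  have int: "\<theta> ` A \<inter> \<theta> ` B = \<theta> ` (A \<inter> B)" if "A \<subseteq> \<Union>\<C>" "B \<subseteq> \<Union>\<C>" for A B
    using inj_on_image_Int[OF inj that] by simp
  show ?thesis
    unfolding cell_complex_def
  proof (intro conjI ballI impI)
    show "finite ((`) \<theta> ` \<C>)" using cc(1) by simp
    show "cell D" if "D \<in> (`) \<theta> ` \<C>" for D using that cell_image[OF h K sub] cc(2) by blast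
    show "pairwise disjnt ((`) \<theta> ` \<C>)"
      unfolding pairwise_def disjnt_def
    proof (intro ballI impI)
      fix D D' assume "D \<in> (`) \<theta> ` \<C>" "D' \<in> (`) \<theta> ` \<C>" "D \<noteq> D'"
      then obtain C C' where C: "C \<in> \<C>" "D = \<theta> ` C" "C' \<in> \<C>" "D' = \<theta> ` C'" "C \<noteq> C'" by auto
      then have "C \<inter> C' = {}" using cc(5) by blast
      then show "D \<inter> D' = {}" using C int[OF sub sub, of C C'] by simp
    qed
    show "D' \<subseteq> closure D" if D: "D \<in> (`) \<theta> ` \<C>" "D' \<in> (`) \<theta> ` \<C>" "D' \<inter> closure D \<noteq> {}" for D D'
    proof -
      obtain C C' where C: "C \<in> \<C>" "D = \<theta> ` C" "C' \<in> \<C>" "D' = \<theta> ` C'" using D by auto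
      have "\<theta> ` (C' \<inter> closure C) \<noteq> {}"
        using D(3) C int[OF sub cl(1), of C' C] cl(2)[OF C(1)] by simp
      then have "C' \<subseteq> closure C" using cc(3)[OF C(1,3)] by blast
      then show ?thesis using C cl(2)[OF C(1)] by auto
    qed
    show "closure D \<subseteq> \<Union>((`) \<theta> ` \<C>)" if D: "D \<in> (`) \<theta> ` \<C>" for D
    proof -
      obtain C where C: "C \<in> \<C>" "D = \<theta> ` C" using D by auto
      then have "closure D \<subseteq> \<theta> ` \<Union>\<C>" using cl(1,2)[OF C(1)] by auto
      then show ?thesis unfolding image_Union .
    qed
  qed
qed

lemma cell_singleton: "cell {a :: 'a::t2_space}"
proof -
  have "boundary_connected {a}"
    unfolding boundary_connected_def
  proof (intro ballI allI impI)
    fix x U assume "x \<in> closure {a}" "open U" "x \<in> U"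
    then show "\<exists>V. open V \<and> x \<in> V \<and> V \<subseteq> U \<and> connected (V \<inter> {a})"
      by (intro exI[of _ U]) (cases "a \<in> U"; auto)
  qed
  moreover have "contractible {a}" by (metis contractible_space_top_of_set contractible_space_subtopology_singleton)
  ultimately show ?thesis unfolding cell_def by (simp add: cofibration_empty)
qed

definition bounded_coords :: "point set \<Rightarrow> bool" where
  "bounded_coords S \<longleftrightarrow> (\<exists>r. \<forall>x\<in>S. \<forall>i. \<bar>x i\<bar> \<le> r)"

lemma continuous_on_coord_compose:
  fixes f :: "'a::topological_space \<Rightarrow> point"
  shows "continuous_on S f \<Longrightarrow> continuous_on S (\<lambda>x. f x i)"
  by (rule continuous_on_product_then_coordinatewise)

text \<open>A point is moved along \<open>u\<close> until its coordinate \<open>n\<close> vanishes,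
  and the parameter is recorded. This splits off the direction in which the polynomials are
  monic.\<close>

lemma translate_homeomorphism:
  assumes u: "u \<in> coord_space (Suc n)" "u n \<noteq> 0"
  shows "homeomorphism (coord_space n \<times> UNIV) (coord_space (Suc n)) (\<lambda>z. translate u (fst z) (snd z))
    (\<lambda>y. (translate u y (- (y n / u n)), y n / u n))"
proof (rule homeomorphismI)
  show "continuous_on (coord_space n \<times> UNIV) (\<lambda>z. translate u (fst z) (snd z))"
    unfolding translate_def by (intro continuous_intros continuous_on_coord_compose)
  show "continuous_on (coord_space (Suc n)) (\<lambda>y. (translate u y (- (y n / u n)), y n / u n))"
    unfolding translate_def using u(2) by (intro continuous_intros continuous_on_coord_compose) auto
  show "(\<lambda>z. translate u (fst z) (snd z)) ` (coord_space n \<times> UNIV) \<subseteq> coord_space (Suc n)"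
    using u(1) by (auto simp: coord_space_def translate_def)
  show "(\<lambda>y. (translate u y (- (y n / u n)), y n / u n)) ` coord_space (Suc n) \<subseteq> coord_space n \<times> UNIV"
  proof (rule image_subsetI)
    fix y assume y: "y \<in> coord_space (Suc n)"
    have "translate u y (- (y n / u n)) i = 0" if "i \<ge> n" for i
    proof (cases "i = n")
      case True
      then show ?thesis using u(2) by (simp add: translate_def)
    next
      case False
      then have "y i = 0" "u i = 0" using u(1) y that by (auto simp: coord_space_def)
      then show ?thesis by (simp add: translate_def)
    qed
    then show "(translate u y (- (y n / u n)), y n / u n) \<in> coord_space n \<times> UNIV"
      by (simp add: coord_space_def)
  qed
  show "(translate u (translate u (fst z) (snd z)) (- (translate u (fst z) (snd z) n / u n)),
      translate u (fst z) (snd z) n / u n) = z" if zV: "z \<in> coord_space n \<times> UNIV" for z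
  proof -
    obtain x t where z: "z = (x, t)" "x n = 0" using zV by (cases z) (auto simp: coord_space_def)
    then have "translate u (fst z) (snd z) n / u n = t" using u(2) by (simp add: translate_def)
    moreover have "translate u (translate u x t) (- t) = x" by (simp add: translate_def)
    ultimately show ?thesis using z(1) by simp
  qed
  show "translate u (fst (translate u y (- (y n / u n)), y n / u n)) (snd (translate u y (- (y n / u n)), y n / u n)) = y"
    if "y \<in> coord_space (Suc n)" for y
    by (auto simp: translate_def)
qed

text \<open>Induction on the dimension. The polynomials that decide the root counts are imposed on a
  decomposition of \<open>coord_space n\<close>; over its cells the real roots form families, and
  the resulting cylinder is sheared back along \<open>u\<close>.\<close>

theorem cylindrical_decomposition:
  assumes "finite F" "\<And>f. f \<in> F \<Longrightarrow> polyfun f" "B \<subseteq> coord_space n" "bounded_coords B"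
  shows "\<exists>\<C>. cell_complex \<C> \<and> B \<subseteq> \<Union>\<C> \<and> \<Union>\<C> \<subseteq> coord_space n \<and>
    (\<forall>f\<in>F. \<forall>C\<in>\<C>. (\<forall>x\<in>C. f x = 0) \<or> (\<forall>x\<in>C. f x \<noteq> 0))"
  using assms
proof (induction n arbitrary: F B)
  case 0
  let ?o = "\<lambda>i::nat. 0::real"
  have V: "coord_space 0 = {?o}" by (auto simp: coord_space_def)
  have "cell_complex {{?o}}" unfolding cell_complex_def by (simp add: cell_singleton)
  then show ?case using 0(3) V by (intro exI[of _ "{{?o}}"]) auto
next
  case (Suc n)
  let ?V = "coord_space (Suc n)"
  \<comment> \<open>A polynomial that vanishes on the whole coordinate space has no top part to
    avoid, and it is zero on every cell anyway.\<close>
  define F' where "F' = {f \<in> F. \<exists>x\<in>?V. f x \<noteq> 0}"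
  have F': "finite F'" "\<And>f. f \<in> F' \<Longrightarrow> polyfun f \<and> (\<exists>x\<in>?V. f x \<noteq> 0)" using Suc.prems by (auto simp: F'_def)
  obtain u P where u: "u \<in> ?V" "u n \<noteq> 0" and P: "\<And>f. f \<in> F' \<Longrightarrow> monic_polyfun (P f)"
    "\<And>f x t. f \<in> F' \<Longrightarrow> x \<in> ?V \<Longrightarrow> poly (P f x) t = f (translate u x t)"
    by (rule monic_direction[OF F'], assumption, rule that)
  define Q where "Q = (\<lambda>x. \<Prod>f\<in>F'. P f x)"
  have Q: "monic_polyfun Q" unfolding Q_def using monic_polyfun_prod[OF F'(1) P(1)] .
  \<comment> \<open>The product \<open>Q\<close> supplies the branches. Each factor is included as
    well, so that its own real roots form a family, to which \<open>subfamily_constant\<close>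
    applies inside \<open>cylinder_complex\<close>.\<close>
  define \<P> where "\<P> = insert Q (P ` F')"
  have \<P>: "finite \<P>" "\<And>p. p \<in> \<P> \<Longrightarrow> monic_polyfun p" using F' P Q by (auto simp: \<P>_def)
  have "\<forall>p\<in>\<P>. \<exists>G. finite G \<and> (\<forall>f\<in>G. polyfun f) \<and>
      (\<forall>x y. (\<forall>f\<in>G. f x = 0 \<longleftrightarrow> f y = 0) \<longrightarrow> card (complex_roots (p x)) = card (complex_roots (p y)))"
  proof (rule ballI)
    fix p assume "p \<in> \<P>"
    from card_roots_zero_determined[OF \<P>(2)[OF this]]
    show "\<exists>G. finite G \<and> (\<forall>f\<in>G. polyfun f) \<and>
      (\<forall>x y. (\<forall>f\<in>G. f x = 0 \<longleftrightarrow> f y = 0) \<longrightarrow> card (complex_roots (p x)) = card (complex_roots (p y)))" .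
  qed
  from bchoice[OF this] obtain G where G0: "\<forall>p\<in>\<P>. finite (G p) \<and> (\<forall>f\<in>G p. polyfun f) \<and>
      (\<forall>x y. (\<forall>f\<in>G p. f x = 0 \<longleftrightarrow> f y = 0) \<longrightarrow> card (complex_roots (p x)) = card (complex_roots (p y)))" ..
  define H where "H = (\<Union>p\<in>\<P>. G p)"
  have H: "finite H" "\<And>f. f \<in> H \<Longrightarrow> polyfun f" using \<P>(1) G0 by (auto simp: H_def)
  let ?\<theta> = "\<lambda>z. translate u (fst z) (snd z)"
  let ?\<theta>' = "\<lambda>y. (translate u y (- (y n / u n)), y n / u n)"
  note hom = translate_homeomorphism[OF u]
  \<comment> \<open>The shadow of \<open>B\<close> under projection along \<open>u\<close>, which
    the base cells have to cover.\<close>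
  define B0 where "B0 = (\<lambda>y. translate u y (- (y n / u n))) ` B"
  obtain b where b: "\<And>x i. x \<in> B \<Longrightarrow> \<bar>x i\<bar> \<le> b" using Suc.prems(4) unfolding bounded_coords_def by blast
  have B0V: "B0 \<subseteq> coord_space n"
    unfolding B0_def using homeomorphism_image2[OF hom] Suc.prems(3) by auto
  obtain ub where ub: "\<And>i. \<bar>u i\<bar> \<le> ub"
  proof (rule that[of "\<Sum>i\<le>n. \<bar>u i\<bar>"])
    fix i show "\<bar>u i\<bar> \<le> (\<Sum>i\<le>n. \<bar>u i\<bar>)"
    proof (cases "i \<le> n")
      case True
      then show ?thesis by (intro member_le_sum) auto
    next
      case False
      then have "u i = 0" using u(1) by (auto simp: coord_space_def)
      then show ?thesis by (simp add: sum_nonneg)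
    qed
  qed
  have B0b: "bounded_coords B0"
    unfolding bounded_coords_def
  proof (intro exI[of _ "b + b / \<bar>u n\<bar> * ub"] ballI allI)
    fix x i assume "x \<in> B0"
    then obtain y where y: "y \<in> B" "x = translate u y (- (y n / u n))" by (auto simp: B0_def)
    have b0: "0 \<le> b" using b[OF y(1), of i] by linarith
    have "x i = y i - y n / u n * u i" unfolding y(2) translate_def by simp
    then have "\<bar>x i\<bar> \<le> \<bar>y i\<bar> + \<bar>y n / u n * u i\<bar>" by (simp only: abs_triangle_ineq4)
    also have "\<dots> \<le> b + b / \<bar>u n\<bar> * ub"
      unfolding abs_mult abs_divide using b[OF y(1)] ub b0 by (intro add_mono mult_mono divide_right_mono) auto
    finally show "\<bar>x i\<bar> \<le> b + b / \<bar>u n\<bar> * ub" .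
  qed
  have ex: "\<exists>\<C>. cell_complex \<C> \<and> B0 \<subseteq> \<Union>\<C> \<and> \<Union>\<C> \<subseteq> coord_space n \<and>
    (\<forall>f\<in>H. \<forall>C\<in>\<C>. (\<forall>x\<in>C. f x = 0) \<or> (\<forall>x\<in>C. f x \<noteq> 0))"
    by (rule Suc.IH[OF H(1) _ B0V B0b]) (rule H(2))
  obtain \<C> where \<C>: "cell_complex \<C>" "B0 \<subseteq> \<Union>\<C>" "\<Union>\<C> \<subseteq> coord_space n"
    "\<forall>f\<in>H. \<forall>C\<in>\<C>. (\<forall>x\<in>C. f x = 0) \<or> (\<forall>x\<in>C. f x \<noteq> 0)"
    using ex by (elim exE conjE) (rule that)
  have M: "compact (\<Union>\<C>)" by (rule complex_compact[OF \<C>(1)])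
  have conn: "connected C" if "C \<in> \<C>" for C using cells(2)[OF \<C>(1) that] by (simp add: cell_def)
  have const: "card (complex_roots (p x)) = card (complex_roots (p y))"
    if "p \<in> \<P>" "C \<in> \<C>" "x \<in> C" "y \<in> C" for p C x y
  proof -
    have "\<forall>f\<in>G p. f x = 0 \<longleftrightarrow> f y = 0" using \<C>(4) that by (auto simp: H_def)
    then show ?thesis using G0 that(1) by blast
  qed
  have VS: "x \<in> ?V" if "x \<in> coord_space n" for x using that by (auto simp: coord_space_def)
  obtain \<rho> where \<rho>: "\<rho> > 0" "\<And>x z. x \<in> \<Union>\<C> \<Longrightarrow> z \<in> complex_roots (Q x) \<Longrightarrow> norm z \<le> \<rho>"
    by (rule monic_family_roots_bounded[OF monic_family_polyfun[OF Q] M]) (rule that)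
  \<comment> \<open>Larger than every root of \<open>Q\<close> over the base, and at least the
    absolute height \<open>y n / u n\<close> of every point of \<open>B\<close>.\<close>
  define R where "R = \<rho> + \<bar>b\<bar> / \<bar>u n\<bar> + 1"
  have "\<bar>b\<bar> / \<bar>u n\<bar> \<ge> 0" by simp
  then have R: "R > \<rho>" "R \<ge> \<bar>b\<bar> / \<bar>u n\<bar>" "R > 0" using \<rho>(1) unfolding R_def by linarith+
  let ?q = "[:- (R * R), 0, 1:] :: real poly"
  \<comment> \<open>The quadratic factor adds the roots \<open>-R\<close> and \<open>R\<close>. Over
    the base they are never roots of \<open>Q\<close>, so the number of distinct roots over a cell
    stays constant.\<close>
  define T where "T = (\<lambda>x. Q x * ?q)"
  have T: "monic_polyfun T" unfolding T_def by (intro monic_polyfun_mult Q monic_polyfun_const) simp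
  have val_q: "poly (map_poly complex_of_real ?q) z = z * z - complex_of_real R * complex_of_real R" for z
    by (simp add: map_poly_pCons)
  have map_mult: "map_poly complex_of_real (a * b) = map_poly complex_of_real a * map_poly complex_of_real b" for a b
    by (intro poly_eqI) (simp add: coeff_map_poly coeff_mult)
  have roots_T: "complex_roots (T x) = complex_roots (Q x) \<union> {complex_of_real R, - complex_of_real R}" for x
  proof -
    have "map_poly complex_of_real (T x) = map_poly complex_of_real (Q x) * map_poly complex_of_real ?q"
      unfolding T_def by (rule map_mult)
    then show ?thesis unfolding complex_roots_def by (auto simp: val_q square_eq_iff simp del: map_poly_pCons)
  qed
  have disj: "complex_roots (Q x) \<inter> {complex_of_real R, - complex_of_real R} = {}" if "x \<in> \<Union>\<C>" for x
    using \<rho>(2)[OF that] R by fastforce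
  have Q0: "Q x \<noteq> 0" for x using Q unfolding monic_polyfun_def by (metis leading_coeff_0_iff)
  have constT: "card (complex_roots (T x)) = card (complex_roots (T y))" if C: "C \<in> \<C>" "x \<in> C" "y \<in> C" for C x y
  proof -
    have U: "x \<in> \<Union>\<C>" "y \<in> \<Union>\<C>" using C by blast+
    have "card (complex_roots (T z)) = card (complex_roots (Q z)) + card {complex_of_real R, - complex_of_real R}"
      if "z \<in> \<Union>\<C>" for z
      unfolding roots_T by (rule card_Un_disjoint[OF finite_complex_roots[OF Q0] _ disj[OF that]]) simp
    moreover have "card (complex_roots (Q x)) = card (complex_roots (Q y))"
      by (rule const[OF _ C]) (simp add: \<P>_def)
    ultimately show ?thesis using U by simp
  qed
  have real_T: "real_roots (T x) = real_roots (Q x) \<union> {R, - R}" for x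
    unfolding real_roots_def T_def by (auto simp: square_eq_iff algebra_simps)
  have fam: "root_family \<C> (\<lambda>x. real_roots (T x))"
    by (rule root_family_real_roots[OF monic_family_polyfun[OF T] M conn constT])
  have famP: "root_family \<C> (\<lambda>x. real_roots (p x))" if "p \<in> \<P>" for p
    by (rule root_family_real_roots[OF monic_family_polyfun[OF \<P>(2)[OF that]] M conn const[OF that]])
  have ends: "- R \<in> real_roots (T x) \<and> R \<in> real_roots (T x) \<and> real_roots (T x) \<subseteq> {- R..R}" if "x \<in> \<Union>\<C>" for x
  proof -
    have "\<bar>t\<bar> \<le> R" if "t \<in> real_roots (Q x)" for t
      using \<rho>(2)[OF \<open>x \<in> \<Union>\<C>\<close>, of "complex_of_real t"] that complex_roots_real R by simp
    then have "t \<in> {- R..R}" if "t \<in> real_roots (Q x)" for t using that by (fastforce simp: abs_le_iff)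
    then show ?thesis unfolding real_T using R(3) by auto
  qed
  obtain \<D> where \<D>: "cell_complex \<D>" "\<Union>\<D> = \<Union>\<C> \<times> {-R..R}"
    "\<And>r' D. root_family \<C> r' \<Longrightarrow> (\<And>x. x \<in> \<Union>\<C> \<Longrightarrow> r' x \<subseteq> real_roots (T x)) \<Longrightarrow> D \<in> \<D> \<Longrightarrow>
       (\<forall>z\<in>D. snd z \<in> r' (fst z)) \<or> (\<forall>z\<in>D. snd z \<notin> r' (fst z))"
    apply (rule cylinder_complex[OF \<C>(1) fam ends])
     apply assumption
    subgoal premises prems for \<D> by (rule prems(1)[OF prems(2-4)])
    done
  have DV: "\<Union>\<D> \<subseteq> coord_space n \<times> UNIV" using \<D>(2) \<C>(3) by auto
  have homD: "homeomorphism (\<Union>\<D>) (?\<theta> ` \<Union>\<D>) ?\<theta> ?\<theta>'"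
    by (rule homeomorphism_of_subsets[OF hom DV]) (use homeomorphism_image1[OF hom] DV in auto)
  show ?case
  proof (intro exI[of _ "(`) ?\<theta> ` \<D>"] conjI ballI)
    show "cell_complex ((`) ?\<theta> ` \<D>)" by (rule cell_complex_image[OF \<D>(1) homD])
    show "\<Union>((`) ?\<theta> ` \<D>) \<subseteq> ?V" using DV homeomorphism_image1[OF hom] by blast
    show "B \<subseteq> \<Union>((`) ?\<theta> ` \<D>)"
    proof
      fix y assume y: "y \<in> B"
      have "translate u y (- (y n / u n)) \<in> \<Union>\<C>" using y \<C>(2) by (auto simp: B0_def)
      moreover have "y n / u n \<in> {- R..R}"
      proof -
        have "\<bar>y n / u n\<bar> \<le> \<bar>b\<bar> / \<bar>u n\<bar>"
          unfolding abs_divide using b[OF y, of n] by (intro divide_right_mono) auto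
        then have "\<bar>y n / u n\<bar> \<le> R" using R(2) by (rule order_trans)
        then show ?thesis unfolding atLeastAtMost_iff abs_le_iff by linarith
      qed
      ultimately have "?\<theta>' y \<in> \<Union>\<D>" unfolding \<D>(2) by simp
      then obtain D where "D \<in> \<D>" "?\<theta>' y \<in> D" by blast
      moreover have "?\<theta> (?\<theta>' y) = y" using homeomorphism_apply2[OF hom] y Suc.prems(3) by blast
      ultimately show "y \<in> \<Union>((`) ?\<theta> ` \<D>)" by (intro UN_I[of D]) (auto intro: rev_image_eqI)
    qed
    fix f C assume f: "f \<in> F" and C: "C \<in> (`) ?\<theta> ` \<D>"
    obtain D where D: "D \<in> \<D>" "C = ?\<theta> ` D" using C by auto
    show "(\<forall>x\<in>C. f x = 0) \<or> (\<forall>x\<in>C. f x \<noteq> 0)"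
    proof (cases "f \<in> F'")
      case False
      have "C \<subseteq> ?V" using D DV homeomorphism_image1[OF hom] by blast
      then show ?thesis using False f by (auto simp: F'_def)
    next
      case True
      have sub: "real_roots (P f x) \<subseteq> real_roots (T x)" for x
      proof -
        have "P f x dvd Q x" unfolding Q_def using True F'(1) by (rule dvd_prodI[rotated])
        then show ?thesis unfolding real_T by (auto simp: real_roots_def elim: dvdE)
      qed
      have "root_family \<C> (\<lambda>x. real_roots (P f x))" using famP True by (auto simp: \<P>_def)
      from \<D>(3)[OF this sub D(1)]
      have "(\<forall>z\<in>D. snd z \<in> real_roots (P f (fst z))) \<or> (\<forall>z\<in>D. snd z \<notin> real_roots (P f (fst z)))" .
      moreover have "snd z \<in> real_roots (P f (fst z)) \<longleftrightarrow> f (?\<theta> z) = 0" if "z \<in> D" for z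
      proof -
        have "fst z \<in> ?V" using that D(1) DV VS by (force simp: mem_Times_iff)
        then show ?thesis using P(2)[OF True] by (simp add: real_roots_def)
      qed
      ultimately show ?thesis unfolding D(2) by (simp add: ball_simps)
    qed
  qed
qed

section \<open>Tame sets and products with intervals and the plane\<close>

section \<open>Euler characteristics of bounded semialgebraic sets\<close>

definition locally_closed :: "'a::topological_space set \<Rightarrow> bool" where
  "locally_closed S \<longleftrightarrow> closed (closure S - S)"

lemma locally_closed_closed_Int_open:
  assumes "closed K" "open U"
  shows "locally_closed (K \<inter> U)"
proof -
  have "closure (K \<inter> U) - K \<inter> U = closure (K \<inter> U) - U"
    using closure_minimal[of "K \<inter> U" K] assms(1) by auto
  then show ?thesis unfolding locally_closed_def using assms(2) by (simp only: closed_Diff closed_closure)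
qed

lemma locally_closedE:
  assumes "locally_closed S"
  obtains K U where "closed K" "open U" "S = K \<inter> U"
proof (rule that)
  show "S = closure S \<inter> - (closure S - S)" using closure_subset[of S] by blast
  show "closed (closure S)" by (rule closed_closure)
  show "open (- (closure S - S))" using assms unfolding locally_closed_def by (rule open_Compl)
qed

lemma locally_closed_Int:
  assumes "locally_closed S" "locally_closed T"
  shows "locally_closed (S \<inter> T)"
proof -
  obtain K U where KU: "closed K" "open U" "S = K \<inter> U" using assms(1) by (rule locally_closedE)
  obtain L V where LV: "closed L" "open V" "T = L \<inter> V" using assms(2) by (rule locally_closedE)
  have "S \<inter> T = (K \<inter> L) \<inter> (U \<inter> V)" using KU(3) LV(3) by blast
  then show ?thesis using KU LV by (simp add: locally_closed_closed_Int_open closed_Int open_Int)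
qed

lemma locally_closed_closed: "closed K \<Longrightarrow> locally_closed K"
  using locally_closed_closed_Int_open[of K UNIV] by simp

lemma locally_closed_vimage:
  assumes "locally_closed S" "continuous_on UNIV f"
  shows "locally_closed (f -` S)"
proof -
  obtain K U where "closed K" "open U" "S = K \<inter> U" using assms(1) by (rule locally_closedE)
  then show ?thesis
    using assms(2) by (auto simp: vimage_Int intro!: locally_closed_closed_Int_open closed_vimage open_vimage)
qed

text \<open>Dependence on the signs of finitely many polynomials describes the finite Boolean
  combinations of polynomial equations and inequalities without naming a formula.\<close>

definition semialgebraic :: "point set \<Rightarrow> bool" where
  "semialgebraic S \<longleftrightarrow> (\<exists>F. finite F \<and> (\<forall>f\<in>F. polyfun f) \<and>
     (\<forall>x y. (\<forall>f\<in>F. sgn (f x) = sgn (f y)) \<longrightarrow> (x \<in> S \<longleftrightarrow> y \<in> S)))"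

lemma semialgebraic_Compl: "semialgebraic S \<Longrightarrow> semialgebraic (- S)"
  unfolding semialgebraic_def by simp

lemma semialgebraic_Int:
  assumes "semialgebraic S" "semialgebraic T"
  shows "semialgebraic (S \<inter> T)"
proof -
  obtain F where F: "finite F" "\<forall>f\<in>F. polyfun f" "\<forall>x y. (\<forall>f\<in>F. sgn (f x) = sgn (f y)) \<longrightarrow> (x \<in> S \<longleftrightarrow> y \<in> S)"
    using assms(1) unfolding semialgebraic_def by auto
  obtain G where G: "finite G" "\<forall>f\<in>G. polyfun f" "\<forall>x y. (\<forall>f\<in>G. sgn (f x) = sgn (f y)) \<longrightarrow> (x \<in> T \<longleftrightarrow> y \<in> T)"
    using assms(2) unfolding semialgebraic_def by auto
  show ?thesis
    unfolding semialgebraic_def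
  proof (intro exI[of _ "F \<union> G"] conjI allI impI)
    fix x y assume "\<forall>f\<in>F \<union> G. sgn (f x) = sgn (f y)"
    then have "x \<in> S \<longleftrightarrow> y \<in> S" "x \<in> T \<longleftrightarrow> y \<in> T" using F(3) G(3) by blast+
    then show "x \<in> S \<inter> T \<longleftrightarrow> y \<in> S \<inter> T" by simp
  qed (use F G in auto)
qed

lemma semialgebraic_Un: "semialgebraic S \<Longrightarrow> semialgebraic T \<Longrightarrow> semialgebraic (S \<union> T)"
  using semialgebraic_Compl[OF semialgebraic_Int[OF semialgebraic_Compl semialgebraic_Compl], of S T] by simp

lemma semialgebraic_Diff: "semialgebraic S \<Longrightarrow> semialgebraic T \<Longrightarrow> semialgebraic (S - T)"
  by (simp add: Diff_eq semialgebraic_Int semialgebraic_Compl)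

lemma semialgebraic_zero: "polyfun f \<Longrightarrow> semialgebraic {x. f x = 0}"
  unfolding semialgebraic_def
proof (intro exI[of _ "{f}"] conjI allI impI)
  fix x y assume "\<forall>g\<in>{f}. sgn (g x) = sgn (g y)"
  then have "sgn (f x) = sgn (f y)" by simp
  then show "x \<in> {x. f x = 0} \<longleftrightarrow> y \<in> {x. f x = 0}" unfolding mem_Collect_eq sgn_eq_0_iff[symmetric, of "f x"] sgn_eq_0_iff[symmetric, of "f y"] by (simp only:)
qed auto

lemma semialgebraic_nonneg: "polyfun f \<Longrightarrow> semialgebraic {x. f x \<ge> 0}"
  unfolding semialgebraic_def
proof (intro exI[of _ "{f}"] conjI allI impI)
  fix x y assume "\<forall>g\<in>{f}. sgn (g x) = sgn (g y)"
  then have "sgn (f x) = sgn (f y)" by simp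
  then show "x \<in> {x. f x \<ge> 0} \<longleftrightarrow> y \<in> {x. f x \<ge> 0}"
  proof -
    have "f z \<ge> 0 \<longleftrightarrow> sgn (f z) \<noteq> -1" for z by (simp add: sgn_real_def)
    then show ?thesis unfolding mem_Collect_eq using \<open>sgn (f x) = sgn (f y)\<close> by (simp only:)
  qed
qed auto

lemma polyfun_compose:
  assumes "polyfun f" "\<And>i. polyfun (\<lambda>x. g x i)"
  shows "polyfun (\<lambda>x. f (g x))"
  using assms(1) by (induction rule: polyfun.induct) (auto intro: polyfun.intros assms(2))

lemma semialgebraic_vimage:
  assumes "semialgebraic S" "\<And>i. polyfun (\<lambda>x. g x i)"
  shows "semialgebraic (g -` S)"
proof -
  obtain F where F: "finite F" "\<forall>f\<in>F. polyfun f" "\<forall>x y. (\<forall>f\<in>F. sgn (f x) = sgn (f y)) \<longrightarrow> (x \<in> S \<longleftrightarrow> y \<in> S)"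
    using assms(1) unfolding semialgebraic_def by auto
  show ?thesis
    unfolding semialgebraic_def
  proof (intro exI[of _ "(\<lambda>f. f \<circ> g) ` F"] conjI allI impI)
    fix x y assume "\<forall>f\<in>(\<lambda>f. f \<circ> g) ` F. sgn (f x) = sgn (f y)"
    then have "\<forall>f\<in>F. sgn (f (g x)) = sgn (f (g y))" by auto
    then show "x \<in> g -` S \<longleftrightarrow> y \<in> g -` S" using F(3) by auto
  next
    show "\<forall>f\<in>(\<lambda>f. f \<circ> g) ` F. polyfun f" using F(2) polyfun_compose[of _ g, OF _ assms(2)] by (auto simp: comp_def)
  qed (use F in simp)
qed

lemma connected_sign_constant:
  fixes f :: "'a::topological_space \<Rightarrow> real"
  assumes "connected C" "continuous_on C f" "\<forall>x\<in>C. f x \<noteq> 0" "x \<in> C" "y \<in> C"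
  shows "sgn (f x) = sgn (f y)"
proof (rule ccontr)
  assume ne: "sgn (f x) \<noteq> sgn (f y)"
  have "f x \<noteq> 0" "f y \<noteq> 0" using assms by auto
  then have "f x < 0 \<and> 0 < f y \<or> f y < 0 \<and> 0 < f x" using ne by (auto simp: sgn_real_def split: if_splits)
  moreover have "is_interval (f ` C)"
    using connected_continuous_image[OF assms(2,1)] by (simp add: is_interval_connected_1)
  moreover have "f x \<in> f ` C" "f y \<in> f ` C" using assms(4,5) by auto
  ultimately have "0 \<in> f ` C" unfolding is_interval_1 by (metis less_imp_le)
  then show False using assms(3) by auto
qed

text \<open>It is enough that each polynomial either vanishes on a cell or has no zero in it: on a
  connected cell without zeros its sign is constant.\<close>

lemma semialgebraic_complex:
  assumes "finite \<S>" "\<And>S. S \<in> \<S> \<Longrightarrow> semialgebraic S" "B \<subseteq> coord_space n" "bounded_coords B"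
  shows "\<exists>\<C>. cell_complex \<C> \<and> B \<subseteq> \<Union>\<C> \<and> 
    (\<forall>S\<in>\<S>. \<forall>C\<in>\<C>. C \<subseteq> coord_space n \<inter> S \<or> C \<inter> (coord_space n \<inter> S) = {})"
proof -
  have "\<forall>S\<in>\<S>. \<exists>F. finite F \<and> (\<forall>f\<in>F. polyfun f) \<and>
     (\<forall>x y. (\<forall>f\<in>F. sgn (f x) = sgn (f y)) \<longrightarrow> (x \<in> S \<longleftrightarrow> y \<in> S))"
    using assms(2) unfolding semialgebraic_def by simp
  then obtain F where F: "\<forall>S\<in>\<S>. finite (F S) \<and> (\<forall>f\<in>F S. polyfun f) \<and>
     (\<forall>x y. (\<forall>f\<in>F S. sgn (f x) = sgn (f y)) \<longrightarrow> (x \<in> S \<longleftrightarrow> y \<in> S))"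
    unfolding bchoice_iff by (elim exE)
  have "finite (\<Union>S\<in>\<S>. F S)" "\<forall>f\<in>(\<Union>S\<in>\<S>. F S). polyfun f" using F assms(1) by auto
  from cylindrical_decomposition[OF this(1) bspec[OF this(2)] assms(3,4)]
  obtain \<C> where C: "cell_complex \<C>" "B \<subseteq> \<Union>\<C>" "\<Union>\<C> \<subseteq> coord_space n"
    "\<forall>f\<in>(\<Union>S\<in>\<S>. F S). \<forall>C\<in>\<C>. (\<forall>x\<in>C. f x = 0) \<or> (\<forall>x\<in>C. f x \<noteq> 0)"
    by auto
  show ?thesis
  proof (intro exI[of _ \<C>] conjI ballI C(1,2))
    fix S C assume S: "S \<in> \<S>" "C \<in> \<C>"
    have conn: "connected C" using cells(2)[OF C(1) S(2)] by (simp add: cell_def)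
    have iff: "x \<in> S \<longleftrightarrow> y \<in> S" if "x \<in> C" "y \<in> C" for x y
    proof -
      have "sgn (f x) = sgn (f y)" if f: "f \<in> F S" for f
      proof -
        have "polyfun f" using F S(1) f by blast
        have "(\<forall>x\<in>C. f x = 0) \<or> (\<forall>x\<in>C. f x \<noteq> 0)" using C(4) S f by blast
        then show ?thesis
        proof
          assume "\<forall>x\<in>C. f x = 0"
          then show ?thesis using \<open>x \<in> C\<close> \<open>y \<in> C\<close> by simp
        next
          assume "\<forall>x\<in>C. f x \<noteq> 0"
          then show ?thesis
            by (rule connected_sign_constant[OF conn continuous_on_polyfun[OF \<open>polyfun f\<close>] _ \<open>x \<in> C\<close> \<open>y \<in> C\<close>])
        qed
      qed
      then show ?thesis using F S(1) by blast
    qed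
    show "C \<subseteq> coord_space n \<inter> S \<or> C \<inter> (coord_space n \<inter> S) = {}"
    proof (rule disjCI)
      assume "C \<inter> (coord_space n \<inter> S) \<noteq> {}"
      then obtain x where x: "x \<in> C" "x \<in> S" by blast
      have "C \<subseteq> coord_space n" using C(3) S(2) by blast
      moreover have "C \<subseteq> S" using iff x by blast
      ultimately show "C \<subseteq> coord_space n \<inter> S" by blast
    qed
  qed
qed

definition tame_set :: "nat \<Rightarrow> point set \<Rightarrow> bool" where
  "tame_set n S \<longleftrightarrow> bounded_coords S \<and> locally_closed S \<and> (\<exists>V. semialgebraic V \<and> S = coord_space n \<inter> V)"

lemma tame_set_ctame:
  assumes "tame_set n S"
  shows "ctame S" "cofibration (closure S) (closure S - S)" "compact (closure S)" "closed (closure S - S)"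
proof -
  obtain V where V: "semialgebraic V" "S = coord_space n \<inter> V" using assms by (auto simp: tame_set_def)
  have S: "finite {V}" "\<forall>T\<in>{V}. semialgebraic T" "S \<subseteq> coord_space n" "bounded_coords S"
    using assms V by (auto simp: tame_set_def)
  obtain \<C> where C: "cell_complex \<C>" "S \<subseteq> \<Union>\<C>" "\<forall>C\<in>\<C>. C \<subseteq> S \<or> C \<inter> S = {}"
    using semialgebraic_complex[OF S(1) _ S(3,4)] S(2) unfolding V(2) by auto
  define \<S> where "\<S> = {C \<in> \<C>. C \<subseteq> S}"
  have eq: "\<Union>\<S> = S" using C(2,3) unfolding \<S>_def by blast
  have sub: "\<S> \<subseteq> \<C>" by (auto simp: \<S>_def)
  show cl: "closed (closure S - S)" using assms by (simp add: tame_set_def locally_closed_def)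
  show "ctame S" "cofibration (closure S) (closure S - S)" "compact (closure S)"
    using locally_closed_union[OF C(1) sub] cl unfolding eq by simp_all
qed

text \<open>One complex is adapted to both sets, and the cells of the union are those of
  \<open>S\<close> together with those of \<open>T\<close>.\<close>

lemma cchi_Un:
  assumes "tame_set n S" "tame_set n T" "tame_set n (S \<union> T)" "S \<inter> T = {}"
  shows "cchi (S \<union> T) = cchi S + cchi T"
proof -
  obtain V W where V: "semialgebraic V" "S = coord_space n \<inter> V" and W: "semialgebraic W" "T = coord_space n \<inter> W"
    using assms(1,2) by (auto simp: tame_set_def)
  have fam: "finite {V, W}" "\<forall>U\<in>{V, W}. semialgebraic U" "S \<union> T \<subseteq> coord_space n" "bounded_coords (S \<union> T)"
    using assms(3) V W by (auto simp: tame_set_def)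
  obtain \<C> where C: "cell_complex \<C>" "S \<union> T \<subseteq> \<Union>\<C>" "\<forall>C\<in>\<C>. C \<subseteq> S \<or> C \<inter> S = {}" "\<forall>C\<in>\<C>. C \<subseteq> T \<or> C \<inter> T = {}"
  proof -
    have "\<exists>\<C>. cell_complex \<C> \<and> S \<union> T \<subseteq> \<Union>\<C> \<and> 
        (\<forall>U\<in>{V, W}. \<forall>C\<in>\<C>. C \<subseteq> coord_space n \<inter> U \<or> C \<inter> (coord_space n \<inter> U) = {})"
      by (rule semialgebraic_complex[OF fam(1) _ fam(3,4)]) (rule bspec[OF fam(2)])
    then obtain \<C> where C: "cell_complex \<C>" "S \<union> T \<subseteq> \<Union>\<C>" 
      "\<forall>U\<in>{V, W}. \<forall>C\<in>\<C>. C \<subseteq> coord_space n \<inter> U \<or> C \<inter> (coord_space n \<inter> U) = {}"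
      by (elim exE conjE) (rule that)
    show thesis
      by (rule that[OF C(1,2) bspec[OF C(3), of V, folded V(2)] bspec[OF C(3), of W, folded W(2)]]) simp_all
  qed
  define cells_in where "cells_in U = {C \<in> \<C>. C \<subseteq> U}" for U
  have sub: "cells_in U \<subseteq> \<C>" for U by (auto simp: cells_in_def)
  have cover: "\<Union>(cells_in U) = U" if "U \<subseteq> \<Union>\<C>" "\<forall>C\<in>\<C>. C \<subseteq> U \<or> C \<inter> U = {}" for U
    using that unfolding cells_in_def by blast
  have eq: "\<Union>(cells_in S) = S" "\<Union>(cells_in T) = T" using C(2) by (auto intro!: cover C(3,4))
  have un: "cells_in (S \<union> T) = cells_in S \<union> cells_in T"
  proof
    show "cells_in (S \<union> T) \<subseteq> cells_in S \<union> cells_in T"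
    proof
      fix C assume "C \<in> cells_in (S \<union> T)"
      then have "C \<in> \<C>" "C \<subseteq> S \<union> T" by (auto simp: cells_in_def)
      moreover from \<open>C \<in> \<C>\<close> C(3,4) have "C \<subseteq> S \<or> C \<inter> S = {}" "C \<subseteq> T \<or> C \<inter> T = {}" by simp_all
      ultimately show "C \<in> cells_in S \<union> cells_in T" unfolding cells_in_def by blast
    qed
  qed (auto simp: cells_in_def)
  have "C \<noteq> {}" if "C \<in> \<C>" for C using cells(2)[OF C(1) that] by (simp add: cell_def)
  then have dis: "cells_in S \<inter> cells_in T = {}" using assms(4) unfolding cells_in_def by blast
  have fin: "finite (cells_in U)" for U using cells(1)[OF C(1)] sub finite_subset by blast
  have eqU: "\<Union>(cells_in (S \<union> T)) = S \<union> T" using eq un by simp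
  have "cchi (\<Union>(cells_in U)) = (\<Sum>C\<in>cells_in U. cchi C)" if "tame_set n (\<Union>(cells_in U))" for U
    using locally_closed_union(2)[OF C(1) sub] tame_set_ctame(4)[OF that] by simp
  from this[of S] this[of T] this[of "S \<union> T"] show ?thesis
    unfolding eq eqU unfolding un using assms(1-3) fin dis by (simp add: sum.union_disjoint)
qed

lemma closed_coord_space: "closed (coord_space n)"
proof -
  have "coord_space n = (\<Inter>i\<in>{n..}. {x. x i = 0})" by (auto simp: coord_space_def)
  moreover have "closed {x :: point. x i = 0}" for i
    by (intro closed_Collect_eq continuous_on_product_coordinates continuous_on_const)
  ultimately show ?thesis by (metis (no_types, lifting) closed_INT)
qed

context
  fixes n :: nat and S :: "point set"
  assumes S: "tame_set n S"
begin

text \<open>The product with \<open>I\<close>, placed in the next coordinate. For suitable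
  \<open>I\<close> it is again a tame set, so the construction can be repeated.\<close>

definition slab :: "real set \<Rightarrow> point set" where
  "slab I = {x \<in> coord_space (Suc n). x(n := 0) \<in> S \<and> x n \<in> I}"

lemma continuous_on_fun_upd: "continuous_on UNIV (\<lambda>x :: point. x(n := 0))"
proof (rule continuous_on_coordinatewise_then_product)
  fix i show "continuous_on UNIV (\<lambda>x :: point. (x(n := 0)) i)"
    by (cases "i = n") (auto intro: continuous_on_product_coordinates)
qed

lemma slab_homeomorphic: "S \<times> I homeomorphic slab I"
proof -
  have z: "x n = 0" if "x \<in> S" for x using S that by (auto simp: tame_set_def coord_space_def)
  have "homeomorphism (S \<times> I) (slab I) (\<lambda>z. (fst z)(n := snd z)) (\<lambda>x. (x(n := 0), x n))"
  proof (rule homeomorphismI)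
    show "continuous_on (S \<times> I) (\<lambda>z. (fst z)(n := snd z))"
    proof (rule continuous_on_coordinatewise_then_product)
      fix i show "continuous_on (S \<times> I) (\<lambda>z. ((fst z)(n := snd z)) i)"
        by (cases "i = n") (simp_all add: continuous_on_snd continuous_on_fst continuous_on_coord_compose continuous_on_id)
    qed
    show "continuous_on (slab I) (\<lambda>x. (x(n := 0), x n))"
      by (intro continuous_on_Pair continuous_on_subset[OF continuous_on_fun_upd] continuous_on_product_coordinates
          continuous_on_subset[OF continuous_on_product_coordinates]) auto
    show "(\<lambda>z. (fst z)(n := snd z)) ` (S \<times> I) \<subseteq> slab I"
      using S z by (auto simp: slab_def tame_set_def coord_space_def fun_upd_idem)
  qed (use z in \<open>auto simp: slab_def fun_upd_idem\<close>)
  then show ?thesis unfolding homeomorphic_def by blast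
qed

lemma slab_tame:
  assumes "semialgebraic {x. x n \<in> I}" "locally_closed I" "I \<subseteq> {0..1}"
  shows "tame_set (Suc n) (slab I)"
proof -
  have eq: "slab I = coord_space (Suc n) \<inter> ((\<lambda>x. x(n := 0)) -` S \<inter> (\<lambda>x. x n) -` I)"
    by (auto simp: slab_def)
  obtain V where V: "semialgebraic V" "S = coord_space n \<inter> V" using S by (auto simp: tame_set_def)
  have S': "S \<subseteq> coord_space n" "bounded_coords S" "locally_closed S"
    using S by (auto simp: tame_set_def)
  have poly: "polyfun (\<lambda>x. (x(n := 0)) i)" for i by (cases "i = n") (auto intro: polyfun.intros)
  let ?V = "(\<lambda>x. x(n := 0)) -` V \<inter> {x. x n \<in> I}"
  have "x(n := 0) \<in> coord_space n" if "x \<in> coord_space (Suc n)" for x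
    using that by (auto simp: coord_space_def Suc_le_eq)
  moreover have "y \<in> S \<longleftrightarrow> y \<in> coord_space n \<and> y \<in> V" for y using V(2) by blast
  ultimately have sa: "slab I = coord_space (Suc n) \<inter> ?V" unfolding slab_def by auto
  have sV: "semialgebraic ?V"
    using semialgebraic_Int[OF semialgebraic_vimage[of _ "\<lambda>x. x(n := 0)", OF V(1) poly] assms(1)] .
  have lc: "locally_closed (slab I)"
    unfolding eq by (intro locally_closed_Int locally_closed_closed closed_coord_space
        locally_closed_vimage[OF S'(3) continuous_on_fun_upd] locally_closed_vimage[OF assms(2)]
        continuous_on_product_coordinates)
  have "bounded_coords (slab I)"
  proof -
    obtain r where r: "\<forall>x\<in>S. \<forall>i. \<bar>x i\<bar> \<le> r" using S'(2) unfolding bounded_coords_def by auto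
    have "\<bar>x i\<bar> \<le> max r 1" if "x \<in> slab I" for x i
    proof (cases "i = n")
      case True
      then show ?thesis using that assms(3) by (fastforce simp: slab_def)
    next
      case False
      then have "\<bar>(x(n := 0)) i\<bar> \<le> r" using that r unfolding slab_def by blast
      then show ?thesis using False by simp
    qed
    then show ?thesis unfolding bounded_coords_def by blast
  qed
  then show ?thesis unfolding tame_set_def using sa lc sV by blast
qed

text \<open>The closed slab has the value of \<open>S\<close>, and so has each of its two faces;
  removing both faces leaves the value once minus twice.\<close>

lemma slab_open_interval:
  "tame_set (Suc n) (slab {0<..<1})" "cchi (slab {0<..<1}) = - cchi S"
proof -
  have sa: "semialgebraic {x. x n \<in> {a}}" for a
    using semialgebraic_zero[of "\<lambda>x. x n - a"] by (simp add: polyfun_diff polyfun.intros)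
  have ge: "semialgebraic {x. a \<le> x n}" "semialgebraic {x. x n \<le> a}" for a
    using semialgebraic_nonneg[of "\<lambda>x. x n - a"] semialgebraic_nonneg[of "\<lambda>x. a - x n"]
    by (simp_all add: polyfun_diff polyfun.intros)
  have I: "semialgebraic {x. x n \<in> {0..1}}" using semialgebraic_Int[OF ge(1)[of 0] ge(2)[of 1]]
    by (simp add: Collect_conj_eq)
  have O: "semialgebraic {x. x n \<in> {0<..<1}}"
  proof -
    have "{x. x n \<in> {0<..<1::real}} = {x. x n \<in> {0..1}} - {x. x n \<in> {0}} - {x. x n \<in> {1}}" by auto
    then show ?thesis using semialgebraic_Diff[OF semialgebraic_Diff[OF I sa] sa] by simp
  qed
  have two: "semialgebraic {x. x n \<in> {0, 1}}"
    using semialgebraic_Un[OF sa[of 0] sa[of 1]] by (simp add: Collect_disj_eq)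
  have t: "tame_set (Suc n) (slab {0..1})" "tame_set (Suc n) (slab {0,1})" "tame_set (Suc n) (slab {0})"
    "tame_set (Suc n) (slab {1})"
    by (auto intro!: slab_tame I two sa[unfolded singleton_iff] sa[of 0] sa[of 1] locally_closed_closed)
  show o: "tame_set (Suc n) (slab {0<..<1})"
    using locally_closed_closed_Int_open[of UNIV "{0<..<1::real}"] by (auto intro!: slab_tame O)
  have eq: "slab {0,1} = slab {0} \<union> slab {1}" "slab {0..1} = slab {0,1} \<union> slab {0<..<1}"
    "slab {0} \<inter> slab {1} = {}" "slab {0,1} \<inter> slab {0<..<1} = {}"
    by (auto simp: slab_def)
  have pt: "cchi (slab {a}) = cchi S" for a
  proof -
    have "homeomorphism S (S \<times> {a}) (\<lambda>x. (x, a)) fst"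
      by (rule homeomorphismI)
        (auto intro: continuous_on_fst continuous_on_id continuous_on_Pair continuous_on_const)
    then have "S homeomorphic S \<times> {a}" unfolding homeomorphic_def by blast
    then have "S homeomorphic slab {a}" using slab_homeomorphic homeomorphic_trans by blast
    then show ?thesis by (rule ctame_homeomorphic(2)[OF tame_set_ctame(1)[OF S]])
  qed
  have cl: "cchi (slab {0..1}) = cchi S"
  proof -
    have SS: "closure S - (closure S - S) = S" by (simp add: double_diff closure_subset)
    note tS = tame_set_ctame[OF S]
    have "ctame (S \<times> {0..1::real})" "cchi (S \<times> {0..1::real}) = cchi S"
      using ctame_times_interval[OF tS(2,3,4)] tS(1) unfolding SS by auto
    then show ?thesis using ctame_homeomorphic(2)[OF _ slab_homeomorphic] by simp
  qed
  have "cchi (slab {0..1}) = cchi (slab {0,1}) + cchi (slab {0<..<1})"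
    unfolding eq(2) by (rule cchi_Un[OF t(2) o _ eq(4)]) (use t(1) eq(2) in simp)
  moreover have "cchi (slab {0,1}) = cchi (slab {0}) + cchi (slab {1})"
    unfolding eq(1) by (rule cchi_Un[OF t(3,4) _ eq(3)]) (use t(2) eq(1) in simp)
  ultimately show "cchi (slab {0<..<1}) = - cchi S" using pt cl by simp
qed

end

lemma homeomorphic_Times:
  fixes A :: "'a::topological_space set" and B :: "'b::topological_space set"
    and A' :: "'c::topological_space set" and B' :: "'d::topological_space set"
  assumes "A homeomorphic A'" "B homeomorphic B'"
  shows "A \<times> B homeomorphic A' \<times> B'"
proof -
  obtain f f' where f: "homeomorphism A A' f f'" using assms(1) unfolding homeomorphic_def by auto
  obtain g g' where g: "homeomorphism B B' g g'" using assms(2) unfolding homeomorphic_def by auto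
  have comp: "continuous_on (C \<times> D) (\<lambda>z. (h (fst z), k (snd z)))" if "continuous_on C h" "continuous_on D k"
    for C :: "'x::topological_space set" and D :: "'y::topological_space set"
      and h :: "'x \<Rightarrow> 'z::topological_space" and k :: "'y \<Rightarrow> 'w::topological_space"
    by (intro continuous_on_Pair continuous_on_compose2[OF that(1)] continuous_on_compose2[OF that(2)]
        continuous_on_fst continuous_on_snd continuous_on_id) auto
  note F = homeomorphism_cont1[OF f] homeomorphism_cont2[OF f] homeomorphism_image1[OF f] homeomorphism_image2[OF f]
  note G = homeomorphism_cont1[OF g] homeomorphism_cont2[OF g] homeomorphism_image1[OF g] homeomorphism_image2[OF g]
  have "homeomorphism (A \<times> B) (A' \<times> B') (\<lambda>z. (f (fst z), g (snd z))) (\<lambda>z. (f' (fst z), g' (snd z)))"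
  proof (rule homeomorphismI)
    show "(\<lambda>z. (f (fst z), g (snd z))) ` (A \<times> B) \<subseteq> A' \<times> B'" using F(3) G(3) by auto
    show "(\<lambda>z. (f' (fst z), g' (snd z))) ` (A' \<times> B') \<subseteq> A \<times> B" using F(4) G(4) by auto
  qed (use homeomorphism_apply1[OF f] homeomorphism_apply1[OF g] homeomorphism_apply2[OF f]
      homeomorphism_apply2[OF g] in \<open>auto intro!: comp F(1,2) G(1,2)\<close>)
  then show ?thesis unfolding homeomorphic_def by blast
qed

text \<open>The plane is homeomorphic to a product of two open intervals, and each of them changes
  the sign.\<close>

lemma cchi_times_complex:
  fixes Z :: "'a::topological_space set"
  assumes "tame_set n S" "Z homeomorphic S"
  shows "ctame (Z \<times> (UNIV :: complex set))" "cchi (Z \<times> (UNIV :: complex set)) = cchi S"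
proof -
  let ?I = "{0<..<1::real}"
  note t1 = slab_open_interval[OF assms(1)]
  note t2 = slab_open_interval[OF t1(1)]
  have I: "?I homeomorphic (UNIV :: real set)"
    using homeomorphic_open_interval_UNIV[of "0::real" 1] by (simp add: box_real)
  have C: "(UNIV :: complex set) homeomorphic (UNIV :: real set) \<times> (UNIV :: real set)"
  proof -
    have "homeomorphism UNIV (UNIV \<times> UNIV) (\<lambda>z. (Re z, Im z)) (\<lambda>p. Complex (fst p) (snd p))"
      by (rule homeomorphismI) (auto intro!: continuous_intros simp: Complex_eq complex_eq[symmetric])
    then show ?thesis unfolding homeomorphic_def by blast
  qed
  have sq: "?I \<times> ?I homeomorphic (UNIV :: complex set)"
    by (rule homeomorphic_trans[OF homeomorphic_Times[OF I I]]) (use C homeomorphic_sym in blast)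
  have "slab (Suc n) (slab n S ?I) ?I homeomorphic (slab n S ?I) \<times> ?I"
    using slab_homeomorphic[OF t1(1)] homeomorphic_sym by blast
  also have "\<dots> homeomorphic (S \<times> ?I) \<times> ?I"
    by (intro homeomorphic_Times homeomorphic_refl) (use slab_homeomorphic[OF assms(1)] homeomorphic_sym in blast)
  also have "\<dots> homeomorphic S \<times> (?I \<times> ?I)"
  proof -
    have "homeomorphism ((S \<times> ?I) \<times> ?I) (S \<times> (?I \<times> ?I)) (\<lambda>z. (fst (fst z), snd (fst z), snd z))
      (\<lambda>z. ((fst z, fst (snd z)), snd (snd z)))"
      by (rule homeomorphismI)
        (auto intro!: continuous_on_Pair continuous_on_fst continuous_on_snd continuous_on_id)
    then show ?thesis unfolding homeomorphic_def by blast
  qed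
  also have "\<dots> homeomorphic Z \<times> (UNIV :: complex set)"
    by (intro homeomorphic_Times sq) (use assms(2) homeomorphic_sym in blast)
  finally have h: "slab (Suc n) (slab n S ?I) ?I homeomorphic Z \<times> (UNIV :: complex set)" .
  show "ctame (Z \<times> (UNIV :: complex set))" "cchi (Z \<times> (UNIV :: complex set)) = cchi S"
    using ctame_homeomorphic[OF tame_set_ctame(1)[OF t2(1)] h] t1(2) t2(2) by simp_all
qed

section \<open>Real algebraic sets of families of complex matrices\<close>

section \<open>Sets of families of matrices\<close>

type_synonym mat3 = "complex ^ 3 ^ 3"

text \<open>Real polynomials with complex values: conjugation is allowed, so that conditions such as
  being Hermitian can be written.\<close>

inductive regular :: "(('e \<Rightarrow> mat3) \<Rightarrow> complex) \<Rightarrow> bool" where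
  const: "regular (\<lambda>x. c)"
| entry: "regular (\<lambda>x. x e $ i $ j)"
| cnj: "regular f \<Longrightarrow> regular (\<lambda>x. cnj (f x))"
| add: "regular f \<Longrightarrow> regular g \<Longrightarrow> regular (\<lambda>x. f x + g x)"
| mult: "regular f \<Longrightarrow> regular g \<Longrightarrow> regular (\<lambda>x. f x * g x)"

lemma regular_diff: "regular f \<Longrightarrow> regular g \<Longrightarrow> regular (\<lambda>x. f x - g x)"
  using regular.add[OF _ regular.mult[OF regular.const[of "-1"]], of f g] by simp

lemma regular_sum: "(\<And>i. i \<in> A \<Longrightarrow> regular (f i)) \<Longrightarrow> regular (\<lambda>x. \<Sum>i\<in>A. f i x)"
  by (induction A rule: infinite_finite_induct) (auto intro: regular.intros)

lemma continuous_on_mat_entry: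
  fixes f :: "'a::topological_space \<Rightarrow> mat3"
  shows "continuous_on S f \<Longrightarrow> continuous_on S (\<lambda>x. f x $ i $ j)"
  by (intro continuous_intros)

lemma continuous_on_regular: "regular f \<Longrightarrow> continuous_on S f"
  by (induction rule: regular.induct)
    (auto intro!: continuous_intros continuous_on_mat_entry continuous_on_subset[OF continuous_on_product_coordinates])

inductive constructible :: "('e \<Rightarrow> mat3) set \<Rightarrow> bool" where
  zero: "regular f \<Longrightarrow> constructible {x. f x = 0}"
| Compl: "constructible S \<Longrightarrow> constructible (- S)"
| Int: "constructible S \<Longrightarrow> constructible T \<Longrightarrow> constructible (S \<inter> T)"

lemma constructible_UNIV: "constructible UNIV"
  using constructible.zero[OF regular.const[of 0]] by simp

text \<open>Families indexed by different edge sets share one function type. The value zero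
  elsewhere makes them a space of finite dimension when \<open>E\<close> is finite.\<close>

definition zero_outside :: "'e set \<Rightarrow> ('e \<Rightarrow> mat3) set" where
  "zero_outside E = {x. \<forall>e. e \<notin> E \<longrightarrow> x e = 0}"

text \<open>A bound that costs nothing: entries of projectors have absolute value at most 1.\<close>

definition box_matrices :: "'e set \<Rightarrow> ('e \<Rightarrow> mat3) set" where
  "box_matrices E = {x \<in> zero_outside E. \<forall>e i j. norm (x e $ i $ j) \<le> 1}"

definition tame :: "'e set \<Rightarrow> ('e \<Rightarrow> mat3) set \<Rightarrow> bool" where
  "tame E S \<longleftrightarrow> S \<subseteq> box_matrices E \<and> locally_closed S \<and> (\<exists>V. constructible V \<and> S = zero_outside E \<inter> V)"

text \<open>The real and imaginary parts of all entries are numbered. The inverse is stated to be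
  continuous everywhere and polynomial because images of sets under the chart are written as its
  preimages.\<close>

lemma matrix_chart:
  fixes E :: "'e set"
  assumes "finite E"
  obtains N :: nat and \<kappa> :: "('e \<Rightarrow> mat3) \<Rightarrow> point" and \<kappa>' where
    "homeomorphism (zero_outside E) (coord_space N) \<kappa> \<kappa>'" "continuous_on UNIV \<kappa>'"
    "\<forall>e i j. polyfun (\<lambda>y. Re (\<kappa>' y e $ i $ j)) \<and> polyfun (\<lambda>y. Im (\<kappa>' y e $ i $ j))"
    "\<forall>x\<in>box_matrices E. \<forall>n. \<bar>\<kappa> x n\<bar> \<le> 1"
proof -
  define A where "A = E \<times> (UNIV :: 3 set) \<times> (UNIV :: 3 set) \<times> (UNIV :: bool set)"
  have "finite A" using assms by (simp add: A_def)
  then obtain \<iota> and N :: nat where \<iota>: "\<iota> ` A = {i. i < N}" "inj_on \<iota> A" 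
    using finite_imp_inj_to_nat_seg[of A] by auto
  define \<kappa> :: "('e \<Rightarrow> mat3) \<Rightarrow> point" where "\<kappa> x = (\<lambda>n. if n < N then
    (let a = inv_into A \<iota> n; z = x (fst a) $ fst (snd a) $ fst (snd (snd a)) in if snd (snd (snd a)) then Re z else Im z) else 0)" for x
  define \<kappa>' :: "point \<Rightarrow> 'e \<Rightarrow> mat3" where
    "\<kappa>' y = (\<lambda>e. if e \<in> E then (\<chi> i j. complex_of_real (y (\<iota> (e, i, j, True))) + \<i> * complex_of_real (y (\<iota> (e, i, j, False)))) else 0)" for y
  have lt: "\<iota> (e, i, j, b) < N" if "e \<in> E" for e i j b using \<iota>(1) that unfolding A_def by blast
  have inv: "inv_into A \<iota> (\<iota> (e, i, j, b)) = (e, i, j, b)" if "e \<in> E" for e i j b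
    by (rule inv_into_f_f[OF \<iota>(2)]) (use that in \<open>auto simp: A_def\<close>)
  have poly: "polyfun (\<lambda>y. Re (\<kappa>' y e $ i $ j)) \<and> polyfun (\<lambda>y. Im (\<kappa>' y e $ i $ j))" for e i j
    by (cases "e \<in> E") (auto simp: \<kappa>'_def intro: polyfun.intros)
  have cont': "continuous_on UNIV \<kappa>'"
  proof (rule continuous_on_coordinatewise_then_product)
    fix e show "continuous_on UNIV (\<lambda>y. \<kappa>' y e)"
      unfolding \<kappa>'_def
      by (cases "e \<in> E") (auto intro!: continuous_intros continuous_on_vec_lambda continuous_on_product_coordinates)
  qed
  have left: "\<kappa>' (\<kappa> x) = x" if "x \<in> zero_outside E" for x
  proof
    fix e show "\<kappa>' (\<kappa> x) e = x e"
    proof (cases "e \<in> E")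
      case True
      then show ?thesis unfolding \<kappa>'_def \<kappa>_def by (simp add: vec_eq_iff lt inv Let_def complex_eq[symmetric])
    next
      case False
      then show ?thesis using that by (simp add: \<kappa>'_def zero_outside_def)
    qed
  qed
  have right: "\<kappa> (\<kappa>' y) = y" if "y \<in> coord_space N" for y
  proof
    fix n show "\<kappa> (\<kappa>' y) n = y n"
    proof (cases "n < N")
      case True
      then have "n \<in> \<iota> ` A" using \<iota>(1) by simp
      then obtain e i j b where n: "e \<in> E" "n = \<iota> (e, i, j, b)" by (auto simp: A_def)
      then show ?thesis using True by (cases b) (simp_all add: \<kappa>_def \<kappa>'_def inv)
    next
      case False
      then show ?thesis using that by (simp add: \<kappa>_def coord_space_def)
    qed
  qed
  have cont: "continuous_on UNIV \<kappa>"
  proof (rule continuous_on_coordinatewise_then_product)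
    fix n show "continuous_on UNIV (\<lambda>x. \<kappa> x n)"
      unfolding \<kappa>_def Let_def by (cases "n < N"; cases "snd (snd (snd (inv_into A \<iota> n)))")
        (simp_all, auto intro!: continuous_on_Re continuous_on_Im continuous_on_mat_entry continuous_on_product_coordinates)
  qed
  have "homeomorphism (zero_outside E) (coord_space N) \<kappa> \<kappa>'"
  proof (rule homeomorphismI)
    show "\<kappa> ` zero_outside E \<subseteq> coord_space N" by (auto simp: \<kappa>_def coord_space_def)
    show "\<kappa>' ` coord_space N \<subseteq> zero_outside E" by (auto simp: \<kappa>'_def zero_outside_def)
  qed (use left right continuous_on_subset[OF cont] continuous_on_subset[OF cont'] in auto)
  moreover have "\<bar>\<kappa> x n\<bar> \<le> 1" if "x \<in> box_matrices E" for x n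
  proof -
    have "\<bar>Re z\<bar> \<le> 1 \<and> \<bar>Im z\<bar> \<le> 1" if "norm z \<le> 1" for z
      using abs_Re_le_cmod[of z] abs_Im_le_cmod[of z] that by linarith
    then show ?thesis using that by (simp add: \<kappa>_def Let_def box_matrices_def)
  qed
  ultimately show thesis using cont' poly by (intro that) blast+
qed

lemma semialgebraic_constructible:
  assumes "constructible S" "\<forall>e i j. polyfun (\<lambda>y. Re (h y e $ i $ j)) \<and> polyfun (\<lambda>y. Im (h y e $ i $ j))"
  shows "semialgebraic (h -` S)"
  using assms(1)
proof (induction rule: constructible.induct)
  case (zero f)
  then have "polyfun (\<lambda>y. Re (f (h y))) \<and> polyfun (\<lambda>y. Im (f (h y)))"
  proof (induction rule: regular.induct)
    case (cnj f)
    then show ?case by (auto intro: polyfun_minus)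
  qed (use assms(2) in \<open>auto intro!: polyfun.intros polyfun_diff\<close>)
  then have "semialgebraic ({y. Re (f (h y)) = 0} \<inter> {y. Im (f (h y)) = 0})"
    by (intro semialgebraic_Int semialgebraic_zero) auto
  moreover have "h -` {x. f x = 0} = {y. Re (f (h y)) = 0} \<inter> {y. Im (f (h y)) = 0}"
    by (auto simp: complex_eq_iff)
  ultimately show ?case by simp
next
  case (Compl S)
  then show ?case by (simp add: vimage_Compl semialgebraic_Compl)
next
  case (Int S T)
  then show ?case by (simp add: vimage_Int semialgebraic_Int)
qed

lemma tame_chart:
  fixes E :: "'e set"
  assumes "finite E"
  obtains N :: nat and \<kappa> :: "('e \<Rightarrow> mat3) \<Rightarrow> point" where
    "inj_on \<kappa> (zero_outside E)" "\<forall>S. tame E S \<longrightarrow> tame_set N (\<kappa> ` S) \<and> S homeomorphic \<kappa> ` S"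
proof -
  obtain N :: nat and \<kappa> :: "('e \<Rightarrow> mat3) \<Rightarrow> point" and \<kappa>' where h: "homeomorphism (zero_outside E) (coord_space N) \<kappa> \<kappa>'"
    and c: "continuous_on UNIV \<kappa>'"
    and p: "\<forall>e i j. polyfun (\<lambda>y. Re (\<kappa>' y e $ i $ j)) \<and> polyfun (\<lambda>y. Im (\<kappa>' y e $ i $ j))"
    and b: "\<forall>x\<in>box_matrices E. \<forall>n. \<bar>\<kappa> x n\<bar> \<le> 1"
    by (rule matrix_chart[OF assms]) (rule that)
  note hd = homeomorphism_apply1[OF h] homeomorphism_apply2[OF h] homeomorphism_image1[OF h] homeomorphism_image2[OF h]
  have img: "\<kappa> ` (zero_outside E \<inter> V) = coord_space N \<inter> \<kappa>' -` V" for V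
    using hd by (auto simp: image_iff) (metis IntI imageI)+
  show thesis
  proof (rule that)
    show "inj_on \<kappa> (zero_outside E)" by (intro inj_onI) (metis hd(1))
    show "\<forall>S. tame E S \<longrightarrow> tame_set N (\<kappa> ` S) \<and> S homeomorphic \<kappa> ` S"
    proof (intro allI impI conjI)
      fix S assume t: "tame E S"
      then obtain V where V: "constructible V" "S = zero_outside E \<inter> V" by (auto simp: tame_def)
      have SS: "S \<subseteq> box_matrices E" "locally_closed S" using t by (auto simp: tame_def)
      have "S = zero_outside E \<inter> S" using V(2) by blast
      then have "\<kappa> ` S = coord_space N \<inter> \<kappa>' -` S" using img[of S] by simp
      then have lc: "locally_closed (\<kappa> ` S)"
        using locally_closed_Int[OF locally_closed_closed[OF closed_coord_space] locally_closed_vimage[OF SS(2) c]] by simp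
      have "semialgebraic (\<kappa>' -` V)" by (rule semialgebraic_constructible[OF V(1) p])
      moreover have "\<kappa> ` S = coord_space N \<inter> \<kappa>' -` V" unfolding V(2) by (rule img)
      moreover have "bounded_coords (\<kappa> ` S)" unfolding bounded_coords_def using b SS(1) by blast
      ultimately show "tame_set N (\<kappa> ` S)" unfolding tame_set_def using lc by blast
      show "S homeomorphic \<kappa> ` S"
        using homeomorphism_of_subsets[OF h, of S "\<kappa> ` S"] V(2) hd(3) unfolding homeomorphic_def by blast
    qed
  qed
qed

lemma tame_ctame:
  assumes "finite E" "tame E S"
  shows "ctame S"
proof -
  obtain N :: nat and \<kappa> where k: "inj_on \<kappa> (zero_outside E)"
    "\<forall>S. tame E S \<longrightarrow> tame_set N (\<kappa> ` S) \<and> S homeomorphic \<kappa> ` S"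
    by (rule tame_chart[OF assms(1)]) (rule that)
  have "ctame (\<kappa> ` S)" "\<kappa> ` S homeomorphic S" using k(2) assms(2) tame_set_ctame(1) homeomorphic_sym by blast+
  then show ?thesis by (rule ctame_homeomorphic(1))
qed

lemma tame_times_complex:
  assumes "finite E" "tame E S"
  shows "ctame (S \<times> (UNIV :: complex set))" "cchi (S \<times> (UNIV :: complex set)) = cchi S"
proof -
  obtain N :: nat and \<kappa> where k: "inj_on \<kappa> (zero_outside E)"
    "\<forall>S. tame E S \<longrightarrow> tame_set N (\<kappa> ` S) \<and> S homeomorphic \<kappa> ` S"
    by (rule tame_chart[OF assms(1)]) (rule that)
  have S: "tame_set N (\<kappa> ` S)" "S homeomorphic \<kappa> ` S" using k(2) assms(2) by auto
  have "cchi (\<kappa> ` S) = cchi S" by (rule ctame_homeomorphic(2)[OF tame_ctame[OF assms] S(2)])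
  then show "ctame (S \<times> (UNIV :: complex set))" "cchi (S \<times> (UNIV :: complex set)) = cchi S"
    using cchi_times_complex[OF S] by simp_all
qed

lemma tame_Int_zero:
  assumes "tame E S" "regular g"
  shows "tame E (S \<inter> {x. g x = 0})" "tame E (S \<inter> {x. g x \<noteq> 0})"
proof -
  obtain V where V: "constructible V" "S = zero_outside E \<inter> V" using assms(1) by (auto simp: tame_def)
  have S: "S \<subseteq> box_matrices E" "locally_closed S" using assms(1) by (auto simp: tame_def)
  have o: "open {x. g x \<noteq> 0}"
    by (intro open_Collect_neq continuous_on_regular assms(2) continuous_on_const)
  have c: "closed {x. g x = 0}"
    by (intro closed_Collect_eq continuous_on_regular assms(2) continuous_on_const)
  have ne: "{x. g x \<noteq> 0} = - {x. g x = 0}" by auto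
  have "constructible (V \<inter> {x. g x = 0})" "constructible (V \<inter> {x. g x \<noteq> 0})"
    unfolding ne by (intro constructible.intros V(1) assms(2))+
  moreover have "locally_closed (S \<inter> {x. g x = 0})" "locally_closed (S \<inter> {x. g x \<noteq> 0})"
    using locally_closed_Int[OF S(2) locally_closed_closed[OF c]]
      locally_closed_Int[OF S(2) locally_closed_closed_Int_open[OF closed_UNIV o]] by simp_all
  ultimately show "tame E (S \<inter> {x. g x = 0})" "tame E (S \<inter> {x. g x \<noteq> 0})"
    unfolding tame_def using S(1) V(2) Int_assoc by blast+
qed

text \<open>The two parts are closed and open in \<open>S\<close>, so both are tame. In this form
  additivity is used for the configurations around a square.\<close>

lemma cchi_split:
  assumes "finite E" "tame E S" "regular g"
  shows "cchi S = cchi (S \<inter> {x. g x = 0}) + cchi (S \<inter> {x. g x \<noteq> 0})"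
proof -
  let ?A = "S \<inter> {x. g x = 0}" and ?B = "S \<inter> {x. g x \<noteq> 0}"
  obtain N :: nat and \<kappa> where k: "inj_on \<kappa> (zero_outside E)"
    "\<forall>S. tame E S \<longrightarrow> tame_set N (\<kappa> ` S) \<and> S homeomorphic \<kappa> ` S"
    by (rule tame_chart[OF assms(1)]) (rule that)
  have SE: "S \<subseteq> zero_outside E" using assms(2) by (auto simp: tame_def)
  have un: "\<kappa> ` ?A \<union> \<kappa> ` ?B = \<kappa> ` S" by auto
  have dis: "\<kappa> ` ?A \<inter> \<kappa> ` ?B = {}"
    using inj_on_image_Int[OF k(1), of ?A ?B] SE by auto
  note t = assms(2) tame_Int_zero[OF assms(2,3)]
  have ck: "cchi (\<kappa> ` T) = cchi T" if "tame E T" for T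
    using ctame_homeomorphic(2)[OF tame_ctame[OF assms(1) that]] k(2) that by blast
  have "cchi (\<kappa> ` S) = cchi (\<kappa> ` ?A) + cchi (\<kappa> ` ?B)"
    unfolding un[symmetric] by (rule cchi_Un[OF _ _ _ dis]) (use k(2) t un in auto)
  then show ?thesis using ck t by simp
qed

definition variety :: "('e \<Rightarrow> mat3) set \<Rightarrow> bool" where
  "variety V \<longleftrightarrow> (\<exists>F. finite F \<and> (\<forall>f\<in>F. regular f) \<and> V = {x. \<forall>f\<in>F. f x = 0})"

lemma variety_zero: "regular f \<Longrightarrow> variety {x. f x = 0}"
  unfolding variety_def by (intro exI[of _ "{f}"]) simp

lemma variety_UNIV: "variety UNIV"
  unfolding variety_def by (intro exI[of _ "{}"]) simp

lemma variety_Int: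
  assumes "variety V" "variety W"
  shows "variety (V \<inter> W)"
proof -
  obtain F where F: "finite F" "\<forall>f\<in>F. regular f" "V = {x. \<forall>f\<in>F. f x = 0}" using assms(1) by (auto simp: variety_def)
  obtain G where G: "finite G" "\<forall>f\<in>G. regular f" "W = {x. \<forall>f\<in>G. f x = 0}" using assms(2) by (auto simp: variety_def)
  show ?thesis unfolding variety_def by (intro exI[of _ "F \<union> G"]) (use F G in auto)
qed

lemma variety_INT: "finite I \<Longrightarrow> (\<And>i. i \<in> I \<Longrightarrow> variety (V i)) \<Longrightarrow> variety (\<Inter>i\<in>I. V i)"
  by (induction I rule: finite_induct) (auto intro: variety_UNIV variety_Int)

lemma variety_Collect_conj: "variety {x. P x} \<Longrightarrow> variety {x. Q x} \<Longrightarrow> variety {x. P x \<and> Q x}"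
  using variety_Int by (simp add: Collect_conj_eq)

lemma variety_Collect_ball: "finite I \<Longrightarrow> (\<And>i. i \<in> I \<Longrightarrow> variety {x. P i x}) \<Longrightarrow> variety {x. \<forall>i\<in>I. P i x}"
  using variety_INT[of I "\<lambda>i. {x. P i x}"] by (simp add: INTER_eq)

lemma variety_Collect_all: "(\<And>i. variety {x. P i x}) \<Longrightarrow> variety {x. \<forall>i::'i::finite. P i x}"
  using variety_Collect_ball[of UNIV P] by simp

lemma variety_constructible: "variety V \<Longrightarrow> constructible V"
proof -
  assume "variety V"
  then obtain F where F: "finite F" "\<forall>f\<in>F. regular f" "V = {x. \<forall>f\<in>F. f x = 0}" by (auto simp: variety_def)
  have "constructible {x. \<forall>f\<in>F. f x = 0}" using F(1,2)
  proof (induction F rule: finite_induct)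
    case (insert f F)
    have "{x. \<forall>g\<in>insert f F. g x = 0} = {x. f x = 0} \<inter> {x. \<forall>g\<in>F. g x = 0}" by auto
    then show ?case using insert by (auto intro: constructible.intros)
  qed (simp add: constructible_UNIV)
  then show ?thesis using F(3) by simp
qed

lemma variety_closed: "variety V \<Longrightarrow> closed V"
proof -
  assume "variety V"
  then obtain F where F: "finite F" "\<forall>f\<in>F. regular f" "V = {x. \<forall>f\<in>F. f x = 0}" by (auto simp: variety_def)
  have "V = (\<Inter>f\<in>F. {x. f x = 0})" using F(3) by auto
  moreover have "closed {x. f x = 0}" if "f \<in> F" for f
    using F(2) that by (intro closed_Collect_eq continuous_on_regular continuous_on_const) auto
  ultimately show ?thesis by auto
qed

lemma compact_box_matrices:
  fixes E :: "'e set"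
  shows "compact (box_matrices E)"
proof -
  define K :: "'e \<Rightarrow> mat3 set" where "K e = (if e \<in> E then {M. \<forall>i j. norm (M $ i $ j) \<le> 1} else {0})" for e
  have "compact {M :: mat3. \<forall>i j. norm (M $ i $ j) \<le> 1}"
  proof (rule compact_eq_bounded_closed[THEN iffD2], rule conjI)
    have "norm M \<le> 9" if "\<forall>i j. norm (M $ i $ j) \<le> 1" for M :: mat3
    proof -
      have "norm M \<le> (\<Sum>i\<in>UNIV. norm (M $ i))" by (simp add: norm_vec_def L2_set_le_sum)
      also have "\<dots> \<le> (\<Sum>i\<in>(UNIV :: 3 set). \<Sum>j\<in>(UNIV :: 3 set). norm (M $ i $ j))"
        by (intro sum_mono) (simp add: norm_vec_def[where 'a = complex] L2_set_le_sum)
      also have "\<dots> \<le> (\<Sum>i\<in>(UNIV :: 3 set). \<Sum>j\<in>(UNIV :: 3 set). 1)"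
        using that by (intro sum_mono) auto
      finally show ?thesis by simp
    qed
    then show "bounded {M :: mat3. \<forall>i j. norm (M $ i $ j) \<le> 1}" unfolding bounded_iff by blast
    have "closed {M :: mat3. norm (M $ i $ j) \<le> 1}" for i j
      by (intro closed_Collect_le continuous_intros)
    then show "closed {M :: mat3. \<forall>i j. norm (M $ i $ j) \<le> 1}"
      by (intro closed_Collect_all)
  qed
  then have "compactin euclidean (K e)" for e by (simp add: K_def)
  then have "compactin (product_topology (\<lambda>e. euclidean) UNIV) (PiE UNIV K)"
    by (simp add: compactin_PiE)
  then have "compact (PiE UNIV K)" by (simp add: euclidean_product_topology)
  moreover have "PiE UNIV K = box_matrices E"
    by (auto simp: PiE_def Pi_def K_def box_matrices_def zero_outside_def split: if_splits) (metis norm_zero zero_index zero_le_one)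
  ultimately show ?thesis by simp
qed

lemma closed_zero_outside: "closed (zero_outside E)"
proof -
  have "zero_outside E = (\<Inter>e\<in>- E. {x. x e = 0})" by (auto simp: zero_outside_def)
  moreover have "closed {x :: 'a \<Rightarrow> mat3. x e = 0}" for e
    by (intro closed_Collect_eq continuous_on_product_coordinates continuous_on_const)
  ultimately show ?thesis by (metis (no_types, lifting) closed_INT)
qed

lemma variety_tame:
  assumes "variety V" "zero_outside E \<inter> V \<subseteq> box_matrices E"
  shows "tame E (zero_outside E \<inter> V)" "compact (zero_outside E \<inter> V)"
proof -
  have c: "closed (zero_outside E \<inter> V)" using closed_zero_outside variety_closed[OF assms(1)] by (rule closed_Int)
  then show "tame E (zero_outside E \<inter> V)"
    unfolding tame_def using assms locally_closed_closed variety_constructible by blast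
  have "zero_outside E \<inter> V = box_matrices E \<inter> (zero_outside E \<inter> V)" using assms(2) by blast
  then show "compact (zero_outside E \<inter> V)" using compact_Int_closed[OF compact_box_matrices c] by metis
qed

section \<open>Linear algebra of orthogonal lines in three dimensions\<close>

section \<open>Orthogonal projectors of rank one\<close>

text \<open>A Hermitian matrix of trace one whose \<open>2 \<times> 2\<close> minors vanish is the orthogonal projector onto a line.\<close>

definition projector :: "mat3 \<Rightarrow> bool" where
  "projector P \<longleftrightarrow> (\<forall>i j. P $ j $ i = cnj (P $ i $ j)) \<and>
     (\<forall>i j k l. P $ i $ j * P $ k $ l = P $ i $ l * P $ k $ j) \<and> (\<Sum>i\<in>UNIV. P $ i $ i) = 1"

definition proj_on :: "complex ^ 3 \<Rightarrow> mat3" where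
  "proj_on v = (\<chi> i j. v $ i * cnj (v $ j) / complex_of_real ((norm v)\<^sup>2))"

definition perp :: "mat3 \<Rightarrow> mat3 \<Rightarrow> bool" where
  "perp P Q \<longleftrightarrow> P ** Q = 0"

lemma norm_square_vec: "complex_of_real ((norm (v :: complex ^ 3))\<^sup>2) = (\<Sum>i\<in>UNIV. v $ i * cnj (v $ i))"
  by (simp add: norm_vec_def L2_set_def sum_nonneg complex_norm_square[symmetric])

lemma projector_proj_on:
  assumes "v \<noteq> 0"
  shows "projector (proj_on v)"
proof -
  have "complex_of_real ((norm v)\<^sup>2) \<noteq> 0" using assms by simp
  then have "(\<Sum>i\<in>UNIV. proj_on v $ i $ i) = 1"
    unfolding proj_on_def by (simp add: sum_divide_distrib[symmetric] norm_square_vec[symmetric] del: of_real_power)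
  then show ?thesis unfolding projector_def by (simp add: proj_on_def)
qed

text \<open>The trace gives a nonzero diagonal entry; by symmetry and the vanishing minors, the
  column through it spans the line.\<close>

lemma projector_cases:
  assumes "projector P"
  obtains v where "v \<noteq> 0" "P = proj_on v"
proof -
  have herm: "P $ j $ i = cnj (P $ i $ j)" and minor: "P $ i $ j * P $ k $ l = P $ i $ l * P $ k $ j"
    and trace: "(\<Sum>i\<in>UNIV. P $ i $ i) = 1" for i j k l
    using assms unfolding projector_def by blast+
  obtain i where i: "P $ i $ i \<noteq> 0"
  proof (rule ccontr)
    assume "\<not> thesis"
    then have "P $ i $ i = 0" for i using that by blast
    then show False using trace by simp
  qed
  define v where "v = (\<chi> m. P $ m $ i)"
  have vv: "v $ m * cnj (v $ l) = P $ m $ l * P $ i $ i" for m l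
    unfolding v_def using herm[of i l] minor[of m i i l] by simp
  have "complex_of_real ((norm v)\<^sup>2) = P $ i $ i"
    unfolding norm_square_vec vv sum_distrib_right[symmetric] trace by simp
  then have "P = proj_on v" using i unfolding proj_on_def vec_eq_iff by (simp add: vv)
  moreover have "v \<noteq> 0" using i by (auto simp: v_def vec_eq_iff)
  ultimately show thesis using that by blast
qed

lemma proj_on_scale: "c \<noteq> 0 \<Longrightarrow> proj_on (c *s v) = proj_on v"
proof -
  assume c: "c \<noteq> 0"
  have "complex_of_real ((norm (c *s v))\<^sup>2) = c * cnj c * complex_of_real ((norm v)\<^sup>2)"
    unfolding norm_square_vec by (simp add: sum_distrib_left mult_ac)
  then show ?thesis using c unfolding proj_on_def vec_eq_iff by (simp del: of_real_power)
qed

lemma hermitian_cnj: "hermitian y x = cnj (hermitian x y)"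
  by (simp add: hermitian_def mult.commute)

lemma mult_proj_on:
  "(proj_on v ** proj_on w) $ i $ j =
     v $ i * cnj (w $ j) * hermitian w v / (complex_of_real ((norm v)\<^sup>2) * complex_of_real ((norm w)\<^sup>2))"
  unfolding matrix_matrix_mult_def hermitian_def proj_on_def
  by (simp add: sum_distrib_left sum_divide_distrib mult_ac)

lemma perp_proj_on:
  assumes "v \<noteq> 0" "w \<noteq> 0"
  shows "perp (proj_on v) (proj_on w) \<longleftrightarrow> hermitian v w = 0"
proof
  assume p: "perp (proj_on v) (proj_on w)"
  obtain i where "v $ i \<noteq> 0" using assms(1) by (auto simp: vec_eq_iff)
  moreover obtain j where "w $ j \<noteq> 0" using assms(2) by (auto simp: vec_eq_iff)
  moreover have "(proj_on v ** proj_on w) $ i $ j = 0" using p by (simp add: perp_def)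
  ultimately show "hermitian v w = 0" using assms unfolding mult_proj_on by (simp add: hermitian_cnj[of v w])
next
  assume "hermitian v w = 0"
  then have "hermitian w v = 0" by (simp add: hermitian_cnj[of w v])
  then show "perp (proj_on v) (proj_on w)" unfolding perp_def vec_eq_iff by (simp add: mult_proj_on)
qed

lemma perp_sym:
  assumes "projector P" "projector Q" "perp P Q"
  shows "perp Q P"
proof -
  obtain v where v: "v \<noteq> 0" "P = proj_on v" using assms(1) by (rule projector_cases)
  obtain w where w: "w \<noteq> 0" "Q = proj_on w" using assms(2) by (rule projector_cases)
  show ?thesis using assms(3) hermitian_cnj[of v w] unfolding v(2) w(2) perp_proj_on[OF v(1) w(1)] perp_proj_on[OF w(1) v(1)]
    by simp
qed

text \<open>For lines spanned by \<open>u\<close>, \<open>v\<close>, \<open>w\<close> the product of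
  the projectors is a nonzero matrix multiplied by the inner products \<open>hermitian v u\<close>
  and \<open>hermitian w v\<close>.\<close>

lemma perp_three_cases:
  assumes "projector P" "projector Q" "projector R" "P ** Q ** R = 0"
  shows "perp P Q \<or> perp Q R"
proof -
  obtain u where u: "u \<noteq> 0" "P = proj_on u" using assms(1) by (rule projector_cases)
  obtain v where v: "v \<noteq> 0" "Q = proj_on v" using assms(2) by (rule projector_cases)
  obtain w where w: "w \<noteq> 0" "R = proj_on w" using assms(3) by (rule projector_cases)
  obtain i where i: "u $ i \<noteq> 0" using u(1) by (auto simp: vec_eq_iff)
  obtain j where j: "w $ j \<noteq> 0" using w(1) by (auto simp: vec_eq_iff)
  have "0 = (P ** Q ** R) $ i $ j" using assms(4) by simp
  also have "\<dots> = (\<Sum>k\<in>UNIV. (P ** Q) $ i $ k * R $ k $ j)"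
    by (simp add: matrix_matrix_mult_def)
  also have "\<dots> = u $ i * cnj (w $ j) * hermitian v u * hermitian w v /
    (complex_of_real ((norm u)\<^sup>2) * complex_of_real ((norm v)\<^sup>2) * complex_of_real ((norm w)\<^sup>2))"
    unfolding u(2) v(2) w(2) mult_proj_on unfolding proj_on_def hermitian_def[of w v]
    by (simp add: sum_distrib_left sum_divide_distrib mult_ac)
  finally have "hermitian v u = 0 \<or> hermitian w v = 0" using u(1) v(1) w(1) i j by auto
  then have "hermitian u v = 0 \<or> hermitian v w = 0" by (simp add: hermitian_cnj[of u v] hermitian_cnj[of v w])
  then show ?thesis unfolding u(2) v(2) w(2) by (simp add: perp_proj_on u(1) v(1) w(1))
qed

lemma matrix_ring_distribs:
  fixes A B C :: mat3
  shows "(A + B) ** C = A ** C + B ** C" "A ** (B - C) = A ** B - A ** C" "(A - B) ** C = A ** C - B ** C"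
  by (simp_all add: vec_eq_iff matrix_matrix_mult_def sum.distrib sum_subtractf algebra_simps)

lemma projector_idem: "projector P \<Longrightarrow> P ** P = P"
proof -
  assume P: "projector P"
  have minor: "P $ i $ j * P $ k $ l = P $ i $ l * P $ k $ j" for i j k l using P unfolding projector_def by blast
  have trace: "(\<Sum>k\<in>UNIV. P $ k $ k) = 1" using P unfolding projector_def by blast
  have "(\<Sum>k\<in>UNIV. P $ i $ k * P $ k $ j) = P $ i $ j" for i j
  proof -
    have "(\<Sum>k\<in>UNIV. P $ i $ k * P $ k $ j) = (\<Sum>k\<in>UNIV. P $ i $ j * P $ k $ k)"
      by (rule sum.cong[OF refl]) (rule minor)
    also have "\<dots> = P $ i $ j * 1"
      unfolding sum_distrib_left[symmetric] trace by simp
    also have "\<dots> = P $ i $ j" by simp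
    finally show ?thesis .
  qed
  then show ?thesis by (simp add: vec_eq_iff matrix_matrix_mult_def)
qed

text \<open>The difference of the two sides is a Hermitian idempotent of trace zero.\<close>

lemma perp_sum_eq_one:
  assumes P: "projector P" and Q: "projector Q" and R: "projector R"
    and p: "perp P Q" "perp P R" "perp Q R"
  shows "P + Q + R = mat 1"
proof -
  define M :: mat3 where "M = mat 1 - (P + Q + R)"
  have z: "P ** Q = 0" "P ** R = 0" "Q ** R = 0" "Q ** P = 0" "R ** P = 0" "R ** Q = 0"
    using p perp_sym[OF P Q] perp_sym[OF P R] perp_sym[OF Q R] by (auto simp: perp_def)
  have "(P + Q + R) ** (P + Q + R) = P + Q + R"
    by (simp add: matrix_add_ldistrib matrix_ring_distribs z projector_idem P Q R)
  then have idem: "M ** M = M"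
    unfolding M_def by (simp add: matrix_ring_distribs)
  have herm: "M $ j $ i = cnj (M $ i $ j)" for i j
  proof -
    have "P $ j $ i = cnj (P $ i $ j)" "Q $ j $ i = cnj (Q $ i $ j)" "R $ j $ i = cnj (R $ i $ j)"
      using P Q R unfolding projector_def by blast+
    then show ?thesis unfolding M_def by (simp add: mat_def)
  qed
  have trace: "(\<Sum>i\<in>UNIV. M $ i $ i) = 0"
  proof -
    have "(\<Sum>i\<in>UNIV. P $ i $ i) = 1" "(\<Sum>i\<in>UNIV. Q $ i $ i) = 1" "(\<Sum>i\<in>UNIV. R $ i $ i) = 1"
      using P Q R unfolding projector_def by blast+
    then show ?thesis unfolding M_def by (simp add: mat_def sum_subtractf sum.distrib)
  qed
  \<comment> \<open>For a Hermitian matrix the sum of the squared absolute values of the entries is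
    the trace of the square, which here is the trace of \<open>M\<close> itself.\<close>
  have "(\<Sum>i\<in>UNIV. \<Sum>j\<in>UNIV. (norm (M $ i $ j))\<^sup>2) = 0"
  proof -
    have "complex_of_real (\<Sum>i\<in>UNIV. \<Sum>j\<in>UNIV. (norm (M $ i $ j))\<^sup>2) = (\<Sum>i\<in>UNIV. \<Sum>j\<in>UNIV. M $ i $ j * M $ j $ i)"
      by (simp add: complex_norm_square herm[symmetric] del: of_real_power)
    also have "\<dots> = (\<Sum>i\<in>UNIV. (M ** M) $ i $ i)" by (simp add: matrix_matrix_mult_def)
    also have "\<dots> = 0" unfolding idem by (rule trace)
    finally show ?thesis by (simp only: of_real_eq_0_iff)
  qed
  then have "M = 0" by (simp add: sum_nonneg_eq_0_iff sum_nonneg vec_eq_iff)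
  then show ?thesis by (simp add: M_def)
qed

text \<open>The conjugated cross product is orthogonal to both vectors. If it vanishes,
  \<open>w\<close> is a multiple of \<open>v\<close>, and any nonzero cross product of
  \<open>v\<close> with another vector will do.\<close>

lemma exists_perp_vector:
  assumes "v \<noteq> 0"
  obtains u where "u \<noteq> 0" "hermitian u v = 0" "hermitian u w = 0"
proof -
  define cr :: "complex ^ 3 \<Rightarrow> complex ^ 3" where "cr x = vector [cnj (v $ 2 * x $ 3 - v $ 3 * x $ 2),
     cnj (v $ 3 * x $ 1 - v $ 1 * x $ 3), cnj (v $ 1 * x $ 2 - v $ 2 * x $ 1)]" for x
  have cr: "cr x $ 1 = cnj (v $ 2 * x $ 3 - v $ 3 * x $ 2)" "cr x $ 2 = cnj (v $ 3 * x $ 1 - v $ 1 * x $ 3)"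
    "cr x $ 3 = cnj (v $ 1 * x $ 2 - v $ 2 * x $ 1)" for x by (simp_all add: cr_def)
  have orth: "hermitian (cr x) v = 0" "hermitian (cr x) x = 0" for x
    unfolding hermitian_def sum_3 cr by (simp_all add: algebra_simps flip: complex_cnj_mult complex_cnj_diff complex_cnj_add)
  show thesis
  proof (cases "cr w = 0")
    case False
    then show thesis using that orth by blast
  next
    case True
    have par: "v $ i * w $ j = v $ j * w $ i" for i j
    proof -
      have "v $ 2 * w $ 3 = v $ 3 * w $ 2" "v $ 3 * w $ 1 = v $ 1 * w $ 3" "v $ 1 * w $ 2 = v $ 2 * w $ 1"
        using True unfolding vec_eq_iff forall_3 cr zero_index complex_cnj_zero_iff right_minus_eq by blast+
      then show ?thesis using exhaust_3[of i] exhaust_3[of j] by auto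
    qed
    obtain i where i: "v $ i \<noteq> 0" using assms by (auto simp: vec_eq_iff)
    have w: "w $ j = w $ i / v $ i * v $ j" for j using par[of i j] i by (simp add: field_simps)
    have "\<exists>x. cr x \<noteq> 0"
    proof (rule ccontr)
      assume "\<not> ?thesis"
      then have "cr (axis 1 1) = 0" "cr (axis 2 1) = 0" by blast+
      then have "v = 0" unfolding vec_eq_iff forall_3 cr by (simp add: axis_def)
      then show False using assms by simp
    qed
    then obtain x where x: "cr x \<noteq> 0" by blast
    have "hermitian (cr x) w = cnj (w $ i / v $ i) * hermitian (cr x) v"
      unfolding hermitian_def by (subst w) (simp add: sum_distrib_left mult_ac)
    then show thesis using that[OF x] orth by simp
  qed
qed

lemma exists_perp:
  assumes "projector P" "projector Q"
  obtains R where "projector R" "perp P R" "perp Q R"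
proof -
  obtain v where v: "v \<noteq> 0" "P = proj_on v" using assms(1) by (rule projector_cases)
  obtain w where w: "w \<noteq> 0" "Q = proj_on w" using assms(2) by (rule projector_cases)
  obtain u where u: "u \<noteq> 0" "hermitian u v = 0" "hermitian u w = 0" by (rule exists_perp_vector[OF v(1)])
  have "perp P (proj_on u)" "perp Q (proj_on u)"
    unfolding v(2) w(2) perp_proj_on[OF v(1) u(1)] perp_proj_on[OF w(1) u(1)]
    using u(2,3) by (simp_all add: hermitian_cnj[of _ u])
  then show thesis using that projector_proj_on[OF u(1)] by blast
qed

lemma perp_complement:
  assumes "projector P" "projector Q" "perp P Q"
  obtains R where "projector R" "perp P R" "perp Q R" "R = mat 1 - P - Q"
proof -
  obtain R where R: "projector R" "perp P R" "perp Q R" using exists_perp[OF assms(1,2)] .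
  have "P + Q + R = mat 1" using perp_sum_eq_one[OF assms(1,2) R(1) assms(3) R(2,3)] .
  then have "R = mat 1 - P - Q" by (simp add: algebra_simps)
  then show thesis using that R by blast
qed

text \<open>Two distinct lines have only one common orthogonal line. If \<open>T\<close> completes
  \<open>P\<close> and \<open>R\<close> to a frame, then \<open>Q ** T ** R'\<close> vanishes, so
  \<open>T\<close> is orthogonal to \<open>Q\<close> or to \<open>R'\<close>. In the first case
  \<open>Q\<close> takes the place of \<open>P\<close> in the frame, in the second \<open>R'\<close>
  takes that of \<open>R\<close>.\<close>

lemma perp_unique:
  assumes P: "projector P" and Q: "projector Q" and R: "projector R" and R': "projector R'"
    and p: "perp P R" "perp Q R" "perp P R'" "perp Q R'"
  shows "P = Q \<or> R = R'"
proof -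
  obtain T where T: "projector T" "perp P T" "perp R T" "T = mat 1 - P - R"
    by (rule perp_complement[OF P R p(1)])
  have "Q ** T ** R' = 0"
  proof -
    have "Q ** T = Q - Q ** P"
      using p(2) unfolding T(4) by (simp add: matrix_ring_distribs perp_def)
    then have "Q ** T ** R' = Q ** R' - Q ** (P ** R')" by (simp add: matrix_ring_distribs matrix_mul_assoc)
    then show ?thesis using p(3,4) by (simp add: perp_def)
  qed
  then have "perp Q T \<or> perp T R'" using perp_three_cases[OF Q T(1) R'] by simp
  then show ?thesis
  proof
    assume "perp Q T"
    then have "Q + R + T = mat 1" using p(2) T by (intro perp_sum_eq_one Q R) auto
    then show ?thesis unfolding T(4) by (simp add: algebra_simps)
  next
    assume "perp T R'"
    then have "P + T + R' = mat 1" using p(3) T by (intro perp_sum_eq_one P R') auto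
    then show ?thesis unfolding T(4) by (simp add: algebra_simps)
  qed
qed

lemma projector_diagonal:
  assumes "projector P"
  shows "norm (P $ i $ j) \<le> 1" "P $ i $ i = 0 \<Longrightarrow> P $ i $ j = 0" "P $ i $ i = 0 \<Longrightarrow> P $ j $ i = 0"
proof -
  obtain v where v: "v \<noteq> 0" "P = proj_on v" using assms by (rule projector_cases)
  have "norm (v $ i) * norm (v $ j) \<le> norm v * norm v" by (intro mult_mono component_le_norm_cart Finite_Cartesian_Product.norm_nth_le) auto
  then show "norm (P $ i $ j) \<le> 1"
    unfolding v(2) using v(1) by (simp add: proj_on_def norm_divide norm_mult power2_eq_square)
  show "P $ i $ j = 0" "P $ j $ i = 0" if "P $ i $ i = 0"
    using that v(1) unfolding v(2) by (auto simp: proj_on_def)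
qed

lemma projector_axis: "projector (proj_on (axis i 1))"
  "proj_on (axis i 1) $ k $ l = (if k = i \<and> l = i then 1 else 0)"
proof -
  show "projector (proj_on (axis i 1))" by (rule projector_proj_on) (simp add: axis_eq_0_iff)
  show "proj_on (axis i 1) $ k $ l = (if k = i \<and> l = i then 1 else 0)"
    by (simp add: proj_on_def) (simp add: axis_def)
qed

text \<open>This makes orthogonality to a coordinate axis one regular equation, as
  \<open>cchi_split\<close> requires.\<close>

lemma perp_axis:
  assumes "projector P"
  shows "perp (proj_on (axis i 1)) P \<longleftrightarrow> P $ i $ i = 0"
proof -
  have e: "(proj_on (axis i 1) ** P) $ k $ l = (if k = i then P $ i $ l else 0)" for k l
    unfolding matrix_matrix_mult_def by (simp add: projector_axis(2) if_distrib[of "\<lambda>z. z * _"] cong: if_cong)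
  show ?thesis unfolding perp_def vec_eq_iff e using projector_diagonal(2)[OF assms, of i] by auto
qed

section \<open>Configurations of lines on the legs and sides of a square\<close>

section \<open>The configurations around a square\<close>

lemma separated_functions:
  fixes x y :: "'a \<Rightarrow> 'b::t2_space"
  assumes "x \<noteq> y"
  shows "\<exists>U V. open U \<and> open V \<and> x \<in> U \<and> y \<in> V \<and> U \<inter> V = {}"
proof -
  obtain e where "x e \<noteq> y e" using assms by auto
  then obtain U V where UV: "open U" "open V" "x e \<in> U" "y e \<in> V" "U \<inter> V = {}"
    using hausdorff[of "x e" "y e"] by auto
  have "continuous_on UNIV (\<lambda>z :: 'a \<Rightarrow> 'b. z e)" by (rule continuous_on_product_coordinates)
  then have "open ((\<lambda>z. z e) -` U)" "open ((\<lambda>z. z e) -` V)" using UV(1,2) open_vimage by blast+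
  moreover have "(\<lambda>z. z e) -` U \<inter> (\<lambda>z. z e) -` V = {}" using UV(5) by auto
  ultimately show ?thesis using UV(3,4) by (metis vimageI)
qed

instance "fun" :: (type, t2_space) t0_space
proof
  fix x y :: "'a \<Rightarrow> 'b" assume "x \<noteq> y"
  then show "\<exists>U. open U \<and> (x \<in> U) \<noteq> (y \<in> U)" using separated_functions by blast
qed

instance "fun" :: (type, t2_space) t1_space
proof
  fix x y :: "'a \<Rightarrow> 'b" assume "x \<noteq> y"
  then show "\<exists>U. open U \<and> x \<in> U \<and> y \<notin> U" using separated_functions by blast
qed

instance "fun" :: (type, t2_space) t2_space
proof
  fix x y :: "'a \<Rightarrow> 'b" assume "x \<noteq> y"
  then show "\<exists>U V. open U \<and> open V \<and> x \<in> U \<and> y \<in> V \<and> U \<inter> V = {}" by (rule separated_functions)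
qed

text \<open>On a noncompact piece a continuous bijection need not be a homeomorphism. Here the piece
  is the full preimage of \<open>T\<close> in a compact set, which makes the map closed over
  \<open>T\<close>.\<close>

lemma homeomorphic_compact_fibres:
  fixes f :: "'a::t2_space \<Rightarrow> 'b::t2_space"
  assumes K: "compact K" "continuous_on K f" and S: "S = K \<inter> f -` T" and f: "inj_on f S" "T \<subseteq> f ` S"
  shows "S homeomorphic T"
proof -
  have SK: "S \<subseteq> K" and im: "f ` S = T" using S f(2) by auto
  have cont: "continuous_on S f" using K(2) SK by (rule continuous_on_subset)
  have closed_map: "closedin (top_of_set T) (f ` U)" if U: "closedin (top_of_set S) U" for U
  proof -
    obtain C where C: "closed C" "U = S \<inter> C" using U unfolding closedin_closed by auto
    have "compact (f ` (K \<inter> C))"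
      by (intro compact_continuous_image continuous_on_subset[OF K(2)] compact_Int_closed K(1) C(1)) auto
    moreover have "f ` U = T \<inter> f ` (K \<inter> C)" using C(2) S by auto
    ultimately show ?thesis unfolding closedin_closed using compact_imp_closed by blast
  qed
  obtain g where "homeomorphism S T f g"
    using homeomorphism_injective_closed_map[OF cont im f(1) closed_map] by blast
  then show ?thesis unfolding homeomorphic_def by blast
qed

definition restrict_to :: "'e set \<Rightarrow> ('e \<Rightarrow> mat3) \<Rightarrow> 'e \<Rightarrow> mat3" where
  "restrict_to E x = (\<lambda>e. if e \<in> E then x e else 0)"

lemma restrict_to_in: "e \<in> E \<Longrightarrow> restrict_to E x e = x e"
  by (simp add: restrict_to_def)

lemma restrict_to_zero_outside: "restrict_to E x \<in> zero_outside E"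
  by (simp add: restrict_to_def zero_outside_def)

lemma continuous_on_restrict_to: "continuous_on S (restrict_to E)"
proof (rule continuous_on_coordinatewise_then_product)
  fix e show "continuous_on S (\<lambda>x. restrict_to E x e)"
    by (cases "e \<in> E") (auto simp: restrict_to_def intro: continuous_on_subset[OF continuous_on_product_coordinates])
qed

lemma regular_restrict_to: "regular f \<Longrightarrow> regular (\<lambda>x. f (restrict_to E x))"
proof (induction rule: regular.induct)
  case (entry e i j)
  then show ?case by (cases "e \<in> E") (auto simp: restrict_to_def intro: regular.intros)
qed (auto intro: regular.intros)

lemma variety_restrict_to: "variety V \<Longrightarrow> variety {x. restrict_to E x \<in> V}"
proof -
  assume "variety V"
  then obtain F where F: "finite F" "\<forall>f\<in>F. regular f" "V = {x. \<forall>f\<in>F. f x = 0}" by (auto simp: variety_def)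
  then show ?thesis
    unfolding variety_def by (intro exI[of _ "(\<lambda>f x. f (restrict_to E x)) ` F"]) (auto intro: regular_restrict_to)
qed

text \<open>The squared Hilbert-Schmidt distance: equality of two matrices becomes the vanishing of
  a single regular function.\<close>

definition mat_gap :: "mat3 \<Rightarrow> mat3 \<Rightarrow> complex" where
  "mat_gap A B = (\<Sum>i\<in>UNIV. \<Sum>j\<in>UNIV. (A $ i $ j - B $ i $ j) * cnj (A $ i $ j - B $ i $ j))"

lemma mat_gap_eq_0: "mat_gap A B = 0 \<longleftrightarrow> A = B"
proof -
  have "mat_gap A B = complex_of_real (\<Sum>i\<in>UNIV. \<Sum>j\<in>UNIV. (norm (A $ i $ j - B $ i $ j))\<^sup>2)"
    unfolding mat_gap_def of_real_sum complex_norm_square ..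
  then show ?thesis
    by (simp only: of_real_eq_0_iff) (simp add: sum_nonneg_eq_0_iff sum_nonneg vec_eq_iff)
qed

lemma regular_mat_gap: "regular (\<lambda>x. mat_gap (x e) (x e'))"
  unfolding mat_gap_def by (intro regular_sum regular.mult regular.cnj regular_diff regular.entry)

lemma variety_eq: "variety {x. x e = x e'}"
  using variety_zero[OF regular_mat_gap, of e e'] by (simp add: mat_gap_eq_0)

lemma variety_projector: "variety {x. projector (x e)}"
proof -
  have "variety {x. x e $ j $ i = cnj (x e $ i $ j)}" for i j
    using variety_zero[OF regular_diff[OF regular.entry regular.cnj[OF regular.entry]], of e j i e i j] by simp
  moreover have "variety {x. x e $ i $ j * x e $ k $ l = x e $ i $ l * x e $ k $ j}" for i j k l
    using variety_zero[OF regular_diff[OF regular.mult[OF regular.entry regular.entry] regular.mult[OF regular.entry regular.entry]],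
        of e i j e k l e i l e k j] by simp
  moreover have "variety {x. (\<Sum>i\<in>UNIV. x e $ i $ i) = 1}"
    using variety_zero[OF regular_diff[OF regular_sum[of UNIV "\<lambda>i x. x e $ i $ i", OF regular.entry] regular.const[of 1]]] by simp
  ultimately show ?thesis
    unfolding projector_def by (intro variety_Collect_conj variety_Collect_all)
qed

lemma variety_perp: "variety {x. perp (x e) (x e')}"
proof -
  have "variety {x. (\<Sum>k\<in>UNIV. x e $ i $ k * x e' $ k $ j) = 0}" for i j
    by (intro variety_zero regular_sum regular.intros)
  then show ?thesis
    unfolding perp_def vec_eq_iff matrix_matrix_mult_def by (simp add: variety_Collect_all)
qed

definition triple :: "mat3 \<Rightarrow> mat3 \<Rightarrow> mat3 \<Rightarrow> bool" where
  "triple P Q R \<longleftrightarrow> perp P Q \<and> perp P R \<and> perp Q R"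

lemma variety_triple: "variety {x. triple (x e) (x e') (x e'')}"
  unfolding triple_def by (intro variety_Collect_conj variety_perp)

text \<open>\<open>E0\<close> and \<open>V\<close> stand for the edges and the conditions outside
  the square. Leg \<open>a\<close> meets the sides \<open>q0\<close> and \<open>q3\<close>, and so
  on cyclically. The sides are distinct, but the legs are not assumed to be, as two of them may be
  the ends of one edge.\<close>

locale square_geometry =
  fixes E0 :: "'e set" and V :: "('e \<Rightarrow> mat3) set" and a b c d q0 q1 q2 q3 :: 'e
  assumes finite_E0: "finite E0" and variety_V: "variety V"
    and projector_V: "\<And>x e. x \<in> zero_outside E0 \<Longrightarrow> x \<in> V \<Longrightarrow> e \<in> E0 \<Longrightarrow> projector (x e)"
    and legs: "a \<in> E0" "b \<in> E0" "c \<in> E0" "d \<in> E0"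
    and sides: "distinct [q0, q1, q2, q3]" "q0 \<notin> E0" "q1 \<notin> E0" "q2 \<notin> E0" "q3 \<notin> E0"
begin

definition E where "E = E0 \<union> {q0, q1, q2, q3}"

definition Y where "Y = zero_outside E0 \<inter> V"

definition X where
  "X = zero_outside E \<inter> {x. restrict_to E0 x \<in> V \<and>
     projector (x q0) \<and> projector (x q1) \<and> projector (x q2) \<and> projector (x q3) \<and>
     triple (x a) (x q0) (x q3) \<and> triple (x b) (x q1) (x q0) \<and>
     triple (x c) (x q2) (x q1) \<and> triple (x d) (x q3) (x q2)}"

text \<open>The decorations of one resolution, still indexed by the outer edges of the original
  graph: fused edges carry equal matrices.\<close>

definition X' where "X' = Y \<inter> {x. x a = x b \<and> x c = x d}"

definition Z where "Z = Y \<inter> {x. x a = x b \<and> x c = x d \<and> x a = x c}"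

definition W where "W = X \<inter> {x. x q0 = x q2 \<and> x q1 = x q3}"

lemma finite_E: "finite E"
  using finite_E0 by (simp add: E_def)

lemma X_props:
  assumes "x \<in> X"
  shows "restrict_to E0 x \<in> Y" "\<And>e. e \<in> E \<Longrightarrow> projector (x e)"
    "triple (x a) (x q0) (x q3)" "triple (x b) (x q1) (x q0)"
    "triple (x c) (x q2) (x q1)" "triple (x d) (x q3) (x q2)" "\<And>e. e \<notin> E \<Longrightarrow> x e = 0"
proof -
  show Y: "restrict_to E0 x \<in> Y" using assms restrict_to_zero_outside by (auto simp: X_def Y_def)
  then have "projector (x e)" if "e \<in> E0" for e
    using projector_V[of "restrict_to E0 x" e] that by (simp add: Y_def restrict_to_in)
  then show "projector (x e)" if "e \<in> E" for e using assms that by (auto simp: X_def E_def)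
qed (use assms in \<open>auto simp: X_def zero_outside_def\<close>)

lemma in_E: "a \<in> E" "b \<in> E" "c \<in> E" "d \<in> E" "q0 \<in> E" "q1 \<in> E" "q2 \<in> E" "q3 \<in> E"
  using legs by (auto simp: E_def)

lemma Y_props:
  assumes "x \<in> Y"
  shows "\<And>e. e \<in> E0 \<Longrightarrow> projector (x e)" "\<And>e. e \<notin> E0 \<Longrightarrow> x e = 0" "restrict_to E0 x = x"
  using assms projector_V by (auto simp: Y_def zero_outside_def restrict_to_def)

lemma tame_X: "tame E X" "compact X"
proof -
  have V: "variety {x. restrict_to E0 x \<in> V \<and>
     projector (x q0) \<and> projector (x q1) \<and> projector (x q2) \<and> projector (x q3) \<and>
     triple (x a) (x q0) (x q3) \<and> triple (x b) (x q1) (x q0) \<and>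
     triple (x c) (x q2) (x q1) \<and> triple (x d) (x q3) (x q2)}"
    by (intro variety_Collect_conj variety_triple variety_projector variety_restrict_to variety_V)
  have "norm (x e $ i $ j) \<le> 1" if "x \<in> X" for x e i j
    using X_props(2,7)[OF that, of e] projector_diagonal(1)[of "x e" i j] by (cases "e \<in> E") auto
  then have "X \<subseteq> box_matrices E" unfolding box_matrices_def X_def by blast
  then show "tame E X" "compact X" using variety_tame[OF V, of E] unfolding X_def by simp_all
qed

lemma tame_Y_Int:
  assumes "variety U"
  shows "tame E0 (Y \<inter> U)" "compact (Y \<inter> U)"
proof -
  have eq: "Y \<inter> U = zero_outside E0 \<inter> (V \<inter> U)" by (auto simp: Y_def)
  have "norm (x e $ i $ j) \<le> 1" if "x \<in> Y" for x e i j
    using Y_props(1,2)[OF that, of e] projector_diagonal(1)[of "x e" i j] by (cases "e \<in> E0") auto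
  then have "zero_outside E0 \<inter> (V \<inter> U) \<subseteq> box_matrices E0" unfolding box_matrices_def Y_def by blast
  then show "tame E0 (Y \<inter> U)" "compact (Y \<inter> U)"
    unfolding eq using variety_tame[OF variety_Int[OF variety_V assms]] by simp_all
qed

lemma X_legs:
  assumes "x \<in> X"
  shows "x a = mat 1 - x q0 - x q3" "x b = mat 1 - x q1 - x q0"
    "x c = mat 1 - x q2 - x q1" "x d = mat 1 - x q3 - x q2"
proof -
  have eq: "P = mat 1 - Q - R" if "triple P Q R" "projector P" "projector Q" "projector R" for P Q R
    using perp_sum_eq_one[of P Q R] that by (simp add: triple_def eq_diff_eq add_ac)
  show "x a = mat 1 - x q0 - x q3" "x b = mat 1 - x q1 - x q0"
    "x c = mat 1 - x q2 - x q1" "x d = mat 1 - x q3 - x q2"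
    using X_props(2-6)[OF assms] in_E by (simp_all add: eq)
qed

text \<open>Each of \<open>q0\<close> and \<open>q2\<close> is orthogonal to both \<open>q1\<close>
  and \<open>q3\<close>, so \<open>perp_unique\<close> applies.\<close>

lemma opposite_sides:
  assumes "x \<in> X"
  shows "x q0 = x q2 \<or> x q1 = x q3"
proof -
  note pr = X_props(2)[OF assms]
  have "perp (x q0) (x q3)" "perp (x q1) (x q0)" "perp (x q2) (x q1)" "perp (x q3) (x q2)"
    using X_props(3-6)[OF assms] by (simp_all add: triple_def)
  then show ?thesis
    using perp_unique[of "x q0" "x q2" "x q1" "x q3"] perp_sym pr in_E by blast
qed

lemma X_memI:
  assumes z: "z \<in> Y" and P: "projector P0" "projector P1" "projector P2" "projector P3"
    and t: "triple (z a) P0 P3" "triple (z b) P1 P0" "triple (z c) P2 P1" "triple (z d) P3 P2"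
  obtains x where "x \<in> X" "restrict_to E0 x = z" "x q0 = P0" "x q1 = P1" "x q2 = P2" "x q3 = P3"
proof -
  define x where "x = z(q0 := P0, q1 := P1, q2 := P2, q3 := P3)"
  have xq: "x q0 = P0" "x q1 = P1" "x q2 = P2" "x q3 = P3" using sides(1) by (auto simp: x_def)
  have x0: "x e = z e" if "e \<in> E0" for e using that sides(2-5) by (auto simp: x_def)
  have r: "restrict_to E0 x = z" using x0 Y_props(2)[OF z] by (auto simp: restrict_to_def)
  have "x e = 0" if "e \<notin> E" for e using that Y_props(2)[OF z, of e] by (auto simp: x_def E_def)
  then have "x \<in> X"
    unfolding X_def zero_outside_def using z r P t by (simp add: xq x0 legs Y_def)
  then show thesis using that r xq by blast
qed

lemma X_eqI:
  assumes "x \<in> X" "y \<in> X" "restrict_to E0 x = restrict_to E0 y"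
    "x q0 = y q0" "x q1 = y q1" "x q2 = y q2" "x q3 = y q3"
  shows "x = y"
proof
  fix e show "x e = y e"
  proof (cases "e \<in> E0")
    case True
    then show ?thesis using fun_cong[OF assms(3), of e] by (simp add: restrict_to_in)
  next
    case False
    then show ?thesis
      using assms(4-7) X_props(7)[OF assms(1), of e] X_props(7)[OF assms(2), of e]
      by (cases "e \<in> {q0, q1, q2, q3}") (auto simp: E_def)
  qed
qed

text \<open>On this piece \<open>q1 = q3\<close>, and this line is the only one orthogonal to the
  two distinct legs \<open>a\<close> and \<open>c\<close>. Then \<open>q0\<close> and
  \<open>q2\<close> complete the frames at these legs, so the outer data determine the
  sides.\<close>

lemma side_homeomorphic: "X \<inter> {x. x q0 \<noteq> x q2} homeomorphic X' \<inter> {x. x a \<noteq> x c}"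
proof (rule homeomorphic_compact_fibres)
  \<comment> \<open>A compact set containing the piece. Inside it the condition
    \<open>q0 ~= q2\<close> can be expressed by the legs, which makes the piece a full
    preimage.\<close>
  let ?K = "X \<inter> {x. x q1 = x q3}" and ?T = "X' \<inter> {x. x a \<noteq> x c}" and ?S = "X \<inter> {x. x q0 \<noteq> x q2}"
  show "compact ?K" by (intro compact_Int_closed tame_X variety_closed variety_eq)
  show "continuous_on ?K (restrict_to E0)" by (rule continuous_on_restrict_to)
  have S: "x q1 = x q3 \<and> x a = x b \<and> x c = x d \<and> x a \<noteq> x c" if "x \<in> ?S" for x
  proof -
    have x: "x \<in> X" "x q0 \<noteq> x q2" using that by auto
    then have eq: "x q1 = x q3" using opposite_sides by blast
    note l = X_legs[OF x(1), unfolded eq]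
    have "x a = x b" "x c = x d" unfolding l by simp_all
    moreover have "x a \<noteq> x c" unfolding l using x(2) by simp
    ultimately show ?thesis using eq by blast
  qed
  show eq: "?S = ?K \<inter> restrict_to E0 -` ?T"
  proof (intro equalityI subsetI)
    fix x assume x: "x \<in> ?S"
    then show "x \<in> ?K \<inter> restrict_to E0 -` ?T"
      using S[OF x] X_props(1)[of x] by (auto simp: X'_def restrict_to_in legs)
  next
    fix x assume "x \<in> ?K \<inter> restrict_to E0 -` ?T"
    then have x: "x \<in> X" "x q1 = x q3" "x a \<noteq> x c" by (auto simp: X'_def restrict_to_in legs)
    have "x q0 \<noteq> x q2" using x(3) unfolding X_legs[OF x(1)] x(2) by auto
    then show "x \<in> ?S" using x(1) by blast
  qed
  show "inj_on (restrict_to E0) ?S"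
  proof (rule inj_onI)
    fix x y assume x: "x \<in> ?S" and y: "y \<in> ?S" and r: "restrict_to E0 x = restrict_to E0 y"
    have X: "x \<in> X" "y \<in> X" using x y by auto
    have xy: "x e = y e" if "e \<in> E0" for e using fun_cong[OF r, of e] that by (simp add: restrict_to_in)
    have "perp (x a) (x q1)" "perp (x c) (x q1)" "perp (x a) (y q1)" "perp (x c) (y q1)"
      using X_props(3,5)[OF X(1)] X_props(3,5)[OF X(2)] S[OF x] S[OF y] xy[OF legs(1)] xy[OF legs(3)]
      by (simp_all add: triple_def)
    then have q1: "x q1 = y q1"
      using perp_unique[of "x a" "x c" "x q1" "y q1"] S[OF x] X_props(2)[OF X(1)] X_props(2)[OF X(2)] in_E by blast
    then have q3: "x q3 = y q3" using S[OF x] S[OF y] by simp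
    have q0: "x q0 = y q0"
      using X_legs(1)[OF X(1)] X_legs(1)[OF X(2)] q3 xy[OF legs(1)] by simp
    have q2: "x q2 = y q2"
      using X_legs(3)[OF X(1)] X_legs(3)[OF X(2)] q1 xy[OF legs(3)] by simp
    show "x = y" by (rule X_eqI[OF X r q0 q1 q2 q3])
  qed
  show "?T \<subseteq> restrict_to E0 ` ?S"
  proof
    fix z assume "z \<in> ?T"
    then have z: "z \<in> Y" "z b = z a" "z d = z c" "z a \<noteq> z c" by (auto simp: X'_def)
    have pr: "projector (z a)" "projector (z c)" using Y_props(1)[OF z(1)] legs by auto
    obtain Q where Q: "projector Q" "perp (z a) Q" "perp (z c) Q" by (rule exists_perp[OF pr])
    obtain P where P: "projector P" "perp (z a) P" "perp Q P" "P = mat 1 - z a - Q"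
      by (rule perp_complement[OF pr(1) Q(1,2)])
    obtain R where R: "projector R" "perp (z c) R" "perp Q R" "R = mat 1 - z c - Q"
      by (rule perp_complement[OF pr(2) Q(1,3)])
    have "perp P Q" "perp R Q" using perp_sym P R Q by blast+
    then obtain x where x: "x \<in> X" "restrict_to E0 x = z" "x q0 = P" "x q2 = R"
      using X_memI[OF z(1) P(1) Q(1) R(1) Q(1)] P Q R z unfolding triple_def by metis
    moreover have "P \<noteq> R" using P(4) R(4) z(4) by auto
    ultimately show "z \<in> restrict_to E0 ` ?S" by auto
  qed
qed

lemma W_props:
  assumes "x \<in> W"
  shows "x \<in> X" "x q2 = x q0" "x q3 = x q1" "restrict_to E0 x \<in> Z" "restrict_to E0 x a = x a"
    "perp (x a) (x q0)" "projector (x a)" "projector (x q0)" "x q1 = mat 1 - x a - x q0"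
proof -
  show X: "x \<in> X" "x q2 = x q0" "x q3 = x q1" using assms by (auto simp: W_def)
  note s = X_legs[OF X(1), unfolded X(2,3)]
  have "x b = x a" "x c = x a" "x d = x a" unfolding s by simp_all
  then show "restrict_to E0 x \<in> Z" using X_props(1)[OF X(1)] by (simp add: Z_def restrict_to_in legs)
  show "restrict_to E0 x a = x a" by (simp add: restrict_to_in legs)
  show "perp (x a) (x q0)" using X_props(3)[OF X(1)] by (simp add: triple_def)
  show "projector (x a)" "projector (x q0)" using X_props(2)[OF X(1)] in_E by auto
  show "x q1 = mat 1 - x a - x q0" unfolding s(1) by simp
qed

lemma W_eqI:
  assumes "x \<in> W" "y \<in> W" "restrict_to E0 x = restrict_to E0 y" "x q0 = y q0"
  shows "x = y"
proof -
  note x = W_props[OF assms(1)] and y = W_props[OF assms(2)]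
  have "x a = y a" using x(5) y(5) assms(3) by simp
  then have "x q1 = y q1" using x(9) y(9) assms(4) by simp
  then show ?thesis using X_eqI[OF x(1) y(1) assms(3,4)] x(2,3) y(2,3) assms(4) by simp
qed

lemma W_memI:
  assumes z: "z \<in> Z" and Q: "projector Q" "perp (z a) Q"
  obtains x where "x \<in> W" "restrict_to E0 x = z" "x q0 = Q"
proof -
  have zY: "z \<in> Y" "z b = z a" "z c = z a" "z d = z a" using z by (auto simp: Z_def)
  have a: "projector (z a)" using Y_props(1)[OF zY(1)] legs by auto
  obtain P where P: "projector P" "perp (z a) P" "perp Q P" by (rule perp_complement[OF a Q])
  have "perp P Q" using perp_sym P Q by blast
  then obtain x where "x \<in> X" "restrict_to E0 x = z" "x q0 = Q" "x q1 = P" "x q2 = Q" "x q3 = P"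
    using X_memI[OF zY(1) Q(1) P(1) Q(1) P(1)] P Q zY unfolding triple_def by metis
  then show thesis by (intro that[of x]) (simp_all add: W_def)
qed

lemma compact_W: "compact W"
  unfolding W_def by (intro compact_Int_closed tame_X variety_closed variety_Collect_conj variety_eq)

text \<open>On the stratum the leg has a nonzero component along axis \<open>i\<close>. So it is not
  axis \<open>j\<close>, and among the lines orthogonal to the leg exactly one is also orthogonal to
  axis \<open>j\<close>. The remaining choices of \<open>q0\<close> form a product of the base with
  the complex plane. Each of the two parts contributes the value of the base.\<close>

lemma W_stratum:
  assumes ijk: "distinct [i, j, k]"
    and C: "\<And>A. projector A \<Longrightarrow> C A \<Longrightarrow> A $ i $ i \<noteq> 0"
    and tW: "tame E (W \<inter> {x. C (x a)})" and tZ: "tame E0 (Z \<inter> {x. C (x a)})"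
  shows "cchi (W \<inter> {x. C (x a)}) = 2 * cchi (Z \<inter> {x. C (x a)})"
proof -
  let ?T = "Z \<inter> {x. C (x a)}" and ?U = "W \<inter> {x. C (x a)}"
  let ?S = "?U \<inter> {x. x q0 $ j $ j = 0}" and ?R = "?U \<inter> {x. x q0 $ j $ j \<noteq> 0}"
  let ?ax = "\<lambda>m. proj_on (axis m 1)"
  have ne: "i \<noteq> j" "i \<noteq> k" "j \<noteq> k" using ijk by auto
  have UN: "m = i \<or> m = j \<or> m = k" for m :: 3
    using ne exhaust_3[of m] exhaust_3[of i] exhaust_3[of j] exhaust_3[of k] by auto
  have reg: "regular (\<lambda>x. x q0 $ j $ j)" by (rule regular.entry)
  note tame_SR = tame_Int_zero[OF tW reg]
  have fib: "restrict_to E0 x \<in> ?T \<longleftrightarrow> C (x a)" if "x \<in> W" for x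
    using W_props(4,5)[OF that] by simp
  have aZ: "projector (z a)" if "z \<in> Z" for z using that Y_props(1) legs by (auto simp: Z_def)
  have a_ax: "x a \<noteq> B" if "projector (x a)" "C (x a)" "B $ i $ i = 0" for x :: "'e \<Rightarrow> mat3" and B
    using C[OF that(1,2)] that(3) by auto
  have axis_ne: "?ax m \<noteq> ?ax n" if "m \<noteq> n" for m n :: 3
    using that projector_axis(2)[of m m m] projector_axis(2)[of n m m] by auto
  \<comment> \<open>The section: the leg differs from axis \<open>j\<close>, so exactly one choice
    of \<open>q0\<close> is orthogonal to both.\<close>
  have "?S homeomorphic ?T"
  proof (rule homeomorphic_compact_fibres)
    let ?K = "W \<inter> {x. x q0 $ j $ j = 0}"
    show "compact ?K" by (intro compact_Int_closed compact_W variety_closed variety_zero reg)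
    show "continuous_on ?K (restrict_to E0)" by (rule continuous_on_restrict_to)
    show "?S = ?K \<inter> restrict_to E0 -` ?T" using fib by blast
    show "inj_on (restrict_to E0) ?S"
    proof (rule inj_onI)
      fix x y assume x: "x \<in> ?S" and y: "y \<in> ?S" and r: "restrict_to E0 x = restrict_to E0 y"
      have W: "x \<in> W" "y \<in> W" using x y by auto
      note px = W_props[OF W(1)] and py = W_props[OF W(2)]
      have a: "y a = x a" using px(5) py(5) r by simp
      have "perp (?ax j) (x q0)" "perp (?ax j) (y q0)"
        using x y perp_axis[OF px(8)] perp_axis[OF py(8)] by auto
      moreover have "x a \<noteq> ?ax j" using a_ax[of x "?ax j"] px(7) x ne projector_axis(2)[of j i i] by auto
      ultimately have "x q0 = y q0"
        using perp_unique[OF px(7) projector_axis(1) px(8) py(8)] px(6) py(6) a by metis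
      then show "x = y" by (rule W_eqI[OF W r])
    qed
    show "?T \<subseteq> restrict_to E0 ` ?S"
    proof
      fix z assume z: "z \<in> ?T"
      then have zZ: "z \<in> Z" by simp
      obtain Q where Q: "projector Q" "perp (z a) Q" "perp (?ax j) Q"
        by (rule exists_perp[OF aZ[OF zZ] projector_axis(1)])
      obtain x where x: "x \<in> W" "restrict_to E0 x = z" "x q0 = Q" by (rule W_memI[OF zZ Q(1,2)])
      have "x q0 $ j $ j = 0" using Q(1,3) x(3) perp_axis by blast
      then have "x \<in> ?S" using x z fib[OF x(1)] by simp
      then show "z \<in> restrict_to E0 ` ?S" using x(2) by blast
    qed
  qed
  then have chi_S: "cchi ?S = cchi ?T"
    by (rule ctame_homeomorphic(2)[OF tame_ctame[OF finite_E tame_SR(1)], symmetric])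
  \<comment> \<open>The lines in the plane orthogonal to axis \<open>i\<close>, with the exception
    of axis \<open>j\<close>. This set does not depend on the leg.\<close>
  define \<P> where "\<P> = {B. projector B \<and> B $ i $ i = 0 \<and> B $ k $ k \<noteq> 0}"
  \<comment> \<open>The incidence set of configurations and lines \<open>B\<close> orthogonal to
    \<open>q0\<close> and to axis \<open>i\<close>. As \<open>q0\<close> is never axis
    \<open>i\<close> on the stratum, it determines \<open>B\<close>; as \<open>B\<close> is never
    the leg there, \<open>B\<close> and the leg determine \<open>q0\<close>. Replacing
    \<open>q0\<close> by \<open>B\<close>, which varies in a fixed plane, trivializes the
    bundle.\<close>
  define K where "K = (W \<times> {B. projector B}) \<inter> {p. snd p $ i $ i = 0} \<inter> {p. snd p ** fst p q0 = 0}"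
  have compact_K: "compact K"
  proof -
    have "compact {B. projector B}"
    proof -
      have "zero_outside {q0} \<inter> {x. projector (x q0)} \<subseteq> box_matrices {q0}"
        using projector_diagonal(1) by (fastforce simp: box_matrices_def zero_outside_def)
      then have "compact (zero_outside {q0} \<inter> {x. projector (x q0)})"
        by (rule variety_tame(2)[OF variety_projector])
      then have "compact ((\<lambda>x. x q0) ` (zero_outside {q0} \<inter> {x. projector (x q0)}))"
        by (rule compact_continuous_image[rotated]) (rule continuous_on_subset[OF continuous_on_product_coordinates subset_UNIV])
      moreover have "(\<lambda>x. x q0) ` (zero_outside {q0} \<inter> {x. projector (x q0)}) = {B. projector B}"
      proof (intro equalityI subsetI)
        fix B assume "B \<in> {B. projector B}"
        then show "B \<in> (\<lambda>x. x q0) ` (zero_outside {q0} \<inter> {x. projector (x q0)})"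
          by (intro image_eqI[of _ _ "\<lambda>e. if e = q0 then B else 0"]) (auto simp: zero_outside_def)
      qed auto
      ultimately show ?thesis by simp
    qed
    moreover have cf: "continuous_on UNIV (\<lambda>p :: ('e \<Rightarrow> mat3) \<times> mat3. fst p q0)"
      by (rule continuous_on_product_then_coordinatewise) (rule continuous_on_fst[OF continuous_on_id])
    then have cp: "continuous_on UNIV (\<lambda>p :: ('e \<Rightarrow> mat3) \<times> mat3. snd p ** fst p q0)"
      unfolding matrix_matrix_mult_def
      by (intro continuous_on_vec_lambda continuous_on_sum continuous_on_mult continuous_on_mat_entry
          continuous_on_snd continuous_on_id)
    have "closed {p :: ('e \<Rightarrow> mat3) \<times> mat3. snd p $ i $ i = 0}"
      by (intro closed_Collect_eq continuous_on_mat_entry continuous_on_snd continuous_on_id continuous_on_const)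
    moreover have "closed {p :: ('e \<Rightarrow> mat3) \<times> mat3. snd p ** fst p q0 = 0}"
      by (intro closed_Collect_eq cp continuous_on_const)
    ultimately show ?thesis unfolding K_def by (intro compact_Int_closed compact_Times compact_W)
  qed
  have K: "(x, B) \<in> K \<longleftrightarrow> x \<in> W \<and> projector B \<and> B $ i $ i = 0 \<and> perp B (x q0)" for x B
    by (auto simp: K_def perp_def)
  have ax_i: "perp (?ax i) B \<longleftrightarrow> B $ i $ i = 0" if "projector B" for B using perp_axis[OF that] .
  have ax_j: "projector (?ax j)" "?ax j $ i $ i = 0" "?ax j $ k $ k = 0" "?ax j $ j $ j = 1"
    using ne projector_axis by auto
  have q0_ne: "x q0 \<noteq> ?ax i" if x: "x \<in> ?U" for x
  proof
    have W: "x \<in> W" using x by simp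
    assume "x q0 = ?ax i"
    then have "perp (?ax i) (x a)" using W_props(6-8)[OF W] perp_sym by metis
    then show False using ax_i[OF W_props(7)[OF W]] C W_props(7)[OF W] x by auto
  qed
  \<comment> \<open>The exceptional values correspond: \<open>q0\<close> is orthogonal to axis
    \<open>j\<close> exactly when \<open>B\<close> is axis \<open>j\<close>, that is, when the
    diagonal entry of \<open>B\<close> at \<open>k\<close> vanishes.\<close>
  have coord: "x q0 $ j $ j = 0 \<longleftrightarrow> B $ k $ k = 0" if x: "x \<in> ?U" and B: "(x, B) \<in> K" for x B
  proof
    have W: "x \<in> W" using x by simp
    have B': "projector B" "B $ i $ i = 0" "perp B (x q0)" using B K by auto
    note px = W_props(8)[OF W]
    {
      assume "x q0 $ j $ j = 0"
      then have j: "perp (?ax j) (x q0)" using perp_axis[OF px] by blast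
      have "perp (x q0) B" "perp (x q0) (?ax j)"
        using perp_sym[OF B'(1) px B'(3)] perp_sym[OF ax_j(1) px j] by auto
      moreover have "perp (?ax i) B" "perp (?ax i) (?ax j)" using ax_i B'(1,2) ax_j by auto
      ultimately have "B = ?ax j"
        using perp_unique[OF px projector_axis(1) B'(1) ax_j(1)] q0_ne[OF x] by blast
      then show "B $ k $ k = 0" using ax_j by simp
    next
      assume "B $ k $ k = 0"
      then have "perp (?ax k) B" using perp_axis[OF B'(1)] by blast
      moreover have "perp (?ax i) B" "perp (?ax i) (?ax j)" "perp (?ax k) (?ax j)"
        using ax_i B'(1,2) ax_j perp_axis[OF ax_j(1), of k] by auto
      ultimately have "B = ?ax j"
        using perp_unique[OF projector_axis(1)[of i] projector_axis(1)[of k] B'(1) ax_j(1)] axis_ne[OF ne(2)] by blast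
      then show "x q0 $ j $ j = 0" using B'(3) perp_axis[OF px] by simp
    }
  qed
  let ?S1 = "K \<inter> {p. C (fst p a) \<and> snd p $ k $ k \<noteq> 0}"
  have h1: "?S1 homeomorphic ?T \<times> \<P>"
  proof (rule homeomorphic_compact_fibres[OF compact_K])
    let ?f = "\<lambda>p. (restrict_to E0 (fst p), snd p :: mat3)"
    show "continuous_on K ?f"
      by (intro continuous_on_Pair continuous_on_compose2[OF continuous_on_restrict_to[of UNIV]]
          continuous_on_fst continuous_on_snd continuous_on_id) auto
    show "?S1 = K \<inter> ?f -` (?T \<times> \<P>)"
    proof (intro equalityI subsetI)
      fix p assume p: "p \<in> ?S1"
      obtain x B where xB: "p = (x, B)" by fastforce
      then show "p \<in> K \<inter> ?f -` (?T \<times> \<P>)" using p K[of x B] fib[of x] by (simp add: \<P>_def)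
    next
      fix p assume p: "p \<in> K \<inter> ?f -` (?T \<times> \<P>)"
      obtain x B where xB: "p = (x, B)" by fastforce
      then show "p \<in> ?S1" using p K[of x B] fib[of x] by (simp add: \<P>_def)
    qed
    show "inj_on ?f ?S1"
    proof (rule inj_onI)
      fix p p' assume p: "p \<in> ?S1" "p' \<in> ?S1" "?f p = ?f p'"
      obtain x B where xB: "p = (x, B)" by fastforce
      obtain y where yB: "p' = (y, B)" using p(3) xB by (cases p') auto
      have r: "restrict_to E0 x = restrict_to E0 y" using p(3) xB yB by simp
      have B: "x \<in> W" "y \<in> W" "projector B" "B $ i $ i = 0" "perp B (x q0)" "perp B (y q0)" "C (x a)"
        using p(1,2) xB yB K by auto
      note px = W_props[OF B(1)] and py = W_props[OF B(2)]
      have a: "y a = x a" using px(5) py(5) r by simp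
      have "x a \<noteq> B" using a_ax px(7) B(4,7) by blast
      then have "x q0 = y q0"
        using perp_unique[OF px(7) B(3) px(8) py(8)] px(6) py(6) B(5,6) a by simp
      then show "p = p'" using W_eqI[OF B(1,2) r] xB yB by simp
    qed
    show "?T \<times> \<P> \<subseteq> ?f ` ?S1"
    proof
      fix t assume t: "t \<in> ?T \<times> \<P>"
      obtain z B where zB: "t = (z, B)" by fastforce
      then have z: "z \<in> ?T" "z \<in> Z" and B: "projector B" "B $ i $ i = 0" "B $ k $ k \<noteq> 0" using t by (auto simp: \<P>_def)
      obtain Q where Q: "projector Q" "perp (z a) Q" "perp B Q" by (rule exists_perp[OF aZ[OF z(2)] B(1)])
      obtain x where x: "x \<in> W" "restrict_to E0 x = z" "x q0 = Q" by (rule W_memI[OF z(2) Q(1,2)])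
      have "(x, B) \<in> ?S1" using K[of x B] x Q B fib[OF x(1)] z(1) by simp
      then show "t \<in> ?f ` ?S1" using x(2) zB by force
    qed
  qed
  have h2: "?S1 homeomorphic ?R"
  proof (rule homeomorphic_compact_fibres[OF compact_K])
    show "continuous_on K fst" by (intro continuous_on_fst continuous_on_id)
    show "?S1 = K \<inter> fst -` ?R"
    proof (intro equalityI subsetI)
      fix p assume p: "p \<in> ?S1"
      obtain x B where xB: "p = (x, B)" by fastforce
      then show "p \<in> K \<inter> fst -` ?R" using p K[of x B] coord[of x B] by simp
    next
      fix p assume p: "p \<in> K \<inter> fst -` ?R"
      obtain x B where xB: "p = (x, B)" by fastforce
      then show "p \<in> ?S1" using p K[of x B] coord[of x B] by simp
    qed
    show "inj_on fst ?S1"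
    proof (rule inj_onI)
      fix p p' assume p: "p \<in> ?S1" "p' \<in> ?S1" "fst p = fst p'"
      obtain x B where xB: "p = (x, B)" by fastforce
      obtain B' where xB': "p' = (x, B')" using p(3) xB by (cases p') auto
      have B: "x \<in> W" "projector B" "B $ i $ i = 0" "perp B (x q0)" "projector B'" "B' $ i $ i = 0" "perp B' (x q0)" "x \<in> ?U"
        using p(1,2) xB xB' K by auto
      note px = W_props(8)[OF B(1)]
      have "perp (x q0) B" "perp (x q0) B'" using perp_sym px B by blast+
      moreover have "perp (?ax i) B" "perp (?ax i) B'" using ax_i B by auto
      ultimately have "B = B'" using perp_unique[OF px projector_axis(1) B(2,5)] q0_ne[OF B(8)] by blast
      then show "p = p'" using xB xB' by simp
    qed
    show "?R \<subseteq> fst ` ?S1"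
    proof
      fix x assume x: "x \<in> ?R"
      then have W: "x \<in> W" by simp
      note px = W_props(8)[OF W]
      obtain B where B: "projector B" "perp (?ax i) B" "perp (x q0) B" by (rule exists_perp[OF projector_axis(1) px])
      have "(x, B) \<in> K" using K W B ax_i perp_sym[OF px B(1,3)] by blast
      moreover from this have "B $ k $ k \<noteq> 0" using coord[of x B] x by auto
      ultimately have "(x, B) \<in> ?S1" using x by simp
      then show "x \<in> fst ` ?S1" by force
    qed
  qed
  have h3: "\<P> homeomorphic (UNIV :: complex set)"
  proof -
    \<comment> \<open>The affine coordinate on a projective line without one point: each line in
      \<open>\<P>\<close> has a unique spanning vector with entry 1 at \<open>k\<close>.\<close>
    define v :: "complex \<Rightarrow> complex ^ 3" where "v \<zeta> = (\<chi> m. if m = j then \<zeta> else if m = k then 1 else 0)" for \<zeta>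
    have v: "v \<zeta> $ i = 0" "v \<zeta> $ j = \<zeta>" "v \<zeta> $ k = 1" for \<zeta> using ne by (auto simp: v_def)
    have v0: "v \<zeta> \<noteq> 0" for \<zeta> using v(3)[of \<zeta>] by (metis zero_index zero_neq_one)
    have cv: "continuous_on UNIV (\<lambda>\<zeta>. v \<zeta> $ m)" for m
      using UN[of m] v by (auto intro: continuous_on_const continuous_on_id)
    have n0: "complex_of_real ((norm (v \<zeta>))\<^sup>2) \<noteq> 0" for \<zeta>
      unfolding of_real_eq_0_iff using v0[of \<zeta>] by simp
    have "continuous_on UNIV v"
      unfolding v_def by (intro continuous_on_vec_lambda) (use cv in \<open>simp add: v_def\<close>)
    then have cp: "continuous_on UNIV (\<lambda>\<zeta>. proj_on (v \<zeta>))"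
      unfolding proj_on_def
      by (intro continuous_on_vec_lambda continuous_on_divide continuous_on_mult continuous_on_cnj cv
          continuous_on_of_real continuous_on_power continuous_on_norm \<open>continuous_on UNIV v\<close>) (use n0 in blast)
    have "homeomorphism \<P> UNIV (\<lambda>B. B $ j $ k / B $ k $ k) (\<lambda>\<zeta>. proj_on (v \<zeta>))"
    proof (rule homeomorphismI)
      show "continuous_on \<P> (\<lambda>B. B $ j $ k / B $ k $ k)"
        by (intro continuous_on_divide continuous_on_mat_entry continuous_on_id) (auto simp: \<P>_def)
      have pv: "proj_on (v \<zeta>) $ i $ i = 0 \<and> proj_on (v \<zeta>) $ k $ k \<noteq> 0 \<and>
        proj_on (v \<zeta>) $ j $ k / proj_on (v \<zeta>) $ k $ k = \<zeta>" for \<zeta>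
        using v0[of \<zeta>] by (simp add: proj_on_def v)
      then show "(\<lambda>\<zeta>. proj_on (v \<zeta>)) ` UNIV \<subseteq> \<P>" using projector_proj_on[OF v0] by (auto simp: \<P>_def)
      show "(\<lambda>B. B $ j $ k / B $ k $ k) (proj_on (v \<zeta>)) = \<zeta>" for \<zeta> using pv by simp
      show "proj_on (v (B $ j $ k / B $ k $ k)) = B" if "B \<in> \<P>" for B
      proof -
        have B: "projector B" "B $ i $ i = 0" "B $ k $ k \<noteq> 0" using that by (auto simp: \<P>_def)
        obtain y where y: "y \<noteq> 0" "B = proj_on y" using B(1) by (rule projector_cases)
        have yi: "y $ i = 0" "y $ k \<noteq> 0" using B(2,3) y by (auto simp: proj_on_def)
        have q: "B $ j $ k / B $ k $ k = y $ j / y $ k" using y(1) yi(2) unfolding y(2) by (simp add: proj_on_def)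
        have "y = y $ k *s v (y $ j / y $ k)"
          unfolding vec_eq_iff
        proof
          fix m show "y $ m = (y $ k *s v (y $ j / y $ k)) $ m" using UN[of m] yi v by auto
        qed
        then have "proj_on (v (y $ j / y $ k)) = proj_on y" using proj_on_scale[OF yi(2)] by metis
        then show ?thesis using q y(2) by simp
      qed
    qed (use cp in auto)
    then show ?thesis unfolding homeomorphic_def by blast
  qed
  have "?R homeomorphic ?T \<times> (UNIV :: complex set)"
    using h1 h2 homeomorphic_Times[OF homeomorphic_refl h3, of ?T] by (meson homeomorphic_sym homeomorphic_trans)
  then have "cchi ?R = cchi (?T \<times> (UNIV :: complex set))"
    by (rule ctame_homeomorphic(2)[OF tame_ctame[OF finite_E tame_SR(2)], symmetric])
  then have chi_R: "cchi ?R = cchi ?T" using tame_times_complex[OF finite_E0 tZ] by simp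
  have "cchi ?U = cchi ?S + cchi ?R" by (rule cchi_split[OF finite_E tW reg])
  then show ?thesis using chi_S chi_R by simp
qed

text \<open>The strata are given by the first nonzero diagonal entry of the leg; there is one
  because the trace is 1.\<close>

lemma cchi_W: "cchi W = 2 * cchi Z"
proof -
  have "W = X \<inter> {x. mat_gap (x q0) (x q2) = 0} \<inter> {x. mat_gap (x q1) (x q3) = 0}"
    by (auto simp: W_def mat_gap_eq_0)
  then have tW: "tame E W"
    by (simp only: tame_Int_zero(1)[OF tame_Int_zero(1)[OF tame_X(1) regular_mat_gap] regular_mat_gap])
  have "variety {x. x a = x b \<and> x c = x d \<and> x a = x c}" by (intro variety_Collect_conj variety_eq)
  then have tZ: "tame E0 Z" unfolding Z_def by (rule tame_Y_Int(1))
  let ?g = "\<lambda>i x. x a $ i $ i"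
  have reg: "regular (?g i)" for i by (rule regular.entry)
  let ?A = "\<lambda>S. S \<inter> {x. x a $ 1 $ 1 \<noteq> 0}" and ?B = "\<lambda>S. S \<inter> {x. x a $ 1 $ 1 = 0} \<inter> {x. x a $ 2 $ 2 \<noteq> 0}"
    and ?D = "\<lambda>S. S \<inter> {x. x a $ 1 $ 1 = 0} \<inter> {x. x a $ 2 $ 2 = 0}"
  have pieces: "tame F (?A S) \<and> tame F (?B S) \<and> tame F (?D S)" "cchi S = cchi (?A S) + cchi (?B S) + cchi (?D S)"
    if "finite F" "tame F S" for F S
  proof -
    note t1 = tame_Int_zero[OF that(2) reg[of 1]]
    note t2 = tame_Int_zero[OF t1(1) reg[of 2]]
    show "tame F (?A S) \<and> tame F (?B S) \<and> tame F (?D S)" using t1 t2 by simp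
    show "cchi S = cchi (?A S) + cchi (?B S) + cchi (?D S)"
      using cchi_split[OF that reg[of 1]] cchi_split[OF that(1) t1(1) reg[of 2]] by simp
  qed
  note pW = pieces[OF finite_E tW] and pZ = pieces[OF finite_E0 tZ]
  have eqs: "?B S = S \<inter> {x. x a $ 1 $ 1 = 0 \<and> x a $ 2 $ 2 \<noteq> 0}"
    "?D S = S \<inter> {x. x a $ 1 $ 1 = 0 \<and> x a $ 2 $ 2 = 0}" for S by auto
  have "A $ 3 $ 3 \<noteq> 0" if "projector A" "A $ 1 $ 1 = 0 \<and> A $ 2 $ 2 = 0" for A
  proof -
    have "(\<Sum>i\<in>UNIV. A $ i $ i) = 1" using that(1) unfolding projector_def by blast
    then show ?thesis using that(2) by (auto simp: sum_3)
  qed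
  then have "cchi (?D W) = 2 * cchi (?D Z)"
    unfolding eqs using pW(1) pZ(1) unfolding eqs
    by (intro W_stratum[of 3 1 2 "\<lambda>A. A $ 1 $ 1 = 0 \<and> A $ 2 $ 2 = 0"]) auto
  moreover have "cchi (?B W) = 2 * cchi (?B Z)"
    unfolding eqs using pW(1) pZ(1) unfolding eqs
    by (intro W_stratum[of 2 1 3 "\<lambda>A. A $ 1 $ 1 = 0 \<and> A $ 2 $ 2 \<noteq> 0"]) auto
  moreover have "cchi (?A W) = 2 * cchi (?A Z)"
    using pW(1) pZ(1) by (intro W_stratum[of 1 2 3 "\<lambda>A. A $ 1 $ 1 \<noteq> 0"]) auto
  ultimately show ?thesis using pW(2) pZ(2) by simp
qed

lemma tame_X': "tame E0 X'" "compact X'"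
proof -
  have "variety {x. x a = x b \<and> x c = x d}" by (intro variety_Collect_conj variety_eq)
  then show "tame E0 X'" "compact X'" unfolding X'_def by (rule tame_Y_Int)+
qed

lemma cchi_side: "cchi (X \<inter> {x. x q0 \<noteq> x q2}) = cchi X' - cchi Z"
proof -
  have ne: "X \<inter> {x. x q0 \<noteq> x q2} = X \<inter> {x. mat_gap (x q0) (x q2) \<noteq> 0}"
    "X' \<inter> {x. x a \<noteq> x c} = X' \<inter> {x. mat_gap (x a) (x c) \<noteq> 0}" by (simp_all add: mat_gap_eq_0)
  have "tame E (X \<inter> {x. x q0 \<noteq> x q2})" unfolding ne(1) by (rule tame_Int_zero(2)[OF tame_X(1) regular_mat_gap])
  then have "cchi (X' \<inter> {x. x a \<noteq> x c}) = cchi (X \<inter> {x. x q0 \<noteq> x q2})"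
    by (rule ctame_homeomorphic(2)[OF tame_ctame[OF finite_E] side_homeomorphic])
  moreover have "cchi X' = cchi (X' \<inter> {x. mat_gap (x a) (x c) = 0}) + cchi (X' \<inter> {x. x a \<noteq> x c})"
    unfolding ne(2) by (rule cchi_split[OF finite_E0 tame_X'(1) regular_mat_gap])
  moreover have "X' \<inter> {x. mat_gap (x a) (x c) = 0} = Z" by (auto simp: X'_def Z_def mat_gap_eq_0)
  ultimately show ?thesis by simp
qed

theorem cchi_square:
  assumes "X'' = Y \<inter> {x. x a = x d \<and> x b = x c}"
  shows "cchi X = cchi X' + cchi X''" "tame E0 X''" "compact X''"
proof -
  \<comment> \<open>Turning the square by one step preserves \<open>X\<close> and \<open>Z\<close>
    and turns the description of one resolution into that of the other.\<close>
  interpret rotated: square_geometry E0 V b c d a q1 q2 q3 q0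
    using finite_E0 variety_V projector_V legs sides by unfold_locales auto
  have X: "rotated.X = X"
  proof -
    have "rotated.E = E" by (auto simp: E_def rotated.E_def)
    then show ?thesis unfolding X_def rotated.X_def by auto
  qed
  have Z: "rotated.Z = Z" unfolding rotated.Z_def Z_def by auto
  have X'': "rotated.X' = X''" unfolding rotated.X'_def assms by auto
  show "tame E0 X''" "compact X''" using rotated.tame_X' unfolding X'' by simp_all
  have side: "cchi (X \<inter> {x. x q1 \<noteq> x q3}) = cchi X'' - cchi Z"
    using rotated.cchi_side unfolding X Z X'' .
  have gap: "{x. mat_gap (x e) (x e') = 0} = {x. x e = x e'}" for e e' by (simp add: mat_gap_eq_0)
  let ?P = "X \<inter> {x. x q0 = x q2}"
  have tP: "tame E ?P" using tame_Int_zero(1)[OF tame_X(1) regular_mat_gap, of q0 q2] by (simp add: gap)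
  have "cchi X = cchi ?P + cchi (X \<inter> {x. x q0 \<noteq> x q2})"
    using cchi_split[OF finite_E tame_X(1) regular_mat_gap, of q0 q2] by (simp add: mat_gap_eq_0)
  moreover have "cchi ?P = cchi (?P \<inter> {x. x q1 = x q3}) + cchi (?P \<inter> {x. x q1 \<noteq> x q3})"
    using cchi_split[OF finite_E tP regular_mat_gap, of q1 q3] by (simp add: mat_gap_eq_0)
  moreover have "?P \<inter> {x. x q1 = x q3} = W" by (auto simp: W_def)
  moreover have "?P \<inter> {x. x q1 \<noteq> x q3} = X \<inter> {x. x q1 \<noteq> x q3}" using opposite_sides by blast
  ultimately show "cchi X = cchi X' + cchi X''" using cchi_W cchi_side side by simp
qed

end

section \<open>From lines to projectors\<close>

section \<open>Decoration spaces as sets of matrices\<close>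

text \<open>The choice of the spanning vector does not matter, because \<open>proj_on\<close> is
  invariant under rescaling.\<close>

definition line_projector :: "(complex ^ 3) set \<Rightarrow> mat3" where
  "line_projector L = proj_on (SOME v. v \<noteq> 0 \<and> L = vec.span {v})"

lemma span_scale:
  fixes v :: "complex ^ 3"
  shows "c \<noteq> 0 \<Longrightarrow> vec.span {c *s v} = vec.span {v}"
  by (intro vec.span_eq[THEN iffD2]) (auto simp: vec.span_singleton intro: image_eqI[of _ _ "inverse c"])

lemma proj_on_eq_iff:
  assumes "v \<noteq> 0" "w \<noteq> 0"
  shows "proj_on v = proj_on w \<longleftrightarrow> vec.span {v} = vec.span {w}"
proof
  assume eq: "proj_on v = proj_on w"
  obtain j where j: "v $ j \<noteq> 0" using assms(1) by (auto simp: vec_eq_iff)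
  define n m where "n = complex_of_real ((norm v)\<^sup>2)" and "m = complex_of_real ((norm w)\<^sup>2)"
  have nm: "n \<noteq> 0" "m \<noteq> 0" using assms by (simp_all add: n_def m_def)
  have e: "v $ i * cnj (v $ j) / n = w $ i * cnj (w $ j) / m" for i
    using arg_cong[OF eq, of "\<lambda>P. P $ i $ j"] by (simp add: proj_on_def n_def m_def)
  have wj: "w $ j \<noteq> 0" using e[of j] j nm by auto
  let ?c = "n * cnj (w $ j) / (m * cnj (v $ j))"
  have "v = ?c *s w" unfolding vec_eq_iff using e j nm by (simp add: field_simps)
  moreover have "?c \<noteq> 0" using j wj nm by simp
  ultimately show "vec.span {v} = vec.span {w}" using span_scale by metis
next
  assume "vec.span {v} = vec.span {w}"
  then have "v \<in> vec.span {w}" by (metis vec.span_base singletonI)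
  then obtain c where c: "v = c *s w" by (auto simp: vec.span_singleton)
  then have "c \<noteq> 0" using assms by auto
  then show "proj_on v = proj_on w" unfolding c by (rule proj_on_scale)
qed

lemma line_projector_span:
  assumes "v \<noteq> 0"
  shows "line_projector (vec.span {v}) = proj_on v"
proof -
  define w where "w = (SOME w. w \<noteq> 0 \<and> vec.span {v} = vec.span {w})"
  have w: "w \<noteq> 0 \<and> vec.span {v} = vec.span {w}" unfolding w_def by (rule someI[of _ v]) (use assms in simp)
  then have "proj_on w = proj_on v" using proj_on_eq_iff[of w v] assms by blast
  then show ?thesis by (simp only: line_projector_def w_def)
qed

lemma complex_line_cases:
  assumes "L \<in> complex_lines"
  obtains v where "v \<noteq> 0" "L = vec.span {v}" "line_projector L = proj_on v"
proof -
  from assms obtain v where v: "v \<in> - {0}" "L = vec.span {v}" unfolding complex_lines_eq by blast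
  then have "v \<noteq> 0" by simp
  then show thesis using that v(2) line_projector_span by blast
qed

lemma inj_on_line_projector: "inj_on line_projector complex_lines"
proof (rule inj_onI)
  fix L M assume LM: "L \<in> complex_lines" "M \<in> complex_lines" "line_projector L = line_projector M"
  obtain v where v: "v \<noteq> 0" "L = vec.span {v}" "line_projector L = proj_on v" using LM(1) by (rule complex_line_cases)
  obtain w where w: "w \<noteq> 0" "M = vec.span {w}" "line_projector M = proj_on w" using LM(2) by (rule complex_line_cases)
  have "proj_on v = proj_on w" using LM(3) v(3) w(3) by simp
  then have "vec.span {v} = vec.span {w}" using proj_on_eq_iff[OF v(1) w(1)] by blast
  then show "L = M" using v(2) w(2) by blast
qed

lemma line_projector_image: "line_projector ` complex_lines = {P. projector P}"
proof (intro equalityI subsetI)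
  fix P assume "P \<in> line_projector ` complex_lines"
  then show "P \<in> {P. projector P}" by (auto elim!: complex_line_cases simp: projector_proj_on)
next
  fix P assume "P \<in> {P. projector P}"
  then obtain v where "v \<noteq> 0" "P = proj_on v" by (auto elim: projector_cases)
  then show "P \<in> line_projector ` complex_lines"
    using line_projector_span[of v] span_in_complex_lines[of v] by (metis imageI)
qed

lemma hermitian_scale: "hermitian (c *s v) (d *s w) = c * cnj d * hermitian v w"
  by (simp add: hermitian_def sum_distrib_left mult_ac)

lemma orthogonal_lines_iff:
  assumes "L \<in> complex_lines" "M \<in> complex_lines"
  shows "orthogonal_lines L M \<longleftrightarrow> perp (line_projector L) (line_projector M)"
proof -
  obtain v where v: "v \<noteq> 0" "L = vec.span {v}" "line_projector L = proj_on v" using assms(1) by (rule complex_line_cases)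
  obtain w where w: "w \<noteq> 0" "M = vec.span {w}" "line_projector M = proj_on w" using assms(2) by (rule complex_line_cases)
  have "orthogonal_lines L M \<longleftrightarrow> hermitian v w = 0"
  proof
    assume "orthogonal_lines L M"
    then show "hermitian v w = 0"
      unfolding orthogonal_lines_def v(2) w(2) by (simp add: vec.span_base)
  next
    assume "hermitian v w = 0"
    then show "orthogonal_lines L M"
      unfolding orthogonal_lines_def v(2) w(2) vec.span_singleton by (auto simp: hermitian_scale)
  qed
  then show ?thesis unfolding v(3) w(3) perp_proj_on[OF v(1) w(1)] .
qed

lemma continuous_map_line_projector: "continuous_map CP2 euclidean line_projector"
proof (rule continuous_compose_quotient_map[OF quotient_map_CP2])
  have "continuous_on (- {0}) proj_on"
    unfolding proj_on_def
    by (intro continuous_on_vec_lambda continuous_on_divide continuous_on_mult continuous_on_cnj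
        continuous_on_of_real continuous_on_power continuous_on_norm continuous_on_id continuous_intros) auto
  then have "continuous_map (top_of_set (- {0})) euclidean proj_on" by simp
  then show "continuous_map (top_of_set (- {0})) euclidean (line_projector \<circ> (\<lambda>x. vec.span {x}))"
    by (rule continuous_map_eq) (simp add: line_projector_span)
qed

lemma compact_space_CP2: "compact_space CP2"
proof -
  let ?S = "sphere (0 :: complex ^ 3) 1"
  have "compactin (top_of_set (- {0})) ?S" by (auto simp: compactin_subtopology)
  then have "compactin CP2 ((\<lambda>x. vec.span {x}) ` ?S)"
    using quotient_imp_continuous_map[OF quotient_map_CP2] by (rule image_compactin)
  moreover have "(\<lambda>x. vec.span {x}) ` ?S = complex_lines"
  proof (intro equalityI subsetI)
    fix L assume "L \<in> complex_lines"
    then obtain v :: "complex ^ 3" where v: "v \<noteq> 0" "L = vec.span {v}" by (rule complex_line_cases)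
    have c: "complex_of_real (1 / norm v) \<noteq> 0" using v(1) by simp
    have "complex_of_real (1 / norm v) *s v = (1 / norm v) *\<^sub>R v"
      unfolding vec_eq_iff by (simp add: scaleR_conv_of_real[where 'a = complex])
    then have "norm (complex_of_real (1 / norm v) *s v) = 1" using v(1) by simp
    then show "L \<in> (\<lambda>x. vec.span {x}) ` ?S"
      using span_scale[OF c, of v] v(2) by (intro image_eqI[of _ _ "complex_of_real (1 / norm v) *s v"]) auto
  next
    fix L assume "L \<in> (\<lambda>x. vec.span {x}) ` ?S"
    then obtain v :: "complex ^ 3" where "norm v = 1" "L = vec.span {v}" by auto
    then show "L \<in> complex_lines" using span_in_complex_lines[of v] by (metis norm_zero zero_neq_one)
  qed
  ultimately show ?thesis by (simp add: compact_space_def topspace_CP2)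
qed

text \<open>The map \<open>r\<close> lets the edges of another graph index the matrices.\<close>

definition decoration_matrices ::
    "('v, 'h, 'f) multigraph \<Rightarrow> 'e set \<Rightarrow> ('e \<Rightarrow> 'f) \<Rightarrow> ('e \<Rightarrow> mat3) set" where
  "decoration_matrices H E r = {x \<in> zero_outside E. (\<forall>e\<in>E. projector (x e)) \<and>
     (\<forall>e\<in>E. \<forall>e'\<in>E. r e = r e' \<longrightarrow> x e = x e') \<and>
     (\<forall>v\<in>verts H. \<forall>h\<in>ends_at H v. \<forall>h'\<in>ends_at H v. h \<noteq> h' \<longrightarrow>
        (\<forall>e\<in>E. \<forall>e'\<in>E. r e = end_edge H h \<longrightarrow> r e' = end_edge H h' \<longrightarrow> perp (x e) (x e')))}"

text \<open>A continuous injection of a compact space into a Hausdorff space is an embedding, so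
  only the image has to be found. As \<open>r\<close> is onto the edges of \<open>H\<close>,
  families constant on its fibres are the same as families indexed by these edges.\<close>

lemma decoration_space_homeomorphic:
  fixes H :: "('v, 'h, 'f) multigraph" and E :: "'e set"
  assumes r: "r ` E = edges H" and H: "end_edge H ` ends H \<subseteq> edges H"
  shows "decoration_space H homeomorphic_space top_of_set (decoration_matrices H E r)"
proof -
  let ?P = "product_topology (\<lambda>e. CP2) (edges H)"
  define \<Phi> where "\<Phi> D = (\<lambda>e. if e \<in> E then line_projector (D (r e)) else 0)" for D :: "'f \<Rightarrow> (complex ^ 3) set"
  have top: "topspace ?P = PiE (edges H) (\<lambda>e. complex_lines)" by (simp add: topspace_CP2)
  have "continuous_map ?P (product_topology (\<lambda>e. euclidean) UNIV) \<Phi>"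
    unfolding continuous_map_componentwise_UNIV
  proof
    fix e show "continuous_map ?P euclidean (\<lambda>D. \<Phi> D e)"
    proof (cases "e \<in> E")
      case True
      then have "continuous_map ?P CP2 (\<lambda>D. D (r e))" using r by (intro continuous_map_product_projection) auto
      from continuous_map_compose[OF this continuous_map_line_projector]
      show ?thesis using True by (simp add: \<Phi>_def comp_def)
    qed (simp add: \<Phi>_def)
  qed
  then have cont: "continuous_map ?P euclidean \<Phi>" by (simp add: euclidean_product_topology)
  have cs: "compact_space ?P" by (simp add: compact_space_product_topology compact_space_CP2)
  then have closed_map: "closed_map ?P euclidean \<Phi>"
    proof (rule continuous_imp_closed_map_gen[OF _ _ cont])
    have "Hausdorff_space (euclidean :: ('e \<Rightarrow> mat3) topology)"
      unfolding Hausdorff_space_def using hausdorff by (auto simp: disjnt_def)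
    then show "kc_space (euclidean :: ('e \<Rightarrow> mat3) topology)" by (rule Hausdorff_imp_kc_space)
  qed
  have inj: "inj_on \<Phi> (topspace ?P)"
    unfolding top
  proof (rule inj_onI)
    fix D D' assume D: "D \<in> PiE (edges H) (\<lambda>e. complex_lines)" "D' \<in> PiE (edges H) (\<lambda>e. complex_lines)" "\<Phi> D = \<Phi> D'"
    show "D = D'"
    proof (rule PiE_ext[OF D(1,2)])
      fix f assume f: "f \<in> edges H"
      then obtain e where e: "e \<in> E" "f = r e" using r by auto
      have "line_projector (D f) = line_projector (D' f)" using fun_cong[OF D(3), of e] e by (simp add: \<Phi>_def)
      then show "D f = D' f" using inj_on_line_projector D(1,2) f by (auto dest: inj_onD)
    qed
  qed
  have "embedding_map ?P euclidean \<Phi>" by (rule injective_closed_imp_embedding_map[OF cont closed_map inj])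
  then have hm: "homeomorphic_map ?P (top_of_set (\<Phi> ` topspace ?P)) \<Phi>" by (simp add: embedding_map_def)
  let ?S = "topspace ?P \<inter> {D. admissible H D}"
  have "homeomorphic_map (subtopology ?P {D. admissible H D})
    (subtopology (top_of_set (\<Phi> ` topspace ?P)) (\<Phi> ` ?S)) \<Phi>"
    by (rule homeomorphic_map_subtopologies[OF hm]) auto
  moreover have "subtopology (top_of_set (\<Phi> ` topspace ?P)) (\<Phi> ` ?S) = top_of_set (\<Phi> ` ?S)"
    by (simp add: subtopology_subtopology Int_absorb1 image_mono)
  ultimately have hs: "decoration_space H homeomorphic_space top_of_set (\<Phi> ` ?S)"
    unfolding decoration_space_def using homeomorphic_space by fastforce
  have eH: "end_edge H h \<in> edges H" if "h \<in> ends_at H v" for h v using H that by (auto simp: ends_at_def)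
  have "\<Phi> ` ?S = decoration_matrices H E r"
  proof (intro equalityI subsetI)
    fix x assume "x \<in> \<Phi> ` ?S"
    then obtain D where D: "x = \<Phi> D" "D \<in> PiE (edges H) (\<lambda>e. complex_lines)" "admissible H D"
      unfolding top by auto
    have L: "D f \<in> complex_lines" if "f \<in> edges H" for f using D(2) that by auto
    have x: "x e = line_projector (D (r e))" if "e \<in> E" for e using that by (simp add: D(1) \<Phi>_def)
    show "x \<in> decoration_matrices H E r"
      unfolding decoration_matrices_def
    proof (intro CollectI conjI ballI impI)
      show "x \<in> zero_outside E" by (simp add: zero_outside_def D(1) \<Phi>_def)
      show "projector (x e)" if "e \<in> E" for e
        using x[OF that] L[of "r e"] r that line_projector_image by blast
      show "x e = x e'" if "e \<in> E" "e' \<in> E" "r e = r e'" for e e' using x that by simp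
      fix v h h' e e'
      assume a: "v \<in> verts H" "h \<in> ends_at H v" "h' \<in> ends_at H v" "h \<noteq> h'" "e \<in> E" "e' \<in> E"
        "r e = end_edge H h" "r e' = end_edge H h'"
      then have "orthogonal_lines (D (r e)) (D (r e'))" using D(3) unfolding admissible_def by simp
      then show "perp (x e) (x e')" using orthogonal_lines_iff L a(2,3,5-8) eH x by simp
    qed
  next
    fix x assume x: "x \<in> decoration_matrices H E r"
    note x' = x[unfolded decoration_matrices_def mem_Collect_eq]
    have pr: "projector (x e)" if "e \<in> E" for e using conjunct1[OF conjunct2[OF x']] that by (rule bspec)
    have eq: "x e = x e'" if "e \<in> E" "e' \<in> E" "r e = r e'" for e e'
      by (rule mp[OF bspec[OF bspec[OF conjunct1[OF conjunct2[OF conjunct2[OF x']]] that(1)] that(2)] that(3)])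
    have z: "x e = 0" if "e \<notin> E" for e using conjunct1[OF x'] that by (simp add: zero_outside_def)
    have "\<forall>f\<in>edges H. \<exists>L. L \<in> complex_lines \<and> (\<forall>e\<in>E. r e = f \<longrightarrow> line_projector L = x e)"
    proof
      fix f assume "f \<in> edges H"
      then have "f \<in> r ` E" using r by simp
      then obtain e where e: "e \<in> E" "r e = f" by auto
      have "x e \<in> line_projector ` complex_lines" unfolding line_projector_image using pr[OF e(1)] by simp
      then obtain L where L: "L \<in> complex_lines" "line_projector L = x e" by auto
      show "\<exists>L. L \<in> complex_lines \<and> (\<forall>e\<in>E. r e = f \<longrightarrow> line_projector L = x e)"
      proof (intro exI[of _ L] conjI ballI impI)
        fix e' assume "e' \<in> E" "r e' = f"
        then have "x e = x e'" using e by (intro eq) simp_all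
        then show "line_projector L = x e'" using L(2) by simp
      qed (rule L(1))
    qed
    then obtain L where L: "\<forall>f\<in>edges H. L f \<in> complex_lines \<and> (\<forall>e\<in>E. r e = f \<longrightarrow> line_projector (L f) = x e)"
      unfolding bchoice_iff by (elim exE)
    let ?D = "restrict L (edges H)"
    have D: "?D \<in> topspace ?P" unfolding top using L by auto
    have Dx: "line_projector (?D (r e)) = x e" if "e \<in> E" for e using L r that by auto
    have "admissible H ?D"
      unfolding admissible_def
    proof (intro ballI impI)
      fix v h h' assume a: "v \<in> verts H" "h \<in> ends_at H v" "h' \<in> ends_at H v" "h \<noteq> h'"
      have "end_edge H h \<in> r ` E" using eH[OF a(2)] r by simp
      then obtain e where e: "e \<in> E" "r e = end_edge H h" by auto
      have "end_edge H h' \<in> r ` E" using eH[OF a(3)] r by simp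
      then obtain e' where e': "e' \<in> E" "r e' = end_edge H h'" by auto
      have "perp (x e) (x e')"
        using x'[THEN conjunct2, THEN conjunct2, THEN conjunct2] a e e' by blast
      then have "perp (line_projector (?D (r e))) (line_projector (?D (r e')))" using Dx e(1) e'(1) by simp
      moreover have "?D (r e) \<in> complex_lines" "?D (r e') \<in> complex_lines" using L r e(1) e'(1) by auto
      ultimately show "orthogonal_lines (?D (end_edge H h)) (?D (end_edge H h'))"
        using orthogonal_lines_iff e(2) e'(2) by metis
    qed
    moreover have "\<Phi> ?D = x"
    proof
      fix e show "\<Phi> ?D e = x e" using Dx[of e] z[of e] by (simp add: \<Phi>_def)
    qed
    ultimately show "x \<in> \<Phi> ` ?S" using D by blast
  qed
  then show ?thesis using hs by simp
qed

lemma euler_characteristic_decoration_space: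
  fixes H :: "('v, 'h, 'f) multigraph" and E :: "'e set"
  assumes "r ` E = edges H" "end_edge H ` ends H \<subseteq> edges H"
    and "compact (decoration_matrices H E r)" "ctame (decoration_matrices H E r)"
  shows "euler_characteristic (decoration_space H) = cchi (decoration_matrices H E r)"
  by (rule euler_characteristic_eq_cchi[OF decoration_space_homeomorphic[OF assms(1,2)] assms(3,4)])

section \<open>Combinatorics of the square and of the fused edges\<close>

section \<open>Resolving a square\<close>

lemma all_less_4: "(\<forall>k<4. P k) \<longleftrightarrow> P 0 \<and> P 1 \<and> P 2 \<and> P (3 :: nat)"
  by (auto simp: numeral_eq_Suc less_Suc_eq)

text \<open>The leg, an end of \<open>q k\<close> and an end of the preceding side, whose index is
  \<open>(k + 3) mod 4\<close>, lie on three different edges; trivalence leaves no room for further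
  ends at \<open>v k\<close>.\<close>

lemma square_ends:
  assumes G: "multigraph G" "trivalent G" "square G v q l" and k: "k < 4"
  obtains s t where "ends_at G (v k) = {l k, s, t}" "l k \<noteq> s" "l k \<noteq> t" "s \<noteq> t"
    "end_edge G s = q k" "end_edge G t = q ((k + 3) mod 4)"
proof -
  let ?j = "(k + 3) mod 4"
  have j: "?j < 4" "Suc ?j mod 4 = k" "?j \<noteq> k"
  proof -
    have "k = 0 \<or> k = 1 \<or> k = 2 \<or> k = 3" using k by arith
    then show "?j < 4" "Suc ?j mod 4 = k" "?j \<noteq> k" by (elim disjE; simp)+
  qed
  have inj: "inj_on q {..<4}" and vq: "v k \<in> verts G" and lk: "l k \<in> ends_at G (v k)" "end_edge G (l k) \<notin> q ` {..<4}"
    and ends: "\<And>m. m < 4 \<Longrightarrow> end_vertex G ` ends_on G (q m) = {v m, v (Suc m mod 4)}"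
    using G(3) k unfolding square_def by auto
  obtain s where s: "s \<in> ends_on G (q k)" "v k = end_vertex G s" using ends[OF k] by blast
  obtain t where t: "t \<in> ends_on G (q ?j)" "v k = end_vertex G t" using ends[OF j(1)] unfolding j(2) by blast
  have es: "end_edge G s = q k" "s \<in> ends_at G (v k)" using s by (auto simp: ends_on_def ends_at_def)
  have et: "end_edge G t = q ?j" "t \<in> ends_at G (v k)" using t by (auto simp: ends_on_def ends_at_def)
  have "q k \<noteq> q ?j" using inj k j by (auto dest: inj_onD)
  then have st: "s \<noteq> t" using es et by auto
  have ls: "l k \<noteq> s" "l k \<noteq> t" using lk(2) es(1) et(1) k j(1) by auto
  have c3: "card (ends_at G (v k)) = 3" using G(2) vq by (simp add: trivalent_def)
  then have "finite (ends_at G (v k))" by (metis card.infinite zero_neq_numeral)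
  moreover have "{l k, s, t} \<subseteq> ends_at G (v k)" using lk es et by auto
  moreover have "card {l k, s, t} = 3" using st ls by simp
  ultimately have "{l k, s, t} = ends_at G (v k)" using c3 by (intro card_subset_eq) auto
  then show thesis using that st ls es(1) et(1) by metis
qed

definition outer_edges :: "('v, 'h, 'e) multigraph \<Rightarrow> (nat \<Rightarrow> 'e) \<Rightarrow> 'e set" where
  "outer_edges G q = edges G - q ` {..<4}"

lemma end_edge_outer:
  assumes "multigraph G" "square G v q l" "h \<in> ends G" "end_vertex G h \<notin> v ` {..<4}"
  shows "end_edge G h \<in> outer_edges G q"
proof -
  have "end_edge G h \<noteq> q k" if k: "k < 4" for k
  proof
    assume "end_edge G h = q k"
    then have "h \<in> ends_on G (q k)" using assms(3) by (simp add: ends_on_def)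
    moreover have "end_vertex G ` ends_on G (q k) = {v k, v (Suc k mod 4)}" using assms(2) k by (simp add: square_def)
    ultimately have "end_vertex G h \<in> {v k, v (Suc k mod 4)}" by blast
    then show False using assms(4) k by auto
  qed
  moreover have "end_edge G h \<in> edges G" using assms(1,3) by (auto simp: multigraph_def)
  ultimately show ?thesis by (auto simp: outer_edges_def)
qed

text \<open>The part of admissibility that does not involve the square. It is common to the graph
  and both resolutions.\<close>

definition outer_matrices :: "('v, 'h, 'e) multigraph \<Rightarrow> (nat \<Rightarrow> 'v) \<Rightarrow> (nat \<Rightarrow> 'e) \<Rightarrow> ('e \<Rightarrow> mat3) set" where
  "outer_matrices G v q = {x. (\<forall>e\<in>outer_edges G q. projector (x e)) \<and>
     (\<forall>w\<in>verts G - v ` {..<4}. \<forall>h\<in>ends_at G w. \<forall>h'\<in>ends_at G w. h \<noteq> h' \<longrightarrow>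
        perp (x (end_edge G h)) (x (end_edge G h')))}"

lemma variety_outer_matrices:
  assumes "multigraph G"
  shows "variety (outer_matrices G v q)"
proof -
  have fin: "finite (outer_edges G q)" "finite (verts G - v ` {..<4})" "finite (ends_at G w)" for w
    using assms by (auto simp: multigraph_def outer_edges_def ends_at_def)
  have "variety {x. h \<noteq> h' \<longrightarrow> perp (x (end_edge G h)) (x (end_edge G h'))}" for h h'
    by (cases "h = h'") (simp_all add: variety_UNIV variety_perp)
  then show ?thesis
    unfolding outer_matrices_def by (intro variety_Collect_conj variety_Collect_ball fin variety_projector)
qed

text \<open>The fused edges are the classes of the equivalence relation generated by
  \<open>J\<close>, so constancy on classes reduces to the equations for its two pairs. Chains that
  close up to a vertexless circle are covered without a separate case.\<close>

lemma resolution_matrices: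
  fixes G :: "('v, 'h, 'e) multigraph"
  assumes G: "multigraph G" "square G v q l"
    and J: "J = {(\<alpha>, \<beta>), (\<gamma>, \<delta>)}" "J \<subseteq> outer_edges G q \<times> outer_edges G q"
  defines "r \<equiv> \<lambda>e. fusion G q J `` {e}" and "H \<equiv> replace_square G v q J"
  shows "r ` outer_edges G q = edges H" "end_edge H ` ends H \<subseteq> edges H"
    "decoration_matrices H (outer_edges G q) r =
       zero_outside (outer_edges G q) \<inter> outer_matrices G v q \<inter> {x. x \<alpha> = x \<beta> \<and> x \<gamma> = x \<delta>}"
proof -
  let ?E = "outer_edges G q" and ?R = "(J \<union> J\<inverse>)\<^sup>*"
  have fusion: "(e, e') \<in> fusion G q J \<longleftrightarrow> e \<in> ?E \<and> e' \<in> ?E \<and> (e, e') \<in> ?R" for e e'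
    by (auto simp: fusion_def outer_edges_def)
  have sym: "sym ?R" by (intro sym_rtrancl) (auto simp: sym_def)
  have r_eq: "r e = r e' \<longleftrightarrow> (e, e') \<in> ?R" if "e \<in> ?E" "e' \<in> ?E" for e e'
  proof
    assume "r e = r e'"
    moreover have "e' \<in> r e'" using that fusion by (simp add: r_def)
    ultimately have "e' \<in> r e" by simp
    then show "(e, e') \<in> ?R" using fusion by (simp add: r_def)
  next
    assume ee: "(e, e') \<in> ?R"
    then have "(e', e) \<in> ?R" using sym by (rule symD[rotated])
    then show "r e = r e'" using ee that unfolding r_def by (auto simp: fusion intro: rtrancl_trans)
  qed
  have H: "verts H = verts G - v ` {..<4}" "ends H = {h \<in> ends G. end_vertex G h \<notin> v ` {..<4}}"
    "edges H = ?E // fusion G q J" "end_vertex H = end_vertex G" "end_edge H h = r (end_edge G h)" for h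
    by (simp_all add: H_def replace_square_def outer_edges_def r_def)
  show edges: "r ` ?E = edges H" unfolding H(3) quotient_def r_def by auto
  show "end_edge H ` ends H \<subseteq> edges H"
    unfolding edges[symmetric] H(2,5) using end_edge_outer[OF G] by auto
  have ends_at: "ends_at H w = ends_at G w" if "w \<in> verts H" for w
    using that unfolding ends_at_def H(1,2,4) by auto
  have outer: "end_edge G h \<in> ?E" if "h \<in> ends_at G w" "w \<in> verts H" for h w
    using that end_edge_outer[OF G, of h] unfolding H(1) ends_at_def by auto
  have const: "(\<forall>e\<in>?E. \<forall>e'\<in>?E. r e = r e' \<longrightarrow> x e = x e') \<longleftrightarrow> x \<alpha> = x \<beta> \<and> x \<gamma> = x \<delta>" for x :: "'e \<Rightarrow> mat3"
  proof
    assume a: "\<forall>e\<in>?E. \<forall>e'\<in>?E. r e = r e' \<longrightarrow> x e = x e'"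
    have "x e = x e'" if "(e, e') \<in> J" for e e'
    proof -
      have "e \<in> ?E" "e' \<in> ?E" using that J(2) by auto
      moreover have "(e, e') \<in> ?R" using that by auto
      ultimately show ?thesis using a r_eq by blast
    qed
    then show "x \<alpha> = x \<beta> \<and> x \<gamma> = x \<delta>" unfolding J(1) by blast
  next
    assume a: "x \<alpha> = x \<beta> \<and> x \<gamma> = x \<delta>"
    have "x e = x e'" if "(e, e') \<in> ?R" for e e'
      using that
    proof (induction rule: rtrancl_induct)
      case (step y z)
      then have "x y = x z" using a J(1) by auto
      then show ?case using step.IH by simp
    qed simp
    then show "\<forall>e\<in>?E. \<forall>e'\<in>?E. r e = r e' \<longrightarrow> x e = x e'" using r_eq by blast
  qed
  show "decoration_matrices H ?E r = zero_outside ?E \<inter> outer_matrices G v q \<inter> {x. x \<alpha> = x \<beta> \<and> x \<gamma> = x \<delta>}"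
  proof (rule Set.set_eqI)
    fix x :: "'e \<Rightarrow> mat3"
    have vert: "(\<forall>w\<in>verts H. \<forall>h\<in>ends_at H w. \<forall>h'\<in>ends_at H w. h \<noteq> h' \<longrightarrow>
        (\<forall>e\<in>?E. \<forall>e'\<in>?E. r e = end_edge H h \<longrightarrow> r e' = end_edge H h' \<longrightarrow> perp (x e) (x e'))) \<longleftrightarrow>
      (\<forall>w\<in>verts G - v ` {..<4}. \<forall>h\<in>ends_at G w. \<forall>h'\<in>ends_at G w. h \<noteq> h' \<longrightarrow>
        perp (x (end_edge G h)) (x (end_edge G h')))"
      if c: "\<forall>e\<in>?E. \<forall>e'\<in>?E. r e = r e' \<longrightarrow> x e = x e'"
      unfolding H(1)[symmetric]
    proof (rule ball_cong[OF refl])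
      fix w assume w: "w \<in> verts H"
      have "(\<forall>e\<in>?E. \<forall>e'\<in>?E. r e = end_edge H h \<longrightarrow> r e' = end_edge H h' \<longrightarrow> perp (x e) (x e')) \<longleftrightarrow>
        perp (x (end_edge G h)) (x (end_edge G h'))" if "h \<in> ends_at G w" "h' \<in> ends_at G w" for h h'
      proof
        assume "\<forall>e\<in>?E. \<forall>e'\<in>?E. r e = end_edge H h \<longrightarrow> r e' = end_edge H h' \<longrightarrow> perp (x e) (x e')"
        then show "perp (x (end_edge G h)) (x (end_edge G h'))" using outer[OF that(1) w] outer[OF that(2) w] H(5) by simp
      next
        assume p: "perp (x (end_edge G h)) (x (end_edge G h'))"
        show "\<forall>e\<in>?E. \<forall>e'\<in>?E. r e = end_edge H h \<longrightarrow> r e' = end_edge H h' \<longrightarrow> perp (x e) (x e')"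
        proof (intro ballI impI)
          fix e e' assume a: "e \<in> ?E" "e' \<in> ?E" "r e = end_edge H h" "r e' = end_edge H h'"
          have "x e = x (end_edge G h)" "x e' = x (end_edge G h')"
            using c a outer[OF that(1) w] outer[OF that(2) w] H(5) by metis+
          then show "perp (x e) (x e')" using p by simp
        qed
      qed
      then show "(\<forall>h\<in>ends_at H w. \<forall>h'\<in>ends_at H w. h \<noteq> h' \<longrightarrow>
          (\<forall>e\<in>?E. \<forall>e'\<in>?E. r e = end_edge H h \<longrightarrow> r e' = end_edge H h' \<longrightarrow> perp (x e) (x e'))) \<longleftrightarrow>
        (\<forall>h\<in>ends_at G w. \<forall>h'\<in>ends_at G w. h \<noteq> h' \<longrightarrow> perp (x (end_edge G h)) (x (end_edge G h')))"
        unfolding ends_at[OF w] by (simp cong: ball_cong)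
    qed
    show "x \<in> decoration_matrices H ?E r \<longleftrightarrow>
      x \<in> zero_outside ?E \<inter> outer_matrices G v q \<inter> {x. x \<alpha> = x \<beta> \<and> x \<gamma> = x \<delta>}"
    proof (cases "\<forall>e\<in>?E. \<forall>e'\<in>?E. r e = r e' \<longrightarrow> x e = x e'")
      case True
      then have "x \<alpha> = x \<beta> \<and> x \<gamma> = x \<delta>" using const by blast
      then show ?thesis
        unfolding decoration_matrices_def outer_matrices_def mem_Collect_eq Int_iff vert[OF True] eqTrueI[OF True]
        by (simp only: simp_thms conj_assoc)
    next
      case False
      then have "\<not> (x \<alpha> = x \<beta> \<and> x \<gamma> = x \<delta>)" using const by blast
      then show ?thesis unfolding decoration_matrices_def mem_Collect_eq Int_iff eq_False[THEN iffD2, OF False]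
        by (simp only: simp_thms)
    qed
  qed
qed

theorem lemma4:
  fixes G :: "('v, 'h, 'e) multigraph"
    and p :: "'v \<Rightarrow> complex" and \<gamma> :: "'e \<Rightarrow> real \<Rightarrow> complex"
    and v :: "nat \<Rightarrow> 'v" and q :: "nat \<Rightarrow> 'e" and l :: "nat \<Rightarrow> 'h"
  assumes "multigraph G" and "trivalent G"
    and "plane_drawing G p \<gamma>"
    and "square_in_disk G p \<gamma> v q l"
  shows "euler_characteristic (decoration_space G) =
           euler_characteristic (decoration_space (resolution_ab_cd G v q l)) +
           euler_characteristic (decoration_space (resolution_ad_bc G v q l))"
proof -
  have sq: "square G v q l" using assms(4) by (simp add: square_in_disk_def)
  let ?E = "outer_edges G q"
  define L where "L k = end_edge G (l k)" for k
  have L: "L k \<in> ?E" "q k \<in> edges G" "v k \<in> verts G" if "k < 4" for k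
  proof -
    have "l k \<in> ends G" "end_edge G (l k) \<notin> q ` {..<4}" using sq that by (auto simp: square_def ends_at_def)
    then show "L k \<in> ?E" using assms(1) by (auto simp: outer_edges_def L_def multigraph_def)
    show "q k \<in> edges G" "v k \<in> verts G" using sq that by (auto simp: square_def)
  qed
  have inj: "inj_on q {..<4}" using sq by (simp add: square_def)
  have q4: "q ` {..<4} = {q 0, q 1, q 2, q 3}" by (auto simp: numeral_eq_Suc less_Suc_eq lessThan_Suc)
  \<comment> \<open>The leg at \<open>v k\<close> meets the sides \<open>q k\<close> and
    \<open>q ((k + 3) mod 4)\<close>, which is the cyclic pattern of the locale.\<close>
  interpret square_geometry ?E "outer_matrices G v q" "L 0" "L 1" "L 2" "L 3" "q 0" "q 1" "q 2" "q 3"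
  proof
    show "finite ?E" using assms(1) by (simp add: multigraph_def outer_edges_def)
    show "variety (outer_matrices G v q)" by (rule variety_outer_matrices[OF assms(1)])
    show "projector (x e)" if "x \<in> zero_outside ?E" "x \<in> outer_matrices G v q" "e \<in> ?E" for x e
      using that by (simp add: outer_matrices_def)
    show "L 0 \<in> ?E" "L 1 \<in> ?E" "L 2 \<in> ?E" "L 3 \<in> ?E" using L(1) by simp_all
    show "distinct [q 0, q 1, q 2, q 3]" using inj by (auto simp: inj_on_eq_iff)
    show "q 0 \<notin> ?E" "q 1 \<notin> ?E" "q 2 \<notin> ?E" "q 3 \<notin> ?E" by (simp_all add: outer_edges_def)
  qed
  have E: "E = edges G" using L(2) unfolding E_def by (unfold outer_edges_def q4) auto
  have tri: "(triple (x (L 0)) (x (q 0)) (x (q 3)) \<and> triple (x (L 1)) (x (q 1)) (x (q 0)) \<and>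
      triple (x (L 2)) (x (q 2)) (x (q 1)) \<and> triple (x (L 3)) (x (q 3)) (x (q 2))) \<longleftrightarrow>
    (\<forall>k<4. triple (x (L k)) (x (q k)) (x (q ((k + 3) mod 4))))" for x :: "'e \<Rightarrow> mat3"
  proof -
    have "(0 + 3) mod 4 = (3 :: nat)" "(1 + 3) mod 4 = (0 :: nat)" "(2 + 3) mod 4 = (1 :: nat)" "(3 + 3) mod 4 = (2 :: nat)"
      by simp_all
    then show ?thesis unfolding all_less_4 by (simp only:)
  qed
  \<comment> \<open>Nothing is fused, so the index map is the identity. The four vertices of the
    square give the triples, and the other vertices give \<open>outer_matrices\<close>.\<close>
  have X: "decoration_matrices G (edges G) id = X"
  proof (intro equalityI subsetI)
    fix x assume x: "x \<in> decoration_matrices G (edges G) id"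
    have pr: "projector (x e)" if "e \<in> edges G" for e 
      by (rule bspec[OF conjunct1[OF conjunct2[OF x[unfolded decoration_matrices_def mem_Collect_eq]]] that])
    have perp: "perp (x (end_edge G h)) (x (end_edge G h'))"
      if "w \<in> verts G" "h \<in> ends_at G w" "h' \<in> ends_at G w" "h \<noteq> h'" for w h h'
    proof -
      have "end_edge G h \<in> edges G" "end_edge G h' \<in> edges G"
        using that assms(1) by (auto simp: multigraph_def ends_at_def)
      then show ?thesis
        using x[unfolded decoration_matrices_def mem_Collect_eq, THEN conjunct2, THEN conjunct2, THEN conjunct2] that
        by simp
    qed
    have "triple (x (L k)) (x (q k)) (x (q ((k + 3) mod 4)))" if k: "k < 4" for k
    proof -
      obtain s t where st: "ends_at G (v k) = {l k, s, t}" "l k \<noteq> s" "l k \<noteq> t" "s \<noteq> t"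
        "end_edge G s = q k" "end_edge G t = q ((k + 3) mod 4)"
        by (rule square_ends[OF assms(1,2) sq k])
      then show ?thesis
        using perp[OF L(3)[OF k], of "l k" s] perp[OF L(3)[OF k], of "l k" t] perp[OF L(3)[OF k], of s t]
        by (simp add: triple_def L_def)
    qed
    moreover have "restrict_to ?E x \<in> outer_matrices G v q"
      unfolding outer_matrices_def
    proof (intro CollectI conjI ballI impI)
      show "projector (restrict_to ?E x e)" if "e \<in> ?E" for e
        using that pr by (simp add: restrict_to_in) (simp add: outer_edges_def)
      fix w h h' assume a: "w \<in> verts G - v ` {..<4}" "h \<in> ends_at G w" "h' \<in> ends_at G w" "h \<noteq> h'"
      have "end_edge G h \<in> ?E" "end_edge G h' \<in> ?E"
        using a end_edge_outer[OF assms(1) sq] by (auto simp: ends_at_def)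
      then show "perp (restrict_to ?E x (end_edge G h)) (restrict_to ?E x (end_edge G h'))"
        using perp[of w h h'] a by (simp add: restrict_to_in)
    qed
    moreover have "x \<in> zero_outside (edges G)" 
      by (rule conjunct1[OF x[unfolded decoration_matrices_def mem_Collect_eq]])
    ultimately show "x \<in> X" unfolding X_def E using tri[of x] pr L(2) by simp
  next
    fix x assume x: "x \<in> X"
    note px = X_props[OF x]
    have t: "triple (x (L k)) (x (q k)) (x (q ((k + 3) mod 4)))" if "k < 4" for k
      using tri[of x] px(3-6) that by blast
    have pr: "projector (x e)" if "e \<in> edges G" for e using px(2) that E by simp
    have out: "restrict_to ?E x \<in> outer_matrices G v q" using px(1) by (simp add: Y_def)
    have "perp (x (end_edge G h)) (x (end_edge G h'))"
      if a: "w \<in> verts G" "h \<in> ends_at G w" "h' \<in> ends_at G w" "h \<noteq> h'" for w h h'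
    proof (cases "w \<in> v ` {..<4}")
      case False
      then have "end_edge G h \<in> ?E" "end_edge G h' \<in> ?E"
        using a end_edge_outer[OF assms(1) sq] by (auto simp: ends_at_def)
      moreover have "perp (restrict_to ?E x (end_edge G h)) (restrict_to ?E x (end_edge G h'))"
        using out[unfolded outer_matrices_def mem_Collect_eq, THEN conjunct2] False a by blast
      ultimately show ?thesis by (simp only: restrict_to_in)
    next
      case True
      then obtain k where k: "k < 4" "w = v k" by auto
      obtain s t where st: "ends_at G (v k) = {l k, s, t}"
        "end_edge G s = q k" "end_edge G t = q ((k + 3) mod 4)"
        by (rule square_ends[OF assms(1,2) sq k(1)])
      have "projector (x (L k))" "projector (x (q k))" "projector (x (q ((k + 3) mod 4)))"
        using pr L k(1) by (auto simp: outer_edges_def)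
      then show ?thesis
        using t[OF k(1)] a(2-4) st perp_sym unfolding k(2) triple_def L_def by auto
    qed
    then show "x \<in> decoration_matrices G (edges G) id"
      unfolding decoration_matrices_def mem_Collect_eq using pr px(7) E
      by (intro conjI ballI impI) (simp_all add: zero_outside_def)
  qed
  define X'' where "X'' = Y \<inter> {x. x (L 0) = x (L 3) \<and> x (L 1) = x (L 2)}"
  note chi = cchi_square[OF X''_def]
  have end_edges: "end_edge G ` ends G \<subseteq> edges G" using assms(1) by (simp add: multigraph_def)
  have "euler_characteristic (decoration_space G) = cchi X"
    using euler_characteristic_decoration_space[OF _ end_edges, of id "edges G"] tame_X tame_ctame[OF finite_E]
    unfolding X by simp
  moreover have "euler_characteristic (decoration_space (resolution_ab_cd G v q l)) = cchi X'"
  proof -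
    have J: "{(L 0, L 1), (L 2, L 3)} \<subseteq> ?E \<times> ?E" using L(1) by simp
    note R = resolution_matrices[OF assms(1) sq refl J]
    have "X' = zero_outside ?E \<inter> outer_matrices G v q \<inter> {x. x (L 0) = x (L 1) \<and> x (L 2) = x (L 3)}"
      unfolding X'_def Y_def by (rule refl)
    then show ?thesis
      using euler_characteristic_decoration_space[OF R(1,2)] tame_X' tame_ctame[OF finite_E0] R(3)
      unfolding resolution_ab_cd_def L_def by metis
  qed
  moreover have "euler_characteristic (decoration_space (resolution_ad_bc G v q l)) = cchi X''"
  proof -
    have J: "{(L 0, L 3), (L 1, L 2)} \<subseteq> ?E \<times> ?E" using L(1) by simp
    note R = resolution_matrices[OF assms(1) sq refl J]
    have "X'' = zero_outside ?E \<inter> outer_matrices G v q \<inter> {x. x (L 0) = x (L 3) \<and> x (L 1) = x (L 2)}"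
      unfolding X''_def Y_def by (rule refl)
    then show ?thesis
      using euler_characteristic_decoration_space[OF R(1,2)] chi(2,3) tame_ctame[OF finite_E0] R(3)
      unfolding resolution_ad_bc_def L_def by metis
  qed
  ultimately show ?thesis using chi(1) by simp
qed

end
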